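(* Let $D$ be a classifying space of graded-polarized mixed Hodge structures, $F\in D$, and let $\Pi$ denote the orthogonal projection from $V_{\mathbb C}$ to $F^p$ with respect to the mixed Hodge metric $h_F$. Then the curvature at $F$ of the Hodge bundle $\mathcal F^p$ over $D$ (with the mixed Hodge metric) in the directions $u,v\in T^{\rm hol}_F(D)\cong\mathfrak q_F$, as an endomorphism of $F^p$, is $$R_\nabla(u,\bar v)=-\big[\Pi\circ(\bar u_+^* ),\bar v_+\big]-\tfrac12\big([u,\bar v]_0+[v,\bar u]_0^*\big)+\big([\bar v,u]_++\Pi\circ[\bar u,v]_+^*\big).$$
   Context: Classifying space: fix a finite-dimensional real vector space $V_{\mathbb R}$, an increasing (weight) filtration $W$, non-degenerate $(-1)^k$-symmetric real bilinear forms $Q_k$ on $\operatorname{gr}^W_k$, and numbers $h^{p,q}$. $D$ is the set of decreasing filtrations $F$ of $V_{\mathbb C}$ such that $(F,W)$ is a mixed Hodge structure, graded-polarized by $\{Q_k\}$, with Hodge numbers $h^{p,q}$. For $F\in D$ the Deligne bigrading is the unique functorial $V_{\mathbb C}=\bigoplus I^{p,q}$ with $F^p=\bigoplus_{a\ge p}I^{a,b}$, $W_k=\bigoplus_{a+b\le k}I^{a,b}$, $\overline{I^{p,q}}\equiv I^{q,p}$ mod $\bigoplus_{a<q,b<p}I^{a,b}$. The mixed Hodge metric $h_F$ on $V_{\mathbb C}$ makes the bigrading orthogonal with $h_F(u,v)=\mathrm i^{p-q}Q_{p+q}([u],[\bar v])$ for $u,v\in I^{p,q}$; on $\operatorname{End}(V_{\mathbb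 C})$ put $h_F(\alpha,\beta)=\operatorname{Tr}(\alpha\beta^* )$, $\beta^*$ the $h_F$-adjoint. $G_{\mathbb C}$ is the group of complex automorphisms of $V_{\mathbb C}$ preserving $W$ and inducing automorphisms of the $Q_k$; $\mathfrak g_{\mathbb C}$ its Lie algebra, bar complex conjugation. $\mathfrak g^{r,s}$ is the set of elements of $\mathfrak g_{\mathbb C}$ mapping each $I^{p,q}$ to $I^{p+r,q+s}$. $\mathfrak q_F=\bigoplus_{r<0}\mathfrak g^{r,s}$, $\Lambda=\bigoplus_{r,s<0}\mathfrak g^{r,s}$, $\mathfrak n_+=\bigoplus_{a\ge0,b<0}\mathfrak g^{a,b}$, $\mathfrak n_-=\bigoplus_{a<0,b\ge0}\mathfrak g^{a,b}$, so $\mathfrak g_{\mathbb C}=\mathfrak n_+\oplus\mathfrak g^{0,0}\oplus\mathfrak n_-\oplus\Lambda$; $x_+$ and $x_0$ denote the components in $\mathfrak n_+$ and $\mathfrak g^{0,0}$. $D$ is a complex manifold, open in $G_{\mathbb C}\cdot F$, and $u\mapsto\frac{d}{dt}|_0e^{tu}\cdot F$ identifies $\mathfrak q_F$ with the holomorphic tangent space. Order of operations: conjugate, then project, then take adjoint: $\bar u_+^*=((\bar u)_+)^*$, $[x,y]_+^*=([x,y]_+)^*$, $[x,y]_0^*=([x,y]_0)^*$. $\mathcal F^p$ is the tautological holomorphic bundle with fibre $F^p$ at $F$. Elements of $\operatorname{End}(V_{\mathbb C})$ act linearly on $V_{\mathbb C}$; all operators are restricted to $F^p$. Curvature is that of the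 Chern connection $\nabla$: $R_\nabla=\bar\partial\theta$, $\theta=\mathbf h^{-1}\partial\mathbf h$ in a local holomorphic frame ($\mathbf h$ the transposed Gram matrix); for a line bundle $R(\partial_z,\partial_{\bar z})=-\partial_z\partial_{\bar z}\log h$. *)

theory Defs
  imports "HOL-Analysis.Analysis"
begin

text \<open>
  Conventions. \<open>V\<^sub>\<real>\<close> is \<open>real ^ 'n\<close>, its complexification is \<open>complex ^ 'n\<close> with
  componentwise conjugation, and \<open>End(V\<^sub>\<complex>)\<close> is \<open>complex ^ 'n ^ 'n\<close>. A filtration is a function
  on \<open>int\<close>; an \<open>int\<close>-indexed family of bilinear forms on the graded quotients \<open>gr\<^sub>k = W\<^sub>k/W\<^sub>k\<^sub>-\<^sub>1\<close> is
  given by bilinear forms \<open>Q k\<close> on \<open>W k\<close> that descend to the quotient. Subspaces of \<open>gr\<^sub>k\<close> are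
  represented by their preimages in \<open>W\<^sub>k\<close>, that is, by the subspaces between \<open>W\<^sub>k\<^sub>-\<^sub>1\<close> and \<open>W\<^sub>k\<close>.
\<close>

type_synonym 'n cvec = "complex ^ 'n"
type_synonym 'n cmat = "complex ^ 'n ^ 'n"
type_synonym 'n weight_filtration = "int \<Rightarrow> (real ^ 'n) set"
type_synonym 'n graded_forms = "int \<Rightarrow> real ^ 'n \<Rightarrow> real ^ 'n \<Rightarrow> real"
type_synonym 'n filtration = "int \<Rightarrow> 'n cvec set"

definition re_vec :: "'n::finite cvec \<Rightarrow> real ^ 'n" where
  "re_vec v = (\<chi> i. Re (v $ i))"

definition im_vec :: "'n::finite cvec \<Rightarrow> real ^ 'n" where
  "im_vec v = (\<chi> i. Im (v $ i))"

definition cnj_vec :: "'n::finite cvec \<Rightarrow> 'n cvec" where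
  "cnj_vec v = (\<chi> i. cnj (v $ i))"

definition cnj_mat :: "'n::finite cmat \<Rightarrow> 'n cmat" where
  "cnj_mat A = map_matrix cnj A"

definition cscale_mat :: "complex \<Rightarrow> 'n::finite cmat \<Rightarrow> 'n cmat" where
  "cscale_mat c A = map_matrix ((*) c) A"

definition bracket :: "'n::finite cmat \<Rightarrow> 'n cmat \<Rightarrow> 'n cmat" where
  "bracket A B = A ** B - B ** A"

definition mexp :: "'n::finite cmat \<Rightarrow> 'n cmat" where
  "mexp A = (\<Sum>m. (1 / fact m) *\<^sub>R (((**) A ^^ m) (mat 1)))"

definition act :: "'n::finite cmat \<Rightarrow> 'n filtration \<Rightarrow> 'n filtration" where
  "act A F = (\<lambda>p. (\<lambda>v. A *v v) ` F p)"


section \<open>Graded-polarized mixed Hodge structures\<close>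

definition graded_polarization_data :: "'n::finite weight_filtration \<Rightarrow> 'n graded_forms \<Rightarrow> bool" where
  "graded_polarization_data W Q \<longleftrightarrow>
     (\<forall>k. subspace (W k)) \<and> mono W \<and> (\<exists>k. W k = {0}) \<and> (\<exists>k. W k = UNIV) \<and>
     (\<forall>k. \<forall>x\<in>W k. \<forall>y\<in>W k. \<forall>z\<in>W k. \<forall>a b.
        Q k (a *\<^sub>R x + b *\<^sub>R y) z = a * Q k x z + b * Q k y z) \<and>
     (\<forall>k. \<forall>x\<in>W k. \<forall>y\<in>W k. Q k y x = (-1) powi k * Q k x y) \<and>
     (\<forall>k. \<forall>x\<in>W k. (\<forall>y\<in>W k. Q k x y = 0) \<longleftrightarrow> x \<in> W (k - 1))"

definition weight_C :: "'n::finite weight_filtration \<Rightarrow> int \<Rightarrow> 'n cvec set" where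
  "weight_C W k = {v. re_vec v \<in> W k \<and> im_vec v \<in> W k}"

text \<open>The complex bilinear extension of \<open>Q k\<close>.\<close>

definition form_C :: "'n::finite graded_forms \<Rightarrow> int \<Rightarrow> 'n cvec \<Rightarrow> 'n cvec \<Rightarrow> complex" where
  "form_C Q k u v =
     Complex (Q k (re_vec u) (re_vec v) - Q k (im_vec u) (im_vec v))
             (Q k (re_vec u) (im_vec v) + Q k (im_vec u) (re_vec v))"

text \<open>\<open>F\<^sup>p gr\<^sub>k\<close> and \<open>H\<^sup>p\<^sup>,\<^sup>q = F\<^sup>p gr\<^sub>p\<^sub>+\<^sub>q \<inter> cnj (F\<^sup>q gr\<^sub>p\<^sub>+\<^sub>q)\<close>, as preimages in \<open>W\<^sub>k\<close>.\<close>

definition gr_filtration :: "'n::finite weight_filtration \<Rightarrow> 'n filtration \<Rightarrow> int \<Rightarrow> int \<Rightarrow> 'n cvec set" where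
  "gr_filtration W F k p = vec.span ((F p \<inter> weight_C W k) \<union> weight_C W (k - 1))"

definition gr_hodge :: "'n::finite weight_filtration \<Rightarrow> 'n filtration \<Rightarrow> int \<Rightarrow> int \<Rightarrow> 'n cvec set" where
  "gr_hodge W F p q = gr_filtration W F (p + q) p \<inter> cnj_vec ` gr_filtration W F (p + q) q"

definition hodge_filtration :: "'n::finite filtration \<Rightarrow> bool" where
  "hodge_filtration F \<longleftrightarrow>
     (\<forall>p. vec.subspace (F p)) \<and> antimono F \<and> (\<exists>p. F p = {0}) \<and> (\<exists>p. F p = UNIV)"

text \<open>For all \<open>k\<close>, \<open>p\<close>: \<open>gr\<^sub>k\<close> is the direct sum of \<open>F\<^sup>p gr\<^sub>k\<close> and the conjugate of \<open>F\<^sup>k\<^sup>-\<^sup>p\<^sup>+\<^sup>1 gr\<^sub>k\<close>.\<close>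

definition mixed_hodge_structure :: "'n::finite weight_filtration \<Rightarrow> 'n filtration \<Rightarrow> bool" where
  "mixed_hodge_structure W F \<longleftrightarrow> hodge_filtration F \<and>
     (\<forall>k p. vec.span (gr_filtration W F k p \<union> cnj_vec ` gr_filtration W F k (k - p + 1)) = weight_C W k \<and>
            gr_filtration W F k p \<inter> cnj_vec ` gr_filtration W F k (k - p + 1) = weight_C W (k - 1))"

text \<open>The two Hodge--Riemann bilinear relations on every \<open>gr\<^sub>k\<close>.\<close>

definition graded_polarized :: "'n::finite weight_filtration \<Rightarrow> 'n graded_forms \<Rightarrow> 'n filtration \<Rightarrow> bool" where
  "graded_polarized W Q F \<longleftrightarrow>
     (\<forall>k p. \<forall>x\<in>gr_filtration W F k p. \<forall>y\<in>gr_filtration W F k (k - p + 1). form_C Q k x y = 0) \<and>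
     (\<forall>p q. \<forall>x\<in>gr_hodge W F p q - weight_C W (p + q - 1).
        \<i> powi (p - q) * form_C Q (p + q) x (cnj_vec x) \<in> \<real> \<and>
        Re (\<i> powi (p - q) * form_C Q (p + q) x (cnj_vec x)) > 0)"

definition classifying_space ::
  "'n::finite weight_filtration \<Rightarrow> 'n graded_forms \<Rightarrow> (int \<Rightarrow> int \<Rightarrow> nat) \<Rightarrow> 'n filtration set" where
  "classifying_space W Q hn =
     {F. mixed_hodge_structure W F \<and> graded_polarized W Q F \<and>
         (\<forall>p q. vec.dim (gr_hodge W F p q) = hn p q + vec.dim (weight_C W (p + q - 1)))}"


section \<open>Deligne bigrading and mixed Hodge metric\<close>

definition support :: "(int \<Rightarrow> int \<Rightarrow> 'n::finite cvec set) \<Rightarrow> (int \<times> int) set" where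
  "support I = {(p, q). I p q \<noteq> {0}}"

definition is_decomposition ::
  "(int \<Rightarrow> int \<Rightarrow> 'n::finite cvec set) \<Rightarrow> 'n cvec \<Rightarrow> (int \<times> int \<Rightarrow> 'n cvec) \<Rightarrow> bool" where
  "is_decomposition I v c \<longleftrightarrow> (\<forall>p q. c (p, q) \<in> I p q) \<and> v = (\<Sum>pq\<in>support I. c pq)"

definition bigrading :: "(int \<Rightarrow> int \<Rightarrow> 'n::finite cvec set) \<Rightarrow> bool" where
  "bigrading I \<longleftrightarrow> (\<forall>p q. vec.subspace (I p q)) \<and> finite (support I) \<and>
     (\<forall>v. \<exists>!c. is_decomposition I v c)"

text \<open>The last conjunct is the congruence of the conjugate of \<open>I\<^sup>p\<^sup>,\<^sup>q\<close> and \<open>I\<^sup>q\<^sup>,\<^sup>p\<close> modulo the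
  sum of the \<open>I\<^sup>a\<^sup>,\<^sup>b\<close> with \<open>a < q\<close>, \<open>b < p\<close>: both have the same image in the quotient.\<close>

definition is_deligne_bigrading ::
  "'n::finite weight_filtration \<Rightarrow> 'n filtration \<Rightarrow> (int \<Rightarrow> int \<Rightarrow> 'n cvec set) \<Rightarrow> bool" where
  "is_deligne_bigrading W F I \<longleftrightarrow> bigrading I \<and>
     (\<forall>p. F p = vec.span (\<Union>{I a b | a b. a \<ge> p})) \<and>
     (\<forall>k. weight_C W k = vec.span (\<Union>{I a b | a b. a + b \<le> k})) \<and>
     (\<forall>p q. vec.span (cnj_vec ` I p q \<union> \<Union>{I a b | a b. a < q \<and> b < p}) =
            vec.span (I q p \<union> \<Union>{I a b | a b. a < q \<and> b < p}))"

definition deligne :: "'n::finite weight_filtration \<Rightarrow> 'n filtration \<Rightarrow> int \<Rightarrow> int \<Rightarrow> 'n cvec set" where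
  "deligne W F = (THE I. is_deligne_bigrading W F I)"

definition component ::
  "'n::finite weight_filtration \<Rightarrow> 'n filtration \<Rightarrow> 'n cvec \<Rightarrow> int \<times> int \<Rightarrow> 'n cvec" where
  "component W F v = (THE c. is_decomposition (deligne W F) v c)"

definition hodge_metric ::
  "'n::finite weight_filtration \<Rightarrow> 'n graded_forms \<Rightarrow> 'n filtration \<Rightarrow> 'n cvec \<Rightarrow> 'n cvec \<Rightarrow> complex" where
  "hodge_metric W Q F u v =
     (\<Sum>(p, q)\<in>support (deligne W F).
        \<i> powi (p - q) * form_C Q (p + q) (component W F u (p, q)) (cnj_vec (component W F v (p, q))))"

definition hodge_adjoint ::
  "'n::finite weight_filtration \<Rightarrow> 'n graded_forms \<Rightarrow> 'n filtration \<Rightarrow> 'n cmat \<Rightarrow> 'n cmat" where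
  "hodge_adjoint W Q F A =
     (THE B. \<forall>u v. hodge_metric W Q F (A *v u) v = hodge_metric W Q F u (B *v v))"

definition hodge_proj ::
  "'n::finite weight_filtration \<Rightarrow> 'n graded_forms \<Rightarrow> 'n filtration \<Rightarrow> int \<Rightarrow> 'n cmat" where
  "hodge_proj W Q F p =
     (THE P. \<forall>v. P *v v \<in> F p \<and> (\<forall>w\<in>F p. hodge_metric W Q F (v - P *v v) w = 0))"


section \<open>The group, its Lie algebra and the induced bigrading\<close>

definition group_C :: "'n::finite weight_filtration \<Rightarrow> 'n graded_forms \<Rightarrow> 'n cmat set" where
  "group_C W Q =
     {A. invertible A \<and> (\<forall>k. (\<lambda>v. A *v v) ` weight_C W k = weight_C W k) \<and>
         (\<forall>k. \<forall>u\<in>weight_C W k. \<forall>v\<in>weight_C W k. form_C Q k (A *v u) (A *v v) = form_C Q k u v)}"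

definition lie_C :: "'n::finite weight_filtration \<Rightarrow> 'n graded_forms \<Rightarrow> 'n cmat set" where
  "lie_C W Q = {X. \<forall>t::real. mexp (t *\<^sub>R X) \<in> group_C W Q}"

definition lie_bigraded ::
  "'n::finite weight_filtration \<Rightarrow> 'n graded_forms \<Rightarrow> 'n filtration \<Rightarrow> int \<Rightarrow> int \<Rightarrow> 'n cmat set" where
  "lie_bigraded W Q F r s =
     {X \<in> lie_C W Q. \<forall>p q. \<forall>v\<in>deligne W F p q. X *v v \<in> deligne W F (p + r) (q + s)}"

text \<open>The real span below is the sum of subspaces, since every summand is a complex, hence real,
  subspace.\<close>

definition lie_part ::
  "'n::finite weight_filtration \<Rightarrow> 'n graded_forms \<Rightarrow> 'n filtration \<Rightarrow> (int \<times> int) set \<Rightarrow> 'n cmat set" where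
  "lie_part W Q F S = span (\<Union>(r, s)\<in>S. lie_bigraded W Q F r s)"

definition lie_q :: "'n::finite weight_filtration \<Rightarrow> 'n graded_forms \<Rightarrow> 'n filtration \<Rightarrow> 'n cmat set" where
  "lie_q W Q F = lie_part W Q F {(r, s). r < 0}"

definition lie_Lambda :: "'n::finite weight_filtration \<Rightarrow> 'n graded_forms \<Rightarrow> 'n filtration \<Rightarrow> 'n cmat set" where
  "lie_Lambda W Q F = lie_part W Q F {(r, s). r < 0 \<and> s < 0}"

definition lie_n_plus :: "'n::finite weight_filtration \<Rightarrow> 'n graded_forms \<Rightarrow> 'n filtration \<Rightarrow> 'n cmat set" where
  "lie_n_plus W Q F = lie_part W Q F {(a, b). a \<ge> 0 \<and> b < 0}"

definition lie_n_minus :: "'n::finite weight_filtration \<Rightarrow> 'n graded_forms \<Rightarrow> 'n filtration \<Rightarrow> 'n cmat set" where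
  "lie_n_minus W Q F = lie_part W Q F {(a, b). a < 0 \<and> b \<ge> 0}"

definition plus_part ::
  "'n::finite weight_filtration \<Rightarrow> 'n graded_forms \<Rightarrow> 'n filtration \<Rightarrow> 'n cmat \<Rightarrow> 'n cmat" where
  "plus_part W Q F x = (THE a. a \<in> lie_n_plus W Q F \<and>
     (\<exists>b\<in>lie_bigraded W Q F 0 0. \<exists>c\<in>lie_n_minus W Q F. \<exists>d\<in>lie_Lambda W Q F. x = a + b + c + d))"

definition zero_part ::
  "'n::finite weight_filtration \<Rightarrow> 'n graded_forms \<Rightarrow> 'n filtration \<Rightarrow> 'n cmat \<Rightarrow> 'n cmat" where
  "zero_part W Q F x = (THE b. b \<in> lie_bigraded W Q F 0 0 \<and>
     (\<exists>a\<in>lie_n_plus W Q F. \<exists>c\<in>lie_n_minus W Q F. \<exists>d\<in>lie_Lambda W Q F. x = a + b + c + d))"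


section \<open>Chern curvature in a local holomorphic frame\<close>

text \<open>Functions are defined near a point of a complex subspace of \<open>End(V\<^sub>\<complex>)\<close>, and the
  direction \<open>u\<close> lies in that subspace. \<open>wirtinger f u\<close> and \<open>wirtinger_bar f u\<close> are the derivatives of
  \<open>f\<close> along the \<open>(1,0)\<close>-vector \<open>u\<close> and along its conjugate; for \<open>z \<mapsto> x + z u\<close> they
  are \<open>\<partial>/\<partial>z\<close> and its conjugate.\<close>

definition dir_deriv :: "('n::finite cmat \<Rightarrow> complex) \<Rightarrow> 'n cmat \<Rightarrow> 'n cmat \<Rightarrow> complex" where
  "dir_deriv f u x = vector_derivative (\<lambda>t. f (x + t *\<^sub>R u)) (at 0)"

definition wirtinger :: "('n::finite cmat \<Rightarrow> complex) \<Rightarrow> 'n cmat \<Rightarrow> 'n cmat \<Rightarrow> complex" where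
  "wirtinger f u x = (dir_deriv f u x - \<i> * dir_deriv f (cscale_mat \<i> u) x) / 2"

definition wirtinger_bar :: "('n::finite cmat \<Rightarrow> complex) \<Rightarrow> 'n cmat \<Rightarrow> 'n cmat \<Rightarrow> complex" where
  "wirtinger_bar f u x = (dir_deriv f u x + \<i> * dir_deriv f (cscale_mat \<i> u) x) / 2"

text \<open>Square matrices of size \<open>k\<close>, indexed by \<open>{..<k}\<close>; the rank \<open>k\<close> may be \<open>0\<close>.\<close>

definition nmat_inverse :: "nat \<Rightarrow> (nat \<Rightarrow> nat \<Rightarrow> complex) \<Rightarrow> nat \<Rightarrow> nat \<Rightarrow> complex" where
  "nmat_inverse k A = (THE B.
     (\<forall>i<k. \<forall>j<k. (\<Sum>l<k. A i l * B l j) = (if i = j then 1 else 0)) \<and>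
     (\<forall>i j. \<not> (i < k \<and> j < k) \<longrightarrow> B i j = 0))"

text \<open>\<open>\<theta>(u) = h\<^sup>-\<^sup>1 \<partial>\<^sub>u h\<close>, for \<open>h\<close> the transposed Gram matrix.\<close>

definition connection_form ::
  "nat \<Rightarrow> ('n::finite cmat \<Rightarrow> nat \<Rightarrow> nat \<Rightarrow> complex) \<Rightarrow> 'n cmat \<Rightarrow> 'n cmat \<Rightarrow> nat \<Rightarrow> nat \<Rightarrow> complex" where
  "connection_form k h u x i j = (\<Sum>l<k. nmat_inverse k (h x) i l * wirtinger (\<lambda>y. h y l j) u x)"

text \<open>The value at \<open>x\<close> of the \<open>(1,1)\<close>-form \<open>dbar \<theta>\<close> on the pair \<open>(u, cnj v)\<close>. As
  \<open>d(cnj z) \<and> dz\<close> takes the value \<open>-1\<close> on the pair \<open>(\<partial>/\<partial>z, \<partial>/\<partial>(cnj z))\<close>, it is minus the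
  derivative of \<open>\<theta>(u)\<close> along \<open>cnj v\<close>; for line bundles this is \<open>-\<partial>\<^sub>z \<partial>\<^sub>c\<^sub>n\<^sub>j\<^sub>z log h\<close>.\<close>

definition curvature_matrix ::
  "nat \<Rightarrow> ('n::finite cmat \<Rightarrow> nat \<Rightarrow> nat \<Rightarrow> complex) \<Rightarrow> 'n cmat \<Rightarrow> 'n cmat \<Rightarrow> 'n cmat \<Rightarrow> nat \<Rightarrow> nat \<Rightarrow> complex" where
  "curvature_matrix k h u v x i j = - wirtinger_bar (\<lambda>y. connection_form k h u y i j) v x"

text \<open>The endomorphism \<open>e\<^sub>j \<mapsto> \<Sum>\<^sub>i M\<^sub>i\<^sub>j e\<^sub>i\<close> of the span of the linearly independent family \<open>e\<close>.\<close>

definition frame_endomorphism ::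
  "nat \<Rightarrow> (nat \<Rightarrow> 'n::finite cvec) \<Rightarrow> (nat \<Rightarrow> nat \<Rightarrow> complex) \<Rightarrow> 'n cvec \<Rightarrow> 'n cvec" where
  "frame_endomorphism k e M w =
     (\<Sum>j<k. \<Sum>i<k. (M i j * vec.representation (e ` {..<k}) w (e j)) *s e i)"

definition holomorphic_section :: "'n::finite cmat set \<Rightarrow> ('n cmat \<Rightarrow> 'n cvec) \<Rightarrow> bool" where
  "holomorphic_section U s \<longleftrightarrow>
     (\<forall>x\<in>U. \<exists>L. (s has_derivative L) (at x within U) \<and> (\<forall>y. L (cscale_mat \<i> y) = \<i> *s L y))"

text \<open>Near \<open>F\<close> the complex manifold \<open>D\<close> is described by the holomorphic chart
  \<open>x \<mapsto> e\<^sup>x \<cdot> F\<close> on a neighbourhood \<open>U\<close> of \<open>0\<close> in \<open>lie_q W Q F\<close>; its differential at \<open>0\<close> is the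
  identification \<open>u \<mapsto> d/dt e\<^sup>t\<^sup>u \<cdot> F\<close> of \<open>lie_q W Q F\<close> with the holomorphic tangent space.
  \<open>s\<close> is an arbitrary holomorphic frame, over \<open>U\<close>, of the tautological bundle, whose fibre over the
  point with coordinate \<open>x\<close> is \<open>(e\<^sup>x \<cdot> F)\<^sup>p\<close>.\<close>

definition hodge_bundle_frame ::
  "'n::finite weight_filtration \<Rightarrow> 'n graded_forms \<Rightarrow> (int \<Rightarrow> int \<Rightarrow> nat) \<Rightarrow> 'n filtration \<Rightarrow> int \<Rightarrow>
   'n cmat set \<Rightarrow> nat \<Rightarrow> (nat \<Rightarrow> 'n cmat \<Rightarrow> 'n cvec) \<Rightarrow> bool" where
  "hodge_bundle_frame W Q hn F p U k s \<longleftrightarrow>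
     openin (top_of_set (lie_q W Q F)) U \<and> 0 \<in> U \<and>
     (\<forall>x\<in>U. act (mexp x) F \<in> classifying_space W Q hn) \<and>
     (\<forall>j<k. holomorphic_section U (s j)) \<and>
     (\<forall>x\<in>U. inj_on (\<lambda>j. s j x) {..<k} \<and> vec.independent ((\<lambda>j. s j x) ` {..<k}) \<and>
            vec.span ((\<lambda>j. s j x) ` {..<k}) = act (mexp x) F p)"

definition transposed_gram ::
  "'n::finite weight_filtration \<Rightarrow> 'n graded_forms \<Rightarrow> 'n filtration \<Rightarrow> (nat \<Rightarrow> 'n cmat \<Rightarrow> 'n cvec) \<Rightarrow>
   'n cmat \<Rightarrow> nat \<Rightarrow> nat \<Rightarrow> complex" where
  "transposed_gram W Q F s x i j = hodge_metric W Q (act (mexp x) F) (s j x) (s i x)"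

text \<open>The curvature \<open>R\<^sub>\<nabla>(u, cnj v)\<close> at \<open>F\<close> of the tautological bundle with the mixed Hodge metric, as
  an endomorphism of \<open>F\<^sup>p\<close>, computed in the frame \<open>s\<close>.\<close>

definition hodge_bundle_curvature ::
  "'n::finite weight_filtration \<Rightarrow> 'n graded_forms \<Rightarrow> 'n filtration \<Rightarrow> nat \<Rightarrow> (nat \<Rightarrow> 'n cmat \<Rightarrow> 'n cvec) \<Rightarrow>
   'n cmat \<Rightarrow> 'n cmat \<Rightarrow> 'n cvec \<Rightarrow> 'n cvec" where
  "hodge_bundle_curvature W Q F k s u v =
     frame_endomorphism k (\<lambda>j. s j 0) (curvature_matrix k (transposed_gram W Q F s) u v 0)"

end

theory Submission
  imports Defs "HOL-Complex_Analysis.Cauchy_Integral_Formula"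
begin

text \<open>
  Order the bidegrees \<open>(a, b)\<close> lexicographically, with the order of \<open>b\<close> reversed. The sums of the Deligne
  summands over upper segments are functorial in \<open>F\<close> and \<open>W\<close>, and those over lower segments are functorial
  in the conjugate of \<open>F\<close> and \<open>W\<close>; so at the point \<open>g F\<close> with \<open>g = e\<^sup>x\<close> the former are moved by \<open>g\<close> and the
  latter by its conjugate \<open>g'\<close>. Hence the Deligne bigrading at \<open>g F\<close> is governed by the block LU
  decomposition \<open>M = f\<^sup>-\<^sup>1 L\<close> of \<open>M = g\<^sup>-\<^sup>1 g'\<close>, in which \<open>f - 1\<close> only has components of the bidegrees of \<open>n\<^sub>+\<close>
  and \<open>L\<close> is block diagonal up to components that lower the first degree. As \<open>f\<close> preserves the polarizations,
  the metric at \<open>g F\<close>, pulled back by \<open>g\<close>, is \<open>h\<^sub>F(f u, f v)\<close> twisted by the block diagonal part of \<open>L\<close>.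
  Expanding \<open>f M = L\<close> to second order and taking components gives the second order expansion of the
  metric, hence the curvature.
\<close>

section \<open>Linear algebra over the complex numbers\<close>

text \<open>The elements e^x do not preserve the metric, and the Deligne bigrading at the moved
  point is known only through its characterization. It becomes accessible to calculus because the
  projection onto an upper segment solves a linear equation with coefficients in
  \<open>Mm x\<close>, so that its entries are quotients of determinants. The curvature involves
  only first derivatives and one mixed derivative of the metric; hence x = z u + w v with two
  complex parameters, and derivatives are taken first in z, then in w. The factors separate because
  the bidegrees allowed for f - 1 and for L are disjoint: the \<open>Np\<close> component of the
  differentiated equation determines f, after which the (0, 0) component gives the twist. The
  adjoint on bidegree (0, 0) is minus conjugation followed by projection; therefore the two summands
  that carry the factor 1/2 are equal, and each is minus the mixed derivative of the twist.
  Derivatives of the frame cancel against the connection form, so every holomorphic frame gives the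
  same endomorphism.\<close>

lemma cnj_vec_add: "cnj_vec (x + y) = cnj_vec x + cnj_vec y"
  and cnj_vec_diff: "cnj_vec (x - y) = cnj_vec x - cnj_vec y"
  and cnj_vec_scale: "cnj_vec (c *s x) = cnj c *s cnj_vec x"
  and cnj_vec_0 [simp]: "cnj_vec 0 = 0"
  and cnj_vec_cnj_vec [simp]: "cnj_vec (cnj_vec x) = x"
  by (simp_all add: cnj_vec_def vec_eq_iff)

lemma cnj_vec_eq_0 [simp]: "cnj_vec x = 0 \<longleftrightarrow> x = 0"
  by (metis cnj_vec_0 cnj_vec_cnj_vec)

lemma cnj_vec_sum: "cnj_vec (sum f S) = (\<Sum>i\<in>S. cnj_vec (f i))"
  by (induction S rule: infinite_finite_induct) (auto simp: cnj_vec_add)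

lemma cnj_vec_mem_image: "cnj_vec x \<in> S \<longleftrightarrow> x \<in> cnj_vec ` S"
  by (metis cnj_vec_cnj_vec image_iff)

lemma cnj_mat_mult: "cnj_mat (A ** B) = cnj_mat A ** cnj_mat B"
  by (simp add: cnj_mat_def map_matrix_def matrix_matrix_mult_def vec_eq_iff)

lemma cnj_mat_vec: "cnj_vec (A *v x) = cnj_mat A *v cnj_vec x"
  by (simp add: cnj_mat_def map_matrix_def matrix_vector_mult_def cnj_vec_def vec_eq_iff)

lemma cnj_mat_add: "cnj_mat (A + B) = cnj_mat A + cnj_mat B"
  and cnj_mat_diff: "cnj_mat (A - B) = cnj_mat A - cnj_mat B"
  and cnj_mat_0 [simp]: "cnj_mat 0 = 0"
  and cnj_mat_cnj_mat [simp]: "cnj_mat (cnj_mat A) = A"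
  by (simp_all add: cnj_mat_def map_matrix_def vec_eq_iff)

lemma cnj_mat_1 [simp]: "cnj_mat (mat 1) = mat 1"
  by (simp add: cnj_mat_def map_matrix_def vec_eq_iff mat_def)

lemma cnj_mat_sum: "cnj_mat (sum f S) = (\<Sum>i\<in>S. cnj_mat (f i))"
  by (induction S rule: infinite_finite_induct) (auto simp: cnj_mat_add)

lemma cscale_mat_vec: "cscale_mat c A *v x = c *s (A *v x)"
  by (simp add: cscale_mat_def map_matrix_def matrix_vector_mult_def vec_eq_iff sum_distrib_left mult.assoc)

lemma matrix_eqI: "(\<And>x. A *v x = B *v x) \<Longrightarrow> A = (B :: 'n::finite cmat)"
  by (simp add: matrix_eq)

lemma matrix_add_rdistrib: "(A + B) ** (C :: 'n::finite cmat) = A ** C + B ** C"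
  by (simp add: matrix_matrix_mult_def vec_eq_iff distrib_right sum.distrib)

lemma matrix_mult_sum_left: "(\<Sum>i\<in>S. f i) ** (B :: 'n::finite cmat) = (\<Sum>i\<in>S. f i ** B)"
  by (induction S rule: infinite_finite_induct) (auto simp: matrix_add_rdistrib)

lemma matrix_mult_sum_right: "(B :: 'n::finite cmat) ** (\<Sum>i\<in>S. f i) = (\<Sum>i\<in>S. B ** f i)"
  by (induction S rule: infinite_finite_induct) (auto simp: matrix_add_ldistrib)

lemma matrix_vector_mult_sum_left: "(\<Sum>i\<in>S. f i) *v (x :: 'n::finite cvec) = (\<Sum>i\<in>S. f i *v x)"
  by (induction S rule: infinite_finite_induct) (auto simp: matrix_vector_mult_add_rdistrib)

lemma matrix_vector_mult_sum_right: "(A :: 'n::finite cmat) *v (\<Sum>i\<in>S. f i) = (\<Sum>i\<in>S. A *v f i)"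
  by (induction S rule: infinite_finite_induct) (auto simp: matrix_vector_right_distrib)

lemma vec_subspace_cnj: "vec.subspace S \<Longrightarrow> vec.subspace (cnj_vec ` S)"
  unfolding vec.subspace_def Ball_def cnj_vec_mem_image[symmetric]
  by (simp add: cnj_vec_add cnj_vec_scale)

section \<open>Complementary subspaces and their projections\<close>

definition complementary :: "'n::finite cvec set \<Rightarrow> 'n cvec set \<Rightarrow> bool" where
  "complementary U L \<longleftrightarrow> vec.subspace U \<and> vec.subspace L \<and> U \<inter> L = {0} \<and>
     (\<forall>x. \<exists>y\<in>U. \<exists>z\<in>L. x = y + z)"

text \<open>For complementary \<open>U\<close> and \<open>L\<close> the chosen matrix is unique,
  being prescribed on a spanning set.\<close>

definition proj_along :: "'n::finite cvec set \<Rightarrow> 'n cvec set \<Rightarrow> 'n cmat" where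
  "proj_along U L = (SOME P. (\<forall>x\<in>U. P *v x = x) \<and> (\<forall>x\<in>L. P *v x = 0))"

lemma complementary_unique:
  assumes "complementary U L" "y \<in> U" "z \<in> L" "y' \<in> U" "z' \<in> L" "y + z = y' + z'"
  shows "y = y'"
proof -
  have "y - y' = z' - z" using assms(6) by (simp add: algebra_simps)
  moreover have "y - y' \<in> U" "z' - z \<in> L"
    using assms by (auto simp: complementary_def intro: vec.subspace_diff)
  ultimately have "y - y' \<in> U \<inter> L" by simp
  moreover have "U \<inter> L = {0}" using assms(1) by (simp add: complementary_def)
  ultimately show ?thesis by auto
qed

lemma proj_along_exists:
  assumes "complementary U L"
  shows "\<exists>P. (\<forall>x\<in>U. P *v x = x) \<and> (\<forall>x\<in>L. P *v x = 0)"
proof -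
  define f where "f x = (THE y. y \<in> U \<and> (\<exists>z\<in>L. x = y + z))" for x
  have sub: "vec.subspace U" "vec.subspace L" using assms by (auto simp: complementary_def)
  have f: "f (y + z) = y" if "y \<in> U" "z \<in> L" for y z
    unfolding f_def using that complementary_unique[OF assms] by (intro the_equality) auto
  have dec: "\<exists>y\<in>U. \<exists>z\<in>L. x = y + z" for x using assms by (auto simp: complementary_def)
  have "Vector_Spaces.linear (*s) (*s) f"
  proof (rule Vector_Spaces.linear_iff[THEN iffD2], intro conjI allI)
    fix x x' obtain y z y' z' where yz: "y \<in> U" "z \<in> L" "x = y + z" "y' \<in> U" "z' \<in> L" "x' = y' + z'"
      using dec by metis
    have "x + x' = (y + y') + (z + z')" using yz by simp
    then show "f (x + x') = f x + f x'"
      using yz f sub by (metis vec.subspace_add)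
  next
    fix c x obtain y z where yz: "y \<in> U" "z \<in> L" "x = y + z"
      using dec by metis
    have "c *s x = c *s y + c *s z" using yz by (simp add: vec.scale_right_distrib)
    then show "f (c *s x) = c *s f x"
      using yz f sub by (metis vec.subspace_scale)
  qed unfold_locales
  then have "matrix f *v x = f x" for x by (rule matrix_works)
  moreover have "f x = x" if "x \<in> U" for x using f[OF that, of 0] sub(2) vec.subspace_0 by auto
  moreover have "f x = 0" if "x \<in> L" for x using f[of 0 x] that sub(1) vec.subspace_0 by auto
  ultimately show ?thesis by metis
qed

lemma proj_along_id: "complementary U L \<Longrightarrow> x \<in> U \<Longrightarrow> proj_along U L *v x = x"
  and proj_along_0: "complementary U L \<Longrightarrow> x \<in> L \<Longrightarrow> proj_along U L *v x = 0"
  using someI_ex[OF proj_along_exists] unfolding proj_along_def by blast+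

lemma proj_along_in: "complementary U L \<Longrightarrow> proj_along U L *v x \<in> U"
  and proj_along_diff: "complementary U L \<Longrightarrow> x - proj_along U L *v x \<in> L"
proof -
  assume c: "complementary U L"
  then obtain y z where "y \<in> U" "z \<in> L" "x = y + z" unfolding complementary_def by metis
  then show "proj_along U L *v x \<in> U" "x - proj_along U L *v x \<in> L"
    using proj_along_id[OF c] proj_along_0[OF c] by (auto simp: matrix_vector_right_distrib)
qed

text \<open>The pairs are ordered oppositely in their two entries, so their projections form a
  commuting chain. Differences of members of such a chain are orthogonal idempotents, which is how
  \<open>pr\<close> will arise.\<close>

lemma proj_along_nested:
  assumes c: "complementary U L" and c': "complementary U' L'" and "U \<subseteq> U'" "L' \<subseteq> L"
  shows "proj_along U L ** proj_along U' L' = proj_along U L"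
    and "proj_along U' L' ** proj_along U L = proj_along U L"
proof -
  show "proj_along U L ** proj_along U' L' = proj_along U L"
  proof (rule matrix_eqI)
    fix x
    have "proj_along U L *v (x - proj_along U' L' *v x) = 0"
      using proj_along_diff[OF c'] assms by (blast intro: proj_along_0)
    then show "proj_along U L ** proj_along U' L' *v x = proj_along U L *v x"
      by (simp add: matrix_vector_mul_assoc[symmetric] matrix_vector_mult_diff_distrib)
  qed
  show "proj_along U' L' ** proj_along U L = proj_along U L"
    using proj_along_in[OF c] proj_along_id[OF c'] assms
    by (intro matrix_eqI) (auto simp: matrix_vector_mul_assoc[symmetric])
qed

text \<open>Enlarging an entry of a complementary pair destroys the directness of the sum. This is
  what lets \<open>Up\<close> alone determine the projection.\<close>

lemma complementary_mono_eq:
  assumes "complementary U L" "complementary U' L'" "U \<subseteq> U'" "L \<subseteq> L'"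
  shows "U = U'" "L = L'"
proof -
  have "x \<in> U" if "x \<in> U'" for x
    using that complementary_unique[OF assms(2), of x 0] assms
    by (metis (no_types, opaque_lifting) add.right_neutral complementary_def subsetD vec.subspace_0)
  then show "U = U'" using assms by auto
  have "x \<in> L" if x: "x \<in> L'" for x
  proof -
    obtain y z where yz: "y \<in> U" "z \<in> L" "x = y + z" using assms(1) unfolding complementary_def by metis
    have "0 = y" using complementary_unique[OF assms(2), of 0 x y z] yz assms x
      by (auto simp: complementary_def intro: vec.subspace_0)
    then show ?thesis using yz by simp
  qed
  then show "L = L'" using assms by auto
qed

section \<open>Opposed filtrations\<close>

lemma re_vec_add: "re_vec (x + y) = re_vec x + re_vec y"
  and im_vec_add: "im_vec (x + y) = im_vec x + im_vec y"
  and re_vec_scale: "re_vec (c *s x) = Re c *\<^sub>R re_vec x - Im c *\<^sub>R im_vec x"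
  and im_vec_scale: "im_vec (c *s x) = Re c *\<^sub>R im_vec x + Im c *\<^sub>R re_vec x"
  and re_vec_0 [simp]: "re_vec 0 = 0" and im_vec_0 [simp]: "im_vec 0 = 0"
  and re_vec_cnj: "re_vec (cnj_vec x) = re_vec x"
  and im_vec_cnj: "im_vec (cnj_vec x) = - im_vec x"
  by (simp_all add: re_vec_def im_vec_def cnj_vec_def vec_eq_iff)

lemma re_im_vec_eq_0: "re_vec x = 0 \<Longrightarrow> im_vec x = 0 \<Longrightarrow> x = 0"
  by (simp add: re_vec_def im_vec_def vec_eq_iff complex_eq_iff)

lemma span_Un_iff:
  assumes "vec.subspace A" "vec.subspace B"
  shows "x \<in> vec.span (A \<union> B) \<longleftrightarrow> (\<exists>y\<in>A. \<exists>z\<in>B. x = y + z)"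
proof -
  have "vec.span A = A" "vec.span B = B" using assms by (simp_all add: vec.span_eq_iff)
  then have "vec.span (A \<union> B) = {x + y |x y. x \<in> A \<and> y \<in> B}" by (simp only: vec.span_Un)
  then show ?thesis by blast
qed

text \<open>Whatever depends on \<open>W\<close> and \<open>Q\<close> only is separated from
  \<open>F\<close>, since these facts serve the original filtration and the moved one alike.\<close>

locale weighted_forms =
  fixes W :: "'n::finite weight_filtration" and Q :: "'n graded_forms"
  assumes data: "graded_polarization_data W Q"
begin

abbreviation Wc where "Wc \<equiv> weight_C W"

lemma W_real: "subspace (W k)" "i \<le> j \<Longrightarrow> W i \<subseteq> W j" "\<exists>k. W k = {0}" "\<exists>k. W k = UNIV"
  using data by (auto simp: graded_polarization_data_def monoD)

lemma Wc_subspace: "vec.subspace (Wc k)"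
proof -
  note W = W_real(1)[of k]
  show ?thesis
    unfolding vec.subspace_def weight_C_def
    using subspace_0[OF W] subspace_add[OF W] subspace_diff[OF W] subspace_scale[OF W]
    by (simp add: re_vec_add im_vec_add re_vec_scale im_vec_scale)
qed

lemma Wc_mono: "i \<le> j \<Longrightarrow> Wc i \<subseteq> Wc j"
  using W_real(2) by (auto simp: weight_C_def)

lemma Wc_cnj: "cnj_vec x \<in> Wc k \<longleftrightarrow> x \<in> Wc k"
  using subspace_neg[OF W_real(1)[of k], of "im_vec x"] subspace_neg[OF W_real(1)[of k], of "- im_vec x"]
  by (auto simp: weight_C_def re_vec_cnj im_vec_cnj)

lemma Wc_zero: "\<exists>k. Wc k = {0}" and Wc_UNIV: "\<exists>k. Wc k = UNIV"
proof -
  obtain k where "W k = {0}" using W_real(3) by blast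
  then have "x \<in> Wc k \<longleftrightarrow> re_vec x = 0 \<and> im_vec x = 0" for x by (simp add: weight_C_def)
  then have "x \<in> Wc k \<longleftrightarrow> x = 0" for x by (metis re_im_vec_eq_0 re_vec_0 im_vec_0)
  then have "Wc k = {0}" by blast
  then show "\<exists>k. Wc k = {0}" ..
  obtain k where "W k = UNIV" using W_real(4) by blast
  then have "Wc k = UNIV" by (simp add: weight_C_def)
  then show "\<exists>k. Wc k = UNIV" ..
qed

end

locale polarized_mhs = weighted_forms W Q
  for W :: "'n::finite weight_filtration" and Q :: "'n graded_forms" +
  fixes F :: "'n filtration"
  assumes mhs: "mixed_hodge_structure W F" and pol: "graded_polarized W Q F"
begin

lemma F_subspace: "vec.subspace (F p)"
  and F_anti: "p \<le> q \<Longrightarrow> F q \<subseteq> F p"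
  and F_zero: "\<exists>p. F p = {0}" and F_UNIV: "\<exists>p. F p = UNIV"
  using mhs by (auto simp: mixed_hodge_structure_def hodge_filtration_def dest: antimonoD)

text \<open>One bound for both filtrations makes all sums finite. It records only which steps are
  trivial, a property that survives moving \<open>F\<close> by an invertible matrix; hence
  \<open>F\<close> and the moved filtration share the choice \<open>bnd\<close>.\<close>

definition bound_prop :: "int \<Rightarrow> bool" where
  "bound_prop N \<longleftrightarrow> N > 0 \<and> (\<forall>k\<le>-N. Wc k = {0}) \<and> (\<forall>k\<ge>N. Wc k = UNIV) \<and>
     (\<forall>p\<le>-N. F p = UNIV) \<and> (\<forall>p\<ge>N. F p = {0})"

definition bnd :: int where "bnd = (SOME N. bound_prop N)"

lemma bnd: "bound_prop bnd"
proof -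
  obtain a b c d where *: "Wc a = {0}" "Wc b = UNIV" "F c = {0}" "F d = UNIV"
    using Wc_zero Wc_UNIV F_zero F_UNIV by metis
  define N where "N = max 1 (max (-a) (max b (max c (-d))))"
  have "bound_prop N"
    unfolding bound_prop_def
  proof (intro conjI allI impI)
    show "N > 0" by (simp add: N_def)
  next
    fix k assume "k \<le> -N" then have "Wc k \<subseteq> Wc a" by (intro Wc_mono) (simp add: N_def)
    then show "Wc k = {0}" using * vec.subspace_0[OF Wc_subspace[of k]] by auto
  next
    fix k assume "N \<le> k" then have "Wc b \<subseteq> Wc k" by (intro Wc_mono) (simp add: N_def)
    then show "Wc k = UNIV" using * by auto
  next
    fix p assume "p \<le> -N" then have "F d \<subseteq> F p" by (intro F_anti) (simp add: N_def)
    then show "F p = UNIV" using * by auto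
  next
    fix p assume "N \<le> p" then have "F p \<subseteq> F c" by (intro F_anti) (simp add: N_def)
    then show "F p = {0}" using * vec.subspace_0[OF F_subspace[of p]] by auto
  qed
  then show ?thesis unfolding bnd_def by (rule someI)
qed

lemma bnd_pos: "bnd > 0" and Wc_below: "k \<le> - bnd \<Longrightarrow> Wc k = {0}"
  and Wc_above: "k \<ge> bnd \<Longrightarrow> Wc k = UNIV" and F_below: "p \<le> - bnd \<Longrightarrow> F p = UNIV"
  and F_above: "p \<ge> bnd \<Longrightarrow> F p = {0}"
  using bnd by (auto simp: bound_prop_def)

lemma gr_filtration_iff:
  "x \<in> gr_filtration W F k p \<longleftrightarrow> (\<exists>y\<in>F p \<inter> Wc k. \<exists>z\<in>Wc (k - 1). x = y + z)"
  unfolding gr_filtration_def by (rule span_Un_iff) (intro vec.subspace_inter F_subspace Wc_subspace)+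

lemma gr_filtration_subspace: "vec.subspace (gr_filtration W F k p)"
  unfolding gr_filtration_def by (rule vec.subspace_span)

text \<open>Lifts the decomposition of gr_k to representatives; \<open>t\<close> is the error of
  lifting.\<close>

lemma opposed_span:
  assumes "x \<in> Wc k"
  shows "\<exists>y\<in>F p \<inter> Wc k. \<exists>z\<in>cnj_vec ` F (k + 1 - p) \<inter> Wc k. \<exists>t\<in>Wc (k - 1). x = y + z + t"
proof -
  have "x \<in> vec.span (gr_filtration W F k p \<union> cnj_vec ` gr_filtration W F k (k - p + 1))"
    using assms mhs by (auto simp: mixed_hodge_structure_def)
  then obtain a b where ab: "a \<in> gr_filtration W F k p" "b \<in> gr_filtration W F k (k - p + 1)" "x = a + cnj_vec b"
    by (auto simp: span_Un_iff gr_filtration_subspace vec_subspace_cnj)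
  obtain y t where yt: "y \<in> F p \<inter> Wc k" "t \<in> Wc (k - 1)" "a = y + t"
    using ab gr_filtration_iff by metis
  obtain z s where zs: "z \<in> F (k - p + 1) \<inter> Wc k" "s \<in> Wc (k - 1)" "b = z + s"
    using ab gr_filtration_iff by metis
  have "x = y + cnj_vec z + (t + cnj_vec s)" using ab yt zs by (simp add: cnj_vec_add)
  moreover have "t + cnj_vec s \<in> Wc (k - 1)"
    using yt zs by (intro vec.subspace_add Wc_subspace) (simp_all add: Wc_cnj)
  moreover have "cnj_vec z \<in> cnj_vec ` F (k + 1 - p) \<inter> Wc k"
    using zs by (auto simp: Wc_cnj algebra_simps)
  ultimately show ?thesis using yt by blast
qed

text \<open>Modulo lower weight, \<open>y\<close> lies in F^p gr_k and in the conjugate of F^(k+1-p)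
  gr_k, which meet in zero.\<close>

lemma opposed_disjoint:
  assumes "y \<in> F p \<inter> Wc k" "z \<in> cnj_vec ` F (k + 1 - p) \<inter> Wc k" "y - z \<in> Wc (k - 1)"
  shows "y \<in> Wc (k - 1)"
proof -
  obtain z' where z': "z = cnj_vec z'" "z' \<in> F (k + 1 - p)" using assms by auto
  have "y \<in> gr_filtration W F k p"
    unfolding gr_filtration_iff using assms vec.subspace_0[OF Wc_subspace] by force
  moreover have "cnj_vec y \<in> gr_filtration W F k (k - p + 1)"
    unfolding gr_filtration_iff
  proof (intro bexI)
    show "cnj_vec y = z' + cnj_vec (y - z)" using z' by (simp add: cnj_vec_diff)
    show "cnj_vec (y - z) \<in> Wc (k - 1)" using assms by (simp add: Wc_cnj)
    have "k + 1 - p = k - p + 1" by simp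
    moreover have "z' \<in> Wc k" using z' assms Wc_cnj[of z'] by simp
    ultimately show "z' \<in> F (k - p + 1) \<inter> Wc k" using z' by (metis IntI)
  qed
  ultimately have "y \<in> gr_filtration W F k p \<inter> cnj_vec ` gr_filtration W F k (k - p + 1)"
    by (simp add: cnj_vec_mem_image[symmetric])
  moreover have "gr_filtration W F k p \<inter> cnj_vec ` gr_filtration W F k (k - p + 1) = Wc (k - 1)"
    using mhs unfolding mixed_hodge_structure_def by blast
  ultimately show ?thesis by blast
qed

text \<open>For a suitable level function these are the sums of intersections of the conjugate
  filtration with W in Deligne's formula for I^{p,q}. Lower weights enter with larger steps of the
  conjugate filtration, because conjugation respects the bigrading only up to lower weights.\<close>

definition lowt :: "(int \<Rightarrow> int) \<Rightarrow> int \<Rightarrow> 'n cvec set" where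
  "lowt l j = vec.span (\<Union>i\<in>{..j}. cnj_vec ` F (i + 1 - l i) \<inter> Wc i)"

lemma lowt_subspace: "vec.subspace (lowt l j)"
  by (simp add: lowt_def vec.subspace_span)

lemma lowt_Suc: "x \<in> lowt l j \<longleftrightarrow> (\<exists>y\<in>cnj_vec ` F (j + 1 - l j) \<inter> Wc j. \<exists>z\<in>lowt l (j - 1). x = y + z)"
proof -
  have "{..j} = insert j {..j - 1}" by auto
  then have "lowt l j = vec.span ((cnj_vec ` F (j + 1 - l j) \<inter> Wc j) \<union> lowt l (j - 1))"
    unfolding lowt_def by (simp add: vec.span_Un vec.span_span)
  then show ?thesis
    by (simp add: span_Un_iff lowt_subspace vec.subspace_inter vec_subspace_cnj F_subspace Wc_subspace)
qed

lemma lowt_mono: "i \<le> j \<Longrightarrow> lowt l i \<subseteq> lowt l j"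
  unfolding lowt_def by (intro vec.span_mono UN_mono) auto

lemma lowt_Wc: "lowt l j \<subseteq> Wc j"
  unfolding lowt_def by (rule vec.span_minimal) (use Wc_mono Wc_subspace in auto)

lemma lowt_gen: "x \<in> F (i + 1 - l i) \<Longrightarrow> x \<in> Wc i \<Longrightarrow> i \<le> j \<Longrightarrow> cnj_vec x \<in> lowt l j"
  unfolding lowt_def by (rule vec.span_base) (auto simp: Wc_cnj)

text \<open>On \<open>gr\<^sub>k\<close> the filtration \<open>Up\<close> induces \<open>F\<^sup>l\<^sup>(\<^sup>k\<^sup>)\<close> and \<open>lowt\<close> the conjugate of \<open>F\<^sup>k\<^sup>+\<^sup>1\<^sup>-\<^sup>l\<^sup>(\<^sup>k\<^sup>)\<close>, which is
  a complement; the bound on the growth of \<open>l\<close> makes the sum direct.\<close>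

lemma lowt_complement:
  assumes Up: "vec.subspace Up"
    and sub: "\<And>k x. x \<in> Up \<Longrightarrow> x \<in> Wc k \<Longrightarrow> \<exists>y\<in>F (l k) \<inter> Wc k. x - y \<in> Wc (k - 1)"
    and sup: "\<And>k. F (l k) \<inter> Wc k \<subseteq> Up"
    and l: "\<And>k. l k \<le> l (k - 1) + 1"
  shows "Up \<inter> lowt l j = {0} \<and> (\<forall>x\<in>Wc j. \<exists>y\<in>Up \<inter> Wc j. \<exists>z\<in>lowt l j. x = y + z)"
proof (cases "j \<le> - bnd")
  case True
  then show ?thesis
    using lowt_Wc[of l j] Wc_below[OF True] vec.subspace_0[OF Up] vec.subspace_0[OF lowt_subspace[of l j]]
    by auto
next
  case False
  then have "- bnd \<le> j" by simp
  then show ?thesis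
  proof (induction j rule: int_ge_induct)
    case base
    show ?case
      using lowt_Wc[of l "- bnd"] Wc_below[of "- bnd"] vec.subspace_0[OF Up] vec.subspace_0[OF lowt_subspace[of l "- bnd"]]
      by auto
  next
    case (step i)
    show ?case
    proof (intro conjI ballI)
      have "x = 0" if x: "x \<in> Up" "x \<in> lowt l (i + 1)" for x
      proof -
        obtain y n where yn: "y \<in> cnj_vec ` F (i + 1 + 1 - l (i + 1)) \<inter> Wc (i + 1)" "n \<in> lowt l i" "x = y + n"
          using x(2) unfolding lowt_Suc[of x l "i + 1"] by auto
        have n: "n \<in> Wc i" using yn lowt_Wc by auto
        have xW: "x \<in> Wc (i + 1)" using x lowt_Wc by auto
        obtain y' where y': "y' \<in> F (l (i + 1)) \<inter> Wc (i + 1)" "x - y' \<in> Wc i"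
          using sub[OF x(1) xW] by auto
        have "y' - y = n - (x - y')" using yn by simp
        then have "y' - y \<in> Wc i" using n y' by (metis Wc_subspace vec.subspace_diff)
        \<comment> \<open>Both \<open>y'\<close> and \<open>y\<close> represent \<open>x\<close> on
          gr_(i+1) and lie in opposed steps, so \<open>x\<close> already has weight i.\<close>
        then have "y' \<in> Wc i" using opposed_disjoint[OF y'(1) yn(1)] by simp
        then have xi: "x \<in> Wc i" using y' vec.subspace_add[OF Wc_subspace] by force
        have "y = x - n" using yn by simp
        then have yi: "y \<in> Wc i" using xi n vec.subspace_diff[OF Wc_subspace] by metis
        obtain y0 where y0: "y = cnj_vec y0" "y0 \<in> F (i + 1 + 1 - l (i + 1))" using yn by auto
        \<comment> \<open>The bound on the growth of \<open>l\<close> keeps a generator of weight i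
          + 1 a generator after it has dropped to weight i, where the induction hypothesis
          applies.\<close>
        have "i + 1 - l i \<le> i + 1 + 1 - l (i + 1)" using l[of "i + 1"] by simp
        then have "y0 \<in> F (i + 1 - l i)" using F_anti y0 by blast
        then have "y \<in> lowt l i" unfolding y0(1) using yi y0 Wc_cnj by (intro lowt_gen) auto
        then have "x \<in> lowt l i" using yn vec.subspace_add[OF lowt_subspace] by metis
        then show "x = 0" using step x by auto
      qed
      then show "Up \<inter> lowt l (i + 1) = {0}"
        using vec.subspace_0[OF Up] vec.subspace_0[OF lowt_subspace] by auto
    next
      fix x assume "x \<in> Wc (i + 1)"
      then obtain y z t where yzt: "y \<in> F (l (i + 1)) \<inter> Wc (i + 1)"
        "z \<in> cnj_vec ` F (i + 1 + 1 - l (i + 1)) \<inter> Wc (i + 1)" "t \<in> Wc i" "x = y + z + t"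
        using opposed_span[of x "i + 1" "l (i + 1)"] by auto
      obtain a b where ab: "a \<in> Up \<inter> Wc i" "b \<in> lowt l i" "t = a + b" using step yzt by metis
      have "x = (y + a) + (z + b)" using yzt ab by simp
      moreover have "y + a \<in> Up \<inter> Wc (i + 1)"
        using yzt ab sup[of "i + 1"] Wc_mono[of i "i + 1"]
        by (auto intro: vec.subspace_add[OF Up] vec.subspace_add[OF Wc_subspace])
      moreover have "z + b \<in> lowt l (i + 1)" unfolding lowt_Suc[of _ l "i + 1"] using yzt ab by auto
      ultimately show "\<exists>y\<in>Up \<inter> Wc (i + 1). \<exists>z\<in>lowt l (i + 1). x = y + z" by metis
    qed
  qed
qed

text \<open>\<open>Up a b\<close> is to be the sum of the summands of bidegrees \<open>(c, d)\<close> with \<open>c > a\<close>, or \<open>c = a\<close> and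
  \<open>d \<le> b\<close>, and \<open>Low a b\<close> the sum of the others.\<close>

definition lev :: "int \<Rightarrow> int \<Rightarrow> int \<Rightarrow> int" where
  "lev a b k = (if k \<le> a + b then a else a + 1)"

definition Up :: "int \<Rightarrow> int \<Rightarrow> 'n cvec set" where
  "Up a b = {y + z | y z. y \<in> F (a + 1) \<and> z \<in> F a \<inter> Wc (a + b)}"

definition Low :: "int \<Rightarrow> int \<Rightarrow> 'n cvec set" where
  "Low a b = lowt (lev a b) bnd"

lemma Up_subspace: "vec.subspace (Up a b)"
proof -
  have "Up a b = vec.span (F (a + 1) \<union> (F a \<inter> Wc (a + b)))"
    unfolding Up_def
    by (rule set_eqI)
      (simp only: span_Un_iff[OF F_subspace vec.subspace_inter[OF F_subspace Wc_subspace]], blast)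
  then show ?thesis by (simp add: vec.subspace_span)
qed

lemma F_Up: "x \<in> F (a + 1) \<Longrightarrow> x \<in> Up a b" and F_Wc_Up: "x \<in> F a \<Longrightarrow> x \<in> Wc (a + b) \<Longrightarrow> x \<in> Up a b"
  using vec.subspace_0[OF F_subspace] vec.subspace_0[OF Wc_subspace] unfolding Up_def
  by (force, force)

lemma Up_F: "Up a b \<subseteq> F a"
  using F_anti[of a "a + 1"] by (auto simp: Up_def intro: vec.subspace_add[OF F_subspace])

lemma Up_lowt:
  "Up a b \<inter> lowt (lev a b) j = {0} \<and> (\<forall>x\<in>Wc j. \<exists>y\<in>Up a b \<inter> Wc j. \<exists>z\<in>lowt (lev a b) j. x = y + z)"
proof (rule lowt_complement[OF Up_subspace])
  fix k x assume x: "x \<in> Up a b" "x \<in> Wc k"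
  show "\<exists>y\<in>F (lev a b k) \<inter> Wc k. x - y \<in> Wc (k - 1)"
  proof (cases "k \<le> a + b")
    case True
    then show ?thesis using Up_F x vec.subspace_0[OF Wc_subspace] by (force simp: lev_def)
  next
    case False
    obtain y z where yz: "x = y + z" "y \<in> F (a + 1)" "z \<in> F a \<inter> Wc (a + b)" using x by (auto simp: Up_def)
    have "z \<in> Wc (k - 1)" using yz False Wc_mono[of "a + b" "k - 1"] by auto
    moreover have "y = x - z" using yz by simp
    then have "y \<in> Wc k" using x yz False Wc_mono[of "a + b" k] vec.subspace_diff[OF Wc_subspace, of x k z] by auto
    moreover have "x - y = z" using yz by simp
    ultimately show ?thesis using yz False by (intro bexI[of _ y]) (auto simp: lev_def)
  qed
next
  fix k show "F (lev a b k) \<inter> Wc k \<subseteq> Up a b"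
    using Wc_mono[of k "a + b"] by (auto simp: lev_def intro: F_Up F_Wc_Up)
next
  fix k show "lev a b k \<le> lev a b (k - 1) + 1" by (auto simp: lev_def)
qed

lemma complementary_Up_Low: "complementary (Up a b) (Low a b)"
  unfolding complementary_def Low_def
  using Up_subspace lowt_subspace Up_lowt[of a b bnd] by (simp add: Wc_above)

text \<open>The decomposition of \<open>x\<close> inside weight \<open>j\<close> is also its
  decomposition along \<open>Up\<close> and \<open>Low\<close>, whose first component vanishes. Thus
  generators of weight above \<open>j\<close> contribute nothing to elements of weight
  \<open>j\<close>.\<close>

lemma Low_Wc: "x \<in> Low a b \<Longrightarrow> x \<in> Wc j \<Longrightarrow> x \<in> lowt (lev a b) j"
proof (cases "j \<le> bnd")
  case True
  assume x: "x \<in> Low a b" "x \<in> Wc j"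
  obtain y z where yz: "y \<in> Up a b" "z \<in> lowt (lev a b) j" "x = y + z"
    using Up_lowt[of a b j] x(2) by blast
  have "z \<in> Low a b" using yz lowt_mono[OF True] by (auto simp: Low_def)
  then have "0 = y"
    using complementary_unique[OF complementary_Up_Low, of 0 a b x y z] yz x vec.subspace_0[OF Up_subspace] by auto
  then show ?thesis using yz by simp
next
  case False
  assume "x \<in> Low a b"
  then show ?thesis using lowt_mono[of bnd j "lev a b"] False by (auto simp: Low_def)
qed

text \<open>\<open>Low\<close> stops at weight \<open>bnd\<close>, where W is already everything. A
  generator of larger weight has no component in \<open>Up\<close>, because the sum with
  \<open>Up\<close> stays direct in every weight.\<close>

lemma lowt_Low: "lowt (lev a b) j \<subseteq> Low a b"
proof (cases "j \<le> bnd")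
  case False
  have "lowt (lev a b) j \<subseteq> Low a b" unfolding lowt_def
  proof (rule vec.span_minimal)
    show "vec.subspace (Low a b)" by (simp add: Low_def lowt_subspace)
    show "(\<Union>i\<in>{..j}. cnj_vec ` F (i + 1 - lev a b i) \<inter> Wc i) \<subseteq> Low a b"
    proof clarsimp
      fix i x assume x: "x \<in> F (i + 1 - lev a b i)" "cnj_vec x \<in> Wc i"
      obtain y z where yz: "y \<in> Up a b" "z \<in> Low a b" "cnj_vec x = y + z"
        using complementary_Up_Low unfolding complementary_def by metis
      let ?m = "max i bnd"
      have 1: "cnj_vec x \<in> lowt (lev a b) ?m" using x Wc_cnj by (intro lowt_gen[where i=i]) auto
      have 2: "z \<in> lowt (lev a b) ?m" using yz lowt_mono[of bnd ?m] by (auto simp: Low_def)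
      have "y = cnj_vec x - z" using yz by simp
      then have "y \<in> lowt (lev a b) ?m" using 1 2 vec.subspace_diff[OF lowt_subspace] by metis
      then have "y = 0" using Up_lowt[of a b ?m] yz by blast
      then show "cnj_vec x \<in> Low a b" using yz by simp
    qed
  qed
  then show ?thesis .
qed (simp add: Low_def lowt_mono)

lemma Low_gen: "x \<in> F (i + 1 - lev a b i) \<Longrightarrow> x \<in> Wc i \<Longrightarrow> cnj_vec x \<in> Low a b"
  using lowt_gen[of x i "lev a b" i] lowt_Low by blast

lemma Up_mono: "a > a' \<or> a = a' \<and> b \<le> b' \<Longrightarrow> Up a b \<subseteq> Up a' b'"
proof (elim disjE conjE)
  assume "a' < a"
  then have "Up a b \<subseteq> F (a' + 1)" using Up_F F_anti[of "a' + 1" a] by fastforce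
  then show ?thesis using F_Up by blast
next
  assume "a = a'" "b \<le> b'"
  then show ?thesis using Wc_mono[of "a + b" "a + b'"] unfolding Up_def by auto
qed

lemma Low_anti: "a > a' \<or> a = a' \<and> b \<le> b' \<Longrightarrow> Low a' b' \<subseteq> Low a b"
proof -
  assume *: "a > a' \<or> a = a' \<and> b \<le> b'"
  have "lowt (lev a' b') bnd \<subseteq> lowt (lev a b) bnd"
    unfolding lowt_def
  proof (rule vec.span_mono, rule UN_mono)
    fix i have "F (i + 1 - lev a' b' i) \<subseteq> F (i + 1 - lev a b i)"
      using * by (intro F_anti) (auto simp: lev_def)
    then show "cnj_vec ` F (i + 1 - lev a' b' i) \<inter> Wc i \<subseteq> cnj_vec ` F (i + 1 - lev a b i) \<inter> Wc i" by auto
  qed simp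
  then show ?thesis by (simp add: Low_def)
qed

section \<open>Projections onto the individual summands\<close>

definition P :: "int \<Rightarrow> int \<Rightarrow> 'n cmat" where "P a b = proj_along (Up a b) (Low a b)"

definition pr :: "int \<times> int \<Rightarrow> 'n cmat" where "pr \<alpha> = P (fst \<alpha>) (snd \<alpha>) - P (fst \<alpha>) (snd \<alpha> - 1)"

lemma P_in: "P a b *v x \<in> Up a b" and P_diff: "x - P a b *v x \<in> Low a b"
  and P_id: "x \<in> Up a b \<Longrightarrow> P a b *v x = x" and P_0: "x \<in> Low a b \<Longrightarrow> P a b *v x = 0"
  unfolding P_def using complementary_Up_Low
  by (auto intro: proj_along_in proj_along_diff proj_along_id proj_along_0)

lemma P_nested: "a > a' \<or> a = a' \<and> b \<le> b' \<Longrightarrow> P a b ** P a' b' = P a b"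
  "a > a' \<or> a = a' \<and> b \<le> b' \<Longrightarrow> P a' b' ** P a b = P a b"
  unfolding P_def by (intro proj_along_nested complementary_Up_Low Up_mono Low_anti; assumption)+

text \<open>\<open>Up_lowt\<close> decomposes an element of weight \<open>k\<close> within weight
  \<open>k\<close>, and by uniqueness this is the decomposition that \<open>P\<close> sees.\<close>

lemma P_Wc: "x \<in> Wc k \<Longrightarrow> P a b *v x \<in> Wc k"
proof -
  assume "x \<in> Wc k"
  then obtain y z where yz: "y \<in> Up a b \<inter> Wc k" "z \<in> lowt (lev a b) k" "x = y + z"
    using Up_lowt[of a b k] by blast
  have "z \<in> Low a b" using yz lowt_Low by blast
  then have "P a b *v x = y" using yz P_id P_0 by (simp add: matrix_vector_right_distrib)
  then show ?thesis using yz by auto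
qed

text \<open>For fixed \<open>a\<close> the subspaces \<open>Up a b\<close> increase with
  \<open>b\<close> from F^(a+1) to F^a; at these ends consecutive columns are glued in
  \<open>sum_pr\<close>.\<close>

lemma Up_cases:
  "a + b \<ge> bnd \<Longrightarrow> Up a b = F a" "a + b \<le> - bnd \<Longrightarrow> Up a b = F (a + 1)"
  using Up_F[of a b] F_Wc_Up[of _ a b] Wc_above[of "a + b"] Wc_below[of "a + b"]
  by (blast, auto simp: Up_def F_subspace vec.subspace_0)

text \<open>For comparable indices the two lower segments are nested, and nested complements of one
  subspace coincide.\<close>

lemma P_eq: "Up a b = Up a' b' \<Longrightarrow> P a b = P a' b'"
proof -
  have main: "P a b = P a' b'" if "Up a b = Up a' b'" "a > a' \<or> a = a' \<and> b \<le> b'" for a b a' b'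
  proof -
    have "Low a b = Low a' b'"
      using complementary_mono_eq[OF complementary_Up_Low complementary_Up_Low, of a' b' a b]
        Low_anti[OF that(2)] that(1) by auto
    then show ?thesis using that by (simp add: P_def)
  qed
  assume "Up a b = Up a' b'"
  then show ?thesis using main[of a b a' b'] main[of a' b' a b] by (metis linorder_less_linear linear)
qed

end

section \<open>The Deligne bigrading\<close>

lemma matrix_diff_ldistrib: "A ** (B - C) = A ** B - A ** (C :: 'n::finite cmat)"
  and matrix_diff_rdistrib: "(A - B) ** C = A ** C - B ** (C :: 'n::finite cmat)"
  by (simp_all add: matrix_matrix_mult_def vec_eq_iff sum_subtractf algebra_simps)

context polarized_mhs begin

lemma pr_orthogonal: "pr \<alpha> ** pr \<beta> = (if \<alpha> = \<beta> then pr \<alpha> else 0)"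
proof -
  obtain a b c d where ab: "\<alpha> = (a, b)" "\<beta> = (c, d)" by (metis surj_pair)
  have exp: "pr \<alpha> ** pr \<beta> = P a b ** P c d - P a b ** P c (d - 1) - (P a (b - 1) ** P c d - P a (b - 1) ** P c (d - 1))"
    by (simp add: pr_def ab matrix_diff_ldistrib matrix_diff_rdistrib)
  consider "\<alpha> = \<beta>" | "a > c \<or> a = c \<and> b < d" | "c > a \<or> c = a \<and> d < b" using ab by fastforce
  then show ?thesis
  proof cases
    case 1
    then have "c = a" "d = b" using ab by auto
    then show ?thesis
      unfolding exp using P_nested(1)[of a a b b] P_nested(2)[of a a "b - 1" b] P_nested(1)[of a a "b - 1" b]
        P_nested(1)[of a a "b - 1" "b - 1"] by (simp add: 1[symmetric] pr_def ab)
  next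
    case 2
    then have ne: "\<alpha> \<noteq> \<beta>" using ab by auto
    have "P a b ** P c d = P a b" "P a b ** P c (d - 1) = P a b"
      "P a (b - 1) ** P c d = P a (b - 1)" "P a (b - 1) ** P c (d - 1) = P a (b - 1)"
      using 2 by (auto intro!: P_nested)
    then show ?thesis unfolding exp using ne by simp
  next
    case 3
    then have ne: "\<alpha> \<noteq> \<beta>" using ab by auto
    have "P a b ** P c d = P c d" "P a b ** P c (d - 1) = P c (d - 1)"
      "P a (b - 1) ** P c d = P c d" "P a (b - 1) ** P c (d - 1) = P c (d - 1)"
      using 3 by (auto intro!: P_nested)
    then show ?thesis unfolding exp using ne by simp
  qed
qed

lemma pr_orthogonal_vec: "pr \<alpha> *v (pr \<beta> *v x) = (if \<alpha> = \<beta> then pr \<alpha> *v x else 0)"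
  by (simp add: matrix_vector_mul_assoc pr_orthogonal)

text \<open>A summand can be nonzero only if a and a + b lie between - bnd and bnd, which confines b
  to twice that range.\<close>

definition box :: "(int \<times> int) set" where "box = {- bnd..bnd} \<times> {- 2 * bnd..2 * bnd}"

lemma finite_box [simp]: "finite box" by (simp add: box_def)

lemma pr_outside: "\<alpha> \<notin> box \<Longrightarrow> pr \<alpha> = 0"
proof -
  assume *: "\<alpha> \<notin> box"
  obtain a b where ab: "\<alpha> = (a, b)" by (metis surj_pair)
  have "Up a b = Up a (b - 1)"
  proof -
    consider "a + b > bnd" | "a + b \<le> - bnd" | "a \<ge> bnd" | "a < - bnd"
      using * bnd_pos by (fastforce simp: ab box_def)
    then show ?thesis
    proof cases
      case 3
      then have "Up a b \<subseteq> {0}" "Up a (b - 1) \<subseteq> {0}" using Up_F[of a] F_above[of a] by auto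
      then show ?thesis using vec.subspace_0[OF Up_subspace] by blast
    next
      case 4
      then show ?thesis using F_Up[of _ a b] F_Up[of _ a "b - 1"] F_below[of "a + 1"] by auto
    qed (simp_all add: Up_cases)
  qed
  then have "P a b = P a (b - 1)" by (rule P_eq)
  then show ?thesis by (simp add: pr_def ab)
qed

lemma sum_pr: "(\<Sum>\<alpha>\<in>box. pr \<alpha>) = mat 1"
proof -
  have inner: "(\<Sum>b\<in>{- 2 * bnd..2 * bnd}. pr (a, b)) = P a (2 * bnd) - P a (- 2 * bnd - 1)" for a
  proof -
    have gen: "(\<Sum>b\<in>{m..n}. pr (a, b)) = P a n - P a (m - 1)" if "m - 1 \<le> n" for m n :: int
      using that
    proof (induction n rule: int_ge_induct)
      case base then show ?case by simp
    next
      case (step i)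
      have "{m..i + 1} = insert (i + 1) {m..i}" using step by auto
      then show ?case using step by (simp add: pr_def)
    qed
    show ?thesis using bnd_pos by (subst gen) auto
  qed
  \<comment> \<open>The last subspace of column a, which is F^a, is the first one of column a - 1,
    so the column sums telescope in turn.\<close>
  have shift: "P a (2 * bnd) = P (a - 1) (- 2 * bnd - 1)" if "a \<in> {- bnd..bnd + 1}" for a
    using that by (intro P_eq) (simp add: Up_cases)
  have outer: "(\<Sum>a\<in>{- bnd..n}. P a (2 * bnd) - P a (- 2 * bnd - 1)) = P (- bnd) (2 * bnd) - P n (- 2 * bnd - 1)"
    if "- bnd \<le> n" "n \<le> bnd" for n
    using that
  proof (induction n rule: int_ge_induct)
    case base then show ?case using bnd_pos by simp
  next
    case (step i)
    have "{- bnd..i + 1} = insert (i + 1) {- bnd..i}" using step by auto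
    then show ?case using step shift[of "i + 1"] by simp
  qed
  have "P (- bnd) (2 * bnd) = mat 1"
    using P_id[of _ "- bnd" "2 * bnd"] Up_cases(1)[of "- bnd" "2 * bnd"] F_below[of "- bnd"] bnd_pos
    by (intro matrix_eqI) simp
  moreover have "P bnd (- 2 * bnd - 1) = 0"
    using P_in[of bnd "- 2 * bnd - 1"] Up_cases(2)[of bnd "- 2 * bnd - 1"] F_above[of "bnd + 1"] bnd_pos
    by (intro matrix_eqI) simp
  moreover have "(\<Sum>\<alpha>\<in>box. pr \<alpha>) = (\<Sum>a\<in>{- bnd..bnd}. \<Sum>b\<in>{- 2 * bnd..2 * bnd}. pr (a, b))"
    by (simp add: box_def sum.cartesian_product split_def)
  ultimately show ?thesis
    using outer[of bnd] bnd_pos by (simp only: inner) simp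
qed

lemma sum_pr_vec: "(\<Sum>\<alpha>\<in>box. pr \<alpha> *v x) = x"
  by (simp add: matrix_vector_mult_sum_left[symmetric] sum_pr)

lemma sum_pr_vec_subset:
  assumes "finite S" "\<And>\<alpha>. \<alpha> \<notin> S \<Longrightarrow> pr \<alpha> *v x = 0"
  shows "(\<Sum>\<alpha>\<in>S. pr \<alpha> *v x) = x"
proof -
  have "(\<Sum>\<alpha>\<in>S. pr \<alpha> *v x) = (\<Sum>\<alpha>\<in>box. pr \<alpha> *v x)"
    by (rule sum.mono_neutral_cong) (use assms pr_outside in auto)
  then show ?thesis by (simp add: sum_pr_vec)
qed

lemma eq_if_pr: "(\<And>\<alpha>. pr \<alpha> *v x = pr \<alpha> *v y) \<Longrightarrow> x = y"
proof -
  assume "\<And>\<alpha>. pr \<alpha> *v x = pr \<alpha> *v y"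
  then have "(\<Sum>\<alpha>\<in>box. pr \<alpha> *v x) = (\<Sum>\<alpha>\<in>box. pr \<alpha> *v y)" by (rule sum.cong[OF refl])
  then show ?thesis by (simp only: sum_pr_vec)
qed

lemma pr_Up: "pr (a, b) *v x \<in> Up a b"
proof -
  have "P a (b - 1) *v x \<in> Up a b" using P_in[of a "b - 1" x] Up_mono[of a a "b - 1" b] by auto
  then show ?thesis
    using P_in[of a b x] by (auto simp: pr_def matrix_vector_mult_diff_rdistrib intro: vec.subspace_diff[OF Up_subspace])
qed

lemma pr_Low_mem: "pr (a, b) *v x \<in> Low a (b - 1)"
proof -
  have "x - P a b *v x \<in> Low a (b - 1)" using P_diff[of x a b] Low_anti[of a a "b - 1" b] by auto
  then have "(x - P a (b - 1) *v x) - (x - P a b *v x) \<in> Low a (b - 1)"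
    using P_diff[of x a "b - 1"] vec.subspace_diff[OF complementary_Up_Low[unfolded complementary_def, THEN conjunct2, THEN conjunct1]]
    by blast
  then show ?thesis by (simp add: pr_def matrix_vector_mult_diff_rdistrib)
qed

lemma pr_Up_0: "x \<in> Up a b \<Longrightarrow> a > c \<or> a = c \<and> b < d \<Longrightarrow> pr (c, d) *v x = 0"
  using Up_mono[of c a b d, THEN subsetD, of x] Up_mono[of c a b "d - 1", THEN subsetD, of x]
    P_id[of x c d] P_id[of x c "d - 1"]
  by (auto simp: pr_def matrix_vector_mult_diff_rdistrib)

lemma pr_Low_0: "x \<in> Low a b \<Longrightarrow> c > a \<or> c = a \<and> d \<le> b \<Longrightarrow> pr (c, d) *v x = 0"
  using Low_anti[of a c d b, THEN subsetD, of x] Low_anti[of a c "d - 1" b, THEN subsetD, of x]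
    P_0[of x c d] P_0[of x c "d - 1"]
  by (auto simp: pr_def matrix_vector_mult_diff_rdistrib)

lemma Up_Low_pr: "x \<in> Up a b \<Longrightarrow> x \<in> Low a (b - 1) \<Longrightarrow> pr (a, b) *v x = x"
  by (simp add: pr_def matrix_vector_mult_diff_rdistrib P_id P_0)

lemma pr_Wc: "x \<in> Wc k \<Longrightarrow> pr \<alpha> *v x \<in> Wc k"
  by (simp add: pr_def matrix_vector_mult_diff_rdistrib P_Wc vec.subspace_diff[OF Wc_subspace])

lemma F_iff: "x \<in> F p \<longleftrightarrow> (\<forall>\<alpha>. fst \<alpha> < p \<longrightarrow> pr \<alpha> *v x = 0)"
proof
  assume x: "x \<in> F p"
  show "\<forall>\<alpha>. fst \<alpha> < p \<longrightarrow> pr \<alpha> *v x = 0"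
  proof clarsimp
    fix a b assume "a < p"
    then have "x \<in> F (a + 1)" using x F_anti[of "a + 1" p] by auto
    then show "pr (a, b) *v x = 0"
      using P_id[OF F_Up, of x a b] P_id[OF F_Up, of x a "b - 1"] by (simp add: pr_def matrix_vector_mult_diff_rdistrib)
  qed
next
  assume *: "\<forall>\<alpha>. fst \<alpha> < p \<longrightarrow> pr \<alpha> *v x = 0"
  have "pr \<alpha> *v x \<in> F p" for \<alpha>
  proof (cases "fst \<alpha> < p")
    case False
    then show ?thesis
      using pr_Up[of "fst \<alpha>" "snd \<alpha>" x] Up_F[of "fst \<alpha>" "snd \<alpha>"] F_anti[of p "fst \<alpha>"] by auto
  qed (simp add: * vec.subspace_0[OF F_subspace])
  then show "x \<in> F p" using sum_pr_vec[of x] vec.subspace_sum[OF F_subspace] by metis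
qed

text \<open>A second application of \<open>pr (a, b)\<close> kills the summand in F^(a+1) of an
  element of \<open>Up a b\<close> and leaves the one of weight a + b.\<close>

lemma pr_mem_Wc: "pr (a, b) *v x \<in> Wc (a + b)"
proof -
  obtain y z where yz: "y \<in> F (a + 1)" "z \<in> F a \<inter> Wc (a + b)" "pr (a, b) *v x = y + z"
    using pr_Up[of a b x] by (auto simp: Up_def)
  have "pr (a, b) *v x = pr (a, b) *v (pr (a, b) *v x)" by (simp add: pr_orthogonal_vec)
  also have "\<dots> = pr (a, b) *v y + pr (a, b) *v z" by (simp add: yz(3) matrix_vector_right_distrib)
  also have "pr (a, b) *v y = 0" using yz(1) F_iff[of y "a + 1"] by auto
  finally show ?thesis using yz pr_Wc[of z] by auto
qed

lemma Wc_iff: "x \<in> Wc k \<longleftrightarrow> (\<forall>\<alpha>. k < fst \<alpha> + snd \<alpha> \<longrightarrow> pr \<alpha> *v x = 0)"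
proof
  assume x: "x \<in> Wc k"
  show "\<forall>\<alpha>. k < fst \<alpha> + snd \<alpha> \<longrightarrow> pr \<alpha> *v x = 0"
  proof clarsimp
    fix a b assume k: "k < a + b"
    \<comment> \<open>As \<open>x\<close> has weight below a + b, its projection lies in
      \<open>Up a (b - 1)\<close> already, and the two projections in \<open>pr (a, b)\<close> agree
      on \<open>x\<close>.\<close>
    have "P a b *v x \<in> F a" using P_in[of a b x] Up_F by auto
    then have "P a b *v x \<in> Up a (b - 1)"
      using P_Wc[OF x, of a b] Wc_mono[of k "a + (b - 1)"] k by (intro F_Wc_Up) auto
    then have "P a (b - 1) *v (P a b *v x) = P a b *v x" by (rule P_id)
    moreover have "P a (b - 1) *v (P a b *v x) = P a (b - 1) *v x"
      using P_nested(1)[of a a "b - 1" b] by (simp add: matrix_vector_mul_assoc)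
    ultimately show "pr (a, b) *v x = 0" by (simp add: pr_def matrix_vector_mult_diff_rdistrib)
  qed
next
  assume *: "\<forall>\<alpha>. k < fst \<alpha> + snd \<alpha> \<longrightarrow> pr \<alpha> *v x = 0"
  have "pr \<alpha> *v x \<in> Wc k" for \<alpha>
  proof (cases "k < fst \<alpha> + snd \<alpha>")
    case False
    then show ?thesis
      using pr_mem_Wc[of "fst \<alpha>" "snd \<alpha>" x] Wc_mono[of "fst \<alpha> + snd \<alpha>" k] by auto
  qed (simp add: * vec.subspace_0[OF Wc_subspace])
  then show "x \<in> Wc k" using sum_pr_vec[of x] vec.subspace_sum[OF Wc_subspace] by metis
qed

text \<open>The congruence between the conjugate of I^{p,q} and I^{q,p}, on components. The summand
  lies in F^p and in \<open>Low p (q - 1)\<close>. Conjugating the first fact puts the conjugate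
  into \<open>Low q (p - 1)\<close>; conjugating the second puts it into F^q, in weight p + q, plus
  corrections of lower weight. Together the two facts remove exactly the components excluded
  here.\<close>

lemma pr_cnj:
  assumes "\<beta> \<noteq> prod.swap \<alpha>" "\<not> (fst \<beta> < snd \<alpha> \<and> snd \<beta> < fst \<alpha>)"
  shows "pr \<beta> *v cnj_vec (pr \<alpha> *v x) = 0"
proof -
  obtain p q where pq: "\<alpha> = (p, q)" by (metis surj_pair)
  define y where "y = pr \<alpha> *v x"
  have y: "y \<in> Wc (p + q)" "y \<in> F p" "y \<in> Low p (q - 1)"
    using pr_mem_Wc pr_Up Up_F pr_Low_mem unfolding y_def pq by blast+
  have lev1: "lev p (q - 1) (p + q) = p + 1" "lev q (p - 1) (p + q) = q + 1" by (simp_all add: lev_def)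
  have 1: "pr (c, d) *v cnj_vec y = 0" if "c > q \<or> c = q \<and> d \<le> p - 1" for c d
  proof (rule pr_Low_0[OF _ that])
    show "cnj_vec y \<in> Low q (p - 1)"
      using y lev1 by (intro Low_gen[where i = "p + q"]) auto
  qed
  have 2: "pr (c, d) *v cnj_vec y = 0" if cd: "d \<ge> p" "(c, d) \<noteq> (q, p)" for c d
  proof -
    \<comment> \<open>In weight p + q the level is p + 1, so the top generators of
      \<open>Low p (q - 1)\<close> are conjugates from F^q; below that weight the level is
      p.\<close>
    obtain a b where ab: "a \<in> F q \<inter> Wc (p + q)" "b \<in> lowt (lev p (q - 1)) (p + q - 1)" "y = cnj_vec a + b"
      using Low_Wc[OF y(3,1)] lowt_Suc[of y "lev p (q - 1)" "p + q"] lev1 Wc_cnj by force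
    have "pr (c, d) *v a = 0"
    proof (cases "p + q < c + d")
      case True then show ?thesis using ab(1) Wc_iff[of a "p + q"] by auto
    next
      case False
      then have "c < q" using cd by auto
      then show ?thesis using ab(1) F_iff[of a q] by auto
    qed
    moreover have "pr (c, d) *v cnj_vec b = 0"
    proof -
      let ?S = "{z. pr (c, d) *v cnj_vec z = 0}"
      have "lowt (lev p (q - 1)) (p + q - 1) \<subseteq> ?S"
        unfolding lowt_def
      proof (rule vec.span_minimal)
        show "vec.subspace ?S"
          by (simp add: vec.subspace_def cnj_vec_add cnj_vec_scale matrix_vector_right_distrib vector_scalar_commute)
        show "(\<Union>i\<in>{..p + q - 1}. cnj_vec ` F (i + 1 - lev p (q - 1) i) \<inter> Wc i) \<subseteq> ?S"
        proof
          fix z' assume "z' \<in> (\<Union>i\<in>{..p + q - 1}. cnj_vec ` F (i + 1 - lev p (q - 1) i) \<inter> Wc i)"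
          then obtain i z where z: "z' = cnj_vec z" "i \<le> p + q - 1" "z' \<in> Wc i" "z \<in> F (i + 1 - lev p (q - 1) i)"
            by auto
          have zz: "z \<in> Wc i" "z \<in> F (i + 1 - p)" using z Wc_cnj by (auto simp: lev_def)
          have "pr (c, d) *v z = 0"
          proof (cases "i < c + d")
            case True then show ?thesis using zz(1) Wc_iff[of z i] by auto
          next
            case False
            then have "c < i + 1 - p" using cd by auto
            then show ?thesis using zz(2) F_iff[of z "i + 1 - p"] by auto
          qed
          then show "z' \<in> ?S" by (simp add: z)
        qed
      qed
      then show ?thesis using ab by auto
    qed
    ultimately show ?thesis by (simp add: ab(3) cnj_vec_add matrix_vector_right_distrib)
  qed
  obtain c d where cd: "\<beta> = (c, d)" by (metis surj_pair)
  have "(c > q \<or> c = q \<and> d \<le> p - 1) \<or> (d \<ge> p \<and> (c, d) \<noteq> (q, p))"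
    using assms by (auto simp: pq cd)
  then show ?thesis
  proof
    assume "c > q \<or> c = q \<and> d \<le> p - 1"
    then show ?thesis using 1[of c d] by (simp add: y_def cd)
  next
    assume "d \<ge> p \<and> (c, d) \<noteq> (q, p)"
    then show ?thesis using 2[of d c] by (simp add: y_def cd)
  qed
qed

text \<open>Deligne's summand: the range of \<open>pr (p, q)\<close> is the intersection of
  \<open>Up p q\<close> and \<open>Low p (q - 1)\<close>.\<close>

definition I0 :: "int \<Rightarrow> int \<Rightarrow> 'n cvec set" where "I0 p q = {x. pr (p, q) *v x = x}"

lemma I0_subspace: "vec.subspace (I0 p q)"
  by (simp add: I0_def vec.subspace_def matrix_vector_right_distrib vector_scalar_commute)

lemma pr_I0: "pr (p, q) *v x \<in> I0 p q"
  by (simp add: I0_def pr_orthogonal_vec)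

lemma I0_pr: "x \<in> I0 p q \<Longrightarrow> pr \<beta> *v x = (if \<beta> = (p, q) then x else 0)"
  using pr_orthogonal_vec[of \<beta> "(p, q)" x] by (auto simp: I0_def)

lemma support_I0: "support I0 \<subseteq> box"
proof -
  have "I0 p q = {0}" if "(p, q) \<notin> box" for p q using pr_outside[OF that] by (auto simp: I0_def)
  then show ?thesis by (auto simp: support_def)
qed

lemma pr_support: "\<alpha> \<notin> support I0 \<Longrightarrow> pr \<alpha> *v x = 0"
  using pr_I0[of "fst \<alpha>" "snd \<alpha>" x] by (auto simp: support_def case_prod_unfold)

lemma is_decomposition_I0: "is_decomposition I0 v c \<longleftrightarrow> c = (\<lambda>\<alpha>. pr \<alpha> *v v)"
proof
  assume c: "is_decomposition I0 v c"
  have cI: "c \<alpha> \<in> I0 (fst \<alpha>) (snd \<alpha>)" for \<alpha> using c by (cases \<alpha>) (simp add: is_decomposition_def)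
  have fin: "finite (support I0)" using support_I0 finite_subset finite_box by blast
  show "c = (\<lambda>\<alpha>. pr \<alpha> *v v)"
  proof
    fix \<alpha>
    have "pr \<alpha> *v v = (\<Sum>\<beta>\<in>support I0. pr \<alpha> *v c \<beta>)"
      using c by (simp add: is_decomposition_def matrix_vector_mult_sum_right)
    also have "\<dots> = (\<Sum>\<beta>\<in>support I0. if \<beta> = \<alpha> then c \<alpha> else 0)"
      by (intro sum.cong refl) (use I0_pr[OF cI] in auto)
    also have "\<dots> = (if \<alpha> \<in> support I0 then c \<alpha> else 0)" using fin by simp
    also have "\<dots> = c \<alpha>" using cI[of \<alpha>] by (auto simp: support_def case_prod_unfold)
    finally show "c \<alpha> = pr \<alpha> *v v" by simp
  qed
next
  assume "c = (\<lambda>\<alpha>. pr \<alpha> *v v)"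
  then show "is_decomposition I0 v c"
    using finite_subset[OF support_I0 finite_box] pr_support
    by (auto simp: is_decomposition_def pr_I0 sum_pr_vec_subset)
qed

lemma bigrading_I0: "bigrading I0"
  unfolding bigrading_def is_decomposition_I0
  using I0_subspace finite_subset[OF support_I0 finite_box] by simp

text \<open>An arbitrary relation \<open>R\<close> covers F, W and the error terms of the congruence
  in one statement.\<close>

lemma span_I0_iff: "x \<in> vec.span (\<Union>{I0 a b | a b. R a b}) \<longleftrightarrow> (\<forall>\<alpha>. \<not> R (fst \<alpha>) (snd \<alpha>) \<longrightarrow> pr \<alpha> *v x = 0)"
proof
  let ?S = "{x. \<forall>\<alpha>. \<not> R (fst \<alpha>) (snd \<alpha>) \<longrightarrow> pr \<alpha> *v x = 0}"
  have "vec.span (\<Union>{I0 a b | a b. R a b}) \<subseteq> ?S"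
    by (rule vec.span_minimal)
      (auto simp: I0_pr vec.subspace_def matrix_vector_right_distrib vector_scalar_commute)
  then show "x \<in> vec.span (\<Union>{I0 a b | a b. R a b}) \<Longrightarrow> \<forall>\<alpha>. \<not> R (fst \<alpha>) (snd \<alpha>) \<longrightarrow> pr \<alpha> *v x = 0" by auto
next
  assume *: "\<forall>\<alpha>. \<not> R (fst \<alpha>) (snd \<alpha>) \<longrightarrow> pr \<alpha> *v x = 0"
  have "pr \<alpha> *v x \<in> vec.span (\<Union>{I0 a b | a b. R a b})" for \<alpha>
  proof (cases "R (fst \<alpha>) (snd \<alpha>)")
    case True
    then show ?thesis using pr_I0[of "fst \<alpha>" "snd \<alpha>" x] by (intro vec.span_base) auto
  qed (simp add: * vec.span_zero)
  then show "x \<in> vec.span (\<Union>{I0 a b | a b. R a b})"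
    using sum_pr_vec[of x] vec.span_sum[of box "\<lambda>\<alpha>. pr \<alpha> *v x"] by simp
qed

lemma cnj_I0:
  assumes "x \<in> I0 p q"
  shows "cnj_vec x \<in> vec.span (I0 q p \<union> \<Union>{I0 a b | a b. a < q \<and> b < p})"
proof -
  have eq: "I0 q p \<union> \<Union>{I0 a b | a b. a < q \<and> b < p} = \<Union>{I0 a b | a b. a = q \<and> b = p \<or> a < q \<and> b < p}"
    by auto
  have 0: "pr \<alpha> *v cnj_vec x = 0" if "\<not> (fst \<alpha> = q \<and> snd \<alpha> = p \<or> fst \<alpha> < q \<and> snd \<alpha> < p)" for \<alpha>
    using pr_cnj[of \<alpha> "(p, q)" x] I0_pr[OF assms, of "(p, q)"] that by (cases \<alpha>) auto
  show ?thesis unfolding eq span_I0_iff by (intro allI impI 0)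
qed

lemma deligne_I0: "is_deligne_bigrading W F I0"
  unfolding is_deligne_bigrading_def
proof (intro conjI allI)
  show "bigrading I0" by (rule bigrading_I0)
  show "F p = vec.span (\<Union>{I0 a b | a b. p \<le> a})" for p
    by (rule set_eqI) (simp only: span_I0_iff F_iff not_le)
  show "Wc k = vec.span (\<Union>{I0 a b | a b. a + b \<le> k})" for k
    by (rule set_eqI) (simp only: span_I0_iff Wc_iff not_le)
  fix p q
  let ?T = "\<lambda>p q. \<Union>{I0 a b | a b. a < q \<and> b < p}"
  show "vec.span (cnj_vec ` I0 p q \<union> ?T p q) = vec.span (I0 q p \<union> ?T p q)"
  proof
    show "vec.span (cnj_vec ` I0 p q \<union> ?T p q) \<subseteq> vec.span (I0 q p \<union> ?T p q)"
      by (rule vec.span_minimal) (auto simp: vec.subspace_span intro: cnj_I0 vec.span_base)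
    have *: "y \<in> vec.span (cnj_vec ` I0 p q \<union> ?T p q)" if y: "y \<in> I0 q p" for y
    proof -
      \<comment> \<open>The congruence is used twice: \<open>?t\<close> has only components (a, b)
        with a < p and b < q, and conjugating it once more lands in the sum with the two bounds
        exchanged.\<close>
      let ?t = "cnj_vec y - pr (p, q) *v cnj_vec y"
      have *: "pr \<alpha> *v ?t = 0" if "\<not> (fst \<alpha> < p \<and> snd \<alpha> < q)" for \<alpha>
        using pr_cnj[of \<alpha> "(q, p)" y] I0_pr[OF y, of "(q, p)"] that
        by (cases "\<alpha> = (p, q)") (auto simp: pr_orthogonal_vec matrix_vector_mult_diff_distrib)
      have "cnj_vec ?t = (\<Sum>\<alpha>\<in>box. cnj_vec (pr \<alpha> *v ?t))"
        using sum_pr_vec[of ?t] by (simp flip: cnj_vec_sum)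
      moreover have "cnj_vec (pr \<alpha> *v ?t) \<in> vec.span (?T p q)" for \<alpha>
      proof (cases "fst \<alpha> < p \<and> snd \<alpha> < q")
        case True
        then show ?thesis unfolding span_I0_iff by (cases \<alpha>) (auto intro!: pr_cnj)
      qed (simp add: * vec.span_zero)
      ultimately have "cnj_vec ?t \<in> vec.span (?T p q)" by (metis (no_types, lifting) vec.span_sum)
      then have 1: "cnj_vec ?t \<in> vec.span (cnj_vec ` I0 p q \<union> ?T p q)"
        using vec.span_mono[of "?T p q" "cnj_vec ` I0 p q \<union> ?T p q"] by auto
      have 2: "cnj_vec (pr (p, q) *v cnj_vec y) \<in> vec.span (cnj_vec ` I0 p q \<union> ?T p q)"
        using pr_I0 by (intro vec.span_base) auto
      have "cnj_vec (pr (p, q) *v cnj_vec y) + cnj_vec ?t = y" by (simp add: cnj_vec_diff)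
      then show ?thesis using vec.span_add[OF 2 1] by simp
    qed
    have 1: "I0 q p \<subseteq> vec.span (cnj_vec ` I0 p q \<union> ?T p q)" by (rule subsetI, rule *)
    have 2: "?T p q \<subseteq> vec.span (cnj_vec ` I0 p q \<union> ?T p q)"
      using vec.span_superset by (rule order_trans[OF Un_upper2])
    show "vec.span (I0 q p \<union> ?T p q) \<subseteq> vec.span (cnj_vec ` I0 p q \<union> ?T p q)"
      by (rule vec.span_minimal[OF Un_least[OF 1 2] vec.subspace_span])
  qed
qed

text \<open>Any Deligne bigrading has I^{a,b} inside \<open>Up a b\<close>. By induction on the
  weight it also lies in \<open>Low a (b - 1)\<close>, since the congruence expresses it by the
  conjugate of I^{b,a} and summands of smaller weight. This gives one inclusion into
  \<open>I0\<close>, and both families decompose the whole space.\<close>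

lemma deligne_unique:
  assumes I: "is_deligne_bigrading W F I"
  shows "I = I0"
proof -
  have bi: "bigrading I" and IF: "F p = vec.span (\<Union>{I a b | a b. p \<le> a})"
    and IW: "Wc k = vec.span (\<Union>{I a b | a b. a + b \<le> k})"
    and Icnj: "vec.span (cnj_vec ` I p q \<union> \<Union>{I a b | a b. a < q \<and> b < p}) =
            vec.span (I q p \<union> \<Union>{I a b | a b. a < q \<and> b < p})" for p q k
    using I unfolding is_deligne_bigrading_def by blast+
  have Isub: "vec.subspace (I a b)" for a b using bi by (simp add: bigrading_def)
  have IFa: "I a b \<subseteq> F a" "I a b \<subseteq> Wc (a + b)" for a b
    unfolding IF IW by (auto intro: vec.span_base)
  have Low: "I a b \<subseteq> Low a (b - 1)" for a b
  \<comment> \<open>The measure counts the weight from - bnd, at and below which every summand is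
    zero.\<close>
  proof (induction "nat (a + b + bnd)" arbitrary: a b rule: less_induct)
    case less
    show ?case
    proof (cases "a + b \<le> - bnd")
      case True
      then show ?thesis
        using IFa(2)[of a b] Wc_below[of "a + b"] vec.subspace_0[OF lowt_subspace] by (auto simp: Low_def)
    next
      case False
      have "vec.span (cnj_vec ` I b a \<union> \<Union>{I c d | c d. c < a \<and> d < b}) \<subseteq> Low a (b - 1)"
      proof (rule vec.span_minimal)
        show "vec.subspace (Low a (b - 1))" by (simp add: Low_def lowt_subspace)
        have "cnj_vec x \<in> Low a (b - 1)" if "x \<in> I b a" for x
          using that IFa[of b a] by (intro Low_gen[where i = "a + b"]) (auto simp: lev_def add.commute)
        moreover have "I c d \<subseteq> Low a (b - 1)" if "c < a" "d < b" for c d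
        proof -
          have "I c d \<subseteq> Low c (d - 1)" using that False by (intro less) auto
          then show ?thesis using Low_anti[of c a "b - 1" "d - 1"] that by auto
        qed
        ultimately show "cnj_vec ` I b a \<union> \<Union>{I c d | c d. c < a \<and> d < b} \<subseteq> Low a (b - 1)" by blast
      qed
      then show ?thesis unfolding Icnj[of b a] using vec.span_superset by blast
    qed
  qed
  have sub: "I a b \<subseteq> I0 a b" for a b
  proof
    fix x assume x: "x \<in> I a b"
    then have "x \<in> Up a b" using IFa F_Wc_Up by blast
    then show "x \<in> I0 a b" using x Low[of a b] Up_Low_pr[of x a b] by (auto simp: I0_def)
  qed
  have "x \<in> I a b" if x: "x \<in> I0 a b" for a b x
  proof -
    obtain c where c: "is_decomposition I x c" using bi unfolding bigrading_def by metis
    have cI: "c \<beta> \<in> I (fst \<beta>) (snd \<beta>)" for \<beta> using c by (cases \<beta>) (simp add: is_decomposition_def)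
    have "x = pr (a, b) *v x" using x by (simp add: I0_def)
    also have "\<dots> = (\<Sum>\<beta>\<in>support I. pr (a, b) *v c \<beta>)"
      using c by (simp add: is_decomposition_def matrix_vector_mult_sum_right)
    also have "\<dots> \<in> I a b"
    proof (rule vec.subspace_sum[OF Isub])
      fix \<beta> show "pr (a, b) *v c \<beta> \<in> I a b"
        using I0_pr[OF subsetD[OF sub cI], of "(a, b)" \<beta>] cI[of \<beta>] vec.subspace_0[OF Isub]
        by (cases "\<beta> = (a, b)") auto
    qed
    finally show ?thesis .
  qed
  then show ?thesis using sub by (intro ext) blast
qed

lemma deligne_eq: "deligne W F = I0"
  unfolding deligne_def using deligne_I0 deligne_unique by (rule the_equality)

lemma component_eq: "component W F v \<alpha> = pr \<alpha> *v v"
  by (simp add: component_def deligne_eq is_decomposition_I0)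

end

section \<open>The mixed Hodge metric\<close>

context weighted_forms begin

lemma Q_lin1: "x \<in> W k \<Longrightarrow> y \<in> W k \<Longrightarrow> z \<in> W k \<Longrightarrow> Q k (a *\<^sub>R x + b *\<^sub>R y) z = a * Q k x z + b * Q k y z"
  and Q_sym: "x \<in> W k \<Longrightarrow> y \<in> W k \<Longrightarrow> Q k y x = (-1) powi k * Q k x y"
  and Q_radical: "x \<in> W k \<Longrightarrow> (\<forall>y\<in>W k. Q k x y = 0) \<longleftrightarrow> x \<in> W (k - 1)"
  using data unfolding graded_polarization_data_def by blast+

lemma Q_lin2:
  assumes "x \<in> W k" "y \<in> W k" "z \<in> W k"
  shows "Q k z (a *\<^sub>R x + b *\<^sub>R y) = a * Q k z x + b * Q k z y"
proof -
  have "a *\<^sub>R x + b *\<^sub>R y \<in> W k" using assms W_real(1)[of k] by (simp add: subspace_add subspace_scale)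
  then show ?thesis
    using assms Q_sym[of _ k z] Q_lin1[of x k y z a b] by (simp add: algebra_simps)
qed

lemma Wc_re_im: "x \<in> Wc k \<Longrightarrow> re_vec x \<in> W k" "x \<in> Wc k \<Longrightarrow> im_vec x \<in> W k"
  by (auto simp: weight_C_def)

lemma form_C_lin1:
  assumes "x \<in> Wc k" "y \<in> Wc k" "z \<in> Wc k"
  shows "form_C Q k (x + y) z = form_C Q k x z + form_C Q k y z"
    and "form_C Q k (c *s x) z = c * form_C Q k x z"
proof -
  note W = Wc_re_im[OF assms(1)] Wc_re_im[OF assms(2)] Wc_re_im[OF assms(3)]
  have add: "Q k (a + b) t = Q k a t + Q k b t" if "a \<in> W k" "b \<in> W k" "t \<in> W k" for a b t
    using Q_lin1[OF that, of 1 1] by simp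
  have comb: "Q k (r *\<^sub>R a + s *\<^sub>R b) t = r * Q k a t + s * Q k b t" "Q k (r *\<^sub>R a - s *\<^sub>R b) t = r * Q k a t - s * Q k b t"
    if "a \<in> W k" "b \<in> W k" "t \<in> W k" for a b t r s
    using Q_lin1[OF that, of r s] Q_lin1[OF that, of r "- s"] by simp_all
  show "form_C Q k (x + y) z = form_C Q k x z + form_C Q k y z"
    using W by (simp add: form_C_def re_vec_add im_vec_add add complex_eq_iff)
  show "form_C Q k (c *s x) z = c * form_C Q k x z"
    using W by (simp add: form_C_def re_vec_scale im_vec_scale comb complex_eq_iff algebra_simps)
qed

lemma form_C_sym:
  assumes "x \<in> Wc k" "y \<in> Wc k"
  shows "form_C Q k y x = (-1) powi k * form_C Q k x y"
proof -
  note W = Wc_re_im[OF assms(1)] Wc_re_im[OF assms(2)]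
  have "(-1 :: complex) powi k = of_real ((-1) powi k)" by (simp add: of_real_power_int)
  then have "Re ((-1) powi k) = (-1) powi k" "Im ((-1) powi k) = 0"
    by (metis Re_complex_of_real, metis Im_complex_of_real)
  then show ?thesis
    using W Q_sym[of "re_vec x" k "re_vec y"] Q_sym[of "re_vec x" k "im_vec y"]
      Q_sym[of "im_vec x" k "re_vec y"] Q_sym[of "im_vec x" k "im_vec y"]
    by (simp add: form_C_def complex_eq_iff algebra_simps)
qed

lemma form_C_lin2:
  assumes "x \<in> Wc k" "y \<in> Wc k" "z \<in> Wc k"
  shows "form_C Q k z (x + y) = form_C Q k z x + form_C Q k z y"
    and "form_C Q k z (c *s x) = c * form_C Q k z x"
proof -
  have "x + y \<in> Wc k" "c *s x \<in> Wc k"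
    using assms by (auto intro: vec.subspace_add[OF Wc_subspace] vec.subspace_scale[OF Wc_subspace])
  then show "form_C Q k z (x + y) = form_C Q k z x + form_C Q k z y"
      "form_C Q k z (c *s x) = c * form_C Q k z x"
    using assms form_C_sym[of _ k z] form_C_lin1[of x k y z] form_C_lin1(2)[of x k y z c] by (simp_all add: algebra_simps)
qed

lemma form_C_0 [simp]: "x \<in> Wc k \<Longrightarrow> form_C Q k 0 x = 0" "x \<in> Wc k \<Longrightarrow> form_C Q k x 0 = 0"
  using form_C_lin1(2)[of x k x x 0] form_C_lin2(2)[of x k x x 0] by simp_all

lemma form_C_sum1:
  assumes "\<And>i. i \<in> S \<Longrightarrow> f i \<in> Wc k" "z \<in> Wc k"
  shows "form_C Q k (\<Sum>i\<in>S. f i) z = (\<Sum>i\<in>S. form_C Q k (f i) z)"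
  using assms
proof (induction S rule: infinite_finite_induct)
  case (insert x S)
  then show ?case using form_C_lin1(1)[of "f x" k "sum f S" z] vec.subspace_sum[OF Wc_subspace, of S f] by auto
qed auto

lemma form_C_sum2:
  assumes "\<And>i. i \<in> S \<Longrightarrow> f i \<in> Wc k" "z \<in> Wc k"
  shows "form_C Q k z (\<Sum>i\<in>S. f i) = (\<Sum>i\<in>S. form_C Q k z (f i))"
  using assms
proof (induction S rule: infinite_finite_induct)
  case (insert x S)
  then show ?case using form_C_lin2(1)[of "f x" k "sum f S" z] vec.subspace_sum[OF Wc_subspace, of S f] by auto
qed auto

lemma form_C_cnj:
  assumes "x \<in> Wc k" "y \<in> Wc k"
  shows "form_C Q k (cnj_vec x) (cnj_vec y) = cnj (form_C Q k x y)"
proof -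
  note W = Wc_re_im[OF assms(1)] Wc_re_im[OF assms(2)]
  have "Q k (- a) b = - Q k a b" "Q k b (- a) = - Q k b a" if "a \<in> W k" "b \<in> W k" for a b
    using Q_lin1[of a k a b "-1" 0] Q_lin2[of a k a b "-1" 0] that by simp_all
  moreover have "- im_vec y \<in> W k" using W subspace_neg[OF W_real(1)] by blast
  ultimately show ?thesis using W by (simp add: form_C_def re_vec_cnj im_vec_cnj complex_eq_iff)
qed

text \<open>\<open>Q k\<close> is a form on gr_k, so lower weights lie in its radical.\<close>

lemma form_C_radical:
  assumes "x \<in> Wc j" "j < k" "y \<in> Wc k"
  shows "form_C Q k x y = 0" "form_C Q k y x = 0"
proof -
  have x: "x \<in> Wc (k - 1)" "x \<in> Wc k" using assms Wc_mono[of j "k - 1"] Wc_mono[of j k] by auto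
  then have "Q k (re_vec x) z = 0" "Q k (im_vec x) z = 0" if "z \<in> W k" for z
    using Q_radical[of "re_vec x" k] Q_radical[of "im_vec x" k] that Wc_re_im[of x] by auto
  then show "form_C Q k x y = 0"
    using Wc_re_im[OF assms(3)] by (simp add: form_C_def complex_eq_iff)
  then show "form_C Q k y x = 0" using form_C_sym[OF x(2) assms(3)] by simp
qed

end

context polarized_mhs begin

lemma I0_F: "x \<in> I0 p q \<Longrightarrow> x \<in> F p" and I0_Wc: "x \<in> I0 p q \<Longrightarrow> x \<in> Wc (p + q)"
  by (auto simp: F_iff I0_pr Wc_iff)

text \<open>The error terms of the congruence have weight at most p + q - 2, so on the graded
  quotient conjugation is an exact swap.\<close>

lemma cnj_I0_gr:
  assumes "x \<in> I0 p q"
  shows "\<exists>y\<in>I0 q p. \<exists>z\<in>Wc (p + q - 1). cnj_vec x = y + z"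
proof -
  let ?y = "pr (q, p) *v cnj_vec x"
  have x: "pr (p, q) *v x = x" using I0_pr[OF assms] by simp
  have "pr \<alpha> *v (cnj_vec x - ?y) = 0" if "p + q - 1 < fst \<alpha> + snd \<alpha>" for \<alpha>
    using pr_cnj[of \<alpha> "(p, q)" x] that x
    by (cases "\<alpha> = (q, p)") (auto simp: matrix_vector_mult_diff_distrib pr_orthogonal_vec)
  then have "cnj_vec x - ?y \<in> Wc (p + q - 1)" by (auto simp: Wc_iff)
  then show ?thesis using pr_I0[of q p] by (intro bexI[of _ ?y] bexI[of _ "cnj_vec x - ?y"]) auto
qed

lemma gr_filtration_I0: "x \<in> I0 p q \<Longrightarrow> r \<le> p \<Longrightarrow> k = p + q \<Longrightarrow> x \<in> gr_filtration W F k r"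
  unfolding gr_filtration_iff
  using I0_F[of x p q] I0_Wc[of x p q] F_anti[of r p] vec.subspace_0[OF Wc_subspace] by force

lemma form_C_F: "x \<in> gr_filtration W F k p \<Longrightarrow> y \<in> gr_filtration W F k (k - p + 1) \<Longrightarrow> form_C Q k x y = 0"
  using pol by (auto simp: graded_polarized_def)

text \<open>For r > q this is the first bilinear relation. Otherwise the conjugates, taken modulo
  lower weight, satisfy the same condition with the degrees exchanged.\<close>

lemma form_C_orthogonal:
  assumes x: "x \<in> I0 p q" and y: "y \<in> I0 r s" and k: "p + q = k" "r + s = k" and ne: "(r, s) \<noteq> (q, p)"
  shows "form_C Q k x y = 0"
proof (cases "r > q")
  case True
  then show ?thesis
    using k by (intro form_C_F[of x k p y] gr_filtration_I0[OF x] gr_filtration_I0[OF y]) auto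
next
  case False
  then have "r < q" "s > p" using ne k by auto
  obtain x' t where x': "x' \<in> I0 q p" "t \<in> Wc (k - 1)" "cnj_vec x = x' + t" using cnj_I0_gr[OF x] k by auto
  obtain y' w where y': "y' \<in> I0 s r" "w \<in> Wc (k - 1)" "cnj_vec y = y' + w" using cnj_I0_gr[OF y] k by auto
  have W: "x' \<in> Wc k" "y' \<in> Wc k" "t \<in> Wc k" "w \<in> Wc k" "y' + w \<in> Wc k" "x \<in> Wc k" "y \<in> Wc k"
    using I0_Wc[OF x'(1)] I0_Wc[OF y'(1)] I0_Wc[OF x] I0_Wc[OF y] x' y' k Wc_mono[of "k - 1" k]
      vec.subspace_add[OF Wc_subspace, of y' k w]
    by (auto simp: add.commute)
  have "form_C Q k x' y' = 0"
    using k \<open>s > p\<close> by (intro form_C_F[of x' k q y'] gr_filtration_I0[OF x'(1)] gr_filtration_I0[OF y'(1)]) auto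
  then have "form_C Q k (x' + t) (y' + w) = 0"
    using form_C_radical[OF x'(2), of k] form_C_radical[OF y'(2), of k] W
    by (simp add: form_C_lin1(1) form_C_lin2(1))
  then have "cnj (form_C Q k x y) = 0" using x' y' W form_C_cnj[of x k y] by simp
  then show ?thesis by simp
qed

text \<open>Among the components of \<open>z\<close>, those of weight below \<open>k\<close> lie in
  the radical, those of weight above \<open>k\<close> vanish, and of the rest only the one of
  swapped bidegree can pair with the summand.\<close>

lemma form_C_pr:
  assumes "y \<in> Wc k" "z \<in> Wc k" "fst \<alpha> + snd \<alpha> = k"
  shows "form_C Q k (pr \<alpha> *v y) z = form_C Q k (pr \<alpha> *v y) (pr (prod.swap \<alpha>) *v z)"
proof -
  have y: "pr \<alpha> *v y \<in> Wc k" using pr_Wc[OF assms(1)] .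
  have swap_box: "prod.swap \<alpha> \<notin> box \<Longrightarrow> pr (prod.swap \<alpha>) = 0" by (rule pr_outside)
  have "form_C Q k (pr \<alpha> *v y) z = (\<Sum>\<beta>\<in>box. form_C Q k (pr \<alpha> *v y) (pr \<beta> *v z))"
    using form_C_sum2[of box "\<lambda>\<beta>. pr \<beta> *v z" k "pr \<alpha> *v y"] y pr_Wc[OF assms(2)] by (simp add: sum_pr_vec)
  also have "\<dots> = (\<Sum>\<beta>\<in>box. if \<beta> = prod.swap \<alpha> then form_C Q k (pr \<alpha> *v y) (pr (prod.swap \<alpha>) *v z) else 0)"
  proof (rule sum.cong[OF refl])
    fix \<beta>
    have "form_C Q k (pr \<alpha> *v y) (pr \<beta> *v z) = 0" if ne: "\<beta> \<noteq> prod.swap \<alpha>"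
    proof -
      consider "fst \<beta> + snd \<beta> = k" | "fst \<beta> + snd \<beta> < k" | "k < fst \<beta> + snd \<beta>" by linarith
      then show ?thesis
      proof cases
        case 1
        show ?thesis
          using 1 assms(3) ne pr_I0[of "fst \<alpha>" "snd \<alpha>" y] pr_I0[of "fst \<beta>" "snd \<beta>" z]
          by (intro form_C_orthogonal[of _ "fst \<alpha>" "snd \<alpha>" _ "fst \<beta>" "snd \<beta>"]) (auto simp: prod_eq_iff)
      next
        case 2
        then show ?thesis
          using pr_mem_Wc[of "fst \<beta>" "snd \<beta>" z] y form_C_radical(2)[of _ "fst \<beta> + snd \<beta>" k] by simp
      next
        case 3
        then have "pr \<beta> *v z = 0" using Wc_iff[of z k] assms by (cases \<beta>) auto
        then show ?thesis using y by simp
      qed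
    qed
    then show "form_C Q k (pr \<alpha> *v y) (pr \<beta> *v z) = (if \<beta> = prod.swap \<alpha> then form_C Q k (pr \<alpha> *v y) (pr (prod.swap \<alpha>) *v z) else 0)"
      by auto
  qed
  also have "\<dots> = form_C Q k (pr \<alpha> *v y) (pr (prod.swap \<alpha>) *v z)"
    using swap_box y by auto
  finally show ?thesis .
qed

definition wt :: "int \<times> int \<Rightarrow> int" where "wt \<alpha> = fst \<alpha> + snd \<alpha>"

lemma pr_wt: "pr \<alpha> *v x \<in> Wc (wt \<alpha>)" using pr_mem_Wc[of "fst \<alpha>" "snd \<alpha>" x] by (simp add: wt_def)

text \<open>\<open>form_C Q k\<close> is bilinear on \<open>Wc k\<close> only, as nothing is known
  about \<open>Q k\<close> outside \<open>W k\<close>. Inserting both projections gives a complex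
  bilinear form on the whole space, which can be expanded in a basis and differentiated.\<close>

definition qf :: "int \<times> int \<Rightarrow> 'n cvec \<Rightarrow> 'n cvec \<Rightarrow> complex" where
  "qf \<alpha> y z = \<i> powi (fst \<alpha> - snd \<alpha>) * form_C Q (wt \<alpha>) (pr \<alpha> *v y) (pr (prod.swap \<alpha>) *v z)"

lemma pr_swap_wt: "pr (prod.swap \<alpha>) *v x \<in> Wc (wt \<alpha>)"
  using pr_wt[of "prod.swap \<alpha>" x] by (simp add: wt_def add.commute)

lemma qf_lin:
  "qf \<alpha> (x + y) z = qf \<alpha> x z + qf \<alpha> y z" "qf \<alpha> (c *s x) z = c * qf \<alpha> x z"
  "qf \<alpha> x (y + z) = qf \<alpha> x y + qf \<alpha> x z" "qf \<alpha> x (c *s y) = c * qf \<alpha> x y"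
  by (simp_all add: qf_def matrix_vector_right_distrib vector_scalar_commute form_C_lin1[OF pr_wt pr_wt pr_swap_wt]
      form_C_lin2[OF pr_swap_wt pr_swap_wt pr_wt] distrib_left)

lemma qf_form_C:
  assumes "y \<in> Wc (wt \<alpha>)" "z \<in> Wc (wt \<alpha>)"
  shows "\<i> powi (fst \<alpha> - snd \<alpha>) * form_C Q (wt \<alpha>) (pr \<alpha> *v y) z = qf \<alpha> y z"
  using form_C_pr[OF assms] by (simp add: qf_def wt_def)

abbreviation h where "h \<equiv> hodge_metric W Q F"

lemma h_eq: "h u v = (\<Sum>\<alpha>\<in>box. \<i> powi (fst \<alpha> - snd \<alpha>) * form_C Q (wt \<alpha>) (pr \<alpha> *v u) (cnj_vec (pr \<alpha> *v v)))"
proof -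
  have "h u v = (\<Sum>\<alpha>\<in>support I0. \<i> powi (fst \<alpha> - snd \<alpha>) * form_C Q (wt \<alpha>) (pr \<alpha> *v u) (cnj_vec (pr \<alpha> *v v)))"
    by (simp add: hodge_metric_def deligne_eq component_eq case_prod_unfold wt_def)
  also have "\<dots> = (\<Sum>\<alpha>\<in>box. \<i> powi (fst \<alpha> - snd \<alpha>) * form_C Q (wt \<alpha>) (pr \<alpha> *v u) (cnj_vec (pr \<alpha> *v v)))"
    using support_I0 pr_support vec.subspace_0[OF Wc_subspace] by (intro sum.mono_neutral_left) auto
  finally show ?thesis .
qed

lemma h_qf: "h u v = (\<Sum>\<alpha>\<in>box. qf \<alpha> u (cnj_vec (pr \<alpha> *v v)))"
proof -
  have "\<i> powi (fst \<alpha> - snd \<alpha>) * form_C Q (wt \<alpha>) (pr \<alpha> *v u) (cnj_vec (pr \<alpha> *v v)) = qf \<alpha> u (cnj_vec (pr \<alpha> *v v))" for \<alpha>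
    using qf_form_C[of "pr \<alpha> *v u" \<alpha> "cnj_vec (pr \<alpha> *v v)"] pr_wt
    by (simp add: Wc_cnj pr_orthogonal_vec qf_def)
  then show ?thesis by (simp add: h_eq)
qed

lemma h_lin:
  "h (x + y) z = h x z + h y z" "h (c *s x) z = c * h x z"
  "h x (y + z) = h x y + h x z" "h x (c *s y) = cnj c * h x y"
  by (simp_all add: h_qf qf_lin matrix_vector_right_distrib vector_scalar_commute cnj_vec_add cnj_vec_scale sum.distrib sum_distrib_left)

lemma h_0 [simp]: "h 0 x = 0" "h x 0 = 0"
  using h_lin(2)[of 0 0 x] h_lin(4)[of x 0 0] by simp_all

lemma h_minus: "h (- x) y = - h x y" "h x (- y) = - h x y"
  using h_lin(2)[of "-1" x y] h_lin(4)[of x "-1" y] by simp_all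

lemma h_diff: "h (x - y) z = h x z - h y z" "h x (y - z) = h x y - h x z"
  using h_lin(1)[of x "- y" z] h_lin(3)[of x y "- z"] by (simp_all add: h_minus)

lemma h_sum: "h (\<Sum>i\<in>S. f i) x = (\<Sum>i\<in>S. h (f i) x)" "h x (\<Sum>i\<in>S. f i) = (\<Sum>i\<in>S. h x (f i))"
  by (induction S rule: infinite_finite_induct) (auto simp: h_lin)

text \<open>Conjugating the power of the imaginary unit yields the sign (-1)^(p-q), the symmetry of
  the form the sign (-1)^(p+q); their product is 1.\<close>

lemma h_hermitian: "h v u = cnj (h u v)"
proof -
  have "\<i> powi (fst \<alpha> - snd \<alpha>) * form_C Q (wt \<alpha>) (pr \<alpha> *v v) (cnj_vec (pr \<alpha> *v u)) =
     cnj (\<i> powi (fst \<alpha> - snd \<alpha>) * form_C Q (wt \<alpha>) (pr \<alpha> *v u) (cnj_vec (pr \<alpha> *v v)))" for \<alpha>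
  proof -
    let ?a = "pr \<alpha> *v u" and ?b = "pr \<alpha> *v v"
    have "cnj (form_C Q (wt \<alpha>) ?a (cnj_vec ?b)) = form_C Q (wt \<alpha>) (cnj_vec ?a) ?b"
      using form_C_cnj[of ?a "wt \<alpha>" "cnj_vec ?b"] pr_wt by (simp add: Wc_cnj)
    also have "\<dots> = (-1) powi wt \<alpha> * form_C Q (wt \<alpha>) ?b (cnj_vec ?a)"
      using form_C_sym[of ?b "wt \<alpha>" "cnj_vec ?a"] pr_wt by (simp add: Wc_cnj)
    moreover have "cnj (\<i> powi (fst \<alpha> - snd \<alpha>)) * (-1) powi wt \<alpha> = \<i> powi (fst \<alpha> - snd \<alpha>)"
    proof -
      have "cnj (\<i> powi (fst \<alpha> - snd \<alpha>)) = (- \<i>) powi (fst \<alpha> - snd \<alpha>)" by (simp add: power_int_def)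
      also have "- \<i> = \<i> * (-1)" by simp
      also have "(\<i> * (-1)) powi (fst \<alpha> - snd \<alpha>) = \<i> powi (fst \<alpha> - snd \<alpha>) * (-1) powi (fst \<alpha> - snd \<alpha>)"
        by (rule power_int_mult_distrib)
      finally have "cnj (\<i> powi (fst \<alpha> - snd \<alpha>)) * (-1) powi wt \<alpha> =
        \<i> powi (fst \<alpha> - snd \<alpha>) * ((-1) powi (fst \<alpha> - snd \<alpha>) * (-1) powi wt \<alpha>)" by simp
      also have "((-1) powi (fst \<alpha> - snd \<alpha>) * (-1) powi wt \<alpha> :: complex) = (-1) powi (2 * fst \<alpha>)"
        by (simp add: wt_def flip: power_int_add)
      also have "\<dots> = 1" by (simp add: power_int_mult)
      finally show ?thesis by simp
    qed
    ultimately show ?thesis by (simp add: mult.assoc[symmetric])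
  qed
  then show ?thesis by (simp add: h_eq)
qed

lemma I0_gr_hodge: "x \<in> I0 p q \<Longrightarrow> x \<in> gr_hodge W F p q"
proof -
  assume x: "x \<in> I0 p q"
  obtain y z where yz: "y \<in> I0 q p" "z \<in> Wc (p + q - 1)" "cnj_vec x = y + z" using cnj_I0_gr[OF x] by auto
  have "cnj_vec x \<in> gr_filtration W F (p + q) q"
    unfolding gr_filtration_iff using yz I0_F[OF yz(1)] I0_Wc[OF yz(1)] by (auto simp: add.commute)
  then show ?thesis
    unfolding gr_hodge_def cnj_vec_mem_image[symmetric] Int_iff using gr_filtration_I0[OF x] by (simp add: cnj_vec_mem_image)
qed

text \<open>The second bilinear relation applies to every nonzero component, since a nonzero element
  of a summand of weight k is never in W_(k-1).\<close>

lemma h_pos_term: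
  fixes \<alpha> :: "int \<times> int"
  defines "t \<equiv> (\<lambda>u. \<i> powi (fst \<alpha> - snd \<alpha>) * form_C Q (wt \<alpha>) (pr \<alpha> *v u) (cnj_vec (pr \<alpha> *v u)))"
  shows "Re (t u) \<ge> 0" "pr \<alpha> *v u \<noteq> 0 \<Longrightarrow> Re (t u) > 0"
proof -
  have *: "Re (t u) > 0" if "pr \<alpha> *v u \<noteq> 0"
  proof -
    let ?x = "pr \<alpha> *v u"
    have x: "?x \<in> I0 (fst \<alpha>) (snd \<alpha>)" using pr_I0[of "fst \<alpha>" "snd \<alpha>"] by simp
    have "?x \<notin> Wc (fst \<alpha> + snd \<alpha> - 1)"
    proof
      assume "?x \<in> Wc (fst \<alpha> + snd \<alpha> - 1)"
      then have "pr \<alpha> *v ?x = 0" unfolding Wc_iff by (cases \<alpha>) auto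
      then show False using that by (simp add: pr_orthogonal_vec)
    qed
    then have "?x \<in> gr_hodge W F (fst \<alpha>) (snd \<alpha>) - Wc (fst \<alpha> + snd \<alpha> - 1)" using I0_gr_hodge[OF x] by blast
    then show ?thesis using pol unfolding graded_polarized_def t_def wt_def by blast
  qed
  then show "pr \<alpha> *v u \<noteq> 0 \<Longrightarrow> Re (t u) > 0" .
  show "Re (t u) \<ge> 0"
  proof (cases "pr \<alpha> *v u = 0")
    case True
    then show ?thesis by (simp add: t_def vec.subspace_0[OF Wc_subspace])
  qed (use * in auto)
qed

lemma h_pos: "u \<noteq> 0 \<Longrightarrow> Re (h u u) > 0"
proof -
  assume "u \<noteq> 0"
  then obtain \<alpha> where "pr \<alpha> *v u \<noteq> 0" using eq_if_pr[of u 0] by auto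
  moreover from this have "\<alpha> \<in> box" using pr_outside by fastforce
  ultimately show ?thesis
    unfolding h_eq Re_sum using h_pos_term by (intro sum_pos2[of _ \<alpha>]) auto
qed

lemma h_eq_0: "(\<And>v. h u v = 0) \<Longrightarrow> u = 0"
  using h_pos[of u] by (metis less_irrefl zero_complex.simps(1))

lemma h_orthogonal: "\<alpha> \<noteq> \<beta> \<Longrightarrow> h (pr \<alpha> *v u) (pr \<beta> *v v) = 0"
  unfolding h_eq by (rule sum.neutral) (auto simp: pr_orthogonal_vec vec.subspace_0[OF Wc_subspace] pr_wt Wc_cnj)

end

section \<open>Adjoints, projections and block types\<close>

lemma cscale_mat_of_real: "cscale_mat (of_real r) X = r *\<^sub>R X"
  by (simp add: cscale_mat_def map_matrix_def vec_eq_iff) (simp add: scaleR_conv_of_real)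

context weighted_forms begin

text \<open>The infinitesimal form of membership in \<open>group_C\<close>: it is linear in
  \<open>X\<close> and can be checked directly. \<open>lie_C_eq\<close> identifies it with the
  definition through exponentials.\<close>

definition lie :: "'n cmat \<Rightarrow> bool" where
  "lie X \<longleftrightarrow> (\<forall>k. \<forall>x\<in>Wc k. X *v x \<in> Wc k) \<and>
     (\<forall>k. \<forall>x\<in>Wc k. \<forall>y\<in>Wc k. form_C Q k (X *v x) y + form_C Q k x (X *v y) = 0)"

lemma lie_Wc: "lie X \<Longrightarrow> x \<in> Wc k \<Longrightarrow> X *v x \<in> Wc k"
  and lie_form: "lie X \<Longrightarrow> x \<in> Wc k \<Longrightarrow> y \<in> Wc k \<Longrightarrow> form_C Q k (X *v x) y = - form_C Q k x (X *v y)"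
  by (auto simp: lie_def eq_neg_iff_add_eq_0)

lemma lieI:
  assumes "\<And>k x. x \<in> Wc k \<Longrightarrow> X *v x \<in> Wc k"
    "\<And>k x y. x \<in> Wc k \<Longrightarrow> y \<in> Wc k \<Longrightarrow> form_C Q k (X *v x) y = - form_C Q k x (X *v y)"
  shows "lie X"
  using assms by (auto simp: lie_def)

lemma lie_add: "lie X \<Longrightarrow> lie Y \<Longrightarrow> lie (X + Y)"
  by (rule lieI) (auto simp: matrix_vector_mult_add_rdistrib lie_Wc lie_form form_C_lin1(1) form_C_lin2(1)
      intro!: vec.subspace_add[OF Wc_subspace])

lemma lie_cscale: "lie X \<Longrightarrow> lie (cscale_mat c X)"
  by (rule lieI) (auto simp: cscale_mat_vec lie_Wc lie_form form_C_lin1(2) form_C_lin2(2)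
      intro!: vec.subspace_scale[OF Wc_subspace])

lemma lie_scaleR: "lie X \<Longrightarrow> lie (r *\<^sub>R X)"
  using lie_cscale[of X "of_real r"] by (simp add: cscale_mat_of_real)

lemma lie_minus: "lie X \<Longrightarrow> lie (- X)"
  using lie_scaleR[of X "-1"] by simp

lemma lie_0: "lie 0"
  by (rule lieI) (simp_all add: vec.subspace_0[OF Wc_subspace])

lemma lie_bracket: "lie X \<Longrightarrow> lie Y \<Longrightarrow> lie (bracket X Y)"
proof (rule lieI)
  fix k x assume "lie X" "lie Y" "x \<in> Wc k"
  then show "bracket X Y *v x \<in> Wc k"
    by (auto simp: bracket_def matrix_vector_mult_diff_rdistrib matrix_vector_mul_assoc[symmetric] lie_Wc
        intro!: vec.subspace_diff[OF Wc_subspace])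
next
  fix k x y assume *: "lie X" "lie Y" "x \<in> Wc k" "y \<in> Wc k"
  have d: "form_C Q k (a - b) c = form_C Q k a c - form_C Q k b c" "form_C Q k c (a - b) = form_C Q k c a - form_C Q k c b"
    if "a \<in> Wc k" "b \<in> Wc k" "c \<in> Wc k" for a b c
  proof -
    have "a - b \<in> Wc k" using that by (intro vec.subspace_diff[OF Wc_subspace])
    then show "form_C Q k (a - b) c = form_C Q k a c - form_C Q k b c" "form_C Q k c (a - b) = form_C Q k c a - form_C Q k c b"
      using that form_C_lin1(1)[of "a - b" k b c] form_C_lin2(1)[of "a - b" k b c] by simp_all
  qed
  show "form_C Q k (bracket X Y *v x) y = - form_C Q k x (bracket X Y *v y)"
    using * by (simp add: bracket_def matrix_vector_mult_diff_rdistrib matrix_vector_mul_assoc[symmetric] lie_Wc d lie_form)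
qed

lemma lie_cnj: "lie X \<Longrightarrow> lie (cnj_mat X)"
proof (rule lieI)
  assume X: "lie X"
  have e: "cnj_mat X *v x = cnj_vec (X *v cnj_vec x)" for x by (simp add: cnj_mat_vec)
  fix k x assume x: "x \<in> Wc k"
  then show "cnj_mat X *v x \<in> Wc k" using X by (simp add: e Wc_cnj lie_Wc)
  fix y assume y: "y \<in> Wc k"
  show "form_C Q k (cnj_mat X *v x) y = - form_C Q k x (cnj_mat X *v y)"
    using X x y form_C_cnj[of "X *v cnj_vec x" k "cnj_vec y"] form_C_cnj[of "cnj_vec x" k "X *v cnj_vec y"]
    by (simp add: e Wc_cnj lie_Wc lie_form)
qed

end

context polarized_mhs begin

section \<open>Adjoints and orthogonal projections for the metric\<close>

lemma h_gram: "h u v = (\<Sum>i\<in>UNIV. u $ i * ((\<chi> i j. h (axis i 1) (axis j 1)) *v cnj_vec v) $ i)"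
proof -
  have "h u v = h (\<Sum>i\<in>UNIV. (u $ i) *s axis i 1) (\<Sum>i\<in>UNIV. (v $ i) *s axis i 1)"
    by (simp add: basis_expansion)
  also have "\<dots> = (\<Sum>i\<in>UNIV. \<Sum>j\<in>UNIV. u $ i * (h (axis i 1) (axis j 1) * cnj (v $ j)))"
    unfolding h_sum by (subst sum.swap) (simp add: h_lin mult_ac)
  finally show ?thesis by (simp add: matrix_vector_mult_def cnj_vec_def sum_distrib_left)
qed

text \<open>The Gram matrix \<open>G\<close> is invertible by positivity, and the adjoint is the
  conjugate of G^(-1) A^T G.\<close>

lemma adjoint_exists: "\<exists>B. \<forall>u v. h (A *v u) v = h u (B *v v)"
proof -
  define G :: "'n cmat" where "G = (\<chi> i j. h (axis i 1) (axis j 1))"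
  have hG: "h u v = (\<Sum>i\<in>UNIV. u $ i * (G *v cnj_vec v) $ i)" for u v unfolding G_def by (rule h_gram)
  have "cnj_vec x = 0" if "G *v x = 0" for x
  proof -
    have "h u (cnj_vec x) = 0" for u using that by (simp add: hG)
    then have "h (cnj_vec x) u = 0" for u using h_hermitian[of "cnj_vec x" u] by simp
    then show ?thesis by (rule h_eq_0)
  qed
  then obtain G' where G': "G' ** G = mat 1" using matrix_left_invertible_ker[of G] cnj_vec_eq_0 by blast
  then have GG: "G ** G' = mat 1" by (simp add: matrix_left_right_inverse)
  have "h (A *v u) v = h u (cnj_mat (G' ** transpose A ** G) *v v)" for u v
  proof -
    have "h u (cnj_mat (G' ** transpose A ** G) *v v) = (\<Sum>i\<in>UNIV. u $ i * (G *v (G' *v (transpose A *v (G *v cnj_vec v)))) $ i)"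
      by (simp add: hG cnj_mat_vec matrix_vector_mul_assoc matrix_mul_assoc)
    also have "\<dots> = (\<Sum>i\<in>UNIV. u $ i * (transpose A *v (G *v cnj_vec v)) $ i)"
      by (subst matrix_vector_mul_assoc) (simp add: GG)
    also have "\<dots> = (\<Sum>i\<in>UNIV. \<Sum>j\<in>UNIV. A $ j $ i * u $ i * (G *v cnj_vec v) $ j)"
      by (subst (1) matrix_vector_mult_def) (simp add: transpose_def sum_distrib_left mult_ac)
    also have "\<dots> = (\<Sum>j\<in>UNIV. \<Sum>i\<in>UNIV. A $ j $ i * u $ i * (G *v cnj_vec v) $ j)"
      by (rule sum.swap)
    also have "\<dots> = h (A *v u) v"
      unfolding hG by (subst (2) matrix_vector_mult_def) (simp add: sum_distrib_right)
    finally show ?thesis by simp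
  qed
  then show ?thesis by blast
qed

abbreviation adj where "adj \<equiv> hodge_adjoint W Q F"

lemma h_eqI: "(\<And>u. h u v = h u w) \<Longrightarrow> v = w"
proof -
  assume *: "\<And>u. h u v = h u w"
  have "h (v - w) u = 0" for u using *[of u] h_hermitian[of "v - w" u] by (simp add: h_diff)
  then show ?thesis using h_eq_0[of "v - w"] by simp
qed

lemma adj_eqI:
  assumes "\<And>u v. h (A *v u) v = h u (B *v v)"
  shows "adj A = B"
  unfolding hodge_adjoint_def
proof (rule the_equality)
  fix B' assume "\<forall>u v. h (A *v u) v = h u (B' *v v)"
  then have "h u (B' *v v) = h u (B *v v)" for u v using assms by metis
  then have "B' *v v = B *v v" for v by (rule h_eqI)
  then show "B' = B" by (rule matrix_eqI)
qed (use assms in auto)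

lemma h_adj: "h (A *v u) v = h u (adj A *v v)"
  using adjoint_exists[of A] adj_eqI by metis

lemma h_adj': "h u (A *v v) = h (adj A *v u) v"
  using h_adj[of A v u] h_hermitian by metis

definition PF :: "int \<Rightarrow> 'n cmat" where "PF p = (\<Sum>\<alpha>\<in>{\<alpha>\<in>box. p \<le> fst \<alpha>}. pr \<alpha>)"

lemma pr_PF: "pr \<beta> *v (PF p *v x) = (if p \<le> fst \<beta> then pr \<beta> *v x else 0)"
proof -
  have "pr \<beta> *v (PF p *v x) = (\<Sum>\<alpha>\<in>{\<alpha>\<in>box. p \<le> fst \<alpha>}. if \<alpha> = \<beta> then pr \<beta> *v x else 0)"
    by (simp add: PF_def matrix_vector_mult_sum_left matrix_vector_mult_sum_right pr_orthogonal_vec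
        cong: if_cong)
  also have "\<dots> = (if \<beta> \<in> box \<and> p \<le> fst \<beta> then pr \<beta> *v x else 0)"
    using finite_box by (simp add: sum.delta)
  finally show ?thesis using pr_outside[of \<beta>] by auto
qed

lemma PF_in: "PF p *v x \<in> F p"
  by (simp add: F_iff pr_PF)

lemma h_pr_sum: "h u v = (\<Sum>\<alpha>\<in>box. h (pr \<alpha> *v u) (pr \<alpha> *v v))"
proof -
  have "h u v = h (\<Sum>\<alpha>\<in>box. pr \<alpha> *v u) (\<Sum>\<beta>\<in>box. pr \<beta> *v v)" by (simp add: sum_pr_vec)
  also have "\<dots> = (\<Sum>\<beta>\<in>box. \<Sum>\<alpha>\<in>box. h (pr \<alpha> *v u) (pr \<beta> *v v))" by (simp add: h_sum)
  also have "\<dots> = (\<Sum>\<beta>\<in>box. \<Sum>\<alpha>\<in>box. if \<alpha> = \<beta> then h (pr \<beta> *v u) (pr \<beta> *v v) else 0)"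
    by (intro sum.cong refl) (auto simp: h_orthogonal)
  finally show ?thesis by simp
qed

lemma h_PF: "w \<in> F p \<Longrightarrow> h (x - PF p *v x) w = 0"
  unfolding h_pr_sum[of "x - PF p *v x"] matrix_vector_mult_diff_distrib pr_PF
  by (rule sum.neutral) (auto simp: F_iff)

text \<open>As F^p is a sum of mutually orthogonal summands, the orthogonal projection is the sum of
  the corresponding \<open>pr\<close>.\<close>

lemma hodge_proj_eq: "hodge_proj W Q F p = PF p"
  unfolding hodge_proj_def
proof (rule the_equality)
  fix P' assume P': "\<forall>v. P' *v v \<in> F p \<and> (\<forall>w\<in>F p. h (v - P' *v v) w = 0)"
  show "P' = PF p"
  proof (rule matrix_eqI)
    fix v
    let ?d = "PF p *v v - P' *v v"
    have d: "?d \<in> F p" using P' PF_in vec.subspace_diff[OF F_subspace] by blast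
    have "h ((v - P' *v v) - (v - PF p *v v)) ?d = 0"
      unfolding h_diff(1)[of "v - P' *v v"] using P' h_PF[OF d] d by simp
    then have "h ?d ?d = 0" by simp
    then show "P' *v v = PF p *v v" using h_pos[of ?d] by fastforce
  qed
qed (auto simp: PF_in h_PF)

text \<open>\<open>S\<close> contains the shifts of bidegree that \<open>X\<close> may effect.
  Membership in the Lie algebra is kept apart, because the factors f and L and products of matrices
  have to be treated too.\<close>

definition btype :: "(int \<times> int) set \<Rightarrow> 'n cmat \<Rightarrow> bool" where
  "btype S X \<longleftrightarrow> (\<forall>\<alpha> \<beta>. \<beta> - \<alpha> \<notin> S \<longrightarrow> pr \<beta> ** X ** pr \<alpha> = 0)"

lemma btypeD: "btype S X \<Longrightarrow> \<beta> - \<alpha> \<notin> S \<Longrightarrow> pr \<beta> ** X ** pr \<alpha> = 0"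
  unfolding btype_def by blast

definition part :: "(int \<times> int) set \<Rightarrow> 'n cmat \<Rightarrow> 'n cmat" where
  "part S X = (\<Sum>\<alpha>\<in>box. \<Sum>\<beta>\<in>box. if \<beta> - \<alpha> \<in> S then pr \<beta> ** X ** pr \<alpha> else 0)"

lemma blocks_sum: "X = (\<Sum>\<alpha>\<in>box. \<Sum>\<beta>\<in>box. pr \<beta> ** X ** pr \<alpha>)"
  by (simp add: matrix_mult_sum_left[symmetric] matrix_mult_sum_right[symmetric] sum_pr)

lemma eq_if_blocks: "(\<And>\<alpha> \<beta>. pr \<beta> ** X ** pr \<alpha> = pr \<beta> ** Y ** pr \<alpha>) \<Longrightarrow> X = Y"
proof -
  assume *: "\<And>\<alpha> \<beta>. pr \<beta> ** X ** pr \<alpha> = pr \<beta> ** Y ** pr \<alpha>"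
  have "(\<Sum>\<alpha>\<in>box. \<Sum>\<beta>\<in>box. pr \<beta> ** X ** pr \<alpha>) = (\<Sum>\<alpha>\<in>box. \<Sum>\<beta>\<in>box. pr \<beta> ** Y ** pr \<alpha>)"
    by (intro sum.cong refl *)
  then show ?thesis using blocks_sum by metis
qed

lemma block_block: "pr \<delta> ** (pr \<beta> ** X ** pr \<alpha>) ** pr \<gamma> = (if \<delta> = \<beta> \<and> \<gamma> = \<alpha> then pr \<beta> ** X ** pr \<alpha> else 0)"
proof -
  have "pr \<delta> ** (pr \<beta> ** X ** pr \<alpha>) ** pr \<gamma> = (pr \<delta> ** pr \<beta>) ** X ** (pr \<alpha> ** pr \<gamma>)"
    by (simp add: matrix_mul_assoc)
  then show ?thesis by (simp add: pr_orthogonal)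
qed

lemma block_part: "pr \<delta> ** part S X ** pr \<gamma> = (if \<delta> - \<gamma> \<in> S then pr \<delta> ** X ** pr \<gamma> else 0)"
proof (cases "\<gamma> \<in> box \<and> \<delta> \<in> box")
  case True
  have if0: "pr \<delta> ** (if b then M else 0) ** pr \<gamma> = (if b then pr \<delta> ** M ** pr \<gamma> else 0)" for b M by simp
  have "pr \<delta> ** part S X ** pr \<gamma> =
     (\<Sum>\<alpha>\<in>box. \<Sum>\<beta>\<in>box. if \<beta> - \<alpha> \<in> S then pr \<delta> ** (pr \<beta> ** X ** pr \<alpha>) ** pr \<gamma> else 0)"
    by (simp only: part_def matrix_mult_sum_left matrix_mult_sum_right if0)
  also have "\<dots> = (\<Sum>\<alpha>\<in>box. \<Sum>\<beta>\<in>box. if \<beta> = \<delta> then (if \<alpha> = \<gamma> then (if \<delta> - \<gamma> \<in> S then pr \<delta> ** X ** pr \<gamma> else 0) else 0) else 0)"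
    by (intro sum.cong refl) (auto simp: block_block)
  also have "\<dots> = (if \<delta> - \<gamma> \<in> S then pr \<delta> ** X ** pr \<gamma> else 0)" using True by (simp add: sum.delta)
  finally show ?thesis .
next
  case False
  then have "pr \<gamma> = 0 \<or> pr \<delta> = 0" using pr_outside by blast
  then show ?thesis by auto
qed

lemma btype_part: "btype S (part S X)" by (simp add: btype_def block_part)

lemma part_btype: "btype S X \<Longrightarrow> part S X = X"
  by (rule eq_if_blocks) (auto simp: block_part btype_def)

lemma part_disjoint: "btype T X \<Longrightarrow> S \<inter> T = {} \<Longrightarrow> part S X = 0"
proof (rule eq_if_blocks)
  fix \<alpha> \<beta> assume "btype T X" "S \<inter> T = {}"
  then show "pr \<beta> ** part S X ** pr \<alpha> = pr \<beta> ** 0 ** pr \<alpha>"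
    using btypeD[of T X \<beta> \<alpha>] by (auto simp: block_part)
qed

lemma btype_mono: "btype S X \<Longrightarrow> S \<subseteq> T \<Longrightarrow> btype T X" unfolding btype_def by blast

lemma btype_Int: "btype S X \<Longrightarrow> btype T X \<Longrightarrow> btype (S \<inter> T) X" by (auto simp: btype_def)

lemma btype_add: "btype S X \<Longrightarrow> btype S Y \<Longrightarrow> btype S (X + Y)"
  and btype_diff: "btype S X \<Longrightarrow> btype S Y \<Longrightarrow> btype S (X - Y)"
  by (simp_all add: btype_def matrix_add_ldistrib matrix_add_rdistrib matrix_diff_ldistrib matrix_diff_rdistrib)

lemma btype_0: "btype S 0" by (simp add: btype_def)

lemma cscale_mat_mult: "cscale_mat c X ** Y = cscale_mat c (X ** Y)" "X ** cscale_mat c Y = cscale_mat c (X ** Y)"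
  by (simp_all add: cscale_mat_def map_matrix_def matrix_matrix_mult_def vec_eq_iff sum_distrib_left mult_ac)

lemma btype_cscale: "btype S X \<Longrightarrow> btype S (cscale_mat c X)"
  unfolding btype_def cscale_mat_mult by (simp add: cscale_mat_def map_matrix_def vec_eq_iff)

lemma btype_scaleR: "btype S X \<Longrightarrow> btype S (r *\<^sub>R X)"
  using btype_cscale[of S X "of_real r"] by (simp add: cscale_mat_of_real)

lemma btype_one: "(0, 0) \<in> S \<Longrightarrow> btype S (mat 1)"
  by (auto simp: btype_def pr_orthogonal zero_prod_def)

lemma block_mult: "pr \<beta> ** (X ** Y) ** pr \<alpha> = (\<Sum>\<gamma>\<in>box. (pr \<beta> ** X ** pr \<gamma>) ** (pr \<gamma> ** Y ** pr \<alpha>))"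
proof -
  have "(pr \<beta> ** X ** pr \<gamma>) ** (pr \<gamma> ** Y ** pr \<alpha>) = (pr \<beta> ** X) ** pr \<gamma> ** (Y ** pr \<alpha>)" for \<gamma>
  proof -
    have "(pr \<beta> ** X ** pr \<gamma>) ** (pr \<gamma> ** Y ** pr \<alpha>) = (pr \<beta> ** X) ** (pr \<gamma> ** pr \<gamma>) ** (Y ** pr \<alpha>)"
      by (simp only: matrix_mul_assoc)
    then show ?thesis by (simp add: pr_orthogonal)
  qed
  then show ?thesis
    by (simp add: matrix_mult_sum_left[symmetric] matrix_mult_sum_right[symmetric] sum_pr matrix_mul_assoc)
qed

lemma btype_mult:
  assumes "btype S X" "btype T Y" "\<And>s t. s \<in> S \<Longrightarrow> t \<in> T \<Longrightarrow> s + t \<in> R"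
  shows "btype R (X ** Y)"
  unfolding btype_def
proof (intro allI impI)
  fix \<alpha> \<beta> assume no: "\<beta> - \<alpha> \<notin> R"
  have "(pr \<beta> ** X ** pr \<gamma>) ** (pr \<gamma> ** Y ** pr \<alpha>) = 0" for \<gamma>
  proof (cases "\<beta> - \<gamma> \<in> S \<and> \<gamma> - \<alpha> \<in> T")
    case True
    then show ?thesis using no assms(3)[of "\<beta> - \<gamma>" "\<gamma> - \<alpha>"] by simp
  next
    case False
    then show ?thesis using btypeD[OF assms(1)] btypeD[OF assms(2)] by fastforce
  qed
  then show "pr \<beta> ** (X ** Y) ** pr \<alpha> = 0" by (simp add: block_mult)
qed

lemma pr_cnj_mat:
  assumes "\<beta> \<noteq> prod.swap \<alpha>" "\<not> (fst \<beta> < snd \<alpha> \<and> snd \<beta> < fst \<alpha>)"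
  shows "pr \<beta> ** cnj_mat (pr \<alpha>) = 0"
proof (rule matrix_eqI)
  fix x
  show "pr \<beta> ** cnj_mat (pr \<alpha>) *v x = 0 *v x"
    using pr_cnj[OF assms, of "cnj_vec x"] by (simp add: cnj_mat_vec matrix_vector_mul_assoc)
qed

text \<open>The congruence for conjugates is applied to each block of \<open>X\<close>, at its
  source and at its target. The conjugate block joins \<gamma> to \<delta> only if these are the
  swapped bidegrees up to defects; \<open>a\<close> and \<open>b\<close> are the total defects, both
  zero or both positive.\<close>

lemma btype_cnj:
  assumes X: "btype S X"
    and R: "\<And>r s a b. (r, s) \<in> S \<Longrightarrow> a = 0 \<and> b = 0 \<or> a > 0 \<and> b > 0 \<Longrightarrow> (s - a, r - b) \<in> R"
  shows "btype R (cnj_mat X)"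
  unfolding btype_def
proof (intro allI impI)
  fix \<gamma> \<delta> assume no: "\<delta> - \<gamma> \<notin> R"
  have "pr \<delta> ** cnj_mat (pr \<beta> ** X ** pr \<alpha>) ** pr \<gamma> = 0" for \<alpha> \<beta>
  proof -
    have e: "pr \<delta> ** cnj_mat (pr \<beta> ** X ** pr \<alpha>) ** pr \<gamma> = (pr \<delta> ** cnj_mat (pr \<beta>)) ** cnj_mat X ** (cnj_mat (pr \<alpha>) ** pr \<gamma>)"
      by (simp add: cnj_mat_mult matrix_mul_assoc)
    show ?thesis
    proof (cases "\<beta> - \<alpha> \<in> S")
      case False
      then show ?thesis using btypeD[OF X] by simp
    next
      case S: True
      show ?thesis
      proof (cases "\<delta> = prod.swap \<beta> \<or> fst \<delta> < snd \<beta> \<and> snd \<delta> < fst \<beta>")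
        case False
        then show ?thesis unfolding e by (simp add: pr_cnj_mat)
      next
        case d: True
        show ?thesis
        proof (cases "\<alpha> = prod.swap \<gamma> \<or> fst \<alpha> < snd \<gamma> \<and> snd \<alpha> < fst \<gamma>")
          case False
          have "cnj_mat (pr \<alpha>) ** pr \<gamma> = cnj_mat (pr \<alpha> ** cnj_mat (pr \<gamma>))" by (simp add: cnj_mat_mult)
          also have "pr \<alpha> ** cnj_mat (pr \<gamma>) = 0" using False by (intro pr_cnj_mat) auto
          finally show ?thesis unfolding e by simp
        next
          case g: True
          define a b where "a = snd \<beta> - snd \<alpha> - (fst \<delta> - fst \<gamma>)" and "b = fst \<beta> - fst \<alpha> - (snd \<delta> - snd \<gamma>)"
          have "a = 0 \<and> b = 0 \<or> a > 0 \<and> b > 0" using d g by (auto simp: a_def b_def)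
          moreover have "(fst \<beta> - fst \<alpha>, snd \<beta> - snd \<alpha>) \<in> S" using S by (simp add: minus_prod_def)
          ultimately have "(snd \<beta> - snd \<alpha> - a, fst \<beta> - fst \<alpha> - b) \<in> R" by (intro R)
          then have "\<delta> - \<gamma> \<in> R" by (simp add: a_def b_def minus_prod_def)
          then show ?thesis using no by simp
        qed
      qed
    qed
  qed
  moreover have "cnj_mat X = (\<Sum>\<alpha>\<in>box. \<Sum>\<beta>\<in>box. cnj_mat (pr \<beta> ** X ** pr \<alpha>))"
    using arg_cong[OF blocks_sum, of cnj_mat X] by (simp only: cnj_mat_sum)
  ultimately show "pr \<delta> ** cnj_mat X ** pr \<gamma> = 0"
    by (simp add: matrix_mult_sum_left matrix_mult_sum_right)
qed

lemma part_add: "part S (X + Y) = part S X + part S Y"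
  and part_diff: "part S (X - Y) = part S X - part S Y"
  by (rule eq_if_blocks;
      simp add: block_part matrix_add_ldistrib matrix_add_rdistrib matrix_diff_ldistrib matrix_diff_rdistrib)+

lemma part_0 [simp]: "part S 0 = 0" by (rule part_disjoint[of "{}"]) (auto simp: btype_0)

lemma part_minus: "part S (- X) = - part S X"
  using part_diff[of S 0 X] by simp

lemma pr_mult_vec: "pr \<beta> *v (X *v v) = (\<Sum>\<alpha>\<in>box. (pr \<beta> ** X ** pr \<alpha>) *v v)"
  by (simp add: matrix_vector_mult_sum_left[symmetric] matrix_mult_sum_right[symmetric] sum_pr matrix_vector_mul_assoc)

lemma btype_WcD: "btype {(r, s). r + s \<le> 0} X \<Longrightarrow> x \<in> Wc k \<Longrightarrow> X *v x \<in> Wc k"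
  unfolding Wc_iff pr_mult_vec
proof (intro allI impI sum.neutral ballI)
  fix \<beta> \<alpha> :: "int \<times> int" assume X: "btype {(r, s). r + s \<le> 0} X" and x: "\<forall>\<alpha>. k < fst \<alpha> + snd \<alpha> \<longrightarrow> pr \<alpha> *v x = 0" and b: "k < fst \<beta> + snd \<beta>"
  show "(pr \<beta> ** X ** pr \<alpha>) *v x = 0"
  proof (cases "k < fst \<alpha> + snd \<alpha>")
    case True
    then have "pr \<alpha> *v x = 0" using x by blast
    then show ?thesis by (simp add: matrix_vector_mul_assoc[symmetric])
  next
    case False
    then have "pr \<beta> ** X ** pr \<alpha> = 0" using b by (intro btypeD[OF X]) (auto simp: minus_prod_def)
    then show ?thesis by simp
  qed
qed

lemma btype_FD: "btype {(r, s). r \<ge> 0} X \<Longrightarrow> x \<in> F k \<Longrightarrow> X *v x \<in> F k"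
  unfolding F_iff pr_mult_vec
proof (intro allI impI sum.neutral ballI)
  fix \<beta> \<alpha> :: "int \<times> int" assume X: "btype {(r, s). r \<ge> 0} X" and x: "\<forall>\<alpha>. fst \<alpha> < k \<longrightarrow> pr \<alpha> *v x = 0" and b: "fst \<beta> < k"
  show "(pr \<beta> ** X ** pr \<alpha>) *v x = 0"
  proof (cases "fst \<alpha> < k")
    case True
    then have "pr \<alpha> *v x = 0" using x by blast
    then show ?thesis by (simp add: matrix_vector_mul_assoc[symmetric])
  next
    case False
    then have "pr \<beta> ** X ** pr \<alpha> = 0" using b by (intro btypeD[OF X]) (auto simp: minus_prod_def)
    then show ?thesis by simp
  qed
qed

lemma block_zeroI: "(\<And>v. pr \<beta> *v (X *v (pr \<alpha> *v v)) = 0) \<Longrightarrow> pr \<beta> ** X ** pr \<alpha> = 0"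
  by (rule matrix_eqI) (simp add: matrix_vector_mul_assoc[symmetric])

lemma btype_WcI:
  assumes "\<And>k x. x \<in> Wc k \<Longrightarrow> X *v x \<in> Wc k"
  shows "btype {(r, s). r + s \<le> 0} X"
  unfolding btype_def
proof (intro allI impI block_zeroI)
  fix \<alpha> \<beta> :: "int \<times> int" and v assume "\<beta> - \<alpha> \<notin> {(r, s). r + s \<le> 0}"
  then have "wt \<alpha> < fst \<beta> + snd \<beta>" by (simp add: wt_def minus_prod_def)
  moreover have "X *v (pr \<alpha> *v v) \<in> Wc (wt \<alpha>)" using assms pr_wt by blast
  ultimately show "pr \<beta> *v (X *v (pr \<alpha> *v v)) = 0" unfolding Wc_iff by (cases \<beta>) auto
qed

lemma lie_btype: "lie X \<Longrightarrow> btype {(r, s). r + s \<le> 0} X"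
  using lie_Wc by (intro btype_WcI) auto

lemma form_C_pr':
  assumes "y \<in> Wc k" "z \<in> Wc k" "fst \<alpha> + snd \<alpha> = k"
  shows "form_C Q k z (pr \<alpha> *v y) = form_C Q k (pr (prod.swap \<alpha>) *v z) (pr \<alpha> *v y)"
  using form_C_pr[OF assms] form_C_sym[of "pr \<alpha> *v y" k] assms pr_Wc by metis

lemma form_C_blocks:
  assumes "x \<in> Wc k" "y \<in> Wc k"
  shows "form_C Q k x y = (\<Sum>\<alpha>\<in>box. \<Sum>\<beta>\<in>box. form_C Q k (pr \<alpha> *v x) (pr \<beta> *v y))"
proof -
  have "form_C Q k x y = form_C Q k (\<Sum>\<alpha>\<in>box. pr \<alpha> *v x) (\<Sum>\<beta>\<in>box. pr \<beta> *v y)" by (simp add: sum_pr_vec)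
  also have "\<dots> = (\<Sum>\<alpha>\<in>box. form_C Q k (pr \<alpha> *v x) (\<Sum>\<beta>\<in>box. pr \<beta> *v y))"
    using assms by (intro form_C_sum1) (simp_all add: pr_Wc sum_pr_vec)
  also have "\<dots> = (\<Sum>\<alpha>\<in>box. \<Sum>\<beta>\<in>box. form_C Q k (pr \<alpha> *v x) (pr \<beta> *v y))"
    using assms by (intro sum.cong refl form_C_sum2) (simp_all add: pr_Wc)
  finally show ?thesis .
qed

text \<open>Skewness for \<open>form_C Q k\<close> couples the block from \<alpha> to
  \<open>prod.swap \<beta>\<close> with the block from \<beta> to \<open>prod.swap \<alpha>\<close>.
  If \<alpha> and \<beta> have weight k, both blocks have the same shift, so they are kept or
  dropped together.\<close>

lemma lie_part_lie:
  assumes X: "lie X"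
  shows "lie (part S X)"
proof (rule lieI)
  have pW: "x \<in> Wc k \<Longrightarrow> part S X *v x \<in> Wc k" for x k
  proof (rule btype_WcD)
    show "btype {(r, s). r + s \<le> 0} (part S X)"
      using lie_btype[OF X] by (auto simp: btype_def block_part)
  qed
  then show "x \<in> Wc k \<Longrightarrow> part S X *v x \<in> Wc k" for x k .
  have main: "form_C Q k (part S X *v a) b = - form_C Q k a (part S X *v b)"
    if a: "a = pr \<alpha> *v a" and b: "b = pr \<beta> *v b" and k: "fst \<alpha> + snd \<alpha> = k" "fst \<beta> + snd \<beta> = k" for a b \<alpha> \<beta> k
  proof -
    have W: "a \<in> Wc k" "b \<in> Wc k" using pr_wt[of \<alpha> a] pr_wt[of \<beta> b] a b k by (simp_all add: wt_def)
    note XW = lie_Wc[OF X W(1)] lie_Wc[OF X W(2)] pW[OF W(1)] pW[OF W(2)]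
    have bp: "pr \<delta> *v (part S X *v (pr \<gamma> *v c)) = (if \<delta> - \<gamma> \<in> S then pr \<delta> *v (X *v (pr \<gamma> *v c)) else 0)" for \<delta> \<gamma> c
      using arg_cong[OF block_part[of \<delta> S X \<gamma>], of "\<lambda>M. M *v c"] by (simp add: matrix_vector_mul_assoc matrix_mul_assoc)
    have 1: "form_C Q k (Y *v a) b = form_C Q k (pr (prod.swap \<beta>) *v (Y *v a)) b" if "Y *v a \<in> Wc k" for Y
      using form_C_pr'[OF W(2) that k(2)] b by simp
    have 2: "form_C Q k a (Y *v b) = form_C Q k a (pr (prod.swap \<alpha>) *v (Y *v b))" if "Y *v b \<in> Wc k" for Y
      using form_C_pr[OF W(1) that k(1)] a by simp
    have eq: "prod.swap \<beta> - \<alpha> \<in> S \<longleftrightarrow> prod.swap \<alpha> - \<beta> \<in> S"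
    proof -
      have "prod.swap \<beta> - \<alpha> = prod.swap \<alpha> - \<beta>" using k by (simp add: prod_eq_iff)
      then show ?thesis by simp
    qed
    have A: "form_C Q k (part S X *v a) b = (if prod.swap \<beta> - \<alpha> \<in> S then form_C Q k (X *v a) b else 0)"
      using 1[OF XW(3)] 1[OF XW(1)] bp[of "prod.swap \<beta>" \<alpha> a] a W by (simp split: if_splits)
    have B: "form_C Q k a (part S X *v b) = (if prod.swap \<alpha> - \<beta> \<in> S then form_C Q k a (X *v b) else 0)"
      using 2[OF XW(4)] 2[OF XW(2)] bp[of "prod.swap \<alpha>" \<beta> b] b W by (simp split: if_splits)
    show ?thesis unfolding A B eq using lie_form[OF X W] by simp
  qed
  fix k x y assume W: "x \<in> Wc k" "y \<in> Wc k"
  have "form_C Q k (part S X *v (pr \<alpha> *v x)) (pr \<beta> *v y) = - form_C Q k (pr \<alpha> *v x) (part S X *v (pr \<beta> *v y))" for \<alpha> \<beta>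
  proof -
    have m: "pr \<alpha> *v x \<in> Wc k" "pr \<beta> *v y \<in> Wc k" using W pr_Wc by auto
    consider "fst \<alpha> + snd \<alpha> = k" "fst \<beta> + snd \<beta> = k" | "wt \<alpha> < k" | "wt \<beta> < k" | "wt \<alpha> > k" | "wt \<beta> > k"
      unfolding wt_def by linarith
    then show ?thesis
    proof cases
      case 1
      then show ?thesis by (intro main[of _ \<alpha> _ \<beta>]) (simp_all add: pr_orthogonal_vec)
    next
      case 2
      then show ?thesis
        using form_C_radical(1)[OF pW[OF pr_wt] 2 m(2)] form_C_radical(1)[OF pr_wt 2 pW[OF m(2)]] by simp
    next
      case 3
      then show ?thesis
        using form_C_radical(2)[OF pr_wt 3 pW[OF m(1)]] form_C_radical(2)[OF pW[OF pr_wt] 3 m(1)] by simp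
    next
      case 4
      then have "pr \<alpha> *v x = 0" using W unfolding Wc_iff wt_def by (cases \<alpha>) auto
      then show ?thesis using pW m by simp
    next
      case 5
      then have "pr \<beta> *v y = 0" using W unfolding Wc_iff wt_def by (cases \<beta>) auto
      then show ?thesis using pW m by simp
    qed
  qed note * = this
  have e1: "part S X *v x = (\<Sum>\<alpha>\<in>box. part S X *v (pr \<alpha> *v x))" and e2: "part S X *v y = (\<Sum>\<alpha>\<in>box. part S X *v (pr \<alpha> *v y))"
    by (simp_all add: matrix_vector_mult_sum_right[symmetric] sum_pr_vec)
  have "form_C Q k (part S X *v x) y = (\<Sum>\<alpha>\<in>box. \<Sum>\<beta>\<in>box. form_C Q k (part S X *v (pr \<alpha> *v x)) (pr \<beta> *v y))"
    unfolding e1 using form_C_sum1[of box "\<lambda>\<alpha>. part S X *v (pr \<alpha> *v x)" k y] form_C_sum2[of box "\<lambda>\<beta>. pr \<beta> *v y" k] W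
    by (simp add: pW pr_Wc sum_pr_vec)
  moreover have "form_C Q k x (part S X *v y) = (\<Sum>\<alpha>\<in>box. \<Sum>\<beta>\<in>box. form_C Q k (pr \<alpha> *v x) (part S X *v (pr \<beta> *v y)))"
    unfolding e2 using form_C_sum1[of box "\<lambda>\<alpha>. pr \<alpha> *v x" k "\<Sum>\<beta>\<in>box. part S X *v (pr \<beta> *v y)"]
      form_C_sum2[of box "\<lambda>\<beta>. part S X *v (pr \<beta> *v y)" k] W
    by (simp add: pW pr_Wc sum_pr_vec vec.subspace_sum[OF Wc_subspace])
  ultimately show "form_C Q k (part S X *v x) y = - form_C Q k x (part S X *v y)"
    by (simp add: * sum_negf)
qed

end

section \<open>The matrix exponential and the Lie algebra\<close>

definition mpow :: "'n::finite cmat \<Rightarrow> nat \<Rightarrow> 'n cmat" where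
  "mpow X m = ((**) X ^^ m) (mat 1)"

lemma mpow_0 [simp]: "mpow X 0 = mat 1" and mpow_Suc: "mpow X (Suc m) = X ** mpow X m"
  by (simp_all add: mpow_def)

lemma mpow_add: "mpow X (m + l) = mpow X m ** mpow X l"
  by (induction m) (simp_all add: mpow_Suc matrix_mul_assoc)

lemma mpow_uminus: "mpow (- X) m = (-1) ^ m *\<^sub>R mpow (X :: 'n::finite cmat) m"
proof (induction m)
  case (Suc m)
  have "- X ** ((-1) ^ m *\<^sub>R mpow X m) = (-1) ^ Suc m *\<^sub>R (X ** mpow X m)"
    by (simp add: matrix_matrix_mult_def vec_eq_iff sum_negf scaleR_sum_right)
  then show ?case using Suc by (simp add: mpow_Suc)
qed simp

lemma mpow_cnj: "cnj_mat (mpow X m) = mpow (cnj_mat X) m"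
  by (induction m) (simp_all add: mpow_Suc cnj_mat_mult)

lemma mpow_cscale: "mpow (cscale_mat z X) m = cscale_mat (z ^ m) (mpow X m)"
proof (induction m)
  case 0
  show ?case by (simp add: cscale_mat_def map_matrix_def vec_eq_iff)
next
  case (Suc m)
  then show ?case
    by (simp add: mpow_Suc cscale_mat_def map_matrix_def matrix_matrix_mult_def vec_eq_iff sum_distrib_left mult_ac)
qed

text \<open>Each entry of a product is a sum of CARD('n) terms, whence \<open>K\<close>; the
  exponential series is then dominated by that of \<open>K\<close>.\<close>

lemma mpow_bound:
  fixes X :: "'n::finite cmat"
  assumes c: "\<And>i j. norm (X $ i $ j) \<le> c" and K: "K = real CARD('n) * c"
  shows "norm (mpow X m $ i $ j) \<le> K ^ m"
proof (induction m arbitrary: i j)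
  case 0
  show ?case by (simp add: mat_def)
next
  case (Suc m)
  have c0: "0 \<le> c" using c[of i j] norm_ge_zero order_trans by blast
  have "norm (mpow X (Suc m) $ i $ j) \<le> (\<Sum>k\<in>UNIV. norm (X $ i $ k) * norm (mpow X m $ k $ j))"
    unfolding mpow_Suc matrix_matrix_mult_def vec_lambda_beta by (rule order_trans[OF norm_sum]) (simp add: norm_mult)
  also have "\<dots> \<le> (\<Sum>k\<in>(UNIV :: 'n set). c * K ^ m)"
    using c Suc c0 by (intro sum_mono mult_mono) auto
  finally show ?case by (simp add: K mult.assoc)
qed

lemma ex_entry_bound: "\<exists>c. \<forall>i j. norm ((X :: 'n::finite cmat) $ i $ j) \<le> c"
  by (intro exI[of _ "norm X"] allI order_trans[OF Finite_Cartesian_Product.norm_nth_le Finite_Cartesian_Product.norm_nth_le])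

lemma mexp_term_summable: "summable (\<lambda>m. norm ((1 / fact m) *\<^sub>R mpow X m $ i $ j))"
proof -
  obtain c where c: "\<And>i j. norm (X $ i $ j) \<le> c" using ex_entry_bound by blast
  define K where "K = real CARD('a) * c"
  have "norm (norm ((1 / fact m) *\<^sub>R mpow X m $ i $ j)) \<le> inverse (fact m) * K ^ m" for m
    using mpow_bound[OF c K_def, of m i j] by (simp add: divide_inverse)
  then show ?thesis by (intro summable_comparison_test[OF _ summable_exp[of K]] exI[of _ 0] allI impI)
qed

lemma mexp_entry_sums: "(\<lambda>m. (1 / fact m) *\<^sub>R mpow X m $ i $ j) sums (mexp X $ i $ j)"
  and mexp_sums: "(\<lambda>m. (1 / fact m) *\<^sub>R mpow X m) sums mexp X"
proof -
  define E :: "'a cmat" where "E = (\<chi> i j. \<Sum>m. (1 / fact m) *\<^sub>R mpow X m $ i $ j)"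
  have e: "(\<lambda>m. (1 / fact m) *\<^sub>R mpow X m $ i $ j) sums (E $ i $ j)" for i j
    using summable_norm_cancel[OF mexp_term_summable[of X i j]] by (simp add: E_def summable_sums)
  have s: "(\<lambda>m. (1 / fact m) *\<^sub>R mpow X m) sums E"
    unfolding sums_def
    by (intro vec_tendstoI) (use e in \<open>simp add: sums_def\<close>)
  then have "mexp X = E" by (simp add: mexp_def mpow_def[symmetric] sums_unique[symmetric])
  then show "(\<lambda>m. (1 / fact m) *\<^sub>R mpow X m $ i $ j) sums (mexp X $ i $ j)"
    "(\<lambda>m. (1 / fact m) *\<^sub>R mpow X m) sums mexp X" using e s by simp_all
qed

lemma mexp_cnj: "cnj_mat (mexp X) = mexp (cnj_mat X)"
proof -
  have "(\<lambda>m. cnj ((1 / fact m) *\<^sub>R mpow X m $ i $ j)) sums cnj (mexp X $ i $ j)" for i j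
    unfolding sums_cnj by (rule mexp_entry_sums)
  moreover have "cnj ((1 / fact m) *\<^sub>R mpow X m $ i $ j) = (1 / fact m) *\<^sub>R mpow (cnj_mat X) m $ i $ j" for m i j
    unfolding mpow_cnj[symmetric] by (simp add: cnj_mat_def map_matrix_def)
  ultimately have "(\<lambda>m. (1 / fact m) *\<^sub>R mpow (cnj_mat X) m $ i $ j) sums cnj (mexp X $ i $ j)" for i j by simp
  then have "cnj (mexp X $ i $ j) = mexp (cnj_mat X) $ i $ j" for i j using mexp_entry_sums sums_unique2 by blast
  then show ?thesis by (simp add: cnj_mat_def map_matrix_def vec_eq_iff)
qed

lemma mexp_0 [simp]: "mexp (0 :: 'n::finite cmat) = mat 1"
proof -
  have "mpow (0 :: 'n cmat) m = (if m = 0 then mat 1 else 0)" for m by (cases m) (simp_all add: mpow_Suc)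
  then have "(1 / fact m) *\<^sub>R mpow (0 :: 'n cmat) m = (if m = 0 then mat 1 else 0)" for m by simp
  then have "(\<lambda>m. if m = 0 then mat 1 else 0) sums mexp (0 :: 'n cmat)" using mexp_sums[of "0 :: 'n cmat"] by simp
  then show ?thesis using sums_unique2[OF sums_single[of 0 "\<lambda>_. mat 1"]] by metis
qed

text \<open>In the Cauchy product the power of \<open>X\<close> of degree n gets the coefficient (1
  - 1)^n / n!, which vanishes for n > 0.\<close>

lemma mexp_inverse: "mexp X ** mexp (- X) = mat 1"
proof -
  let ?a = "\<lambda>i j m. (1 / fact m) *\<^sub>R mpow X m $ i $ j" and ?b = "\<lambda>i j m. (1 / fact m) *\<^sub>R mpow (- X) m $ i $ j"
  have "(mexp X ** mexp (- X)) $ i $ j = mat 1 $ i $ j" for i j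
  proof -
    have "(\<lambda>n. \<Sum>m\<le>n. ?a i k m * ?b k j (n - m)) sums (mexp X $ i $ k * mexp (- X) $ k $ j)" for k
      using Cauchy_product_sums[OF mexp_term_summable[of X i k] mexp_term_summable[of "- X" k j]]
      by (simp add: mexp_entry_sums[THEN sums_unique, symmetric])
    then have "(\<lambda>n. \<Sum>k\<in>UNIV. \<Sum>m\<le>n. ?a i k m * ?b k j (n - m)) sums (\<Sum>k\<in>UNIV. mexp X $ i $ k * mexp (- X) $ k $ j)"
      by (intro sums_sum) auto
    moreover have "(\<Sum>k\<in>UNIV. \<Sum>m\<le>n. ?a i k m * ?b k j (n - m)) = (if n = 0 then mat 1 $ i $ j else 0)" for n
    proof -
      have prod: "(\<Sum>k\<in>UNIV. mpow X m $ i $ k * mpow (- X) l $ k $ j) = of_real ((-1) ^ l) * mpow X (m + l) $ i $ j" for m l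
      proof -
        have "(\<Sum>k\<in>UNIV. mpow X m $ i $ k * mpow (- X) l $ k $ j) =
          (\<Sum>k\<in>UNIV. of_real ((-1) ^ l) * (mpow X m $ i $ k * mpow X l $ k $ j))"
          unfolding mpow_uminus vector_scaleR_component by (intro sum.cong refl) (simp add: scaleR_conv_of_real)
        also have "\<dots> = of_real ((-1) ^ l) * (mpow X m ** mpow X l) $ i $ j"
          by (simp add: matrix_matrix_mult_def sum_distrib_left)
        finally show ?thesis by (simp add: mpow_add)
      qed
      have "(\<Sum>k\<in>UNIV. \<Sum>m\<le>n. ?a i k m * ?b k j (n - m)) = (\<Sum>m\<le>n. \<Sum>k\<in>UNIV. ?a i k m * ?b k j (n - m))"
        by (rule sum.swap)
      also have "\<dots> = (\<Sum>m\<le>n. of_real (1 / (fact m * fact (n - m))) * (\<Sum>k\<in>UNIV. mpow X m $ i $ k * mpow (- X) (n - m) $ k $ j))"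
        by (simp add: sum_distrib_left scaleR_conv_of_real field_simps)
      also have "\<dots> = (\<Sum>m\<le>n. of_real (of_nat (n choose m) * (-1) ^ (n - m) / fact n) * mpow X n $ i $ j)"
        by (intro sum.cong refl) (simp add: prod binomial_fact)
      also have "\<dots> = of_real ((\<Sum>m\<le>n. of_nat (n choose m) * 1 ^ m * (-1) ^ (n - m)) / fact n) * mpow X n $ i $ j"
        by (simp add: sum_distrib_right sum_divide_distrib)
      also have "(\<Sum>m\<le>n. of_nat (n choose m) * 1 ^ m * (-1) ^ (n - m)) = (1 + (-1 :: real)) ^ n"
        by (rule binomial_ring[symmetric])
      finally show ?thesis by simp
    qed
    ultimately have "(\<lambda>n. if n = 0 then mat 1 $ i $ j else 0) sums (\<Sum>k\<in>UNIV. mexp X $ i $ k * mexp (- X) $ k $ j)" by simp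
    then have "(\<Sum>k\<in>UNIV. mexp X $ i $ k * mexp (- X) $ k $ j) = mat 1 $ i $ j"
      using sums_single[of 0 "\<lambda>_. mat 1 $ i $ j"] by (rule sums_unique2)
    then show ?thesis by (simp add: matrix_matrix_mult_def)
  qed
  then show ?thesis by (simp add: vec_eq_iff)
qed

lemma mexp_inverse': "mexp (- X) ** mexp X = mat 1"
  using mexp_inverse[of "- X"] by simp

lemma mexp_invertible: "invertible (mexp X)"
  unfolding invertible_def using mexp_inverse mexp_inverse' by blast

text \<open>Along a complex line the entries are power series in z whose linear coefficients are the
  entries of \<open>X\<close>.\<close>

lemma mexp_deriv_0: "((\<lambda>z. mexp (cscale_mat z X) $ i $ j) has_field_derivative (X $ i $ j)) (at 0)"
proof -
  let ?c = "\<lambda>m. (1 / fact m) *\<^sub>R mpow X m $ i $ j"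
  have s: "(\<lambda>m. ?c m * z ^ m) sums (mexp (cscale_mat z X) $ i $ j)" for z
    using mexp_entry_sums[of "cscale_mat z X" i j]
    by (simp add: mpow_cscale) (simp add: cscale_mat_def map_matrix_def mult_ac)
  then have eq: "(\<lambda>z. mexp (cscale_mat z X) $ i $ j) = (\<lambda>z. \<Sum>m. ?c m * z ^ m)" by (auto simp: sums_iff)
  have "((\<lambda>z. \<Sum>m. ?c m * z ^ m) has_field_derivative (\<Sum>m. diffs ?c m * 0 ^ m)) (at 0)"
    by (rule termdiffs_strong[where K = 1]) (use s[of 1] in \<open>auto simp: sums_iff\<close>)
  also have "(\<Sum>m. diffs ?c m * 0 ^ m) = X $ i $ j"
    using powser_zero[of "diffs ?c"] by (simp add: diffs_def mpow_Suc)
  finally show ?thesis unfolding eq .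
qed

lemma mexp_real_deriv_0: "((\<lambda>t. mexp (t *\<^sub>R X) $ i $ j) has_vector_derivative (X $ i $ j)) (at 0)"
proof -
  have "((\<lambda>t. mexp (cscale_mat (of_real t) X) $ i $ j) has_vector_derivative (X $ i $ j)) (at 0)"
    by (rule has_vector_derivative_real_field) (simp add: mexp_deriv_0)
  then show ?thesis by (simp add: cscale_mat_of_real)
qed

lemma of_real_scale: "of_real r *s x = r *\<^sub>R (x :: 'n::finite cvec)"
  by (simp add: vec_eq_iff) (simp add: scaleR_conv_of_real)

lemma uminus_mat_vec: "(- A) *v x = - (A *v (x :: 'n::finite cvec))"
  by (simp add: matrix_vector_mult_def vec_eq_iff sum_negf)

lemma scaleR_mat_vec: "(r *\<^sub>R A) *v x = r *\<^sub>R (A *v (x :: 'n::finite cvec))"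
  by (simp add: matrix_vector_mult_def vec_eq_iff scaleR_sum_right)

lemma mat_vec_scaleR: "A *v (r *\<^sub>R x) = r *\<^sub>R (A *v (x :: 'n::finite cvec))"
  by (simp add: matrix_vector_mult_def vec_eq_iff scaleR_sum_right)

lemma mat_vec_bounded_linear: "bounded_linear (\<lambda>x :: 'n::finite cvec. A *v x)"
  by (intro linear_conv_bounded_linear[THEN iffD1] linearI)
    (simp_all add: matrix_vector_right_distrib mat_vec_scaleR)

lemma mexp_vec_sums:
  fixes X :: "'n::finite cmat"
  shows "(\<lambda>m. (1 / fact m) *\<^sub>R (mpow X m *v a)) sums (mexp X *v a)"
proof -
  have "bounded_linear (\<lambda>M :: 'n cmat. M *v a)"
    by (intro linear_conv_bounded_linear[THEN iffD1] linearI)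
      (simp_all add: matrix_vector_mult_add_rdistrib scaleR_mat_vec)
  from bounded_linear.sums[OF this mexp_sums[of X]] show ?thesis
    by (simp add: scaleR_mat_vec)
qed

context polarized_mhs begin

definition PW :: "int \<Rightarrow> 'n cmat" where "PW k = (\<Sum>\<alpha>\<in>{\<alpha>\<in>box. wt \<alpha> \<le> k}. pr \<alpha>)"

lemma PW_in: "PW k *v x \<in> Wc k"
proof -
  have "pr \<alpha> *v x \<in> Wc k" if "wt \<alpha> \<le> k" for \<alpha> using pr_wt[of \<alpha> x] Wc_mono[OF that] by blast
  then show ?thesis unfolding PW_def matrix_vector_mult_sum_left by (intro vec.subspace_sum[OF Wc_subspace]) auto
qed

lemma PW_id: "x \<in> Wc k \<Longrightarrow> PW k *v x = x"
proof -
  assume x: "x \<in> Wc k"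
  have "(\<Sum>\<alpha>\<in>{\<alpha>\<in>box. wt \<alpha> \<le> k}. pr \<alpha> *v x) = x"
  proof (rule sum_pr_vec_subset)
    fix \<alpha> assume "\<alpha> \<notin> {\<alpha>\<in>box. wt \<alpha> \<le> k}"
    then consider "\<alpha> \<notin> box" | "k < wt \<alpha>" by fastforce
    then show "pr \<alpha> *v x = 0"
    proof cases
      case 2 then show ?thesis using x unfolding Wc_iff wt_def by (cases \<alpha>) auto
    qed (simp add: pr_outside)
  qed simp
  then show ?thesis by (simp add: PW_def matrix_vector_mult_sum_left)
qed

text \<open>Composition with \<open>PW k\<close> extends the form from \<open>Wc k\<close> to a
  bilinear form on the whole space, so that it is continuous and can be exchanged with series and
  derivatives.\<close>

definition formP :: "int \<Rightarrow> 'n cvec \<Rightarrow> 'n cvec \<Rightarrow> complex" where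
  "formP k a b = form_C Q k (PW k *v a) (PW k *v b)"

lemma formP_eq: "a \<in> Wc k \<Longrightarrow> b \<in> Wc k \<Longrightarrow> formP k a b = form_C Q k a b"
  by (simp add: formP_def PW_id)

lemma formP_lin:
  "formP k (x + y) z = formP k x z + formP k y z" "formP k (c *s x) z = c * formP k x z"
  "formP k z (x + y) = formP k z x + formP k z y" "formP k z (c *s x) = c * formP k z x"
  by (simp_all add: formP_def matrix_vector_right_distrib vector_scalar_commute form_C_lin1[OF PW_in PW_in PW_in]
      form_C_lin2[OF PW_in PW_in PW_in])

lemma formP_0 [simp]: "formP k 0 x = 0" "formP k x 0 = 0"
  using formP_lin(2)[of k 0 0 x] formP_lin(4)[of k x 0 0] by simp_all

lemma formP_sum: "formP k (\<Sum>i\<in>S. f i) x = (\<Sum>i\<in>S. formP k (f i) x)" "formP k x (\<Sum>i\<in>S. f i) = (\<Sum>i\<in>S. formP k x (f i))"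
  by (induction S rule: infinite_finite_induct) (auto simp: formP_lin)

lemma formP_expand: "formP k a b = (\<Sum>i\<in>UNIV. \<Sum>j\<in>UNIV. a $ i * b $ j * formP k (axis i 1) (axis j 1))"
proof -
  have "formP k a b = formP k (\<Sum>i\<in>UNIV. (a $ i) *s axis i 1) (\<Sum>j\<in>UNIV. (b $ j) *s axis j 1)"
    by (simp add: basis_expansion)
  also have "\<dots> = (\<Sum>j\<in>UNIV. \<Sum>i\<in>UNIV. a $ i * b $ j * formP k (axis i 1) (axis j 1))"
    unfolding formP_sum by (simp add: formP_lin mult_ac)
  finally show ?thesis by (subst sum.swap) simp
qed

lemma formP_bounded_linear: "bounded_linear (\<lambda>a. formP k a b)" "bounded_linear (\<lambda>b. formP k a b)"
proof -
  have "formP k (r *\<^sub>R x) b = r *\<^sub>R formP k x b" "formP k a (r *\<^sub>R x) = r *\<^sub>R formP k a x" for r x a b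
    using formP_lin(2)[of k "of_real r" x b] formP_lin(4)[of k a "of_real r" x]
    by (simp_all add: of_real_scale) (simp_all add: scaleR_conv_of_real)
  then show "bounded_linear (\<lambda>a. formP k a b)" "bounded_linear (\<lambda>b. formP k a b)"
    by (auto intro!: linear_conv_bounded_linear[THEN iffD1] linearI simp: formP_lin)
qed

lemma mpow_vec_Suc: "mpow X (Suc m) *v a = mpow X m *v (X *v a)"
  using mpow_add[of X m 1] by (simp add: mpow_Suc matrix_vector_mul_assoc)

lemma lie_mpow_Wc: "lie X \<Longrightarrow> x \<in> Wc k \<Longrightarrow> mpow X m *v x \<in> Wc k"
  by (induction m arbitrary: x) (simp_all add: mpow_vec_Suc lie_Wc)

lemma lie_mpow_form:
  "lie X \<Longrightarrow> x \<in> Wc k \<Longrightarrow> y \<in> Wc k \<Longrightarrow> form_C Q k (mpow X m *v x) y = form_C Q k x (mpow (- X) m *v y)"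
proof (induction m arbitrary: x y)
  case (Suc m)
  have "form_C Q k (mpow X (Suc m) *v x) y = form_C Q k (X *v x) (mpow (- X) m *v y)"
    using Suc by (simp add: mpow_vec_Suc lie_Wc)
  also have "\<dots> = form_C Q k x (- X *v (mpow (- X) m *v y))"
    using Suc lie_mpow_Wc[OF lie_minus, of X y k m] lie_form[of "- X" "mpow (- X) m *v y" k x] lie_minus[of X]
      lie_form[OF Suc(2), of x k "mpow (- X) m *v y"] form_C_lin2(2)[of "X *v (mpow (- X) m *v y)" k x x "-1"] lie_Wc[OF Suc(2)]
    by (simp add: vector_scalar_commute uminus_mat_vec)
  finally show ?case by (simp add: mpow_Suc matrix_vector_mul_assoc)
qed simp

lemma mexp_Wc:
  assumes "lie X" "x \<in> Wc k"
  shows "mexp X *v x \<in> Wc k"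
  unfolding Wc_iff
proof (intro allI impI)
  fix \<alpha> assume k: "k < fst \<alpha> + snd \<alpha>"
  have "pr \<alpha> *v ((1 / fact m) *\<^sub>R (mpow X m *v x)) = 0" for m
    using lie_mpow_Wc[OF assms, of m] k unfolding Wc_iff by (cases \<alpha>) (simp add: mat_vec_scaleR)
  moreover have "bounded_linear (\<lambda>x. pr \<alpha> *v x)" by (rule mat_vec_bounded_linear)
  from bounded_linear.sums[OF this mexp_vec_sums[of X x]]
  have "(\<lambda>m. pr \<alpha> *v ((1 / fact m) *\<^sub>R (mpow X m *v x))) sums (pr \<alpha> *v (mexp X *v x))" .
  ultimately show "pr \<alpha> *v (mexp X *v x) = 0" using sums_unique2[OF _ sums_zero] by simp
qed

text \<open>Each factor \<open>X\<close> moves to the other argument with a sign, so term by term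
  the exponential of \<open>X\<close> becomes that of \<open>- X\<close>, its inverse.\<close>

lemma mexp_form:
  assumes X: "lie X" and W: "x \<in> Wc k" "y \<in> Wc k"
  shows "form_C Q k (mexp X *v x) (mexp X *v y) = form_C Q k x y"
proof -
  have "form_C Q k (mexp X *v a) b = form_C Q k a (mexp (- X) *v b)" if ab: "a \<in> Wc k" "b \<in> Wc k" for a b
  proof -
    have "(\<lambda>m. formP k ((1 / fact m) *\<^sub>R (mpow X m *v a)) b) sums formP k (mexp X *v a) b"
      using bounded_linear.sums[OF formP_bounded_linear(1) mexp_vec_sums] .
    moreover have "(\<lambda>m. formP k a ((1 / fact m) *\<^sub>R (mpow (- X) m *v b))) sums formP k a (mexp (- X) *v b)"
      using bounded_linear.sums[OF formP_bounded_linear(2) mexp_vec_sums] .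
    moreover have "formP k ((1 / fact m) *\<^sub>R (mpow X m *v a)) b = formP k a ((1 / fact m) *\<^sub>R (mpow (- X) m *v b))" for m
      using lie_mpow_form[OF X ab, of m] lie_mpow_Wc[OF X ab(1), of m] lie_mpow_Wc[OF lie_minus[OF X] ab(2), of m] ab
      by (simp add: of_real_scale[symmetric] formP_lin formP_eq del: of_real_divide)
    ultimately have "formP k (mexp X *v a) b = formP k a (mexp (- X) *v b)" using sums_unique2 by simp
    then show ?thesis using ab mexp_Wc[OF X ab(1)] mexp_Wc[OF lie_minus[OF X] ab(2)] by (simp add: formP_eq)
  qed
  from this[OF W(1) mexp_Wc[OF X W(2)]] show ?thesis by (simp add: matrix_vector_mul_assoc mexp_inverse')
qed

lemma lie_mexp_group:
  assumes X: "lie X"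
  shows "mexp X \<in> group_C W Q"
proof -
  have "(\<lambda>v. mexp X *v v) ` Wc k = Wc k" for k
  proof
    show "(\<lambda>v. mexp X *v v) ` Wc k \<subseteq> Wc k" using mexp_Wc[OF X] by auto
    show "Wc k \<subseteq> (\<lambda>v. mexp X *v v) ` Wc k"
    proof
      fix x assume "x \<in> Wc k"
      then have "mexp (- X) *v x \<in> Wc k" by (rule mexp_Wc[OF lie_minus[OF X]])
      moreover have "x = mexp X *v (mexp (- X) *v x)" by (simp add: matrix_vector_mul_assoc mexp_inverse)
      ultimately show "x \<in> (\<lambda>v. mexp X *v v) ` Wc k" by blast
    qed
  qed
  then show ?thesis by (simp add: group_C_def mexp_invertible mexp_form[OF X])
qed

lemma mexp_vec_entry_deriv:
  "((\<lambda>t. (mexp (t *\<^sub>R X) *v x) $ i) has_vector_derivative (X *v x) $ i) (at 0)"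
proof -
  have "((\<lambda>t. \<Sum>j\<in>UNIV. mexp (t *\<^sub>R X) $ i $ j * x $ j) has_vector_derivative (\<Sum>j\<in>UNIV. X $ i $ j * x $ j)) (at 0)"
    by (intro has_vector_derivative_sum has_vector_derivative_mult_left mexp_real_deriv_0)
  then show ?thesis by (simp add: matrix_vector_mult_def)
qed

text \<open>Both conditions come from differentiating, at t = 0, functions that are constant in t:
  the components of weight above \<open>k\<close>, which vanish, and the values of the form.\<close>

lemma group_lie:
  assumes G: "\<And>t. mexp (t *\<^sub>R X) \<in> group_C W Q"
  shows "lie X"
proof (rule lieI)
  have GW: "mexp (t *\<^sub>R X) *v x \<in> Wc k" if "x \<in> Wc k" for t x k
    using G[of t] that by (auto simp: group_C_def)
  have Gf: "form_C Q k (mexp (t *\<^sub>R X) *v x) (mexp (t *\<^sub>R X) *v y) = form_C Q k x y" if "x \<in> Wc k" "y \<in> Wc k" for t x y k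
    using G[of t] that by (auto simp: group_C_def)
  show XW: "X *v x \<in> Wc k" if x: "x \<in> Wc k" for x k
    unfolding Wc_iff
  proof (intro allI impI)
    fix \<alpha> assume k: "k < fst \<alpha> + snd \<alpha>"
    have zero: "pr \<alpha> *v (mexp (t *\<^sub>R X) *v x) = 0" for t
      using GW[OF x, of t] k unfolding Wc_iff by blast
    have "(pr \<alpha> *v (X *v x)) $ i = 0" for i
    proof -
      have "((\<lambda>t. \<Sum>j\<in>UNIV. pr \<alpha> $ i $ j * (mexp (t *\<^sub>R X) *v x) $ j) has_vector_derivative
          (\<Sum>j\<in>UNIV. pr \<alpha> $ i $ j * (X *v x) $ j)) (at 0)"
        by (intro has_vector_derivative_sum has_vector_derivative_mult_right mexp_vec_entry_deriv)
      moreover have "(\<Sum>j\<in>UNIV. pr \<alpha> $ i $ j * (mexp (t *\<^sub>R X) *v x) $ j) = 0" for t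
        using arg_cong[OF zero[of t], of "\<lambda>v. v $ i"] by (simp add: matrix_vector_mult_def)
      ultimately have "((\<lambda>t. 0) has_vector_derivative (\<Sum>j\<in>UNIV. pr \<alpha> $ i $ j * (X *v x) $ j)) (at 0)" by simp
      then have "(\<Sum>j\<in>UNIV. pr \<alpha> $ i $ j * (X *v x) $ j) = 0"
        using has_vector_derivative_const by (rule vector_derivative_unique_at)
      then show ?thesis by (simp add: matrix_vector_mult_def)
    qed
    then show "pr \<alpha> *v (X *v x) = 0" by (simp add: vec_eq_iff)
  qed
  fix k x y assume W: "x \<in> Wc k" "y \<in> Wc k"
  let ?g = "\<lambda>t. mexp (t *\<^sub>R X)"
  have "((\<lambda>t. \<Sum>i\<in>UNIV. \<Sum>j\<in>UNIV. (?g t *v x) $ i * (?g t *v y) $ j * formP k (axis i 1) (axis j 1))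
    has_vector_derivative (\<Sum>i\<in>UNIV. \<Sum>j\<in>UNIV. ((?g 0 *v x) $ i * (X *v y) $ j + (X *v x) $ i * (?g 0 *v y) $ j) * formP k (axis i 1) (axis j 1))) (at 0)"
    by (intro has_vector_derivative_sum has_vector_derivative_mult_left has_vector_derivative_mult mexp_vec_entry_deriv)
  moreover have "(\<Sum>i\<in>UNIV. \<Sum>j\<in>UNIV. (?g t *v x) $ i * (?g t *v y) $ j * formP k (axis i 1) (axis j 1)) = form_C Q k x y" for t
    unfolding formP_expand[symmetric] using Gf[OF W] GW W by (simp add: formP_eq)
  ultimately have "((\<lambda>t. form_C Q k x y) has_vector_derivative
    (\<Sum>i\<in>UNIV. \<Sum>j\<in>UNIV. ((?g 0 *v x) $ i * (X *v y) $ j + (X *v x) $ i * (?g 0 *v y) $ j) * formP k (axis i 1) (axis j 1))) (at 0)" by simp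
  then have "(\<Sum>i\<in>UNIV. \<Sum>j\<in>UNIV. ((?g 0 *v x) $ i * (X *v y) $ j + (X *v x) $ i * (?g 0 *v y) $ j) * formP k (axis i 1) (axis j 1)) = 0"
    using has_vector_derivative_const by (rule vector_derivative_unique_at)
  then have "formP k x (X *v y) + formP k (X *v x) y = 0"
    by (simp add: formP_expand[of k x] formP_expand[of k "X *v x"] distrib_right sum.distrib)
  then show "form_C Q k (X *v x) y = - form_C Q k x (X *v y)"
    using W XW by (simp add: formP_eq eq_neg_iff_add_eq_0 add.commute)
qed

lemma lie_C_eq: "lie_C W Q = {X. lie X}"
proof (rule set_eqI)
  fix X
  have "X \<in> lie_C W Q \<Longrightarrow> lie X" unfolding lie_C_def by (rule group_lie) blast
  moreover have "lie X \<Longrightarrow> X \<in> lie_C W Q" unfolding lie_C_def using lie_mexp_group[OF lie_scaleR] by blast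
  ultimately show "X \<in> lie_C W Q \<longleftrightarrow> X \<in> {X. lie X}" by blast
qed

end

section \<open>Components of the Lie algebra\<close>

context polarized_mhs begin

lemma lie_bigraded_iff: "X \<in> lie_bigraded W Q F r s \<longleftrightarrow> lie X \<and> btype {(r, s)} X"
proof -
  have "(\<forall>p q. \<forall>v\<in>I0 p q. X *v v \<in> I0 (p + r) (q + s)) \<longleftrightarrow> btype {(r, s)} X"
  proof
    assume *: "\<forall>p q. \<forall>v\<in>I0 p q. X *v v \<in> I0 (p + r) (q + s)"
    show "btype {(r, s)} X"
      unfolding btype_def
    proof (intro allI impI block_zeroI)
      fix \<alpha> \<beta> :: "int \<times> int" and v assume "\<beta> - \<alpha> \<notin> {(r, s)}"
      then have ne: "\<beta> \<noteq> (fst \<alpha> + r, snd \<alpha> + s)" by (auto simp: minus_prod_def)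
      have "X *v (pr \<alpha> *v v) \<in> I0 (fst \<alpha> + r) (snd \<alpha> + s)"
        using * pr_I0[of "fst \<alpha>" "snd \<alpha>" v] by simp
      then show "pr \<beta> *v (X *v (pr \<alpha> *v v)) = 0" using ne I0_pr by simp
    qed
  next
    assume X: "btype {(r, s)} X"
    show "\<forall>p q. \<forall>v\<in>I0 p q. X *v v \<in> I0 (p + r) (q + s)"
    proof (intro allI ballI)
      fix p q v assume v: "v \<in> I0 p q"
      have 0: "pr \<beta> *v (X *v v) = 0" if "\<beta> \<noteq> (p + r, q + s)" for \<beta>
      proof -
        have "pr \<beta> ** X ** pr (p, q) = 0" using that by (intro btypeD[OF X]) (auto simp: minus_prod_def)
        then have "pr \<beta> *v (X *v (pr (p, q) *v v)) = 0" by (simp add: matrix_vector_mul_assoc matrix_mul_assoc)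
        then show ?thesis using v by (simp add: I0_def)
      qed
      show "X *v v \<in> I0 (p + r) (q + s)"
        unfolding I0_def mem_Collect_eq
      proof (rule eq_if_pr)
        fix \<beta> show "pr \<beta> *v (pr (p + r, q + s) *v (X *v v)) = pr \<beta> *v (X *v v)"
          by (cases "\<beta> = (p + r, q + s)") (simp_all add: pr_orthogonal_vec 0)
      qed
    qed
  qed
  then show ?thesis by (simp add: lie_bigraded_def lie_C_eq deligne_eq)
qed

text \<open>Only finitely many shifts occur between members of \<open>box\<close>, and each
  homogeneous part of an element of the Lie algebra is again in it. From here on the subspaces of
  the Lie algebra are conditions on blocks.\<close>

lemma lie_part_iff: "X \<in> lie_part W Q F S \<longleftrightarrow> lie X \<and> btype S X"
proof
  let ?T = "{X. lie X \<and> btype S X}"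
  have "span (\<Union>(r, s)\<in>S. lie_bigraded W Q F r s) \<subseteq> ?T"
  proof (rule span_minimal)
    show "(\<Union>(r, s)\<in>S. lie_bigraded W Q F r s) \<subseteq> ?T"
      by (auto simp: lie_bigraded_iff intro: btype_mono)
    show "subspace ?T" by (simp add: subspace_def lie_0 lie_add lie_scaleR btype_0 btype_add btype_scaleR)
  qed
  then show "X \<in> lie_part W Q F S \<Longrightarrow> lie X \<and> btype S X" by (auto simp: lie_part_def)
next
  assume X: "lie X \<and> btype S X"
  define D where "D = (\<lambda>(\<alpha>, \<beta>). \<beta> - \<alpha>) ` (box \<times> box)"
  have D: "finite D" by (simp add: D_def)
  have "X = (\<Sum>d\<in>D. part {d} X)"
  proof (rule eq_if_blocks)
    fix \<alpha> \<beta>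
    have "pr \<beta> ** (\<Sum>d\<in>D. part {d} X) ** pr \<alpha> = (\<Sum>d\<in>D. if d = \<beta> - \<alpha> then pr \<beta> ** X ** pr \<alpha> else 0)"
      unfolding matrix_mult_sum_left matrix_mult_sum_right by (intro sum.cong refl) (simp add: block_part)
    also have "\<dots> = (if \<beta> - \<alpha> \<in> D then pr \<beta> ** X ** pr \<alpha> else 0)" using D by (simp add: sum.delta)
    also have "\<dots> = pr \<beta> ** X ** pr \<alpha>"
    proof (cases "\<alpha> \<in> box \<and> \<beta> \<in> box")
      case True
      then show ?thesis by (force simp: D_def)
    next
      case False
      then have "pr \<alpha> = 0 \<or> pr \<beta> = 0" using pr_outside by blast
      then show ?thesis by auto
    qed
    finally show "pr \<beta> ** X ** pr \<alpha> = pr \<beta> ** (\<Sum>d\<in>D. part {d} X) ** pr \<alpha>" by simp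
  qed
  moreover have "part {d} X \<in> span (\<Union>(r, s)\<in>S. lie_bigraded W Q F r s)" for d
  proof (cases "d \<in> S")
    case True
    have "part {d} X \<in> lie_bigraded W Q F (fst d) (snd d)"
      using X lie_part_lie btype_part[of "{d}" X] by (simp add: lie_bigraded_iff)
    then show ?thesis using True by (intro span_base) force
  next
    case False
    then have "part {d} X = 0" using X part_disjoint[of S X "{d}"] by auto
    then show ?thesis by (simp add: span_zero)
  qed
  ultimately show "X \<in> lie_part W Q F S"
    unfolding lie_part_def by (metis (no_types, lifting) span_sum)
qed

definition Np :: "(int \<times> int) set" where "Np = {(a, b). a \<ge> 0 \<and> b < 0}"

lemma lie_decomposition_unique:
  assumes "X = a + b + c + d" "btype Np a" "btype {(0, 0)} b" "btype {(a, b). a < 0 \<and> b \<ge> 0} c" "btype {(r, s). r < 0 \<and> s < 0} d"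
  shows "part Np X = a" "part {(0, 0)} X = b"
proof -
  have "part Np b = 0" "part Np c = 0" "part Np d = 0"
    by (rule part_disjoint[OF assms(3)] part_disjoint[OF assms(4)] part_disjoint[OF assms(5)]; auto simp: Np_def)+
  then show "part Np X = a" unfolding assms(1) part_add part_btype[OF assms(2)] by simp
  have "part {(0, 0)} a = 0" "part {(0, 0)} c = 0" "part {(0, 0)} d = 0"
    by (rule part_disjoint[OF assms(2)] part_disjoint[OF assms(4)] part_disjoint[OF assms(5)]; auto simp: Np_def)+
  then show "part {(0, 0)} X = b" unfolding assms(1) part_add part_btype[OF assms(3)] by simp
qed

text \<open>The four sets of shifts cover the half plane r + s \<le> 0, and preservation of W
  excludes all other shifts.\<close>

lemma lie_decomposition_exists:
  assumes "lie X"
  shows "X = part Np X + part {(0, 0)} X + part {(a, b). a < 0 \<and> b \<ge> 0} X + part {(r, s). r < 0 \<and> s < 0} X"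
proof (rule eq_if_blocks)
  fix \<alpha> \<beta> :: "int \<times> int"
  obtain r s where rs: "\<beta> - \<alpha> = (r, s)" by (metis surj_pair)
  have "pr \<beta> ** X ** pr \<alpha> = 0" if "r + s > 0" using btypeD[OF lie_btype[OF assms], of \<beta> \<alpha>] rs that by auto
  then show "pr \<beta> ** X ** pr \<alpha> = pr \<beta> ** (part Np X + part {(0, 0)} X + part {(a, b). a < 0 \<and> b \<ge> 0} X + part {(r, s). r < 0 \<and> s < 0} X) ** pr \<alpha>"
    unfolding matrix_add_ldistrib matrix_add_rdistrib block_part rs by (auto simp: Np_def)
qed

lemma plus_part_eq: "lie X \<Longrightarrow> plus_part W Q F X = part Np X"
  and zero_part_eq: "lie X \<Longrightarrow> zero_part W Q F X = part {(0, 0)} X"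
proof -
  assume X: "lie X"
  note L = lie_n_plus_def lie_n_minus_def lie_Lambda_def lie_part_iff lie_bigraded_iff
  note ex = lie_decomposition_exists[OF X]
  have Np: "btype {(a, b). 0 \<le> a \<and> b < 0} (part Np X)" using btype_part[of Np X] unfolding Np_def .
  show "plus_part W Q F X = part Np X"
    unfolding plus_part_def L
  proof (rule the_equality)
    show "(lie (part Np X) \<and> btype {(a, b). 0 \<le> a \<and> b < 0} (part Np X)) \<and>
      (\<exists>b\<in>lie_bigraded W Q F 0 0. \<exists>c\<in>lie_part W Q F {(a, b). a < 0 \<and> 0 \<le> b}.
         \<exists>d\<in>lie_part W Q F {(r, s). r < 0 \<and> s < 0}. X = part Np X + b + c + d)"
      using ex X btype_part[of Np X] unfolding Np_def[symmetric]
      by (intro conjI bexI[of _ "part {(0, 0)} X"] bexI[of _ "part {(a, b). a < 0 \<and> b \<ge> 0} X"]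
          bexI[of _ "part {(r, s). r < 0 \<and> s < 0} X"]) (simp_all add: L btype_part lie_part_lie)
  next
    fix a assume "(lie a \<and> btype {(a, b). 0 \<le> a \<and> b < 0} a) \<and>
      (\<exists>b\<in>lie_bigraded W Q F 0 0. \<exists>c\<in>lie_part W Q F {(a, b). a < 0 \<and> 0 \<le> b}.
         \<exists>d\<in>lie_part W Q F {(r, s). r < 0 \<and> s < 0}. X = a + b + c + d)"
    then show "a = part Np X" using lie_decomposition_unique(1) by (auto simp: L Np_def)
  qed
  show "zero_part W Q F X = part {(0, 0)} X"
    unfolding zero_part_def
  proof (rule the_equality)
    show "part {(0, 0)} X \<in> lie_bigraded W Q F 0 0 \<and>
      (\<exists>a\<in>lie_n_plus W Q F. \<exists>c\<in>lie_n_minus W Q F. \<exists>d\<in>lie_Lambda W Q F. X = a + part {(0, 0)} X + c + d)"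
      using X btype_part[of Np X]
      by (intro conjI, simp add: L btype_part lie_part_lie)
        (rule bexI[of _ "part Np X"], rule bexI[of _ "part {(a, b). a < 0 \<and> b \<ge> 0} X"],
          rule bexI[of _ "part {(r, s). r < 0 \<and> s < 0} X"], rule ex,
          simp_all add: L btype_part lie_part_lie Np[simplified])
  next
    fix b assume "b \<in> lie_bigraded W Q F 0 0 \<and>
      (\<exists>a\<in>lie_n_plus W Q F. \<exists>c\<in>lie_n_minus W Q F. \<exists>d\<in>lie_Lambda W Q F. X = a + b + c + d)"
    then show "b = part {(0, 0)} X" using lie_decomposition_unique(2) by (auto simp: L Np_def)
  qed
qed

end

section \<open>Wirtinger derivatives\<close>

text \<open>Unlike \<open>wirtinger\<close>, which differentiates along real lines, this is read off
  a total derivative, for which the usual rules hold; \<open>wirtinger_eq\<close> compares the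
  two.\<close>

definition wz :: "(complex \<Rightarrow> complex) \<Rightarrow> complex \<Rightarrow> complex" where
  "wz g a = (frechet_derivative g (at a) 1 - \<i> * frechet_derivative g (at a) \<i>) / 2"

definition wzb :: "(complex \<Rightarrow> complex) \<Rightarrow> complex \<Rightarrow> complex" where
  "wzb g a = (frechet_derivative g (at a) 1 + \<i> * frechet_derivative g (at a) \<i>) / 2"

text \<open>The coefficients in an expression of this shape are unique, so each rule below reduces
  to rewriting a derivative in this form.\<close>

lemma wz_wzb_eq:
  assumes "(g has_derivative (\<lambda>h. h * A + cnj h * B)) (at a)"
  shows "wz g a = A" "wzb g a = B"
proof -
  have "frechet_derivative g (at a) = (\<lambda>h. h * A + cnj h * B)" using frechet_derivative_at[OF assms] by simp
  then show "wz g a = A" "wzb g a = B" by (simp_all add: wz_def wzb_def algebra_simps)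
qed

lemma has_derivative_wirtinger:
  assumes "g differentiable (at a)"
  shows "(g has_derivative (\<lambda>h. h * wz g a + cnj h * wzb g a)) (at a)"
proof -
  let ?D = "frechet_derivative g (at a)"
  have D: "(g has_derivative ?D) (at a)" using assms frechet_derivative_works by blast
  then interpret bounded_linear ?D by (rule has_derivative_bounded_linear)
  have "?D h = h * wz g a + cnj h * wzb g a" for h
  proof -
    have "h = Re h *\<^sub>R 1 + Im h *\<^sub>R \<i>" by (simp add: complex_eq_iff)
    then have "?D h = ?D (Re h *\<^sub>R 1 + Im h *\<^sub>R \<i>)" by (rule arg_cong)
    also have "\<dots> = of_real (Re h) * ?D 1 + of_real (Im h) * ?D \<i>" by (simp only: add scaleR) (simp only: scaleR_conv_of_real)
    also have "\<dots> = h * wz g a + cnj h * wzb g a"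
      unfolding wz_def wzb_def by (subst (3 4) complex_eq[of h]) (simp add: field_simps complex_eq_iff)
    finally show ?thesis .
  qed
  then show ?thesis using D by (metis (no_types, lifting) ext)
qed

lemma wirtinger_const [simp]: "wz (\<lambda>_. c) a = 0" "wzb (\<lambda>_. c) a = 0"
  using wz_wzb_eq[of "\<lambda>_. c" 0 0 a] by simp_all

lemma wirtinger_add:
  assumes "g differentiable (at a)" "h differentiable (at a)"
  shows "wz (\<lambda>x. g x + h x) a = wz g a + wz h a" "wzb (\<lambda>x. g x + h x) a = wzb g a + wzb h a"
proof -
  have "((\<lambda>x. g x + h x) has_derivative (\<lambda>k. k * (wz g a + wz h a) + cnj k * (wzb g a + wzb h a))) (at a)"
    by (rule has_derivative_eq_rhs[OF has_derivative_add[OF has_derivative_wirtinger[OF assms(1)] has_derivative_wirtinger[OF assms(2)]]])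
      (simp add: fun_eq_iff algebra_simps)
  then show "wz (\<lambda>x. g x + h x) a = wz g a + wz h a" "wzb (\<lambda>x. g x + h x) a = wzb g a + wzb h a"
    by (rule wz_wzb_eq)+
qed

lemma wirtinger_mult:
  assumes "g differentiable (at a)" "h differentiable (at a)"
  shows "wz (\<lambda>x. g x * h x) a = wz g a * h a + g a * wz h a" "wzb (\<lambda>x. g x * h x) a = wzb g a * h a + g a * wzb h a"
proof -
  have "((\<lambda>x. g x * h x) has_derivative
      (\<lambda>k. k * (wz g a * h a + g a * wz h a) + cnj k * (wzb g a * h a + g a * wzb h a))) (at a)"
    by (rule has_derivative_eq_rhs[OF has_derivative_mult[OF has_derivative_wirtinger[OF assms(1)] has_derivative_wirtinger[OF assms(2)]]])
      (simp add: fun_eq_iff algebra_simps)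
  then show "wz (\<lambda>x. g x * h x) a = wz g a * h a + g a * wz h a" "wzb (\<lambda>x. g x * h x) a = wzb g a * h a + g a * wzb h a"
    by (rule wz_wzb_eq)+
qed

lemma differentiable_cnj:
  "(g :: complex \<Rightarrow> complex) differentiable (at a) \<Longrightarrow> (\<lambda>x. cnj (g x)) differentiable (at a)"
  using bounded_linear.has_derivative[OF bounded_linear_cnj] unfolding differentiable_def by blast

lemma wirtinger_cnj:
  assumes "g differentiable (at a)"
  shows "wz (\<lambda>x. cnj (g x)) a = cnj (wzb g a)" "wzb (\<lambda>x. cnj (g x)) a = cnj (wz g a)"
proof -
  have "((\<lambda>x. cnj (g x)) has_derivative (\<lambda>k. k * cnj (wzb g a) + cnj k * cnj (wz g a))) (at a)"
    by (rule has_derivative_eq_rhs[OF bounded_linear.has_derivative[OF bounded_linear_cnj has_derivative_wirtinger[OF assms]]])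
      (simp add: fun_eq_iff algebra_simps)
  then show "wz (\<lambda>x. cnj (g x)) a = cnj (wzb g a)" "wzb (\<lambda>x. cnj (g x)) a = cnj (wz g a)"
    by (rule wz_wzb_eq)+
qed

lemma wirtinger_inverse:
  assumes "g differentiable (at a)" "g a \<noteq> 0"
  shows "wz (\<lambda>x. inverse (g x)) a = - (inverse (g a) * wz g a * inverse (g a))"
    "wzb (\<lambda>x. inverse (g x)) a = - (inverse (g a) * wzb g a * inverse (g a))"
proof -
  have "((\<lambda>x. inverse (g x)) has_derivative
      (\<lambda>k. k * - (inverse (g a) * wz g a * inverse (g a)) + cnj k * - (inverse (g a) * wzb g a * inverse (g a)))) (at a)"
    by (rule has_derivative_eq_rhs[OF Deriv.has_derivative_inverse[OF assms(2) has_derivative_wirtinger[OF assms(1)]]])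
      (simp add: fun_eq_iff algebra_simps)
  then show "wz (\<lambda>x. inverse (g x)) a = - (inverse (g a) * wz g a * inverse (g a))"
    "wzb (\<lambda>x. inverse (g x)) a = - (inverse (g a) * wzb g a * inverse (g a))"
    by (rule wz_wzb_eq)+
qed

lemma has_derivative_eventually:
  assumes "(g has_derivative D) (at a)" "\<forall>\<^sub>F x in nhds a. g x = h x"
  shows "(h has_derivative D) (at a)"
proof -
  obtain S where "open S" "a \<in> S" "\<And>x. x \<in> S \<Longrightarrow> g x = h x" using assms(2) unfolding eventually_nhds by blast
  then show ?thesis using has_derivative_transform_within_open[OF assms(1)] by blast
qed

lemma differentiable_eventually:
  assumes "g differentiable (at a)" "\<forall>\<^sub>F x in nhds a. g x = h x"
  shows "h differentiable (at a)"
  using assms has_derivative_eventually unfolding differentiable_def by blast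

text \<open>\<open>frechet_derivative\<close> is a choice among the derivatives at a point, and
  functions that agree nearby have the same derivatives there.\<close>

lemma wirtinger_cong:
  assumes "\<forall>\<^sub>F x in nhds a. g x = h x"
  shows "wz g a = wz h a" "wzb g a = wzb h a"
proof -
  have "\<forall>\<^sub>F x in nhds a. h x = g x" using assms by (rule eventually_mono) simp
  then have "(g has_derivative D) (at a) \<longleftrightarrow> (h has_derivative D) (at a)" for D
    using has_derivative_eventually assms by blast
  then have "frechet_derivative g (at a) = frechet_derivative h (at a)" by (simp add: frechet_derivative_def)
  then show "wz g a = wz h a" "wzb g a = wzb h a" by (simp_all add: wz_def wzb_def)
qed

lemma wirtinger_holomorphic:
  assumes "(g has_field_derivative D) (at a)"
  shows "g differentiable (at a)" "wz g a = D" "wzb g a = 0"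
proof -
  have d: "(g has_derivative (\<lambda>h. h * D + cnj h * 0)) (at a)"
    using assms unfolding has_field_derivative_def by (rule has_derivative_eq_rhs) (simp add: fun_eq_iff)
  then show "g differentiable (at a)" by (auto simp: differentiable_def)
  show "wz g a = D" "wzb g a = 0" using wz_wzb_eq[OF d] by simp_all
qed

text \<open>A weak second order regularity at the origin for functions of two complex variables: exactly the
  derivatives that enter the curvature, first in \<open>z\<close> along \<open>z = 0\<close>, then in \<open>w\<close>, are required.\<close>

definition regular2 :: "(complex \<Rightarrow> complex \<Rightarrow> complex) \<Rightarrow> bool" where
  "regular2 f \<longleftrightarrow> (\<forall>\<^sub>F w in nhds 0. (\<lambda>z. f z w) differentiable (at 0)) \<and> f 0 differentiable (at 0) \<and>
     (\<lambda>w. wz (\<lambda>z. f z w) 0) differentiable (at 0) \<and> (\<lambda>w. wzb (\<lambda>z. f z w) 0) differentiable (at 0)"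

definition dz :: "(complex \<Rightarrow> complex \<Rightarrow> complex) \<Rightarrow> complex" where "dz f = wz (\<lambda>z. f z 0) 0"
definition dzb :: "(complex \<Rightarrow> complex \<Rightarrow> complex) \<Rightarrow> complex" where "dzb f = wzb (\<lambda>z. f z 0) 0"
definition dw :: "(complex \<Rightarrow> complex \<Rightarrow> complex) \<Rightarrow> complex" where "dw f = wz (f 0) 0"
definition dwb :: "(complex \<Rightarrow> complex \<Rightarrow> complex) \<Rightarrow> complex" where "dwb f = wzb (f 0) 0"
definition dzwb :: "(complex \<Rightarrow> complex \<Rightarrow> complex) \<Rightarrow> complex" where "dzwb f = wzb (\<lambda>w. wz (\<lambda>z. f z w) 0) 0"
definition dzbw :: "(complex \<Rightarrow> complex \<Rightarrow> complex) \<Rightarrow> complex" where "dzbw f = wz (\<lambda>w. wzb (\<lambda>z. f z w) 0) 0"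

lemmas d_defs = dz_def dzb_def dw_def dwb_def dzwb_def dzbw_def

lemma regular2D:
  assumes "regular2 f"
  shows "\<forall>\<^sub>F w in nhds 0. (\<lambda>z. f z w) differentiable (at 0)" "(\<lambda>z. f z 0) differentiable (at 0)"
    "f 0 differentiable (at 0)" "(\<lambda>w. wz (\<lambda>z. f z w) 0) differentiable (at 0)" "(\<lambda>w. wzb (\<lambda>z. f z w) 0) differentiable (at 0)"
  using assms eventually_nhds_x_imp_x[of _ "0 :: complex"] by (auto simp: regular2_def)

lemma regular2_const: "regular2 (\<lambda>z w. c)"
  by (simp add: regular2_def)

lemma d_const: "dz (\<lambda>z w. c) = 0" "dzb (\<lambda>z w. c) = 0" "dw (\<lambda>z w. c) = 0" "dwb (\<lambda>z w. c) = 0"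
  "dzwb (\<lambda>z w. c) = 0" "dzbw (\<lambda>z w. c) = 0"
  by (simp_all add: d_defs)

text \<open>The mixed derivatives require the first order rule for all w near 0; this is why
  regularity includes differentiability in z at every nearby w.\<close>

lemma regular2_add:
  assumes f: "regular2 f" and g: "regular2 g"
  shows "regular2 (\<lambda>z w. f z w + g z w)"
    and "dz (\<lambda>z w. f z w + g z w) = dz f + dz g" "dzb (\<lambda>z w. f z w + g z w) = dzb f + dzb g"
    "dw (\<lambda>z w. f z w + g z w) = dw f + dw g" "dwb (\<lambda>z w. f z w + g z w) = dwb f + dwb g"
    "dzwb (\<lambda>z w. f z w + g z w) = dzwb f + dzwb g" "dzbw (\<lambda>z w. f z w + g z w) = dzbw f + dzbw g"
proof -
  note F = regular2D[OF f] note G = regular2D[OF g]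
  have ev: "\<forall>\<^sub>F w in nhds 0. wz (\<lambda>z. f z w) 0 + wz (\<lambda>z. g z w) 0 = wz (\<lambda>z. f z w + g z w) 0"
    "\<forall>\<^sub>F w in nhds 0. wzb (\<lambda>z. f z w) 0 + wzb (\<lambda>z. g z w) 0 = wzb (\<lambda>z. f z w + g z w) 0"
    using F(1) G(1) by (eventually_elim, simp add: wirtinger_add)+
  show "regular2 (\<lambda>z w. f z w + g z w)"
    unfolding regular2_def
  proof (intro conjI)
    show "\<forall>\<^sub>F w in nhds 0. (\<lambda>z. f z w + g z w) differentiable (at 0)"
      using F(1) G(1) by eventually_elim (rule differentiable_add)
    show "(\<lambda>w. f 0 w + g 0 w) differentiable (at 0)" using F(3) G(3) by (rule differentiable_add)
    show "(\<lambda>w. wz (\<lambda>z. f z w + g z w) 0) differentiable (at 0)"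
      by (rule differentiable_eventually[OF differentiable_add[OF F(4) G(4)] ev(1)])
    show "(\<lambda>w. wzb (\<lambda>z. f z w + g z w) 0) differentiable (at 0)"
      by (rule differentiable_eventually[OF differentiable_add[OF F(5) G(5)] ev(2)])
  qed
  show "dz (\<lambda>z w. f z w + g z w) = dz f + dz g" "dzb (\<lambda>z w. f z w + g z w) = dzb f + dzb g"
    "dw (\<lambda>z w. f z w + g z w) = dw f + dw g" "dwb (\<lambda>z w. f z w + g z w) = dwb f + dwb g"
    using F G by (simp_all add: d_defs wirtinger_add)
  show "dzwb (\<lambda>z w. f z w + g z w) = dzwb f + dzwb g" "dzbw (\<lambda>z w. f z w + g z w) = dzbw f + dzbw g"
    using F G wirtinger_cong(2)[OF ev(1)] wirtinger_cong(1)[OF ev(2)] by (simp_all add: d_defs wirtinger_add)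
qed

lemma regular2_mult:
  assumes f: "regular2 f" and g: "regular2 g"
  shows "regular2 (\<lambda>z w. f z w * g z w)"
    and "dz (\<lambda>z w. f z w * g z w) = dz f * g 0 0 + f 0 0 * dz g"
    "dzb (\<lambda>z w. f z w * g z w) = dzb f * g 0 0 + f 0 0 * dzb g"
    "dw (\<lambda>z w. f z w * g z w) = dw f * g 0 0 + f 0 0 * dw g"
    "dwb (\<lambda>z w. f z w * g z w) = dwb f * g 0 0 + f 0 0 * dwb g"
    "dzwb (\<lambda>z w. f z w * g z w) = dzwb f * g 0 0 + dz f * dwb g + (dwb f * dz g + f 0 0 * dzwb g)"
    "dzbw (\<lambda>z w. f z w * g z w) = dzbw f * g 0 0 + dzb f * dw g + (dw f * dzb g + f 0 0 * dzbw g)"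
proof -
  note F = regular2D[OF f] note G = regular2D[OF g]
  have ev: "\<forall>\<^sub>F w in nhds 0. wz (\<lambda>z. f z w) 0 * g 0 w + f 0 w * wz (\<lambda>z. g z w) 0 = wz (\<lambda>z. f z w * g z w) 0"
    "\<forall>\<^sub>F w in nhds 0. wzb (\<lambda>z. f z w) 0 * g 0 w + f 0 w * wzb (\<lambda>z. g z w) 0 = wzb (\<lambda>z. f z w * g z w) 0"
    using F(1) G(1) by (eventually_elim, simp add: wirtinger_mult)+
  note D = differentiable_mult[OF F(4) G(3)] differentiable_mult[OF F(3) G(4)]
    differentiable_mult[OF F(5) G(3)] differentiable_mult[OF F(3) G(5)]
  show "regular2 (\<lambda>z w. f z w * g z w)"
    unfolding regular2_def
  proof (intro conjI)
    show "\<forall>\<^sub>F w in nhds 0. (\<lambda>z. f z w * g z w) differentiable (at 0)"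
      using F(1) G(1) by eventually_elim (rule differentiable_mult)
    show "(\<lambda>w. f 0 w * g 0 w) differentiable (at 0)" using F(3) G(3) by (rule differentiable_mult)
    show "(\<lambda>w. wz (\<lambda>z. f z w * g z w) 0) differentiable (at 0)"
      by (rule differentiable_eventually[OF differentiable_add[OF D(1,2)] ev(1)])
    show "(\<lambda>w. wzb (\<lambda>z. f z w * g z w) 0) differentiable (at 0)"
      by (rule differentiable_eventually[OF differentiable_add[OF D(3,4)] ev(2)])
  qed
  show "dz (\<lambda>z w. f z w * g z w) = dz f * g 0 0 + f 0 0 * dz g"
    "dzb (\<lambda>z w. f z w * g z w) = dzb f * g 0 0 + f 0 0 * dzb g"
    "dw (\<lambda>z w. f z w * g z w) = dw f * g 0 0 + f 0 0 * dw g"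
    "dwb (\<lambda>z w. f z w * g z w) = dwb f * g 0 0 + f 0 0 * dwb g"
    using F G by (simp_all add: d_defs wirtinger_mult)
  show "dzwb (\<lambda>z w. f z w * g z w) = dzwb f * g 0 0 + dz f * dwb g + (dwb f * dz g + f 0 0 * dzwb g)"
    using F G D wirtinger_cong(2)[OF ev(1)] by (simp add: d_defs wirtinger_add wirtinger_mult)
  show "dzbw (\<lambda>z w. f z w * g z w) = dzbw f * g 0 0 + dzb f * dw g + (dw f * dzb g + f 0 0 * dzbw g)"
    using F G D wirtinger_cong(1)[OF ev(2)] by (simp add: d_defs wirtinger_add wirtinger_mult)
qed

text \<open>Conjugation exchanges the two mixed derivatives, which is the reason for carrying both
  along.\<close>

lemma regular2_cnj:
  assumes f: "regular2 f"
  shows "regular2 (\<lambda>z w. cnj (f z w))"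
    and "dz (\<lambda>z w. cnj (f z w)) = cnj (dzb f)" "dzb (\<lambda>z w. cnj (f z w)) = cnj (dz f)"
    "dw (\<lambda>z w. cnj (f z w)) = cnj (dwb f)" "dwb (\<lambda>z w. cnj (f z w)) = cnj (dw f)"
    "dzwb (\<lambda>z w. cnj (f z w)) = cnj (dzbw f)" "dzbw (\<lambda>z w. cnj (f z w)) = cnj (dzwb f)"
proof -
  note F = regular2D[OF f]
  have ev: "\<forall>\<^sub>F w in nhds 0. cnj (wzb (\<lambda>z. f z w) 0) = wz (\<lambda>z. cnj (f z w)) 0"
    "\<forall>\<^sub>F w in nhds 0. cnj (wz (\<lambda>z. f z w) 0) = wzb (\<lambda>z. cnj (f z w)) 0"
    using F(1) by (eventually_elim, simp add: wirtinger_cnj)+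
  show "regular2 (\<lambda>z w. cnj (f z w))"
    unfolding regular2_def
  proof (intro conjI)
    show "\<forall>\<^sub>F w in nhds 0. (\<lambda>z. cnj (f z w)) differentiable (at 0)"
      using F(1) by eventually_elim (rule differentiable_cnj)
    show "(\<lambda>w. cnj (f 0 w)) differentiable (at 0)" using F(3) by (rule differentiable_cnj)
    show "(\<lambda>w. wz (\<lambda>z. cnj (f z w)) 0) differentiable (at 0)"
      by (rule differentiable_eventually[OF differentiable_cnj[OF F(5)] ev(1)])
    show "(\<lambda>w. wzb (\<lambda>z. cnj (f z w)) 0) differentiable (at 0)"
      by (rule differentiable_eventually[OF differentiable_cnj[OF F(4)] ev(2)])
  qed
  show "dz (\<lambda>z w. cnj (f z w)) = cnj (dzb f)" "dzb (\<lambda>z w. cnj (f z w)) = cnj (dz f)"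
    "dw (\<lambda>z w. cnj (f z w)) = cnj (dwb f)" "dwb (\<lambda>z w. cnj (f z w)) = cnj (dw f)"
    using F by (simp_all add: d_defs wirtinger_cnj)
  show "dzwb (\<lambda>z w. cnj (f z w)) = cnj (dzbw f)" "dzbw (\<lambda>z w. cnj (f z w)) = cnj (dzwb f)"
    using F wirtinger_cong(2)[OF ev(1)] wirtinger_cong(1)[OF ev(2)] by (simp_all add: d_defs wirtinger_cnj)
qed

text \<open>Regularity alone is recorded; derivatives of quantities built with inverses are found
  later from equations such as f M = L.\<close>

lemma regular2_inverse:
  assumes f: "regular2 f" and nz: "f 0 0 \<noteq> 0"
  shows "regular2 (\<lambda>z w. inverse (f z w))"
proof -
  note F = regular2D[OF f]
  have "isCont (f 0) 0" using F(3) differentiable_imp_continuous_within by blast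
  then obtain e where "e > 0" "\<forall>y. dist 0 y < e \<longrightarrow> f 0 y \<noteq> 0" using continuous_at_avoid nz by blast
  \<comment> \<open>The derivatives in z are all taken at z = 0, so nonvanishing along that line
    suffices.\<close>
  then have nzev: "\<forall>\<^sub>F w in nhds 0. f 0 w \<noteq> 0" by (auto simp: eventually_nhds_metric dist_commute)
  have ev: "\<forall>\<^sub>F w in nhds 0. - (inverse (f 0 w) * wz (\<lambda>z. f z w) 0 * inverse (f 0 w)) = wz (\<lambda>z. inverse (f z w)) 0"
    "\<forall>\<^sub>F w in nhds 0. - (inverse (f 0 w) * wzb (\<lambda>z. f z w) 0 * inverse (f 0 w)) = wzb (\<lambda>z. inverse (f z w)) 0"
    using F(1) nzev by (eventually_elim, simp add: wirtinger_inverse)+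
  have inv: "(\<lambda>w. inverse (f 0 w)) differentiable (at 0)" using F(3) nz by (rule differentiable_inverse)
  show ?thesis
    unfolding regular2_def
  proof (intro conjI)
    show "\<forall>\<^sub>F w in nhds 0. (\<lambda>z. inverse (f z w)) differentiable (at 0)"
      using F(1) nzev by eventually_elim (rule differentiable_inverse)
    show "(\<lambda>w. inverse (f 0 w)) differentiable (at 0)" by (rule inv)
    show "(\<lambda>w. wz (\<lambda>z. inverse (f z w)) 0) differentiable (at 0)"
      by (rule differentiable_eventually[OF _ ev(1)]) (intro differentiable_minus differentiable_mult inv F)
    show "(\<lambda>w. wzb (\<lambda>z. inverse (f z w)) 0) differentiable (at 0)"
      by (rule differentiable_eventually[OF _ ev(2)]) (intro differentiable_minus differentiable_mult inv F)
  qed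
qed

lemma regular2_cong:
  assumes "\<epsilon> > 0" and eq: "\<And>z w. norm z < \<epsilon> \<Longrightarrow> norm w < \<epsilon> \<Longrightarrow> f z w = g z w" and f: "regular2 f"
  shows "regular2 g" "dz g = dz f" "dzb g = dzb f" "dw g = dw f" "dwb g = dwb f" "dzwb g = dzwb f" "dzbw g = dzbw f"
proof -
  note F = regular2D[OF f]
  have small: "\<forall>\<^sub>F w in nhds 0. norm (w :: complex) < \<epsilon>"
    using assms(1) by (auto simp: eventually_nhds_metric dist_norm)
  have evz: "\<forall>\<^sub>F z in nhds 0. f z w = g z w" if "norm w < \<epsilon>" for w
    using small by eventually_elim (use eq that in auto)
  have evw: "\<forall>\<^sub>F w in nhds 0. f 0 w = g 0 w"
    using small by eventually_elim (use eq assms(1) in auto)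
  have ev: "\<forall>\<^sub>F w in nhds 0. wz (\<lambda>z. f z w) 0 = wz (\<lambda>z. g z w) 0" "\<forall>\<^sub>F w in nhds 0. wzb (\<lambda>z. f z w) 0 = wzb (\<lambda>z. g z w) 0"
    by (rule eventually_mono[OF small]; rule wirtinger_cong[OF evz]; assumption)+
  show "regular2 g"
    unfolding regular2_def
  proof (intro conjI)
    show "\<forall>\<^sub>F w in nhds 0. (\<lambda>z. g z w) differentiable (at 0)"
      using F(1) small by eventually_elim (rule differentiable_eventually[OF _ evz])
  qed (rule differentiable_eventually[OF F(3) evw] differentiable_eventually[OF F(4) ev(1)] differentiable_eventually[OF F(5) ev(2)])+
  show "dz g = dz f" "dzb g = dzb f" "dw g = dw f" "dwb g = dwb f" "dzwb g = dzwb f" "dzbw g = dzbw f"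
    unfolding d_defs
    using wirtinger_cong[OF evz[of 0]] wirtinger_cong[OF evw] wirtinger_cong[OF ev(1)] wirtinger_cong[OF ev(2)] assms(1)
    by simp_all
qed

lemma regular2_sum:
  assumes "\<And>i. i \<in> S \<Longrightarrow> regular2 (f i)"
  shows "regular2 (\<lambda>z w. \<Sum>i\<in>S. f i z w)"
    and "dz (\<lambda>z w. \<Sum>i\<in>S. f i z w) = (\<Sum>i\<in>S. dz (f i))" "dzb (\<lambda>z w. \<Sum>i\<in>S. f i z w) = (\<Sum>i\<in>S. dzb (f i))"
    "dw (\<lambda>z w. \<Sum>i\<in>S. f i z w) = (\<Sum>i\<in>S. dw (f i))" "dwb (\<lambda>z w. \<Sum>i\<in>S. f i z w) = (\<Sum>i\<in>S. dwb (f i))"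
    "dzwb (\<lambda>z w. \<Sum>i\<in>S. f i z w) = (\<Sum>i\<in>S. dzwb (f i))" "dzbw (\<lambda>z w. \<Sum>i\<in>S. f i z w) = (\<Sum>i\<in>S. dzbw (f i))"
  using assms
  by (induction S rule: infinite_finite_induct) (simp_all add: regular2_const d_const regular2_add)

lemma regular2_prod: "(\<And>i. i \<in> S \<Longrightarrow> regular2 (f i)) \<Longrightarrow> regular2 (\<lambda>z w. \<Prod>i\<in>S. f i z w)"
  by (induction S rule: infinite_finite_induct) (simp_all add: regular2_const regular2_mult)

section \<open>Holomorphic functions of two variables\<close>

definition holomorphic2 :: "real \<Rightarrow> (complex \<Rightarrow> complex \<Rightarrow> complex) \<Rightarrow> bool" where
  "holomorphic2 \<epsilon> f \<longleftrightarrow> continuous_on (ball 0 \<epsilon> \<times> ball 0 \<epsilon>) (\<lambda>(z, w). f z w) \<and>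
     (\<forall>w\<in>ball 0 \<epsilon>. (\<lambda>z. f z w) holomorphic_on ball 0 \<epsilon>) \<and> (\<forall>z\<in>ball 0 \<epsilon>. f z holomorphic_on ball 0 \<epsilon>)"

text \<open>The difference quotients in \<open>z\<close> converge uniformly in \<open>w\<close>, by the Cauchy estimate for the second
  derivative; hence the limit is holomorphic in \<open>w\<close>.\<close>

lemma holomorphic2_deriv:
  assumes "\<epsilon> > 0" and f: "holomorphic2 \<epsilon> f"
  shows "(\<lambda>w. deriv (\<lambda>z. f z w) 0) holomorphic_on ball 0 (\<epsilon> / 2)"
proof -
  \<comment> \<open>Circles of radius r about points of the closed disc of radius r stay in the
    closed disc of radius 2 r, hence inside the domain.\<close>
  define r where "r = \<epsilon> / 4"
  have r: "r > 0" "2 * r = \<epsilon> / 2" "2 * r < \<epsilon>" using assms(1) by (auto simp: r_def)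
  have cont: "continuous_on (ball 0 \<epsilon> \<times> ball 0 \<epsilon>) (\<lambda>(z, w). f z w)"
    and hz: "\<And>w. w \<in> ball 0 \<epsilon> \<Longrightarrow> (\<lambda>z. f z w) holomorphic_on ball 0 \<epsilon>"
    and hw: "\<And>z. z \<in> ball 0 \<epsilon> \<Longrightarrow> f z holomorphic_on ball 0 \<epsilon>"
    using f by (auto simp: holomorphic2_def)
  let ?K = "cball (0 :: complex) (2 * r) \<times> cball (0 :: complex) (2 * r)"
  have "continuous_on ?K (\<lambda>(z, w). f z w)"
    using r by (intro continuous_on_subset[OF cont]) auto
  then have "compact ((\<lambda>(z, w). f z w) ` ?K)" by (intro compact_continuous_image compact_Times compact_cball)
  then have "bounded ((\<lambda>(z, w). f z w) ` ?K)" by (rule compact_imp_bounded)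
  then obtain M where M0: "\<forall>x\<in>(\<lambda>(z, w). f z w) ` ?K. norm x \<le> M" unfolding bounded_iff by blast
  have M: "norm (f z w) \<le> M" if "norm z \<le> 2 * r" "norm w \<le> 2 * r" for z w
  proof -
    have "(z, w) \<in> ?K" using that by simp
    then show ?thesis using bspec[OF M0 imageI] by fastforce
  qed
  \<comment> \<open>Cauchy's estimate for the second derivative on circles of radius r, with the
    factor 2!; it bounds the quadratic Taylor remainder uniformly in w.\<close>
  define B where "B = 2 * M / r ^ 2"
  have est: "norm (f z w - f 0 w - deriv (\<lambda>z. f z w) 0 * z) \<le> B * norm z ^ 2" if w: "norm w \<le> 2 * r" and z: "norm z \<le> r" for z w
  proof -
    let ?g = "\<lambda>z. f z w"
    have g: "?g holomorphic_on ball 0 \<epsilon>" using hz[of w] w r by auto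
    have hol: "(deriv ^^ i) ?g holomorphic_on ball 0 \<epsilon>" for i
      using g by (rule holomorphic_higher_deriv) simp
    have bd: "norm ((deriv ^^ Suc 1) ?g x) \<le> B" if x: "x \<in> cball 0 r" for x
    proof -
      have sub: "cball x r \<subseteq> ball 0 \<epsilon>" using x r by (auto simp: dist_norm) (smt (verit) norm_triangle_sub norm_minus_commute)
      have "norm ((deriv ^^ 2) ?g x) \<le> fact 2 * M / r ^ 2"
      proof (rule Cauchy_inequality)
        show "?g holomorphic_on ball x r" using g sub by (meson ball_subset_cball holomorphic_on_subset order_trans)
        show "continuous_on (cball x r) ?g" using g sub holomorphic_on_imp_continuous_on holomorphic_on_subset by blast
        show "0 < r" by (rule r)
        fix y assume "norm (x - y) = r"
        then have "norm y \<le> 2 * r" using x norm_triangle_sub[of y x] by (simp add: norm_minus_commute)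
        then show "norm (f y w) \<le> M" using M w by blast
      qed
      then show ?thesis by (simp add: B_def numeral_2_eq_2)
    qed
    have "norm ((deriv ^^ 0) ?g z - (\<Sum>i\<le>1. (deriv ^^ i) ?g 0 * (z - 0) ^ i / fact i)) \<le> B * norm (z - 0) ^ Suc 1 / fact 1"
    proof (rule complex_Taylor[where S = "cball 0 r"])
      fix i x assume "x \<in> cball (0 :: complex) r"
      then have "x \<in> ball 0 \<epsilon>" using r by auto
      then show "((deriv ^^ i) ?g has_field_derivative (deriv ^^ Suc i) ?g x) (at x within cball 0 r)"
        using holomorphic_derivI[OF hol[of i], of x] by (auto intro: has_field_derivative_at_within)
    qed (use bd z r in auto)
    then show ?thesis by (simp add: diff_diff_eq power2_eq_square)
  qed
  have rn: "r / real (Suc n) \<le> r" for n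
    using r divide_left_mono[of 1 "real (Suc n)" r] by simp
  let ?q = "\<lambda>n w. (f (of_real (r / real (Suc n))) w - f 0 w) / of_real (r / real (Suc n))"
  have lim: "uniform_limit (ball 0 (2 * r)) ?q (\<lambda>w. deriv (\<lambda>z. f z w) 0) sequentially"
  proof (rule uniform_limitI)
    fix e :: real assume e: "e > 0"
    have "(\<lambda>n. \<bar>B\<bar> * (r / real (Suc n))) \<longlonglongrightarrow> \<bar>B\<bar> * 0"
      by (intro tendsto_intros LIMSEQ_Suc lim_const_over_n)
    then have "\<forall>\<^sub>F n in sequentially. \<bar>B\<bar> * (r / real (Suc n)) < e"
      using e by (intro order_tendstoD(2)[where y = "\<bar>B\<bar> * 0"]) auto
    then show "\<forall>\<^sub>F n in sequentially. \<forall>w\<in>ball 0 (2 * r). dist (?q n w) (deriv (\<lambda>z. f z w) 0) < e"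
    proof eventually_elim
      case (elim n)
      show ?case
      proof
        fix w :: complex assume w: "w \<in> ball 0 (2 * r)"
        define z where "z = complex_of_real (r / real (Suc n))"
        have nz: "norm z = r / real (Suc n)" unfolding z_def norm_of_real using r by simp
        have z: "norm z > 0" "norm z \<le> r" using r rn[of n] by (auto simp: nz)
        have "z \<noteq> 0" using z by auto
        then have "?q n w - deriv (\<lambda>z. f z w) 0 = (f z w - f 0 w - deriv (\<lambda>z. f z w) 0 * z) / z"
          unfolding z_def[symmetric] by (simp add: field_simps)
        then have "norm (?q n w - deriv (\<lambda>z. f z w) 0) \<le> B * norm z ^ 2 / norm z"
          using est[of w z] w z by (simp add: norm_divide divide_right_mono)
        also have "\<dots> = B * norm z" using z by (simp add: power2_eq_square)
        also have "\<dots> \<le> \<bar>B\<bar> * (r / real (Suc n))" unfolding nz using r by (intro mult_right_mono) auto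
        finally show "dist (?q n w) (deriv (\<lambda>z. f z w) 0) < e" using elim by (simp add: dist_norm)
      qed
    qed
  qed
  have "(\<lambda>w. deriv (\<lambda>z. f z w) 0) holomorphic_on ball 0 (2 * r)"
  proof (rule holomorphic_uniform_sequence[where f = ?q])
    fix n
    have "norm (complex_of_real (r / real (Suc n))) \<le> r" unfolding norm_of_real using r rn[of n] by simp
    then have m: "complex_of_real (r / real (Suc n)) \<in> ball 0 \<epsilon>" "0 \<in> ball (0 :: complex) \<epsilon>" using r by auto
    have "ball (0 :: complex) (2 * r) \<subseteq> ball 0 \<epsilon>" using r by auto
    then show "?q n holomorphic_on ball 0 (2 * r)"
      using hw[OF m(1)] hw[OF m(2)] r by (intro holomorphic_intros) (auto intro: holomorphic_on_subset)
  next
    fix x :: complex assume "x \<in> ball 0 (2 * r)"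
    then obtain d where d: "d > 0" "cball x d \<subseteq> ball 0 (2 * r)" using open_ball open_contains_cball by blast
    then show "\<exists>d>0. cball x d \<subseteq> ball 0 (2 * r) \<and> uniform_limit (cball x d) ?q (\<lambda>w. deriv (\<lambda>z. f z w) 0) sequentially"
      using uniform_limit_on_subset[OF lim] by blast
  qed simp
  then show ?thesis by (simp add: r(2))
qed

text \<open>The derivative in z is itself holomorphic in w by \<open>holomorphic2_deriv\<close>, so
  the second order derivatives exist and those along conjugate directions vanish.\<close>

lemma holomorphic2_regular2:
  assumes "\<epsilon> > 0" and f: "holomorphic2 \<epsilon> f"
  shows "regular2 f" "dzb f = 0" "dwb f = 0" "dzwb f = 0" "dzbw f = 0"
proof -
  have small: "\<forall>\<^sub>F w in nhds 0. norm (w :: complex) < \<epsilon>"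
    using assms(1) by (auto simp: eventually_nhds_metric dist_norm)
  have hz: "((\<lambda>z. f z w) has_field_derivative deriv (\<lambda>z. f z w) 0) (at 0)" if "norm w < \<epsilon>" for w
    using f that assms(1) by (intro holomorphic_derivI[of _ "ball 0 \<epsilon>"]) (auto simp: holomorphic2_def)
  have hw: "(f 0 has_field_derivative deriv (f 0) 0) (at 0)"
    using f assms(1) by (intro holomorphic_derivI[of _ "ball 0 \<epsilon>"]) (auto simp: holomorphic2_def)
  have hd: "((\<lambda>w. deriv (\<lambda>z. f z w) 0) has_field_derivative deriv (\<lambda>w. deriv (\<lambda>z. f z w) 0) 0) (at 0)"
    using assms(1) by (intro holomorphic_derivI[OF holomorphic2_deriv[OF assms]]) auto
  have ev1: "\<forall>\<^sub>F w in nhds 0. deriv (\<lambda>z. f z w) 0 = wz (\<lambda>z. f z w) 0"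
    using small by eventually_elim (simp add: wirtinger_holomorphic[OF hz])
  have ev2: "\<forall>\<^sub>F w in nhds 0. 0 = wzb (\<lambda>z. f z w) 0"
    using small by eventually_elim (simp add: wirtinger_holomorphic[OF hz])
  show "regular2 f"
    unfolding regular2_def
  proof (intro conjI)
    show "\<forall>\<^sub>F w in nhds 0. (\<lambda>z. f z w) differentiable (at 0)"
      using small by eventually_elim (rule wirtinger_holomorphic[OF hz])
    show "f 0 differentiable (at 0)" by (rule wirtinger_holomorphic[OF hw])
    show "(\<lambda>w. wz (\<lambda>z. f z w) 0) differentiable (at 0)"
      by (rule differentiable_eventually[OF wirtinger_holomorphic(1)[OF hd] ev1])
    show "(\<lambda>w. wzb (\<lambda>z. f z w) 0) differentiable (at 0)"
      by (rule differentiable_eventually[OF _ ev2]) simp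
  qed
  show "dzb f = 0" using wirtinger_holomorphic(3)[OF hz[of 0]] assms(1) by (simp add: dzb_def)
  show "dwb f = 0" using wirtinger_holomorphic(3)[OF hw] by (simp add: dwb_def)
  show "dzwb f = 0" using wirtinger_cong(2)[OF ev1] wirtinger_holomorphic(3)[OF hd] by (simp add: dzwb_def)
  show "dzbw f = 0" using wirtinger_cong(1)[OF ev2] by (simp add: dzbw_def)
qed

section \<open>Derivatives of matrix-valued functions\<close>

definition mreg :: "(complex \<Rightarrow> complex \<Rightarrow> 'n::finite cmat) \<Rightarrow> bool" where
  "mreg X \<longleftrightarrow> (\<forall>i j. regular2 (\<lambda>z w. X z w $ i $ j))"

definition "mdz X = (\<chi> i j. dz (\<lambda>z w. X z w $ i $ j))"
definition "mdzb X = (\<chi> i j. dzb (\<lambda>z w. X z w $ i $ j))"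
definition "mdw X = (\<chi> i j. dw (\<lambda>z w. X z w $ i $ j))"
definition "mdwb X = (\<chi> i j. dwb (\<lambda>z w. X z w $ i $ j))"
definition "mdzwb X = (\<chi> i j. dzwb (\<lambda>z w. X z w $ i $ j))"
definition "mdzbw X = (\<chi> i j. dzbw (\<lambda>z w. X z w $ i $ j))"

lemmas md_defs = mdz_def mdzb_def mdw_def mdwb_def mdzwb_def mdzbw_def

definition vreg :: "(complex \<Rightarrow> complex \<Rightarrow> 'n::finite cvec) \<Rightarrow> bool" where
  "vreg X \<longleftrightarrow> (\<forall>i. regular2 (\<lambda>z w. X z w $ i))"

definition "vdz X = (\<chi> i. dz (\<lambda>z w. X z w $ i))"
definition "vdzb X = (\<chi> i. dzb (\<lambda>z w. X z w $ i))"
definition "vdw X = (\<chi> i. dw (\<lambda>z w. X z w $ i))"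
definition "vdwb X = (\<chi> i. dwb (\<lambda>z w. X z w $ i))"
definition "vdzwb X = (\<chi> i. dzwb (\<lambda>z w. X z w $ i))"
definition "vdzbw X = (\<chi> i. dzbw (\<lambda>z w. X z w $ i))"

lemmas vd_defs = vdz_def vdzb_def vdw_def vdwb_def vdzwb_def vdzbw_def

lemma mregD: "mreg X \<Longrightarrow> regular2 (\<lambda>z w. X z w $ i $ j)" by (simp add: mreg_def)
lemma vregD: "vreg X \<Longrightarrow> regular2 (\<lambda>z w. X z w $ i)" by (simp add: vreg_def)

lemma mreg_const: "mreg (\<lambda>z w. C)" "mdz (\<lambda>z w. C) = 0" "mdzb (\<lambda>z w. C) = 0" "mdw (\<lambda>z w. C) = 0"
  "mdwb (\<lambda>z w. C) = 0" "mdzwb (\<lambda>z w. C) = 0" "mdzbw (\<lambda>z w. C) = 0"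
  by (simp_all add: mreg_def md_defs vec_eq_iff regular2_const d_const)

lemma mreg_mult:
  fixes X Y :: "complex \<Rightarrow> complex \<Rightarrow> 'n::finite cmat"
  assumes "mreg X" "mreg Y"
  shows "mreg (\<lambda>z w. X z w ** Y z w)"
    "mdz (\<lambda>z w. X z w ** Y z w) = mdz X ** Y 0 0 + X 0 0 ** mdz Y"
    "mdzb (\<lambda>z w. X z w ** Y z w) = mdzb X ** Y 0 0 + X 0 0 ** mdzb Y"
    "mdw (\<lambda>z w. X z w ** Y z w) = mdw X ** Y 0 0 + X 0 0 ** mdw Y"
    "mdwb (\<lambda>z w. X z w ** Y z w) = mdwb X ** Y 0 0 + X 0 0 ** mdwb Y"
    "mdzwb (\<lambda>z w. X z w ** Y z w) = mdzwb X ** Y 0 0 + mdz X ** mdwb Y + (mdwb X ** mdz Y + X 0 0 ** mdzwb Y)"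
    "mdzbw (\<lambda>z w. X z w ** Y z w) = mdzbw X ** Y 0 0 + mdzb X ** mdw Y + (mdw X ** mdzb Y + X 0 0 ** mdzbw Y)"
  using assms
  by (simp_all add: mreg_def md_defs vec_eq_iff matrix_matrix_mult_def regular2_sum regular2_mult sum.distrib)

lemma vreg_mult:
  fixes X :: "complex \<Rightarrow> complex \<Rightarrow> 'n::finite cmat"
  assumes "mreg X" "vreg Y"
  shows "vreg (\<lambda>z w. X z w *v Y z w)"
    "vdz (\<lambda>z w. X z w *v Y z w) = mdz X *v Y 0 0 + X 0 0 *v vdz Y"
    "vdzb (\<lambda>z w. X z w *v Y z w) = mdzb X *v Y 0 0 + X 0 0 *v vdzb Y"
    "vdw (\<lambda>z w. X z w *v Y z w) = mdw X *v Y 0 0 + X 0 0 *v vdw Y"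
    "vdwb (\<lambda>z w. X z w *v Y z w) = mdwb X *v Y 0 0 + X 0 0 *v vdwb Y"
    "vdzwb (\<lambda>z w. X z w *v Y z w) = mdzwb X *v Y 0 0 + mdz X *v vdwb Y + (mdwb X *v vdz Y + X 0 0 *v vdzwb Y)"
    "vdzbw (\<lambda>z w. X z w *v Y z w) = mdzbw X *v Y 0 0 + mdzb X *v vdw Y + (mdw X *v vdzb Y + X 0 0 *v vdzbw Y)"
  using assms
  by (simp_all add: mreg_def vreg_def md_defs vd_defs vec_eq_iff matrix_vector_mult_def regular2_sum regular2_mult sum.distrib)

lemma mreg_add:
  assumes "mreg X" "mreg Y"
  shows "mreg (\<lambda>z w. X z w + Y z w)"
    "mdz (\<lambda>z w. X z w + Y z w) = mdz X + mdz Y" "mdzb (\<lambda>z w. X z w + Y z w) = mdzb X + mdzb Y"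
    "mdw (\<lambda>z w. X z w + Y z w) = mdw X + mdw Y" "mdwb (\<lambda>z w. X z w + Y z w) = mdwb X + mdwb Y"
    "mdzwb (\<lambda>z w. X z w + Y z w) = mdzwb X + mdzwb Y" "mdzbw (\<lambda>z w. X z w + Y z w) = mdzbw X + mdzbw Y"
  using assms by (simp_all add: mreg_def md_defs vec_eq_iff regular2_add)

lemma mreg_sum: "(\<And>i. i \<in> S \<Longrightarrow> mreg (X i)) \<Longrightarrow> mreg (\<lambda>z w. \<Sum>i\<in>S. X i z w)"
  by (simp add: mreg_def regular2_sum)

lemma mreg_cnj:
  assumes "mreg X"
  shows "mreg (\<lambda>z w. cnj_mat (X z w))"
    "mdz (\<lambda>z w. cnj_mat (X z w)) = cnj_mat (mdzb X)" "mdzb (\<lambda>z w. cnj_mat (X z w)) = cnj_mat (mdz X)"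
    "mdw (\<lambda>z w. cnj_mat (X z w)) = cnj_mat (mdwb X)" "mdwb (\<lambda>z w. cnj_mat (X z w)) = cnj_mat (mdw X)"
    "mdzwb (\<lambda>z w. cnj_mat (X z w)) = cnj_mat (mdzbw X)" "mdzbw (\<lambda>z w. cnj_mat (X z w)) = cnj_mat (mdzwb X)"
  using assms by (simp_all add: mreg_def md_defs vec_eq_iff cnj_mat_def map_matrix_def regular2_cnj)

lemma vreg_cnj:
  assumes "vreg X"
  shows "vreg (\<lambda>z w. cnj_vec (X z w))"
    "vdz (\<lambda>z w. cnj_vec (X z w)) = cnj_vec (vdzb X)" "vdzb (\<lambda>z w. cnj_vec (X z w)) = cnj_vec (vdz X)"
    "vdw (\<lambda>z w. cnj_vec (X z w)) = cnj_vec (vdwb X)" "vdwb (\<lambda>z w. cnj_vec (X z w)) = cnj_vec (vdw X)"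
    "vdzwb (\<lambda>z w. cnj_vec (X z w)) = cnj_vec (vdzbw X)" "vdzbw (\<lambda>z w. cnj_vec (X z w)) = cnj_vec (vdzwb X)"
  using assms by (simp_all add: vreg_def vd_defs vec_eq_iff cnj_vec_def regular2_cnj)

lemma mreg_cong:
  assumes "\<epsilon> > 0" "\<And>z w. norm z < \<epsilon> \<Longrightarrow> norm w < \<epsilon> \<Longrightarrow> X z w = Y z w" "mreg X"
  shows "mreg Y" "mdz Y = mdz X" "mdzb Y = mdzb X" "mdw Y = mdw X" "mdwb Y = mdwb X" "mdzwb Y = mdzwb X" "mdzbw Y = mdzbw X"
proof -
  have r: "regular2 (\<lambda>z w. X z w $ i $ j)" for i j using assms(3) by (rule mregD)
  note c = regular2_cong[OF assms(1) _ r, where g = "\<lambda>z w. Y z w $ _ $ _"]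
  show "mreg Y" "mdz Y = mdz X" "mdzb Y = mdzb X" "mdw Y = mdw X" "mdwb Y = mdwb X" "mdzwb Y = mdzwb X" "mdzbw Y = mdzbw X"
    unfolding mreg_def md_defs vec_eq_iff vec_lambda_beta
    by (intro allI c; simp add: assms(2))+
qed

lemma vreg_cong:
  assumes "\<epsilon> > 0" "\<And>z w. norm z < \<epsilon> \<Longrightarrow> norm w < \<epsilon> \<Longrightarrow> X z w = Y z w" "vreg X"
  shows "vreg Y" "vdz Y = vdz X" "vdzb Y = vdzb X" "vdw Y = vdw X" "vdwb Y = vdwb X" "vdzwb Y = vdzwb X" "vdzbw Y = vdzbw X"
proof -
  have r: "regular2 (\<lambda>z w. X z w $ i)" for i using assms(3) by (rule vregD)
  note c = regular2_cong[OF assms(1) _ r, where g = "\<lambda>z w. Y z w $ _"]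
  show "vreg Y" "vdz Y = vdz X" "vdzb Y = vdzb X" "vdw Y = vdw X" "vdwb Y = vdwb X" "vdzwb Y = vdzwb X" "vdzbw Y = vdzbw X"
    unfolding vreg_def vd_defs vec_eq_iff vec_lambda_beta
    by (intro allI c; simp add: assms(2))+
qed

lemma regular2_det:
  fixes X :: "complex \<Rightarrow> complex \<Rightarrow> 'n::finite cmat"
  shows "mreg X \<Longrightarrow> regular2 (\<lambda>z w. det (X z w))"
  unfolding det_def
  by (intro regular2_sum(1) regular2_mult(1) regular2_const regular2_prod) (simp add: mreg_def)

text \<open>Cramer's rule for column j of \<open>B\<close>.\<close>

lemma inverse_entry_det:
  fixes A B :: "'n::finite cmat"
  assumes "A ** B = mat 1"
  shows "det A \<noteq> 0" "B $ i $ j = det (\<chi> k l. if l = i then axis j 1 $ k else A $ k $ l) / det A"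
proof -
  show d: "det A \<noteq> 0" using assms det_mul[of A B] by auto
  have "(A *v (\<chi> k. B $ k $ j)) $ m = axis j 1 $ m" for m
    using arg_cong[OF assms, of "\<lambda>M. M $ m $ j"]
    by (simp add: matrix_matrix_mult_def matrix_vector_mult_def mat_def axis_def)
  then have "A *v (\<chi> k. B $ k $ j) = axis j 1" by (simp add: vec_eq_iff)
  then have "(\<chi> k. B $ k $ j) = (\<chi> m. det (\<chi> k l. if l = m then axis j 1 $ k else A $ k $ l) / det A)"
    using cramer[OF d] by blast
  from arg_cong[OF this, of "\<lambda>x. x $ i"]
  show "B $ i $ j = det (\<chi> k l. if l = i then axis j 1 $ k else A $ k $ l) / det A" by simp
qed

text \<open>The entries of an inverse are quotients of determinants, and inverses are unique; hence
  an inverse picked pointwise by choice is automatically regular.\<close>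

lemma mreg_inverse:
  fixes A :: "complex \<Rightarrow> complex \<Rightarrow> 'n::finite cmat"
  assumes "\<epsilon> > 0" and A: "mreg A" and inv: "\<And>z w. norm z < \<epsilon> \<Longrightarrow> norm w < \<epsilon> \<Longrightarrow> A z w ** B z w = mat 1"
  shows "mreg B"
  unfolding mreg_def
proof (intro allI)
  fix i j
  have A00: "A 0 0 ** B 0 0 = mat 1" using inv[of 0 0] assms(1) by simp
  have "regular2 (\<lambda>z w. det (\<chi> k l. if l = i then axis j 1 $ k else A z w $ k $ l) * inverse (det (A z w)))"
  proof (intro regular2_mult(1) regular2_det regular2_inverse A)
    show "det (A 0 0) \<noteq> 0" by (rule inverse_entry_det(1)[OF A00])
    have "regular2 (\<lambda>z w. if l = i then axis j 1 $ k else A z w $ k $ l)" for k l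
      using A by (cases "l = i") (simp_all add: regular2_const mregD)
    then show "mreg (\<lambda>z w. (\<chi> k l. if l = i then axis j 1 $ k else A z w $ k $ l))"
      by (simp add: mreg_def)
  qed
  then show "regular2 (\<lambda>z w. B z w $ i $ j)"
  proof (rule regular2_cong(1)[OF assms(1), rotated])
    fix z w :: complex assume "norm z < \<epsilon>" "norm w < \<epsilon>"
    then show "det (\<chi> k l. if l = i then axis j 1 $ k else A z w $ k $ l) * inverse (det (A z w)) = B z w $ i $ j"
      using inverse_entry_det(2)[OF inv, of z w i j] by (simp add: divide_inverse)
  qed
qed

section \<open>Bilinear expressions in vector-valued functions\<close>

definition cbilinear :: "('n::finite cvec \<Rightarrow> 'n cvec \<Rightarrow> complex) \<Rightarrow> bool" where
  "cbilinear B \<longleftrightarrow> (\<forall>x y z. B (x + y) z = B x z + B y z) \<and> (\<forall>x y z. B x (y + z) = B x y + B x z) \<and>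
    (\<forall>c x y. B (c *s x) y = c * B x y) \<and> (\<forall>c x y. B x (c *s y) = c * B x y)"

lemma cbilinear_expand:
  assumes B: "cbilinear B"
  shows "B x y = (\<Sum>i\<in>UNIV. \<Sum>j\<in>UNIV. x $ i * y $ j * B (axis i 1) (axis j 1))"
proof -
  have z: "B 0 y = 0" "B y 0 = 0" for y
    using B unfolding cbilinear_def by (metis add_cancel_right_right)+
  have s: "B (\<Sum>i\<in>S. f i) y = (\<Sum>i\<in>S. B (f i) y)" "B y (\<Sum>i\<in>S. f i) = (\<Sum>i\<in>S. B y (f i))"
    for S :: "'a set" and f y
    using B by (induction S rule: infinite_finite_induct) (auto simp: z cbilinear_def)
  have "B x y = B (\<Sum>i\<in>UNIV. (x $ i) *s axis i 1) (\<Sum>j\<in>UNIV. (y $ j) *s axis j 1)"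
    by (simp add: basis_expansion)
  also have "\<dots> = (\<Sum>j\<in>UNIV. \<Sum>i\<in>UNIV. x $ i * y $ j * B (axis i 1) (axis j 1))"
    unfolding s using B by (simp add: cbilinear_def mult_ac)
  finally show ?thesis by (subst sum.swap) simp
qed

lemma regular2_cbilinear:
  assumes B: "cbilinear B" and "vreg X" "vreg Y"
  shows "regular2 (\<lambda>z w. B (X z w) (Y z w))"
    "dz (\<lambda>z w. B (X z w) (Y z w)) = B (vdz X) (Y 0 0) + B (X 0 0) (vdz Y)"
    "dwb (\<lambda>z w. B (X z w) (Y z w)) = B (vdwb X) (Y 0 0) + B (X 0 0) (vdwb Y)"
    "dzwb (\<lambda>z w. B (X z w) (Y z w)) = B (vdzwb X) (Y 0 0) + B (vdz X) (vdwb Y) + (B (vdwb X) (vdz Y) + B (X 0 0) (vdzwb Y))"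
proof -
  let ?b = "\<lambda>i j. B (axis i 1) (axis j 1)"
  have r: "regular2 (\<lambda>z w. X z w $ i * Y z w $ j * ?b i j)" for i j
    using assms by (intro regular2_mult(1) regular2_const) (simp_all add: vreg_def)
  have r': "regular2 (\<lambda>z w. X z w $ i * Y z w $ j)" for i j
    using assms by (intro regular2_mult(1)) (simp_all add: vreg_def)
  note R = regular2_sum[OF regular2_sum(1)] regular2_sum[OF r] r regular2_mult[OF r' regular2_const] regular2_mult[OF vregD[OF assms(2)] vregD[OF assms(3)]]
  have e: "(\<lambda>z w. B (X z w) (Y z w)) = (\<lambda>z w. \<Sum>i\<in>UNIV. \<Sum>j\<in>UNIV. X z w $ i * Y z w $ j * ?b i j)"
    by (simp add: cbilinear_expand[OF B, symmetric])
  show "regular2 (\<lambda>z w. B (X z w) (Y z w))" unfolding e by (intro regular2_sum(1) r)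
  show "dz (\<lambda>z w. B (X z w) (Y z w)) = B (vdz X) (Y 0 0) + B (X 0 0) (vdz Y)"
    "dwb (\<lambda>z w. B (X z w) (Y z w)) = B (vdwb X) (Y 0 0) + B (X 0 0) (vdwb Y)"
    "dzwb (\<lambda>z w. B (X z w) (Y z w)) = B (vdzwb X) (Y 0 0) + B (vdz X) (vdwb Y) + (B (vdwb X) (vdz Y) + B (X 0 0) (vdzwb Y))"
    unfolding e unfolding cbilinear_expand[OF B, of "vdz X"] cbilinear_expand[OF B, of "vdwb X"] cbilinear_expand[OF B, of "vdzwb X"]
      cbilinear_expand[OF B, of "X 0 0"]
    by (simp_all add: R d_const vd_defs sum.distrib distrib_right)
qed

lemma holomorphic2_const: "holomorphic2 \<epsilon> (\<lambda>z w. c)"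
  by (simp add: holomorphic2_def case_prod_unfold)

lemma holomorphic2_add: "holomorphic2 \<epsilon> f \<Longrightarrow> holomorphic2 \<epsilon> g \<Longrightarrow> holomorphic2 \<epsilon> (\<lambda>z w. f z w + g z w)"
  and holomorphic2_mult: "holomorphic2 \<epsilon> f \<Longrightarrow> holomorphic2 \<epsilon> g \<Longrightarrow> holomorphic2 \<epsilon> (\<lambda>z w. f z w * g z w)"
  by (auto simp: holomorphic2_def case_prod_unfold intro!: holomorphic_intros continuous_intros)

lemma holomorphic2_sum:
  "(\<And>i. i \<in> S \<Longrightarrow> holomorphic2 \<epsilon> (f i)) \<Longrightarrow> holomorphic2 \<epsilon> (\<lambda>z w. \<Sum>i\<in>S. f i z w)"
  by (induction S rule: infinite_finite_induct) (auto simp: holomorphic2_const holomorphic2_add)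

lemma holomorphic2_mpow:
  fixes u v :: "'n::finite cmat"
  shows "holomorphic2 \<epsilon> (\<lambda>z w. mpow (cscale_mat z u + cscale_mat w v) m $ i $ j)"
proof (induction m arbitrary: i j)
  case 0
  show ?case by (simp add: holomorphic2_const)
next
  case (Suc m)
  have "holomorphic2 \<epsilon> (\<lambda>z w. (cscale_mat z u + cscale_mat w v) $ i $ k)" for k
    by (auto simp: holomorphic2_def case_prod_unfold cscale_mat_def map_matrix_def intro!: holomorphic_intros continuous_intros)
  then show ?case
    unfolding mpow_Suc matrix_matrix_mult_def vec_lambda_beta
    by (intro holomorphic2_sum holomorphic2_mult Suc)
qed

lemma uniform_limit_substitute:
  assumes "uniform_limit A f l F" "\<And>x. x \<in> S \<Longrightarrow> g x \<in> A"
  shows "uniform_limit S (\<lambda>n x. f n (g x)) (\<lambda>x. l (g x)) F"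
  unfolding uniform_limit_iff
proof (intro allI impI)
  fix e :: real assume "e > 0"
  then have "\<forall>\<^sub>F n in F. \<forall>x\<in>A. dist (f n x) (l x) < e" using assms(1) unfolding uniform_limit_iff by blast
  then show "\<forall>\<^sub>F n in F. \<forall>x\<in>S. dist (f n (g x)) (l (g x)) < e"
    by (rule eventually_mono) (use assms(2) in blast)
qed

text \<open>On the unit bidisc the entries of z u + w v are bounded by c + d, so the exponential
  series converges uniformly there; continuity and holomorphy in each variable pass to the
  limit.\<close>

lemma mexp_holomorphic2:
  fixes u v :: "'n::finite cmat"
  shows "holomorphic2 1 (\<lambda>z w. mexp (cscale_mat z u + cscale_mat w v) $ i $ j)"
proof -
  obtain c where c: "\<And>i j. norm (u $ i $ j) \<le> c" using ex_entry_bound by blast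
  obtain d where d: "\<And>i j. norm (v $ i $ j) \<le> d" using ex_entry_bound by blast
  define K where "K = real CARD('n) * (c + d)"
  let ?X = "\<lambda>z w. cscale_mat z u + cscale_mat w v"
  let ?t = "\<lambda>m p. (1 / fact m) *\<^sub>R mpow (?X (fst p) (snd p)) m $ i $ j"
  let ?B = "ball (0 :: complex) 1"
  have bd: "norm (?X z w $ i $ j) \<le> c + d" if "z \<in> ?B" "w \<in> ?B" for z w i j
  proof -
    have "norm (?X z w $ i $ j) \<le> norm z * norm (u $ i $ j) + norm w * norm (v $ i $ j)"
      by (simp add: cscale_mat_def map_matrix_def norm_mult[symmetric] norm_triangle_ineq)
    also have "\<dots> \<le> 1 * c + 1 * d" using that by (intro add_mono mult_mono c d) auto
    finally show ?thesis by simp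
  qed
  have ul: "uniform_limit (?B \<times> ?B) (\<lambda>n p. \<Sum>m<n. ?t m p) (\<lambda>p. \<Sum>m. ?t m p) sequentially"
  proof (rule Weierstrass_m_test)
    show "summable (\<lambda>m. inverse (fact m) * K ^ m)" by (rule summable_exp)
    fix m p assume "p \<in> ?B \<times> ?B"
    then have "norm (mpow (?X (fst p) (snd p)) m $ i $ j) \<le> K ^ m"
      by (intro mpow_bound[OF bd K_def]) auto
    then show "norm (?t m p) \<le> inverse (fact m) * K ^ m" by (simp add: divide_inverse)
  qed
  have lim: "(\<Sum>m. ?t m p) = mexp (?X (fst p) (snd p)) $ i $ j" for p
    by (rule sums_unique[OF mexp_entry_sums, symmetric])
  have ps: "holomorphic2 1 (\<lambda>z w. \<Sum>m<n. ?t m (z, w))" for n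
  proof -
    have "holomorphic2 1 (\<lambda>z w. \<Sum>m<n. of_real (1 / fact m) * mpow (?X z w) m $ i $ j)"
      by (intro holomorphic2_sum holomorphic2_mult holomorphic2_const holomorphic2_mpow)
    then show ?thesis by (simp add: scaleR_conv_of_real)
  qed
  show ?thesis
    unfolding holomorphic2_def
  proof (intro conjI ballI)
    have "continuous_on (?B \<times> ?B) (\<lambda>p. \<Sum>m. ?t m p)"
      using ps ul by (intro uniform_limit_theorem[OF _ ul]) (auto simp: holomorphic2_def case_prod_unfold)
    then show "continuous_on (?B \<times> ?B) (\<lambda>(z, w). mexp (?X z w) $ i $ j)"
      unfolding lim by (simp add: case_prod_unfold)
  next
    fix w assume w: "w \<in> ?B"
    have ulz: "uniform_limit ?B (\<lambda>n z. \<Sum>m<n. ?t m (z, w)) (\<lambda>z. \<Sum>m. ?t m (z, w)) sequentially"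
      by (rule uniform_limit_substitute[OF ul, of ?B "\<lambda>z. (z, w)"]) (use w in auto)
    have "(\<lambda>z. \<Sum>m. ?t m (z, w)) holomorphic_on ?B"
    proof (rule holomorphic_uniform_sequence[OF open_ball])
      show "(\<lambda>z. \<Sum>m<n. ?t m (z, w)) holomorphic_on ?B" for n using ps[of n] w by (simp add: holomorphic2_def)
      fix x assume "x \<in> ?B"
      then obtain d where "d > 0" "cball x d \<subseteq> ?B" using open_ball open_contains_cball by blast
      then show "\<exists>d>0. cball x d \<subseteq> ?B \<and> uniform_limit (cball x d) (\<lambda>n z. \<Sum>m<n. ?t m (z, w)) (\<lambda>z. \<Sum>m. ?t m (z, w)) sequentially"
        using uniform_limit_on_subset[OF ulz] by blast
    qed
    then show "(\<lambda>z. mexp (?X z w) $ i $ j) holomorphic_on ?B" unfolding lim by simp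
  next
    fix z assume z: "z \<in> ?B"
    have ulw: "uniform_limit ?B (\<lambda>n w. \<Sum>m<n. ?t m (z, w)) (\<lambda>w. \<Sum>m. ?t m (z, w)) sequentially"
      by (rule uniform_limit_substitute[OF ul, of ?B "\<lambda>w. (z, w)"]) (use z in auto)
    have "(\<lambda>w. \<Sum>m. ?t m (z, w)) holomorphic_on ?B"
    proof (rule holomorphic_uniform_sequence[OF open_ball])
      show "(\<lambda>w. \<Sum>m<n. ?t m (z, w)) holomorphic_on ?B" for n using ps[of n] z by (simp add: holomorphic2_def)
      fix x assume "x \<in> ?B"
      then obtain d where "d > 0" "cball x d \<subseteq> ?B" using open_ball open_contains_cball by blast
      then show "\<exists>d>0. cball x d \<subseteq> ?B \<and> uniform_limit (cball x d) (\<lambda>n w. \<Sum>m<n. ?t m (z, w)) (\<lambda>w. \<Sum>m. ?t m (z, w)) sequentially"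
        using uniform_limit_on_subset[OF ulw] by blast
    qed
    then show "(\<lambda>w. mexp (?X z w) $ i $ j) holomorphic_on ?B" unfolding lim by simp
  qed
qed

lemma mreg_mexp:
  fixes u v :: "'n::finite cmat"
  defines "E \<equiv> \<lambda>z w. mexp (cscale_mat z u + cscale_mat w v)"
  shows "mreg E" "mdz E = u" "mdzb E = 0" "mdw E = v" "mdwb E = 0" "mdzwb E = 0" "mdzbw E = 0"
proof -
  note H = holomorphic2_regular2[OF zero_less_one mexp_holomorphic2]
  show "mreg E" unfolding mreg_def E_def using H(1) by blast
  show "mdzb E = 0" "mdwb E = 0" "mdzwb E = 0" "mdzbw E = 0"
    unfolding E_def md_defs by (simp_all add: vec_eq_iff H)
  have c0: "cscale_mat 0 X = 0" for X :: "'n cmat" by (simp add: cscale_mat_def map_matrix_def vec_eq_iff)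
  show "mdz E = u" "mdw E = v"
    unfolding E_def md_defs d_defs
    by (simp_all add: vec_eq_iff c0 wirtinger_holomorphic(2)[OF mexp_deriv_0])
qed

section \<open>The metric at a moved filtration\<close>

context polarized_mhs begin

definition Mm :: "'n cmat \<Rightarrow> 'n cmat" where "Mm x = mexp (- x) ** cnj_mat (mexp x)"

text \<open>\<open>vp x \<alpha>\<close> is the projection of the Deligne bigrading at \<open>e\<^sup>x F\<close>, carried back by \<open>e\<^sup>x\<close>. The matrices
  \<open>fm x\<close>, with inverse \<open>fi x\<close>, and \<open>Lm x\<close> are the factors \<open>f\<close> and \<open>L\<close> of the block LU decomposition of \<open>Mm x\<close>.\<close>

definition vp :: "'n cmat \<Rightarrow> int \<times> int \<Rightarrow> 'n cmat" where
  "vp x \<alpha> = mexp (- x) ** polarized_mhs.pr W (act (mexp x) F) \<alpha> ** mexp x"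

definition fm :: "'n cmat \<Rightarrow> 'n cmat" where "fm x = (\<Sum>\<alpha>\<in>box. pr \<alpha> ** vp x \<alpha>)"

definition fi :: "'n cmat \<Rightarrow> 'n cmat" where "fi x = (\<Sum>\<alpha>\<in>box. vp x \<alpha> ** pr \<alpha>)"

definition Lm :: "'n cmat \<Rightarrow> 'n cmat" where "Lm x = fm x ** Mm x"

text \<open>The metric \<open>h\<close> with its conjugated argument twisted by \<open>T\<close>.
  The twist acts after conjugation, so the expression is linear in \<open>a\<close> and in
  \<open>T\<close> and conjugate linear in \<open>b\<close>.\<close>

definition S :: "'n cvec \<Rightarrow> 'n cmat \<Rightarrow> 'n cvec \<Rightarrow> complex" where
  "S a T b = (\<Sum>\<alpha>\<in>box. qf \<alpha> a (T *v cnj_vec (pr \<alpha> *v b)))"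

end

text \<open>Here \<open>x\<close> is fixed and both filtrations are available. The matrices
  \<open>vp x\<close>, \<open>fm x\<close> and \<open>Lm x\<close> are nevertheless defined outside,
  as functions of all \<open>x\<close>, because they have to be differentiated in
  \<open>x\<close>.\<close>

locale moved_mhs = polarized_mhs W Q F
  for W :: "'n::finite weight_filtration" and Q :: "'n graded_forms" and F :: "'n filtration" +
  fixes x :: "'n cmat"
  assumes lie_x: "lie x" and moved: "polarized_mhs W Q (act (mexp x) F)"
begin

sublocale X: polarized_mhs W Q "act (mexp x) F" by (rule moved)

abbreviation "g \<equiv> mexp x"
abbreviation "gi \<equiv> mexp (- x)"
abbreviation "gb \<equiv> cnj_mat (mexp x)"

lemma gi_g: "gi *v (g *v v) = v" and g_gi: "g *v (gi *v v) = v"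
  by (simp_all add: matrix_vector_mul_assoc mexp_inverse mexp_inverse')

lemma g_Wc: "v \<in> Wc k \<Longrightarrow> g *v v \<in> Wc k" and gi_Wc: "v \<in> Wc k \<Longrightarrow> gi *v v \<in> Wc k"
  and gb_Wc: "v \<in> Wc k \<Longrightarrow> gb *v v \<in> Wc k"
  using mexp_Wc[OF lie_x] mexp_Wc[OF lie_minus[OF lie_x]] mexp_Wc[OF lie_cnj[OF lie_x]] by (simp_all add: mexp_cnj)

lemma act_F: "v \<in> act g F p \<longleftrightarrow> gi *v v \<in> F p"
  unfolding act_def image_iff using gi_g g_gi by metis

lemma gi_Up: "v \<in> X.Up a b \<Longrightarrow> gi *v v \<in> Up a b"
  using gi_Wc by (fastforce simp: X.Up_def Up_def act_F matrix_vector_right_distrib)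

lemma g_Up: "v \<in> Up a b \<Longrightarrow> g *v v \<in> X.Up a b"
proof -
  assume "v \<in> Up a b"
  then obtain y z where yz: "v = y + z" "y \<in> F (a + 1)" "z \<in> F a \<inter> Wc (a + b)" by (auto simp: Up_def)
  then have "g *v y \<in> act g F (a + 1)" "g *v z \<in> act g F a \<inter> Wc (a + b)" using g_Wc by (auto simp: act_F gi_g)
  then show ?thesis unfolding X.Up_def yz(1) matrix_vector_right_distrib by blast
qed

lemma gb_Low: "v \<in> Low a b \<Longrightarrow> gb *v v \<in> X.Low a b"
proof -
  have "vec.subspace (X.Low a b)" unfolding X.Low_def by (rule X.lowt_subspace)
  then have sub: "vec.subspace {v. gb *v v \<in> X.Low a b}"
    by (simp add: vec.subspace_def matrix_vector_right_distrib vector_scalar_commute)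
  have "Low a b \<subseteq> {v. gb *v v \<in> X.Low a b}"
    unfolding Low_def lowt_def
  proof (rule vec.span_minimal[OF _ sub], rule subsetI)
    fix v assume "v \<in> (\<Union>i\<in>{..bnd}. cnj_vec ` F (i + 1 - lev a b i) \<inter> Wc i)"
    then obtain i y where y: "v = cnj_vec y" "y \<in> F (i + 1 - lev a b i)" "y \<in> Wc i" using Wc_cnj by auto
    have "cnj_vec (g *v y) \<in> X.Low a b"
      using y g_Wc by (intro X.Low_gen[where i = i]) (auto simp: act_F gi_g X.lev_def lev_def)
    then show "v \<in> {v. gb *v v \<in> X.Low a b}" by (simp add: y(1) cnj_mat_vec)
  qed
  then show "v \<in> Low a b \<Longrightarrow> gb *v v \<in> X.Low a b" by blast
qed

text \<open>The moved filtration has its trivial steps in the same degrees, so the choice behind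
  \<open>bnd\<close> is the same and sums over \<open>box\<close> serve both points.\<close>

lemma X_box: "X.box = box"
proof -
  have "act g F p = UNIV \<longleftrightarrow> F p = UNIV" for p
  proof
    assume *: "act g F p = UNIV"
    have "v \<in> F p" for v using act_F[of "g *v v" p] by (simp add: * gi_g)
    then show "F p = UNIV" by blast
  qed (auto simp: act_F)
  moreover have "act g F p = {0} \<longleftrightarrow> F p = {0}" for p
  proof
    assume *: "act g F p = {0}"
    have "v \<in> F p \<longleftrightarrow> v = 0" for v
      using act_F[of "g *v v" p] gi_g[of v] by (metis * matrix_vector_mult_0_right singleton_iff)
    then show "F p = {0}" by blast
  next
    assume *: "F p = {0}"
    have "v \<in> act g F p \<longleftrightarrow> v = 0" for v
      using g_gi[of v] act_F[of v p] by (metis * matrix_vector_mult_0_right singleton_iff)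
    then show "act g F p = {0}" by blast
  qed
  ultimately have "X.bound_prop = bound_prop" by (simp add: fun_eq_iff X.bound_prop_def bound_prop_def)
  then show ?thesis by (simp add: X.box_def box_def X.bnd_def bnd_def)
qed

definition vpP :: "int \<Rightarrow> int \<Rightarrow> 'n cmat" where "vpP a b = gi ** X.P a b ** g"

lemma vp_vpP: "vp x \<alpha> = vpP (fst \<alpha>) (snd \<alpha>) - vpP (fst \<alpha>) (snd \<alpha> - 1)"
  by (simp add: vp_def vpP_def X.pr_def matrix_diff_ldistrib matrix_diff_rdistrib)

lemma vpP_vec: "vpP a b *v v = gi *v (X.P a b *v (g *v v))"
  and vp_vec: "vp x \<alpha> *v v = gi *v (X.pr \<alpha> *v (g *v v))"
  by (simp_all add: vpP_def vp_def matrix_vector_mul_assoc matrix_mul_assoc)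

lemma Mm_vec: "Mm x *v v = gi *v (gb *v v)"
  by (simp add: Mm_def matrix_vector_mul_assoc)

lemma vpP_id: "v \<in> Up a b \<Longrightarrow> vpP a b *v v = v"
  by (simp add: vpP_vec X.P_id[OF g_Up] gi_g)

lemma vpP_Up: "vpP a b *v v \<in> Up a b"
  unfolding vpP_vec by (rule gi_Up[OF X.P_in])

text \<open>The matrix in parentheses is the identity on \<open>Up a b\<close> and equals
  \<open>Mm x\<close> on \<open>Low a b\<close>, which it carries into the pulled back lower
  segment. Once it is inverted, this expresses the pulled back projection through
  \<open>Mm x\<close> and fixed matrices.\<close>

lemma vpP_C: "vpP a b ** (P a b + Mm x ** (mat 1 - P a b)) = P a b"
proof (rule matrix_eqI)
  fix v
  have "vpP a b *v (P a b *v v) = P a b *v v" by (rule vpP_id[OF P_in])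
  moreover have "vpP a b *v (Mm x *v (v - P a b *v v)) = 0"
    using X.P_0[OF gb_Low[OF P_diff[of v a b]]] by (simp add: vpP_vec Mm_vec g_gi)
  ultimately show "vpP a b ** (P a b + Mm x ** (mat 1 - P a b)) *v v = P a b *v v"
    by (simp add: matrix_vector_mul_assoc[symmetric] matrix_vector_mult_add_rdistrib matrix_vector_mult_diff_rdistrib
        matrix_vector_right_distrib matrix_vector_mult_diff_distrib)
qed

text \<open>A kernel vector is killed by \<open>P a b\<close> because of \<open>vpP_C\<close>, hence
  by \<open>Mm x\<close>, which is injective.\<close>

lemma C_invertible: "\<exists>B. (P a b + Mm x ** (mat 1 - P a b)) ** B = mat 1"
proof -
  let ?C = "P a b + Mm x ** (mat 1 - P a b)"
  have "v = 0" if v: "?C *v v = 0" for v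
  proof -
    have "vpP a b *v (?C *v v) = P a b *v v" using vpP_C[of a b] by (simp add: matrix_vector_mul_assoc)
    then have P0: "P a b *v v = 0" using v by simp
    then have "Mm x *v v = 0"
      using v by (simp add: matrix_vector_mult_add_rdistrib matrix_vector_mult_diff_rdistrib
          matrix_vector_mul_assoc[symmetric] matrix_vector_mult_diff_distrib)
    then have "g *v (gi *v (gb *v v)) = 0" by (simp add: Mm_vec)
    then have "gb *v v = 0" by (simp add: g_gi)
    then have "g *v cnj_vec v = 0" using cnj_mat_vec[of g "cnj_vec v"] by simp
    then have "gi *v (g *v cnj_vec v) = 0" by simp
    then show ?thesis by (simp add: gi_g)
  qed
  then obtain B where "B ** ?C = mat 1" using matrix_left_invertible_ker[of ?C] by blast
  then show ?thesis using matrix_left_right_inverse by blast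
qed

lemma vp_orthogonal: "vp x \<alpha> ** vp x \<beta> = (if \<alpha> = \<beta> then vp x \<alpha> else 0)"
proof (rule matrix_eqI)
  fix v show "vp x \<alpha> ** vp x \<beta> *v v = (if \<alpha> = \<beta> then vp x \<alpha> else 0) *v v"
    by (simp add: matrix_vector_mul_assoc[symmetric] vp_vec g_gi X.pr_orthogonal_vec)
qed

lemma vp_outside: "\<alpha> \<notin> box \<Longrightarrow> vp x \<alpha> = 0"
  using X.pr_outside[of \<alpha>] by (simp add: vp_def X_box)

lemma vp_Wc: "v \<in> Wc k \<Longrightarrow> vp x \<alpha> *v v \<in> Wc k"
  unfolding vp_vec by (intro gi_Wc X.pr_Wc g_Wc)

lemma vp_wt: "vp x \<alpha> *v v \<in> Wc (wt \<alpha>)"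
  unfolding vp_vec using X.pr_wt[of \<alpha>] by (intro gi_Wc) (simp add: wt_def X.wt_def)

text \<open>The mixed terms of the sums vanish by orthogonality; so \<open>fm x\<close> and
  \<open>fi x\<close> intertwine the two systems of projections.\<close>

lemma pr_fm: "pr \<alpha> ** fm x = pr \<alpha> ** vp x \<alpha>" and fm_vp: "fm x ** vp x \<alpha> = pr \<alpha> ** vp x \<alpha>"
  and fi_pr: "fi x ** pr \<alpha> = vp x \<alpha> ** pr \<alpha>" and vp_fi: "vp x \<alpha> ** fi x = vp x \<alpha> ** pr \<alpha>"
proof -
  have "pr \<alpha> ** (pr \<beta> ** vp x \<beta>) = (if \<beta> = \<alpha> then pr \<alpha> ** vp x \<alpha> else 0)"
    "(pr \<beta> ** vp x \<beta>) ** vp x \<alpha> = (if \<beta> = \<alpha> then pr \<alpha> ** vp x \<alpha> else 0)"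
    "(vp x \<beta> ** pr \<beta>) ** pr \<alpha> = (if \<beta> = \<alpha> then vp x \<alpha> ** pr \<alpha> else 0)"
    "vp x \<alpha> ** (vp x \<beta> ** pr \<beta>) = (if \<beta> = \<alpha> then vp x \<alpha> ** pr \<alpha> else 0)" for \<beta>
    by (cases "\<beta> = \<alpha>"; simp add: matrix_mul_assoc pr_orthogonal vp_orthogonal;
        simp add: matrix_mul_assoc[symmetric] pr_orthogonal vp_orthogonal)+
  then show "pr \<alpha> ** fm x = pr \<alpha> ** vp x \<alpha>" "fm x ** vp x \<alpha> = pr \<alpha> ** vp x \<alpha>"
    "fi x ** pr \<alpha> = vp x \<alpha> ** pr \<alpha>" "vp x \<alpha> ** fi x = vp x \<alpha> ** pr \<alpha>"
    using pr_outside[of \<alpha>] vp_outside[of \<alpha>]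
    by (auto simp: fm_def fi_def matrix_mult_sum_left matrix_mult_sum_right sum.delta)
qed

text \<open>Both systems of projections have the same upper segments, so they differ only by terms
  further up in the order; on the diagonal and below it the blocks are those of the
  identity.\<close>

lemma vp_block:
  assumes "\<not> (fst \<beta> > fst \<alpha> \<or> fst \<beta> = fst \<alpha> \<and> snd \<beta> < snd \<alpha>)"
  shows "pr \<beta> *v (vp x \<alpha> *v (pr \<alpha> *v v)) = pr \<beta> *v (pr \<alpha> *v v)"
    and "pr \<beta> *v (vp x \<beta> *v (pr \<alpha> *v v)) = pr \<beta> *v (pr \<alpha> *v v)"
proof -
  obtain a b c d where ab: "\<alpha> = (a, b)" "\<beta> = (c, d)" by (metis surj_pair)
  have y: "pr \<alpha> *v v \<in> Up a b" unfolding ab by (rule pr_Up)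
  have "pr \<beta> *v (vpP a (b - 1) *v (pr \<alpha> *v v)) = 0"
    unfolding ab(2) using assms by (intro pr_Up_0[OF vpP_Up]) (auto simp: ab)
  moreover have vpa: "vp x \<alpha> *v (pr \<alpha> *v v) = pr \<alpha> *v v - vpP a (b - 1) *v (pr \<alpha> *v v)"
    using vpP_id[OF y] by (simp add: vp_vpP ab matrix_vector_mult_diff_rdistrib)
  ultimately show 1: "pr \<beta> *v (vp x \<alpha> *v (pr \<alpha> *v v)) = pr \<beta> *v (pr \<alpha> *v v)"
    by (simp add: matrix_vector_mult_diff_distrib)
  show "pr \<beta> *v (vp x \<beta> *v (pr \<alpha> *v v)) = pr \<beta> *v (pr \<alpha> *v v)"
  proof (cases "\<alpha> = \<beta>")
    case False
    then have lt: "a > c \<or> a = c \<and> b \<le> d - 1" using assms by (auto simp: ab)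
    then have "pr \<alpha> *v v \<in> Up c d" "pr \<alpha> *v v \<in> Up c (d - 1)"
      using y Up_mono[of c a b d] Up_mono[of c a b "d - 1"] by auto
    then have "vp x \<beta> *v (pr \<alpha> *v v) = 0" by (simp add: vp_vpP ab matrix_vector_mult_diff_rdistrib vpP_id)
    then show ?thesis using False by (simp add: pr_orthogonal_vec)
  qed (use 1 in simp)
qed

lemma fm_Wc: "v \<in> Wc k \<Longrightarrow> fm x *v v \<in> Wc k" and fi_Wc: "v \<in> Wc k \<Longrightarrow> fi x *v v \<in> Wc k"
  unfolding fm_def fi_def matrix_vector_mult_sum_left
  by (intro vec.subspace_sum[OF Wc_subspace]; simp add: matrix_vector_mul_assoc[symmetric] vp_Wc pr_Wc)+

text \<open>Shifts upward in the order have r > 0, or r = 0 and s < 0; if moreover r + s \<le> 0,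
  they belong to \<open>Np\<close>.\<close>

lemma btype_NpI:
  assumes "\<And>k v. v \<in> Wc k \<Longrightarrow> X *v v \<in> Wc k"
    and "\<And>\<alpha> \<beta> v. \<not> (fst \<beta> > fst \<alpha> \<or> fst \<beta> = fst \<alpha> \<and> snd \<beta> < snd \<alpha>) \<Longrightarrow> pr \<beta> *v (X *v (pr \<alpha> *v v)) = 0"
  shows "btype Np X"
proof -
  have "btype {(r, s). r > 0 \<or> r = 0 \<and> s < 0} X"
    unfolding btype_def by (intro allI impI block_zeroI assms(2)) (auto simp: minus_prod_def)
  from btype_Int[OF this btype_WcI[OF assms(1)]] show ?thesis
    by (rule btype_mono) (auto simp: Np_def)
qed

lemma fm_type: "btype Np (fm x - mat 1)"
proof (rule btype_NpI)
  show "v \<in> Wc k \<Longrightarrow> (fm x - mat 1) *v v \<in> Wc k" for v k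
    by (simp add: matrix_vector_mult_diff_rdistrib fm_Wc vec.subspace_diff[OF Wc_subspace])
  fix \<alpha> \<beta> :: "int \<times> int" and v assume *: "\<not> (fst \<beta> > fst \<alpha> \<or> fst \<beta> = fst \<alpha> \<and> snd \<beta> < snd \<alpha>)"
  have "pr \<beta> *v (fm x *v (pr \<alpha> *v v)) = pr \<beta> *v (vp x \<beta> *v (pr \<alpha> *v v))"
    using arg_cong[OF pr_fm[of \<beta>], of "\<lambda>M. M *v (pr \<alpha> *v v)"] by (simp add: matrix_vector_mul_assoc[symmetric])
  then show "pr \<beta> *v ((fm x - mat 1) *v (pr \<alpha> *v v)) = 0"
    using vp_block(2)[OF *] by (simp add: matrix_vector_mult_diff_rdistrib matrix_vector_mult_diff_distrib)
qed

lemma fi_type: "btype Np (fi x - mat 1)"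
proof (rule btype_NpI)
  show "v \<in> Wc k \<Longrightarrow> (fi x - mat 1) *v v \<in> Wc k" for v k
    by (simp add: matrix_vector_mult_diff_rdistrib fi_Wc vec.subspace_diff[OF Wc_subspace])
  fix \<alpha> \<beta> :: "int \<times> int" and v assume *: "\<not> (fst \<beta> > fst \<alpha> \<or> fst \<beta> = fst \<alpha> \<and> snd \<beta> < snd \<alpha>)"
  have "fi x *v (pr \<alpha> *v v) = vp x \<alpha> *v (pr \<alpha> *v v)"
    using arg_cong[OF fi_pr[of \<alpha>], of "\<lambda>M. M *v v"] by (simp add: matrix_vector_mul_assoc[symmetric])
  then show "pr \<beta> *v ((fi x - mat 1) *v (pr \<alpha> *v v)) = 0"
    using vp_block(1)[OF *] by (simp add: matrix_vector_mult_diff_rdistrib matrix_vector_mult_diff_distrib)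
qed

text \<open>By orthogonality the product reduces to the sum of the diagonal blocks of the
  \<open>vp x \<alpha>\<close>, which are those of the identity.\<close>

lemma fm_fi: "fm x ** fi x = mat 1" and fi_fm: "fi x ** fm x = mat 1"
proof -
  have "fm x ** fi x = (\<Sum>\<alpha>\<in>box. pr \<alpha> ** (vp x \<alpha> ** fi x))"
    by (simp add: fm_def matrix_mult_sum_left matrix_mul_assoc)
  also have "\<dots> = (\<Sum>\<alpha>\<in>box. pr \<alpha>)"
  proof (rule sum.cong[OF refl], rule matrix_eqI)
    fix \<alpha> v
    show "pr \<alpha> ** (vp x \<alpha> ** fi x) *v v = pr \<alpha> *v v"
      unfolding vp_fi using vp_block(1)[of \<alpha> \<alpha> v] by (simp add: matrix_vector_mul_assoc[symmetric] pr_orthogonal_vec)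
  qed
  finally show "fm x ** fi x = mat 1" by (simp add: sum_pr)
  then show "fi x ** fm x = mat 1" using matrix_left_right_inverse by blast
qed

lemma vp_eq: "vp x \<alpha> = fi x ** pr \<alpha> ** fm x"
proof -
  have "fi x ** pr \<alpha> ** fm x = fi x ** (fm x ** vp x \<alpha>)" by (simp add: matrix_mul_assoc[symmetric] pr_fm fm_vp)
  then show ?thesis by (simp add: matrix_mul_assoc fi_fm)
qed

lemma Mm_Wc: "v \<in> Wc k \<Longrightarrow> Mm x *v v \<in> Wc k"
  by (simp add: Mm_vec gi_Wc gb_Wc)

text \<open>\<open>Mm x\<close> carries \<open>Low a (b - 1)\<close> into the pulled back lower
  segment, which the projections of higher position kill; so L is lower triangular. Preservation of
  W removes the shifts with r = 0 and s > 0.\<close>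

lemma Lm_type: "btype ({(0, 0)} \<union> {(r, s). r < 0}) (Lm x)"
proof -
  have W: "Lm x *v v \<in> Wc k" if "v \<in> Wc k" for v k
    using that by (simp add: Lm_def matrix_vector_mul_assoc[symmetric] Mm_Wc fm_Wc)
  have "btype {(r, s). r < 0 \<or> r = 0 \<and> s \<ge> 0} (Lm x)"
    unfolding btype_def
  proof (intro allI impI block_zeroI)
    fix \<alpha> \<beta> :: "int \<times> int" and v assume *: "\<beta> - \<alpha> \<notin> {(r, s). r < 0 \<or> r = 0 \<and> s \<ge> 0}"
    obtain a b c d where ab: "\<alpha> = (a, b)" "\<beta> = (c, d)" by (metis surj_pair)
    have "gb *v (pr \<alpha> *v v) \<in> X.Low a (b - 1)" unfolding ab(1) by (rule gb_Low[OF pr_Low_mem])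
    then have "X.pr \<beta> *v (gb *v (pr \<alpha> *v v)) = 0"
      unfolding ab(2) using * by (intro X.pr_Low_0) (auto simp: ab)
    then have "vp x \<beta> *v (Mm x *v (pr \<alpha> *v v)) = 0" by (simp add: vp_vec Mm_vec g_gi)
    moreover have "pr \<beta> *v (Lm x *v (pr \<alpha> *v v)) = pr \<beta> *v (vp x \<beta> *v (Mm x *v (pr \<alpha> *v v)))"
      using arg_cong[OF pr_fm[of \<beta>], of "\<lambda>M. M *v (Mm x *v (pr \<alpha> *v v))"]
      by (simp add: Lm_def matrix_vector_mul_assoc[symmetric])
    ultimately show "pr \<beta> *v (Lm x *v (pr \<alpha> *v v)) = 0" by simp
  qed
  from btype_Int[OF this btype_WcI[OF W]] show ?thesis by (rule btype_mono) auto
qed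

text \<open>Off the pairs of swapped bidegrees both sides vanish, by the orthogonality relations at
  the moved point and at \<open>F\<close>. On such a pair \<open>fi x\<close> is written as
  \<open>mat 1 + ?n\<close>: the linear terms have no component in the swapped bidegree, and the
  quadratic term would need a shift in \<open>Np\<close> whose swap is in \<open>Np\<close>
  too.\<close>

lemma form_C_fi:
  assumes W: "y \<in> Wc k" "z \<in> Wc k"
  shows "form_C Q k (fi x *v y) (fi x *v z) = form_C Q k y z"
proof -
  let ?n = "fi x - mat 1"
  have n: "fi x *v y = y + ?n *v y" for y by (simp add: matrix_vector_mult_diff_rdistrib)
  have nW: "v \<in> Wc k \<Longrightarrow> ?n *v v \<in> Wc k" for v k
    by (simp add: matrix_vector_mult_diff_rdistrib fi_Wc vec.subspace_diff[OF Wc_subspace])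
  have nb: "pr \<beta> *v (?n *v (pr \<alpha> *v v)) = 0" if "\<beta> - \<alpha> \<notin> Np" for \<alpha> \<beta> v
    using btypeD[OF fi_type that] by (simp add: matrix_vector_mul_assoc matrix_mul_assoc)
  have main: "form_C Q k (fi x *v y) (fi x *v z) = form_C Q k y z"
    if y: "pr \<alpha> *v y = y" and z: "pr \<beta> *v z = z" and k: "wt \<alpha> = k" "wt \<beta> = k" for y z \<alpha> \<beta>
  proof -
    have yW: "y \<in> Wc k" "z \<in> Wc k" using pr_wt[of \<alpha> y] pr_wt[of \<beta> z] y z k by auto
    have k': "fst \<alpha> + snd \<alpha> = k" "fst \<beta> + snd \<beta> = k" using k by (simp_all add: wt_def)
    show ?thesis
    proof (cases "\<beta> = prod.swap \<alpha>")
      case False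
      have "fi x *v y = vp x \<alpha> *v y" "fi x *v z = vp x \<beta> *v z"
        using arg_cong[OF fi_pr[of \<alpha>], of "\<lambda>M. M *v y"] arg_cong[OF fi_pr[of \<beta>], of "\<lambda>M. M *v z"] y z
        by (simp_all add: matrix_vector_mul_assoc[symmetric])
      then have "form_C Q k (fi x *v y) (fi x *v z) = form_C Q k (g *v (vp x \<alpha> *v y)) (g *v (vp x \<beta> *v z))"
        using mexp_form[OF lie_x, of "vp x \<alpha> *v y" k "vp x \<beta> *v z"] yW by (simp add: vp_Wc)
      also have "\<dots> = form_C Q k (X.pr \<alpha> *v (g *v y)) (X.pr \<beta> *v (g *v z))" by (simp add: vp_vec g_gi)
      also have "\<dots> = 0"
        using X.pr_I0[of "fst \<alpha>" "snd \<alpha>"] X.pr_I0[of "fst \<beta>" "snd \<beta>"] k' False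
        by (intro X.form_C_orthogonal[of _ "fst \<alpha>" "snd \<alpha>" _ "fst \<beta>" "snd \<beta>"]) (auto simp: prod_eq_iff)
      also have "0 = form_C Q k y z"
        using pr_I0[of "fst \<alpha>" "snd \<alpha>" y] pr_I0[of "fst \<beta>" "snd \<beta>" z] k' False y z
        by (intro form_C_orthogonal[of _ "fst \<alpha>" "snd \<alpha>" _ "fst \<beta>" "snd \<beta>", symmetric]) (auto simp: prod_eq_iff)
      finally show ?thesis .
    next
      case True
      have N0: "(0, 0) \<notin> Np" by (simp add: Np_def)
      have 1: "form_C Q k y (?n *v z) = 0"
      proof -
        have "form_C Q k y (?n *v z) = form_C Q k (pr \<alpha> *v y) (pr (prod.swap \<alpha>) *v (?n *v z))"
          using form_C_pr[OF yW(1) nW[OF yW(2)] k'(1)] y by simp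
        also have "pr (prod.swap \<alpha>) *v (?n *v z) = 0"
          using nb[of \<beta> \<beta> z] N0 True z by (simp add: zero_prod_def)
        finally show ?thesis using yW y by simp
      qed
      have 2: "form_C Q k (?n *v y) z = 0"
      proof -
        have "form_C Q k (?n *v y) z = form_C Q k (pr (prod.swap \<beta>) *v (?n *v y)) (pr \<beta> *v z)"
          using form_C_pr'[OF yW(2) nW[OF yW(1)] k'(2)] z by simp
        also have "pr (prod.swap \<beta>) *v (?n *v y) = 0"
          using nb[of \<alpha> \<alpha> y] N0 True y by (simp add: zero_prod_def)
        finally show ?thesis using yW z by simp
      qed
      have 3: "form_C Q k (?n *v y) (?n *v z) = 0"
      proof -
        have "form_C Q k (?n *v y) (?n *v z) = (\<Sum>\<gamma>\<in>box. form_C Q k (pr \<gamma> *v (?n *v y)) (?n *v z))"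
          using form_C_sum1[of box "\<lambda>\<gamma>. pr \<gamma> *v (?n *v y)" k "?n *v z"] nW yW by (simp add: sum_pr_vec pr_Wc)
        also have "\<dots> = 0"
        proof (rule sum.neutral, rule ballI)
          fix \<gamma>
          consider "wt \<gamma> = k" | "wt \<gamma> < k" | "wt \<gamma> > k" by linarith
          then show "form_C Q k (pr \<gamma> *v (?n *v y)) (?n *v z) = 0"
          proof cases
            case 1
            have e: "form_C Q k (pr \<gamma> *v (?n *v y)) (?n *v z) = form_C Q k (pr \<gamma> *v (?n *v y)) (pr (prod.swap \<gamma>) *v (?n *v z))"
              using 1 by (intro form_C_pr nW yW) (simp add: wt_def)
            show ?thesis
            proof (cases "\<gamma> - \<alpha> \<in> Np")
              case False
              then have "pr \<gamma> *v (?n *v y) = 0" using nb[of \<gamma> \<alpha> y] y by simp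
              then show ?thesis using nW yW by simp
            next
              case T: True
              have "prod.swap \<gamma> - \<beta> \<notin> Np" using T True by (auto simp: Np_def minus_prod_def)
              then have "pr (prod.swap \<gamma>) *v (?n *v z) = 0" using nb[of "prod.swap \<gamma>" \<beta> z] z by simp
              then show ?thesis unfolding e using nW yW pr_Wc by simp
            qed
          next
            case 2
            then show ?thesis using form_C_radical(1)[OF pr_wt] nW yW by simp
          next
            case 3
            then have "pr \<gamma> *v (?n *v y) = 0" using nW[OF yW(1)] unfolding Wc_iff wt_def by (cases \<gamma>) auto
            then show ?thesis using nW yW by simp
          qed
        qed
        finally show ?thesis .
      qed
      show ?thesis unfolding n
        using 1 2 3 yW nW by (simp add: form_C_lin1(1) form_C_lin2(1) vec.subspace_add[OF Wc_subspace])
    qed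
  qed
  have blk: "form_C Q k (fi x *v (pr \<alpha> *v y)) (fi x *v (pr \<beta> *v z)) = form_C Q k (pr \<alpha> *v y) (pr \<beta> *v z)" for \<alpha> \<beta>
  proof -
    have m: "pr \<alpha> *v y \<in> Wc k" "pr \<beta> *v z \<in> Wc k" using W pr_Wc by auto
    consider "wt \<alpha> = k" "wt \<beta> = k" | "wt \<alpha> < k" | "wt \<beta> < k" | "wt \<alpha> > k" | "wt \<beta> > k" by linarith
    then show ?thesis
    proof cases
      case 1
      then show ?thesis by (intro main[of \<alpha> _ \<beta>]) (simp_all add: pr_orthogonal_vec)
    next
      case 2
      then show ?thesis
        using form_C_radical(1)[OF fi_Wc[OF pr_wt] 2 fi_Wc[OF m(2)]] form_C_radical(1)[OF pr_wt 2 m(2)] by simp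
    next
      case 3
      then show ?thesis
        using form_C_radical(2)[OF fi_Wc[OF pr_wt] 3 fi_Wc[OF m(1)]] form_C_radical(2)[OF pr_wt 3 m(1)] by simp
    next
      case 4
      then have "pr \<alpha> *v y = 0" using W unfolding Wc_iff wt_def by (cases \<alpha>) auto
      then show ?thesis using fi_Wc m by simp
    next
      case 5
      then have "pr \<beta> *v z = 0" using W unfolding Wc_iff wt_def by (cases \<beta>) auto
      then show ?thesis using fi_Wc m by simp
    qed
  qed
  have e1: "fi x *v y = (\<Sum>\<alpha>\<in>box. fi x *v (pr \<alpha> *v y))" and e2: "fi x *v z = (\<Sum>\<alpha>\<in>box. fi x *v (pr \<alpha> *v z))"
    by (simp_all add: matrix_vector_mult_sum_right[symmetric] sum_pr_vec)
  have "form_C Q k (fi x *v y) (fi x *v z) = (\<Sum>\<alpha>\<in>box. \<Sum>\<beta>\<in>box. form_C Q k (fi x *v (pr \<alpha> *v y)) (fi x *v (pr \<beta> *v z)))"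
    unfolding e1 e2 using form_C_sum1[of box "\<lambda>\<alpha>. fi x *v (pr \<alpha> *v y)" k "\<Sum>\<beta>\<in>box. fi x *v (pr \<beta> *v z)"]
      form_C_sum2[of box "\<lambda>\<beta>. fi x *v (pr \<beta> *v z)" k] W
    by (simp add: pr_Wc fi_Wc vec.subspace_sum[OF Wc_subspace])
  also have "\<dots> = form_C Q k y z" unfolding blk by (rule form_C_blocks[OF W, symmetric])
  finally show ?thesis .
qed

lemma qf_pr_eq: "pr (prod.swap \<alpha>) *v y = pr (prod.swap \<alpha>) *v y' \<Longrightarrow> qf \<alpha> a y = qf \<alpha> a y'"
  by (simp add: qf_def)

text \<open>Each term is pulled back by g and then by \<open>fi x\<close>, both of which preserve
  the forms. This turns the projection at the moved point into \<open>pr \<alpha>\<close> and leaves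
  \<open>Lm x\<close> acting on the conjugated argument, where only its block diagonal part is
  seen.\<close>

lemma metric_moved: "hodge_metric W Q (act g F) (g *v a) (g *v b) = S (fm x *v a) (part {(0, 0)} (Lm x)) (fm x *v b)"
proof -
  have trm: "\<i> powi (fst \<alpha> - snd \<alpha>) * form_C Q (wt \<alpha>) (X.pr \<alpha> *v (g *v a)) (cnj_vec (X.pr \<alpha> *v (g *v b))) =
    qf \<alpha> (fm x *v a) (part {(0, 0)} (Lm x) *v cnj_vec (pr \<alpha> *v (fm x *v b)))" for \<alpha>
  proof -
    let ?d = "cnj_vec (pr \<alpha> *v (fm x *v b))" and ?a = "pr \<alpha> *v (fm x *v a)"
    let ?c = "cnj_vec (vp x \<alpha> *v b)"
    have vW: "vp x \<alpha> *v a \<in> Wc (wt \<alpha>)" "?c \<in> Wc (wt \<alpha>)" using vp_wt by (simp_all add: Wc_cnj)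
    have dW: "?d \<in> Wc (wt \<alpha>)" using pr_wt by (simp add: Wc_cnj)
    have c: "?c = cnj_mat (fi x) *v ?d"
      by (simp add: vp_eq cnj_mat_vec[symmetric] matrix_vector_mul_assoc matrix_mul_assoc)
    have Lc: "Lm x *v ?c \<in> Wc (wt \<alpha>)" using vW by (simp add: Lm_def matrix_vector_mul_assoc[symmetric] fm_Wc Mm_Wc)
    have prg: "X.pr \<alpha> *v (g *v a) = g *v (vp x \<alpha> *v a)" for a by (simp add: vp_vec g_gi)
    have "form_C Q (wt \<alpha>) (X.pr \<alpha> *v (g *v a)) (cnj_vec (X.pr \<alpha> *v (g *v b))) =
        form_C Q (wt \<alpha>) (g *v (vp x \<alpha> *v a)) (g *v (Mm x *v ?c))"
      by (simp add: prg Mm_vec g_gi cnj_mat_vec)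
    also have "\<dots> = form_C Q (wt \<alpha>) (vp x \<alpha> *v a) (Mm x *v ?c)"
      using vW by (intro mexp_form[OF lie_x] Mm_Wc)
    also have "\<dots> = form_C Q (wt \<alpha>) (fi x *v ?a) (fi x *v (Lm x *v ?c))"
      by (simp add: vp_eq Lm_def matrix_vector_mul_assoc matrix_mul_assoc fi_fm)
    also have "\<dots> = form_C Q (wt \<alpha>) ?a (Lm x *v ?c)" using pr_wt Lc by (rule form_C_fi)
    finally have "\<i> powi (fst \<alpha> - snd \<alpha>) * form_C Q (wt \<alpha>) (X.pr \<alpha> *v (g *v a)) (cnj_vec (X.pr \<alpha> *v (g *v b))) =
        qf \<alpha> ?a (Lm x *v ?c)"
      using qf_form_C[of ?a \<alpha> "Lm x *v ?c"] pr_wt Lc by (simp add: pr_orthogonal_vec)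
    also have "\<dots> = qf \<alpha> (fm x *v a) (Lm x *v ?c)" by (simp add: qf_def pr_orthogonal_vec)
    also have "\<dots> = qf \<alpha> (fm x *v a) (part {(0, 0)} (Lm x) *v ?d)"
    proof (rule qf_pr_eq)
      \<comment> \<open>What separates \<open>Lm x *v ?c\<close> from the block diagonal part
        applied to \<open>?d\<close> lowers the first degree. But \<open>?d\<close> has no component
        of first degree above that of \<open>prod.swap \<alpha>\<close>, so nothing can arrive
        there.\<close>
      let ?T = "(Lm x - part {(0, 0)} (Lm x)) + Lm x ** cnj_mat (fi x - mat 1)"
      have T: "btype {(r, s). r < 0} ?T"
      proof (rule btype_add)
        show "btype {(r, s). r < 0} (Lm x - part {(0, 0)} (Lm x))"
          unfolding btype_def
        proof (intro allI impI)
          fix \<alpha> \<beta> :: "int \<times> int" assume "\<beta> - \<alpha> \<notin> {(r, s). r < 0}"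
          then show "pr \<beta> ** (Lm x - part {(0, 0)} (Lm x)) ** pr \<alpha> = 0"
            using btypeD[OF Lm_type, of \<beta> \<alpha>] by (auto simp: matrix_diff_ldistrib matrix_diff_rdistrib block_part)
        qed
        have "btype {(r, s). r < 0} (cnj_mat (fi x - mat 1))"
          by (rule btype_cnj[OF fi_type]) (auto simp: Np_def)
        then show "btype {(r, s). r < 0} (Lm x ** cnj_mat (fi x - mat 1))"
          by (rule btype_mult[OF Lm_type]) auto
      qed
      have "Lm x *v ?c - part {(0, 0)} (Lm x) *v ?d = ?T *v ?d"
        by (simp add: c cnj_mat_diff matrix_diff_ldistrib matrix_vector_mult_add_rdistrib matrix_vector_mult_diff_rdistrib
            matrix_vector_mul_assoc)
      moreover have "pr (prod.swap \<alpha>) *v (?T *v ?d) = 0"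
        unfolding pr_mult_vec[of "prod.swap \<alpha>" ?T ?d]
      proof (rule sum.neutral, rule ballI)
        fix \<gamma>
        show "(pr (prod.swap \<alpha>) ** ?T ** pr \<gamma>) *v ?d = 0"
        proof (cases "prod.swap \<alpha> - \<gamma> \<in> {(r, s). r < 0}")
          case True
          then have "pr \<gamma> *v ?d = 0" by (intro pr_cnj) (auto simp: minus_prod_def)
          then show ?thesis by (simp add: matrix_vector_mul_assoc[symmetric])
        next
          case False
          then show ?thesis using btypeD[OF T] by simp
        qed
      qed
      ultimately have "pr (prod.swap \<alpha>) *v (Lm x *v ?c - part {(0, 0)} (Lm x) *v ?d) = 0" by simp
      then show "pr (prod.swap \<alpha>) *v (Lm x *v ?c) = pr (prod.swap \<alpha>) *v (part {(0, 0)} (Lm x) *v ?d)"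
        by (simp add: matrix_vector_mult_diff_distrib)
    qed
    finally show ?thesis .
  qed
  have "hodge_metric W Q (act g F) (g *v a) (g *v b) =
    (\<Sum>\<alpha>\<in>box. \<i> powi (fst \<alpha> - snd \<alpha>) * form_C Q (wt \<alpha>) (X.pr \<alpha> *v (g *v a)) (cnj_vec (X.pr \<alpha> *v (g *v b))))"
    using X.h_eq[of "g *v a" "g *v b"] by (simp add: X_box X.wt_def wt_def)
  then show ?thesis unfolding S_def trm .
qed

end

section \<open>Second order expansion of the metric\<close>

context polarized_mhs begin

section \<open>The twisted form and the adjoint in bidegree (0, 0)\<close>

lemma cbilinear_qf: "cbilinear (qf \<alpha>)"
  by (simp add: cbilinear_def qf_lin)

lemma S_one: "S a (mat 1) b = h a b"
  by (simp add: S_def h_qf)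

lemma btype0_commute:
  assumes "btype {(0, 0)} T"
  shows "pr \<alpha> *v (T *v v) = T *v (pr \<alpha> *v v)"
proof (rule eq_if_pr)
  fix \<beta>
  have *: "pr \<beta> *v (T *v v) = pr \<beta> *v (T *v (pr \<beta> *v v))" for v
  proof -
    have "pr \<beta> *v (T *v v) = (\<Sum>\<gamma>\<in>box. if \<gamma> = \<beta> then pr \<beta> *v (T *v (pr \<beta> *v v)) else 0)"
      unfolding pr_mult_vec[of \<beta> T v]
    proof (rule sum.cong[OF refl])
      fix \<gamma>
      show "pr \<beta> ** T ** pr \<gamma> *v v = (if \<gamma> = \<beta> then pr \<beta> *v (T *v (pr \<beta> *v v)) else 0)"
        using btypeD[OF assms, of \<beta> \<gamma>] by (auto simp: matrix_vector_mul_assoc matrix_mul_assoc zero_prod_def[symmetric])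
    qed
    then show ?thesis using pr_outside[of \<beta>] by (auto simp: sum.delta)
  qed
  have "pr \<beta> *v (T *v (pr \<alpha> *v v)) = pr \<beta> *v (T *v (pr \<beta> *v (pr \<alpha> *v v)))" by (rule *)
  then show "pr \<beta> *v (pr \<alpha> *v (T *v v)) = pr \<beta> *v (T *v (pr \<alpha> *v v))"
    using *[of v] by (cases "\<beta> = \<alpha>") (simp_all add: pr_orthogonal_vec)
qed

text \<open>Skewness of \<open>T\<close> for the polarizations moves it to the first argument, where
  it commutes with the projections.\<close>

lemma S_lie:
  assumes T: "lie T" "btype {(0, 0)} T"
  shows "S a T b = - h (T *v a) b"
proof -
  have "qf \<alpha> a (T *v cnj_vec (pr \<alpha> *v b)) = - qf \<alpha> (T *v a) (cnj_vec (pr \<alpha> *v b))" for \<alpha>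
  proof -
    let ?c = "cnj_vec (pr \<alpha> *v b)"
    have W: "pr \<alpha> *v a \<in> Wc (wt \<alpha>)" "?c \<in> Wc (wt \<alpha>)" "T *v ?c \<in> Wc (wt \<alpha>)" "pr \<alpha> *v (T *v a) \<in> Wc (wt \<alpha>)"
      using pr_wt lie_Wc[OF T(1)] by (simp_all add: Wc_cnj)
    have e: "qf \<alpha> y z = \<i> powi (fst \<alpha> - snd \<alpha>) * form_C Q (wt \<alpha>) (pr \<alpha> *v y) z" if "z \<in> Wc (wt \<alpha>)" for y z
      using qf_form_C[of "pr \<alpha> *v y" \<alpha> z] pr_wt that by (simp add: pr_orthogonal_vec qf_def)
    show ?thesis
      unfolding e[OF W(2)] e[OF W(3)] btype0_commute[OF T(2)]
      using lie_form[OF T(1) W(1,2)] by simp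
  qed
  then show ?thesis by (simp add: S_def h_qf sum_negf)
qed

text \<open>Conjugation turns a shift (r, s) into some (s - a, r - b) with a, b both zero or both
  positive. If this is (0, 0), then r and s are nonnegative, and r + s \<le> 0 makes them
  vanish.\<close>

lemma part0_cnj:
  assumes "lie X"
  shows "part {(0, 0)} (cnj_mat (part {(0, 0)} X)) = part {(0, 0)} (cnj_mat X)"
proof -
  let ?Y = "X - part {(0, 0)} X"
  have "btype ({(r, s). r + s \<le> 0} - {(0, 0)}) ?Y"
    unfolding btype_def
  proof (intro allI impI)
    fix \<alpha> \<beta> :: "int \<times> int" assume n: "\<beta> - \<alpha> \<notin> {(r, s). r + s \<le> 0} - {(0, 0)}"
    show "pr \<beta> ** ?Y ** pr \<alpha> = 0"
    proof (cases "\<beta> - \<alpha> \<in> {(0, 0)}")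
      case False
      then have "\<beta> - \<alpha> \<notin> {(r, s). r + s \<le> 0}" using n by (metis DiffI)
      then have "pr \<beta> ** X ** pr \<alpha> = 0" by (rule btypeD[OF lie_btype[OF assms]])
      then show ?thesis using False by (simp only: matrix_diff_ldistrib matrix_diff_rdistrib block_part if_False diff_self)
    qed (simp only: matrix_diff_ldistrib matrix_diff_rdistrib block_part if_True diff_self)
  qed
  then have "btype (- {(0, 0)}) (cnj_mat ?Y)" by (rule btype_cnj) auto
  then have "part {(0, 0)} (cnj_mat ?Y) = 0" by (rule part_disjoint) auto
  then show ?thesis by (simp add: cnj_mat_diff part_diff)
qed

text \<open>By \<open>S_lie\<close> the element acts, up to sign, on the conjugated argument; taken
  through the conjugation it becomes the (0, 0) part of its conjugate. The discrepancy
  \<open>?N\<close> lowers both degrees and is not seen by the projection onto the swapped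
  bidegree.\<close>

lemma adj_part0:
  assumes X: "lie X"
  shows "adj (part {(0, 0)} X) = - part {(0, 0)} (cnj_mat X)"
proof (rule adj_eqI)
  fix a b
  let ?T = "part {(0, 0)} X" and ?T' = "part {(0, 0)} (cnj_mat X)"
  let ?N = "cnj_mat ?T' - ?T"
  have "btype ({(0, 0)} \<union> {(r, s). r < 0 \<and> s < 0}) (cnj_mat ?T')"
    by (rule btype_cnj[OF btype_part]) auto
  moreover have "part {(0, 0)} (cnj_mat ?T') = ?T" using part0_cnj[OF lie_cnj[OF X]] by simp
  ultimately have N: "btype {(r, s). r < 0 \<and> s < 0} ?N"
  proof -
    assume B: "btype ({(0, 0)} \<union> {(r, s). r < 0 \<and> s < 0}) (cnj_mat ?T')" and E: "part {(0, 0)} (cnj_mat ?T') = ?T"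
    show ?thesis unfolding btype_def
    proof (intro allI impI)
      fix \<alpha> \<beta> :: "int \<times> int" assume n: "\<beta> - \<alpha> \<notin> {(r, s). r < 0 \<and> s < 0}"
      have "pr \<beta> ** ?T ** pr \<alpha> = (if \<beta> - \<alpha> \<in> {(0, 0)} then pr \<beta> ** cnj_mat ?T' ** pr \<alpha> else 0)"
        using block_part[of \<beta> "{(0, 0)}" "cnj_mat ?T'" \<alpha>] unfolding E .
      then show "pr \<beta> ** ?N ** pr \<alpha> = 0"
        using btypeD[OF B, of \<beta> \<alpha>] n by (auto simp: matrix_diff_ldistrib matrix_diff_rdistrib)
    qed
  qed
  have q: "qf \<alpha> a (?T *v cnj_vec (pr \<alpha> *v b)) = qf \<alpha> a (cnj_vec (pr \<alpha> *v (?T' *v b)))" for \<alpha>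
  proof -
    let ?c = "cnj_vec (pr \<alpha> *v b)"
    have "pr (prod.swap \<alpha>) *v (?N *v ?c) = 0"
      unfolding pr_mult_vec[of "prod.swap \<alpha>" ?N ?c]
    proof (rule sum.neutral, rule ballI)
      fix \<gamma>
      show "(pr (prod.swap \<alpha>) ** ?N ** pr \<gamma>) *v ?c = 0"
      proof (cases "prod.swap \<alpha> - \<gamma> \<in> {(r, s). r < 0 \<and> s < 0}")
        case True
        then have "pr \<gamma> *v ?c = 0" by (intro pr_cnj) (auto simp: minus_prod_def)
        then show ?thesis by (simp add: matrix_vector_mul_assoc[symmetric])
      next
        case False
        then show ?thesis using btypeD[OF N] by simp
      qed
    qed
    then have "pr (prod.swap \<alpha>) *v (?T *v ?c) = pr (prod.swap \<alpha>) *v (cnj_mat ?T' *v ?c)"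
      by (simp add: matrix_vector_mult_diff_rdistrib matrix_vector_mult_diff_distrib)
    also have "cnj_mat ?T' *v ?c = cnj_vec (pr \<alpha> *v (?T' *v b))"
      by (simp add: cnj_mat_vec[symmetric] btype0_commute[OF btype_part])
    finally show ?thesis by (simp add: qf_def)
  qed
  have "h (?T *v a) b = - S a ?T b" using S_lie[OF lie_part_lie[OF X] btype_part] by simp
  also have "\<dots> = - h a (?T' *v b)" unfolding S_def h_qf q ..
  finally show "h (?T *v a) b = h a (- ?T' *v b)" by (simp add: uminus_mat_vec h_minus)
qed

lemma mreg_block:
  fixes A B :: "'n cmat"
  assumes "mreg X"
  shows "mreg (\<lambda>z w. A ** X z w ** B)"
    "mdz (\<lambda>z w. A ** X z w ** B) = A ** mdz X ** B" "mdzb (\<lambda>z w. A ** X z w ** B) = A ** mdzb X ** B"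
    "mdw (\<lambda>z w. A ** X z w ** B) = A ** mdw X ** B" "mdwb (\<lambda>z w. A ** X z w ** B) = A ** mdwb X ** B"
    "mdzwb (\<lambda>z w. A ** X z w ** B) = A ** mdzwb X ** B" "mdzbw (\<lambda>z w. A ** X z w ** B) = A ** mdzbw X ** B"
  using assms by (simp_all add: mreg_mult mreg_const)

text \<open>Blocks outside \<open>T\<close> vanish identically near the origin, hence so do their
  derivatives.\<close>

lemma btype_derivatives:
  assumes \<epsilon>: "\<epsilon> > 0" and X: "mreg X" and T: "\<And>z w. norm z < \<epsilon> \<Longrightarrow> norm w < \<epsilon> \<Longrightarrow> btype T (X z w)"
  shows "btype T (mdz X)" "btype T (mdzb X)" "btype T (mdw X)" "btype T (mdwb X)" "btype T (mdzwb X)" "btype T (mdzbw X)"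
proof -
  have z: "pr \<beta> ** mdz X ** pr \<alpha> = 0 \<and> pr \<beta> ** mdzb X ** pr \<alpha> = 0 \<and> pr \<beta> ** mdw X ** pr \<alpha> = 0 \<and>
    pr \<beta> ** mdwb X ** pr \<alpha> = 0 \<and> pr \<beta> ** mdzwb X ** pr \<alpha> = 0 \<and> pr \<beta> ** mdzbw X ** pr \<alpha> = 0"
    if "\<beta> - \<alpha> \<notin> T" for \<alpha> \<beta>
  proof -
    have "0 = pr \<beta> ** X z w ** pr \<alpha>" if "norm z < \<epsilon>" "norm w < \<epsilon>" for z w
      using btypeD[OF T[OF that] \<open>\<beta> - \<alpha> \<notin> T\<close>] by simp
    from mreg_cong[where X = "\<lambda>z w. 0" and Y = "\<lambda>z w. pr \<beta> ** X z w ** pr \<alpha>", OF \<epsilon> this mreg_const(1)]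
    show ?thesis
      by (simp add: mreg_block[OF X] mreg_const)
  qed
  then show "btype T (mdz X)" "btype T (mdzb X)" "btype T (mdw X)" "btype T (mdwb X)" "btype T (mdzwb X)" "btype T (mdzbw X)"
    unfolding btype_def by blast+
qed

lemma mreg_part:
  assumes X: "mreg X"
  shows "mreg (\<lambda>z w. part T (X z w))"
    "mdz (\<lambda>z w. part T (X z w)) = part T (mdz X)" "mdwb (\<lambda>z w. part T (X z w)) = part T (mdwb X)"
    "mdzwb (\<lambda>z w. part T (X z w)) = part T (mdzwb X)"
proof -
  have r: "mreg (\<lambda>z w. if \<beta> - \<alpha> \<in> T then pr \<beta> ** X z w ** pr \<alpha> else 0)" for \<alpha> \<beta>
    by (cases "\<beta> - \<alpha> \<in> T") (simp_all add: mreg_block[OF X] mreg_const)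
  show *: "mreg (\<lambda>z w. part T (X z w))"
    unfolding part_def by (intro mreg_sum r)
  have blk: "(\<lambda>z w. pr \<beta> ** part T (X z w) ** pr \<alpha>) = (\<lambda>z w. if \<beta> - \<alpha> \<in> T then pr \<beta> ** X z w ** pr \<alpha> else 0)" for \<alpha> \<beta>
    by (simp add: block_part)
  show "mdz (\<lambda>z w. part T (X z w)) = part T (mdz X)"
  proof (rule eq_if_blocks)
    fix \<alpha> \<beta> show "pr \<beta> ** mdz (\<lambda>z w. part T (X z w)) ** pr \<alpha> = pr \<beta> ** part T (mdz X) ** pr \<alpha>"
      unfolding mreg_block(2)[OF *, symmetric] blk block_part
      by (cases "\<beta> - \<alpha> \<in> T") (simp_all add: mreg_block[OF X] mreg_const)
  qed
  show "mdwb (\<lambda>z w. part T (X z w)) = part T (mdwb X)"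
  proof (rule eq_if_blocks)
    fix \<alpha> \<beta> show "pr \<beta> ** mdwb (\<lambda>z w. part T (X z w)) ** pr \<alpha> = pr \<beta> ** part T (mdwb X) ** pr \<alpha>"
      unfolding mreg_block(5)[OF *, symmetric] blk block_part
      by (cases "\<beta> - \<alpha> \<in> T") (simp_all add: mreg_block[OF X] mreg_const)
  qed
  show "mdzwb (\<lambda>z w. part T (X z w)) = part T (mdzwb X)"
  proof (rule eq_if_blocks)
    fix \<alpha> \<beta> show "pr \<beta> ** mdzwb (\<lambda>z w. part T (X z w)) ** pr \<alpha> = pr \<beta> ** part T (mdzwb X) ** pr \<alpha>"
      unfolding mreg_block(6)[OF *, symmetric] blk block_part
      by (cases "\<beta> - \<alpha> \<in> T") (simp_all add: mreg_block[OF X] mreg_const)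
  qed
qed

lemma vreg_F:
  assumes \<epsilon>: "\<epsilon> > 0" and a: "vreg a" and F: "\<And>z w. norm z < \<epsilon> \<Longrightarrow> norm w < \<epsilon> \<Longrightarrow> a z w \<in> F p"
  shows "vdz a \<in> F p" "vdw a \<in> F p"
proof -
  have c: "vreg (\<lambda>z w. 0)" "vdz (\<lambda>z w. 0) = 0" "vdw (\<lambda>z w. 0) = 0"
    by (simp_all add: vreg_def vd_defs vec_eq_iff regular2_const d_const)
  have "pr \<alpha> *v vdz a = 0 \<and> pr \<alpha> *v vdw a = 0" if "fst \<alpha> < p" for \<alpha>
  proof -
    have "0 = pr \<alpha> *v a z w" if "norm z < \<epsilon>" "norm w < \<epsilon>" for z w
      using F[OF that] \<open>fst \<alpha> < p\<close> unfolding F_iff by (cases \<alpha>) simp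
    from vreg_cong[where X = "\<lambda>z w. 0" and Y = "\<lambda>z w. pr \<alpha> *v a z w", OF \<epsilon> this c(1)] show ?thesis using a by (simp add: vreg_mult mreg_const c)
  qed
  then show "vdz a \<in> F p" "vdw a \<in> F p" unfolding F_iff by blast+
qed

text \<open>Conjugation turns a derivative of the second argument into the conjugate one. Since
  \<open>T\<close> starts at the identity with vanishing first derivatives in the two directions,
  the twist contributes a single extra term.\<close>

lemma S_derivatives:
  assumes a: "vreg a" and b: "vreg b" and T: "mreg T" and T0: "T 0 0 = mat 1" "mdz T = 0" "mdwb T = 0"
  shows "regular2 (\<lambda>z w. S (a z w) (T z w) (b z w))"
    "dz (\<lambda>z w. S (a z w) (T z w) (b z w)) = h (vdz a) (b 0 0) + h (a 0 0) (vdzb b)"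
    "dwb (\<lambda>z w. S (a z w) (T z w) (b z w)) = h (vdwb a) (b 0 0) + h (a 0 0) (vdw b)"
    "dzwb (\<lambda>z w. S (a z w) (T z w) (b z w)) = h (vdzwb a) (b 0 0) + h (vdz a) (vdw b) + h (vdwb a) (vdzb b)
       + h (a 0 0) (vdzbw b) + S (a 0 0) (mdzwb T) (b 0 0)"
proof -
  have pb: "vreg (\<lambda>z w. pr \<alpha> *v b z w)" "vdz (\<lambda>z w. pr \<alpha> *v b z w) = pr \<alpha> *v vdz b"
    "vdzb (\<lambda>z w. pr \<alpha> *v b z w) = pr \<alpha> *v vdzb b" "vdw (\<lambda>z w. pr \<alpha> *v b z w) = pr \<alpha> *v vdw b"
    "vdzbw (\<lambda>z w. pr \<alpha> *v b z w) = pr \<alpha> *v vdzbw b" for \<alpha>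
    using b by (simp_all add: vreg_mult mreg_const)
  let ?y = "\<lambda>\<alpha> z w. T z w *v cnj_vec (pr \<alpha> *v b z w)"
  have y: "vreg (?y \<alpha>)" "vdz (?y \<alpha>) = cnj_vec (pr \<alpha> *v vdzb b)" "vdwb (?y \<alpha>) = cnj_vec (pr \<alpha> *v vdw b)"
    "vdzwb (?y \<alpha>) = mdzwb T *v cnj_vec (pr \<alpha> *v b 0 0) + cnj_vec (pr \<alpha> *v vdzbw b)" for \<alpha>
    using T0 by (simp_all add: vreg_mult[OF T vreg_cnj(1)[OF pb(1)]] vreg_cnj[OF pb(1)] pb)
  note R = regular2_cbilinear[OF cbilinear_qf a y(1)]
  show "regular2 (\<lambda>z w. S (a z w) (T z w) (b z w))"
    unfolding S_def by (intro regular2_sum(1) R(1))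
  show "dz (\<lambda>z w. S (a z w) (T z w) (b z w)) = h (vdz a) (b 0 0) + h (a 0 0) (vdzb b)"
    unfolding S_def by (simp add: regular2_sum(2) R y T0 h_qf sum.distrib)
  show "dwb (\<lambda>z w. S (a z w) (T z w) (b z w)) = h (vdwb a) (b 0 0) + h (a 0 0) (vdw b)"
    unfolding S_def by (simp add: regular2_sum(5) R y T0 h_qf sum.distrib)
  show "dzwb (\<lambda>z w. S (a z w) (T z w) (b z w)) = h (vdzwb a) (b 0 0) + h (vdz a) (vdw b) + h (vdwb a) (vdzb b)
       + h (a 0 0) (vdzbw b) + S (a 0 0) (mdzwb T) (b 0 0)"
    unfolding S_def by (simp add: regular2_sum(6) R y T0 h_qf qf_lin sum.distrib)
qed

end

text \<open>Two independent parameters carry the two tangent directions, so that a mixed derivative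
  at the origin is sesquilinear in \<open>u\<close> and \<open>v\<close>, as the curvature
  is.\<close>

locale moving_mhs = polarized_mhs W Q F
  for W :: "'n::finite weight_filtration" and Q :: "'n graded_forms" and F :: "'n filtration" +
  fixes u v :: "'n cmat" and \<epsilon> :: real
  assumes \<epsilon>: "\<epsilon> > 0" and lie_u: "lie u" and lie_v: "lie v"
    and u_type: "btype {(r, s). r < 0} u" and v_type: "btype {(r, s). r < 0} v"
    and moving: "\<And>z w. norm z < \<epsilon> \<Longrightarrow> norm w < \<epsilon> \<Longrightarrow> polarized_mhs W Q (act (mexp (cscale_mat z u + cscale_mat w v)) F)"
begin

abbreviation "xx z w \<equiv> cscale_mat z u + cscale_mat w v"

lemma xx_0 [simp]: "xx 0 0 = 0"
  by (simp add: cscale_mat_def map_matrix_def vec_eq_iff)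

lemma moved_xx: "norm z < \<epsilon> \<Longrightarrow> norm w < \<epsilon> \<Longrightarrow> moved_mhs W Q F (xx z w)"
  using moving[of z w] lie_add[OF lie_cscale[OF lie_u] lie_cscale[OF lie_v]] polarized_mhs_axioms
  by (auto simp: moved_mhs_def moved_mhs_axioms_def)

lemma xx_minus: "- xx z w = cscale_mat z (- u) + cscale_mat w (- v)"
  by (simp add: cscale_mat_def map_matrix_def vec_eq_iff)

lemma Ei: "mreg (\<lambda>z w. mexp (- xx z w))" "mdz (\<lambda>z w. mexp (- xx z w)) = - u" "mdzb (\<lambda>z w. mexp (- xx z w)) = 0"
  "mdw (\<lambda>z w. mexp (- xx z w)) = - v" "mdwb (\<lambda>z w. mexp (- xx z w)) = 0" "mdzwb (\<lambda>z w. mexp (- xx z w)) = 0"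
  "mdzbw (\<lambda>z w. mexp (- xx z w)) = 0"
  unfolding xx_minus by (rule mreg_mexp)+

lemma uminus_mat_mult: "(- A) ** B = - (A ** (B :: 'n cmat))" "A ** (- B) = - (A ** (B :: 'n cmat))"
  by (simp_all add: matrix_matrix_mult_def vec_eq_iff sum_negf)

text \<open>The first factor is holomorphic in the parameters and the second antiholomorphic, so the
  mixed derivatives are products of first derivatives.\<close>

lemma MM: "mreg (\<lambda>z w. Mm (xx z w))" "mdz (\<lambda>z w. Mm (xx z w)) = - u" "mdzb (\<lambda>z w. Mm (xx z w)) = cnj_mat u"
  "mdw (\<lambda>z w. Mm (xx z w)) = - v" "mdwb (\<lambda>z w. Mm (xx z w)) = cnj_mat v"
  "mdzwb (\<lambda>z w. Mm (xx z w)) = - (u ** cnj_mat v)" "mdzbw (\<lambda>z w. Mm (xx z w)) = - (v ** cnj_mat u)"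
proof -
  note m = mreg_mult[OF Ei(1) mreg_cnj(1)[OF mreg_mexp(1)[of u v]]]
  note c = mreg_cnj[OF mreg_mexp(1)[of u v]]
  show "mreg (\<lambda>z w. Mm (xx z w))" unfolding Mm_def by (rule m(1))
  show "mdz (\<lambda>z w. Mm (xx z w)) = - u" "mdzb (\<lambda>z w. Mm (xx z w)) = cnj_mat u"
    "mdw (\<lambda>z w. Mm (xx z w)) = - v" "mdwb (\<lambda>z w. Mm (xx z w)) = cnj_mat v"
    "mdzwb (\<lambda>z w. Mm (xx z w)) = - (u ** cnj_mat v)" "mdzbw (\<lambda>z w. Mm (xx z w)) = - (v ** cnj_mat u)"
    unfolding Mm_def m Ei c mreg_mexp by (simp_all add: uminus_mat_mult)
qed

lemma Mm_0: "Mm 0 = mat 1" by (simp add: Mm_def)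

text \<open>By \<open>vpP_C\<close> the pulled back projections are \<open>P a b\<close> times the
  inverse of a matrix that depends on the parameters only through \<open>Mm\<close>, so their
  regularity comes from that of the exponential.\<close>

lemma mreg_vp: "mreg (\<lambda>z w. vp (xx z w) \<alpha>)"
proof -
  define C where "C a b z w = P a b + Mm (xx z w) ** (mat 1 - P a b)" for a b z w
  define B where "B a b z w = (SOME B. C a b z w ** B = mat 1)" for a b z w
  have CB: "C a b z w ** B a b z w = mat 1" if "norm z < \<epsilon>" "norm w < \<epsilon>" for a b z w
    unfolding B_def C_def by (rule someI_ex[OF moved_mhs.C_invertible[OF moved_xx[OF that]]])
  have mC: "mreg (C a b)" for a b
    unfolding C_def by (intro mreg_add(1) mreg_mult(1) mreg_const MM(1))
  have B: "mreg (B a b)" for a b by (rule mreg_inverse[OF \<epsilon> mC CB])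
  have "mreg (\<lambda>z w. P (fst \<alpha>) (snd \<alpha>) ** B (fst \<alpha>) (snd \<alpha>) z w + (- P (fst \<alpha>) (snd \<alpha> - 1)) ** B (fst \<alpha>) (snd \<alpha> - 1) z w)"
    by (intro mreg_add(1) mreg_mult(1) mreg_const B)
  then show ?thesis
  proof (rule mreg_cong(1)[OF \<epsilon>, rotated])
    fix z w :: complex assume zw: "norm z < \<epsilon>" "norm w < \<epsilon>"
    interpret Y: moved_mhs W Q F "xx z w" using zw by (rule moved_xx)
    have "Y.vpP a b = P a b ** B a b z w" for a b
    proof -
      have "P a b ** B a b z w = Y.vpP a b ** (C a b z w ** B a b z w)"
        using Y.vpP_C[of a b] by (simp add: C_def matrix_mul_assoc)
      then show ?thesis using CB[OF zw] by simp
    qed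
    then show "P (fst \<alpha>) (snd \<alpha>) ** B (fst \<alpha>) (snd \<alpha>) z w + (- P (fst \<alpha>) (snd \<alpha> - 1)) ** B (fst \<alpha>) (snd \<alpha> - 1) z w = vp (xx z w) \<alpha>"
      by (simp add: Y.vp_vpP uminus_mat_mult)
  qed
qed

abbreviation "ff z w \<equiv> fm (xx z w)"
abbreviation "ll z w \<equiv> Lm (xx z w)"

lemma mreg_ff: "mreg ff"
  unfolding fm_def by (intro mreg_sum mreg_mult(1) mreg_const mreg_vp)

lemma mreg_ll: "mreg ll"
  unfolding Lm_def by (intro mreg_mult(1) mreg_ff MM)

lemma ff_type: "norm z < \<epsilon> \<Longrightarrow> norm w < \<epsilon> \<Longrightarrow> btype Np (ff z w - mat 1)"
  using moved_mhs.fm_type[OF moved_xx] .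

lemma ll_type: "norm z < \<epsilon> \<Longrightarrow> norm w < \<epsilon> \<Longrightarrow> btype ({(0, 0)} \<union> {(r, s). r < 0}) (ll z w)"
  using moved_mhs.Lm_type[OF moved_xx] .

text \<open>At x = 0 the two factors agree, so a shift of \<open>fm 0 - mat 1\<close> would be
  allowed both in \<open>Np\<close> and for L, and these sets are disjoint.\<close>

lemma ff_0: "fm 0 = mat 1" and ll_0: "Lm 0 = mat 1"
proof -
  have L: "Lm 0 = fm 0" by (simp add: Lm_def Mm_0)
  have "btype Np (fm 0 - mat 1)" "btype ({(0, 0)} \<union> {(r, s). r < 0}) (fm 0)"
    using ff_type[of 0 0] ll_type[of 0 0] \<epsilon> L by simp_all
  then have "btype Np (fm 0 - mat 1)" "btype ({(0, 0)} \<union> {(r, s). r < 0}) (fm 0 - mat 1)"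
    by (auto intro!: btype_diff btype_one)
  then have "btype (Np \<inter> ({(0, 0)} \<union> {(r, s). r < 0})) (fm 0 - mat 1)" by (rule btype_Int)
  moreover have "Np \<inter> ({(0, 0)} \<union> {(r, s). r < 0}) = {}" by (auto simp: Np_def)
  ultimately have "btype {} (fm 0 - mat 1)" by (simp only:)
  then have "part UNIV (fm 0 - mat 1) = 0" by (rule part_disjoint) simp
  moreover have "part UNIV (fm 0 - mat 1) = fm 0 - mat 1" by (rule part_btype) (simp add: btype_def)
  ultimately show "fm 0 = mat 1" by simp
  then show "Lm 0 = mat 1" using L by simp
qed

lemma ff_derivative_types:
  "btype Np (mdz ff)" "btype Np (mdzb ff)" "btype Np (mdw ff)" "btype Np (mdwb ff)" "btype Np (mdzwb ff)" "btype Np (mdzbw ff)"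
proof -
  let ?g = "\<lambda>z w. ff z w + (- mat 1)"
  have g: "mreg ?g" by (intro mreg_add(1) mreg_ff mreg_const)
  have "btype Np (?g z w)" if "norm z < \<epsilon>" "norm w < \<epsilon>" for z w using ff_type[OF that] by simp
  from btype_derivatives[OF \<epsilon> g this]
  show "btype Np (mdz ff)" "btype Np (mdzb ff)" "btype Np (mdw ff)" "btype Np (mdwb ff)" "btype Np (mdzwb ff)" "btype Np (mdzbw ff)"
    unfolding mreg_add[OF mreg_ff mreg_const(1)] mreg_const by simp_all
qed

lemmas ll_derivative_types = btype_derivatives[OF \<epsilon> mreg_ll ll_type]

lemma ll_derivatives:
  "mdz ll = mdz ff - u" "mdzb ll = mdzb ff + cnj_mat u" "mdw ll = mdw ff - v" "mdwb ll = mdwb ff + cnj_mat v"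
  "mdzwb ll = mdzwb ff + mdz ff ** cnj_mat v + (- (mdwb ff ** u) - u ** cnj_mat v)"
  "mdzbw ll = mdzbw ff - mdzb ff ** v + (mdw ff ** cnj_mat u - v ** cnj_mat u)"
proof -
  have e: "ll = (\<lambda>z w. ff z w ** Mm (xx z w))" by (simp add: Lm_def fun_eq_iff)
  show "mdz ll = mdz ff - u" "mdzb ll = mdzb ff + cnj_mat u" "mdw ll = mdw ff - v" "mdwb ll = mdwb ff + cnj_mat v"
  "mdzwb ll = mdzwb ff + mdz ff ** cnj_mat v + (- (mdwb ff ** u) - u ** cnj_mat v)"
  "mdzbw ll = mdzbw ff - mdzb ff ** v + (mdw ff ** cnj_mat u - v ** cnj_mat u)"
    unfolding e by (simp_all add: mreg_mult[OF mreg_ff MM(1)] MM ff_0 Mm_0 uminus_mat_mult)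
qed

lemma cnj_type: assumes "btype {(r, s). r < 0} X" shows "btype {(r, s). s < 0} (cnj_mat X)"
  by (rule btype_cnj[OF assms]) auto

lemma part_Np_ll: "btype ({(0, 0)} \<union> {(r, s). r < 0}) X \<Longrightarrow> part Np X = 0"
  by (rule part_disjoint) (auto simp: Np_def)

lemma part_Np_neg: "btype {(r, s). r < 0} X \<Longrightarrow> part Np X = 0" "btype {(r, s). r < 0} X \<Longrightarrow> part {(0, 0)} X = 0"
  by (rule part_disjoint[where T = "{(r, s). r < 0}"]; auto simp: Np_def)+

text \<open>First derivatives of L have no component in \<open>Np\<close> and those of f no other,
  so the \<open>Np\<close> part of the differentiated product determines the latter. In the
  holomorphic directions it vanishes, because \<open>u\<close> and \<open>v\<close> lower the first
  degree.\<close>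

lemma ff_first:
  "mdz ff = 0" "mdw ff = 0" "mdzb ff = - part Np (cnj_mat u)" "mdwb ff = - part Np (cnj_mat v)"
proof -
  have "part Np (mdz ff - u) = 0" "part Np (mdw ff - v) = 0" "part Np (mdzb ff + cnj_mat u) = 0" "part Np (mdwb ff + cnj_mat v) = 0"
    unfolding ll_derivatives[symmetric] by (intro part_Np_ll ll_derivative_types; assumption)+
  then show "mdz ff = 0" "mdw ff = 0" "mdzb ff = - part Np (cnj_mat u)" "mdwb ff = - part Np (cnj_mat v)"
    using part_btype[OF ff_derivative_types(1)] part_btype[OF ff_derivative_types(2)]
      part_btype[OF ff_derivative_types(3)] part_btype[OF ff_derivative_types(4)]
      part_Np_neg[OF u_type] part_Np_neg[OF v_type]
    by (simp_all add: part_diff part_add eq_neg_iff_add_eq_0)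
qed

lemma cnj_minus_part_type:
  assumes "lie X" "btype {(r, s). r < 0} X"
  shows "btype {(r, s). r < 0} (cnj_mat X - part Np (cnj_mat X))"
  unfolding btype_def
proof (intro allI impI)
  fix \<alpha> \<beta> :: "int \<times> int" assume "\<beta> - \<alpha> \<notin> {(r, s). r < 0}"
  then show "pr \<beta> ** (cnj_mat X - part Np (cnj_mat X)) ** pr \<alpha> = 0"
    using btypeD[OF cnj_type[OF assms(2)], of \<beta> \<alpha>]
    by (auto simp: matrix_diff_ldistrib matrix_diff_rdistrib block_part Np_def)
qed

text \<open>Without its \<open>Np\<close> part the conjugate of \<open>X\<close> has shifts with r <
  0, and multiplication by \<open>Y\<close> keeps r < 0. Both projections ignore such terms, so the
  truncated product may be completed to the bracket.\<close>

lemma bracket_part: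
  assumes "lie X" "btype {(r, s). r < 0} X" "btype {(r, s). r < 0} Y"
  shows "part Np (part Np (cnj_mat X) ** Y - Y ** cnj_mat X) = part Np (bracket (cnj_mat X) Y)"
    "part {(0, 0)} (part Np (cnj_mat X) ** Y - Y ** cnj_mat X) = part {(0, 0)} (bracket (cnj_mat X) Y)"
proof -
  have "btype {(r, s). r < 0} ((cnj_mat X - part Np (cnj_mat X)) ** Y)"
    by (rule btype_mult[OF cnj_minus_part_type[OF assms(1,2)] assms(3)]) auto
  note Z = part_Np_neg[OF this]
  have e: "part Np (cnj_mat X) ** Y - Y ** cnj_mat X = bracket (cnj_mat X) Y - (cnj_mat X - part Np (cnj_mat X)) ** Y"
    by (simp add: bracket_def matrix_diff_rdistrib)
  show "part Np (part Np (cnj_mat X) ** Y - Y ** cnj_mat X) = part Np (bracket (cnj_mat X) Y)"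
    "part {(0, 0)} (part Np (cnj_mat X) ** Y - Y ** cnj_mat X) = part {(0, 0)} (bracket (cnj_mat X) Y)"
    unfolding e part_diff Z by simp_all
qed

lemma ff_second: "mdzwb ff = - part Np (bracket (cnj_mat v) u)" "mdzbw ff = - part Np (bracket (cnj_mat u) v)"
proof -
  have "part Np (mdzwb ll) = 0" "part Np (mdzbw ll) = 0"
    by (intro part_Np_ll ll_derivative_types; assumption)+
  moreover have "mdzwb ll = mdzwb ff + (part Np (cnj_mat v) ** u - u ** cnj_mat v)"
    "mdzbw ll = mdzbw ff + (part Np (cnj_mat u) ** v - v ** cnj_mat u)"
    unfolding ll_derivatives ff_first by (simp_all add: uminus_mat_mult)
  ultimately show "mdzwb ff = - part Np (bracket (cnj_mat v) u)" "mdzbw ff = - part Np (bracket (cnj_mat u) v)"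
    using part_btype[OF ff_derivative_types(5)] part_btype[OF ff_derivative_types(6)]
      bracket_part(1)[OF lie_v v_type u_type] bracket_part(1)[OF lie_u u_type v_type]
    by (simp_all add: part_add eq_neg_iff_add_eq_0)
qed

abbreviation "tt z w \<equiv> part {(0, 0)} (ll z w)"

text \<open>\<open>u\<close> lowers the first degree and the conjugate of \<open>v\<close> the
  second, so neither has a (0, 0) component and the twist has no first order term in these
  directions.\<close>

lemma tt: "mreg tt" "tt 0 0 = mat 1" "mdz tt = 0" "mdwb tt = 0" "mdzwb tt = part {(0, 0)} (bracket (cnj_mat v) u)"
proof -
  show "mreg tt" by (rule mreg_part(1)[OF mreg_ll])
  show "tt 0 0 = mat 1" using part_btype[OF btype_one[of "{(0, 0)}"]] by (simp add: ll_0)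
  have n: "part {(0, 0)} (part Np X) = 0" for X by (rule part_disjoint[OF btype_part]) (auto simp: Np_def)
  have c: "part {(0, 0)} (cnj_mat v) = 0" by (rule part_disjoint[OF cnj_type[OF v_type]]) auto
  show "mdz tt = 0" unfolding mreg_part[OF mreg_ll] ll_derivatives ff_first
    by (simp add: part_minus part_Np_neg(2)[OF u_type])
  show "mdwb tt = 0" unfolding mreg_part[OF mreg_ll] ll_derivatives ff_first
    by (simp add: part_minus part_add part_diff n c)
  have e: "mdzwb ll = - part Np (bracket (cnj_mat v) u) + (part Np (cnj_mat v) ** u - u ** cnj_mat v)"
    unfolding ll_derivatives ff_first ff_second by (simp add: uminus_mat_mult)
  show "mdzwb tt = part {(0, 0)} (bracket (cnj_mat v) u)"
    unfolding mreg_part[OF mreg_ll] e part_add part_minus n bracket_part(2)[OF lie_v v_type u_type] by simp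
qed

end

section \<open>The Chern curvature\<close>

lemma cscale_mat_expand: "cscale_mat z u = Re z *\<^sub>R u + Im z *\<^sub>R cscale_mat \<i> u"
  by (simp add: cscale_mat_def map_matrix_def vec_eq_iff complex_eq_iff)

lemma cscale_mat_scaleR: "r *\<^sub>R cscale_mat z u = cscale_mat (of_real r * z) u"
  by (simp add: cscale_mat_def map_matrix_def vec_eq_iff) (simp add: scaleR_conv_of_real)

lemma cscale_mat_bounded_linear: "bounded_linear (\<lambda>z. cscale_mat z u)"
  by (subst cscale_mat_expand) (intro bounded_linear_intros bounded_linear_Re bounded_linear_Im)

lemma has_vector_derivative_along:
  fixes G :: "complex \<Rightarrow> complex"
  assumes "G differentiable (at 0)"
  shows "((\<lambda>t. G (of_real t * c)) has_vector_derivative (c * wz G 0 + cnj c * wzb G 0)) (at 0)"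
proof -
  have c: "((\<lambda>t. of_real t * c) has_derivative (\<lambda>t. of_real t * c)) (at (0 :: real))"
    by (intro bounded_linear_imp_has_derivative bounded_linear_intros bounded_linear_of_real)
  have "(G has_derivative (\<lambda>h. h * wz G 0 + cnj h * wzb G 0)) (at (of_real 0 * c))"
    using has_derivative_wirtinger[OF assms] by simp
  from has_derivative_compose[OF c this]
  show ?thesis unfolding has_vector_derivative_def
    by (rule has_derivative_eq_rhs) (simp add: fun_eq_iff scaleR_conv_of_real algebra_simps)
qed

text \<open>On the complex line through \<open>x\<close> in direction \<open>u\<close>, the two real
  directional derivatives are those of a function of one complex variable with a total
  derivative.\<close>

lemma wirtinger_eq:
  assumes G: "(\<lambda>w. f (x + cscale_mat w u)) differentiable (at 0)"
  shows "wirtinger f u x = wz (\<lambda>w. f (x + cscale_mat w u)) 0"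
    and "wirtinger_bar f u x = wzb (\<lambda>w. f (x + cscale_mat w u)) 0"
proof -
  let ?G = "\<lambda>w. f (x + cscale_mat w u)"
  have "dir_deriv f (cscale_mat c u) x = c * wz ?G 0 + cnj c * wzb ?G 0" for c
    unfolding dir_deriv_def cscale_mat_scaleR
    by (rule vector_derivative_at[OF has_vector_derivative_along[OF G]])
  from this[of 1] this[of \<i>]
  have D: "dir_deriv f u x = wz ?G 0 + wzb ?G 0" "dir_deriv f (cscale_mat \<i> u) x = \<i> * wz ?G 0 - \<i> * wzb ?G 0"
    using cscale_mat_of_real[of 1 u] by simp_all
  show "wirtinger f u x = wz ?G 0" "wirtinger_bar f u x = wzb ?G 0"
    unfolding wirtinger_def wirtinger_bar_def D by (simp_all add: algebra_simps)
qed

text \<open>Makes the rules for two variables available for functions of \<open>w\<close>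
  alone.\<close>

lemma regular2_second: "G differentiable (at 0) \<Longrightarrow> regular2 (\<lambda>z w. G w)"
  by (simp add: regular2_def)

text \<open>A \<open>k \<times> k\<close> matrix, \<open>k \<le> n\<close>, is completed by an identity block to a matrix indexed by \<open>'n\<close>, so that
  determinants and Cramer's rule are available for it.\<close>

definition embed :: "(nat \<Rightarrow> 'n::finite) \<Rightarrow> nat \<Rightarrow> (nat \<Rightarrow> nat \<Rightarrow> complex) \<Rightarrow> 'n cmat" where
  "embed \<phi> k A = (\<chi> a b. if a \<in> \<phi> ` {..<k} \<and> b \<in> \<phi> ` {..<k}
     then A (inv_into {..<k} \<phi> a) (inv_into {..<k} \<phi> b) else if a = b then 1 else 0)"

lemma embed_row:
  assumes \<phi>: "inj_on \<phi> {..<k}" and i: "i < k"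
  shows "(\<Sum>b\<in>UNIV. embed \<phi> k A $ \<phi> i $ b * y b) = (\<Sum>l<k. A i l * y (\<phi> l))"
proof -
  let ?J = "\<phi> ` {..<k}"
  have "(\<Sum>b\<in>UNIV. embed \<phi> k A $ \<phi> i $ b * y b) = (\<Sum>b\<in>?J. embed \<phi> k A $ \<phi> i $ b * y b)"
    by (rule sum.mono_neutral_right) (use i in \<open>auto simp: embed_def\<close>)
  also have "\<dots> = (\<Sum>l<k. embed \<phi> k A $ \<phi> i $ \<phi> l * y (\<phi> l))"
    by (simp add: sum.reindex[OF \<phi>])
  also have "\<dots> = (\<Sum>l<k. A i l * y (\<phi> l))"
    by (intro sum.cong refl) (use i in \<open>simp add: embed_def inv_into_f_f[OF \<phi>]\<close>)
  finally show ?thesis .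
qed

text \<open>Injectivity of the small matrix passes to the completed one, whose identity block makes
  the remaining coordinates vanish. Restricting the inverse to the image of \<phi> gives the inverse
  of the small matrix, which injectivity makes unique.\<close>

lemma embed_inverse:
  assumes \<phi>: "inj_on \<phi> {..<k}"
    and ker0: "\<forall>c. (\<forall>i<k. (\<Sum>l<k. A i l * c l) = 0) \<longrightarrow> (\<forall>l<k. c l = 0)"
  shows "\<exists>B. embed \<phi> k A ** B = mat 1"
    and "embed \<phi> k A ** B = mat 1 \<Longrightarrow> i < k \<Longrightarrow> j < k \<Longrightarrow> (\<Sum>l<k. A i l * B $ \<phi> l $ \<phi> j) = (if i = j then 1 else 0)"
    and "embed \<phi> k A ** B = mat 1 \<Longrightarrow> i < k \<Longrightarrow> j < k \<Longrightarrow> nmat_inverse k A i j = B $ \<phi> i $ \<phi> j"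
proof -
  have ker: "c l = 0" if "\<And>i. i < k \<Longrightarrow> (\<Sum>l<k. A i l * c l) = 0" "l < k" for c l
    using ker0 that by blast
  have "x = 0" if x: "embed \<phi> k A *v x = 0" for x
  proof -
    have row: "(\<Sum>b\<in>UNIV. embed \<phi> k A $ a $ b * x $ b) = 0" for a
      using arg_cong[OF x, of "\<lambda>y. y $ a"] by (simp add: matrix_vector_mult_def)
    have 1: "x $ \<phi> l = 0" if "l < k" for l
    proof (rule ker[OF _ that])
      fix i assume "i < k"
      then show "(\<Sum>l<k. A i l * x $ \<phi> l) = 0"
        using row[of "\<phi> i"] embed_row[OF \<phi>, of i A "\<lambda>b. x $ b"] by simp
    qed
    have 2: "x $ a = 0" if "a \<notin> \<phi> ` {..<k}" for a
    proof -
      have "(\<Sum>b\<in>UNIV. embed \<phi> k A $ a $ b * x $ b) = (\<Sum>b\<in>UNIV. if b = a then x $ a else 0)"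
        by (intro sum.cong refl) (use that in \<open>auto simp: embed_def\<close>)
      then show ?thesis using row[of a] by simp
    qed
    have "x $ a = 0" for a using 1 2[of a] by (cases "a \<in> \<phi> ` {..<k}") auto
    then show ?thesis by (simp add: vec_eq_iff)
  qed
 then obtain B0 where "B0 ** embed \<phi> k A = mat 1" using matrix_left_invertible_ker[of "embed \<phi> k A"] by blast
  then show "\<exists>B. embed \<phi> k A ** B = mat 1" using matrix_left_right_inverse by blast
  show inv: "(\<Sum>l<k. A i l * B $ \<phi> l $ \<phi> j) = (if i = j then 1 else 0)"
    if B: "embed \<phi> k A ** B = mat 1" and "i < k" "j < k" for i j B
  proof -
    have "(\<Sum>b\<in>UNIV. embed \<phi> k A $ \<phi> i $ b * B $ b $ \<phi> j) = (if \<phi> i = \<phi> j then 1 else 0)"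
      using arg_cong[OF B, of "\<lambda>M. M $ \<phi> i $ \<phi> j"] by (simp add: matrix_matrix_mult_def mat_def)
    moreover have "\<phi> i = \<phi> j \<longleftrightarrow> i = j" using that inj_onD[OF \<phi>] by auto
    ultimately show ?thesis using embed_row[OF \<phi> \<open>i < k\<close>, of A "\<lambda>b. B $ b $ \<phi> j"] by simp
  qed
  assume B: "embed \<phi> k A ** B = mat 1" and ij: "i < k" "j < k"
  let ?N = "\<lambda>i j. if i < k \<and> j < k then B $ \<phi> i $ \<phi> j else 0"
  have "nmat_inverse k A = ?N"
    unfolding nmat_inverse_def
  proof (rule the_equality)
    show "(\<forall>i<k. \<forall>j<k. (\<Sum>l<k. A i l * ?N l j) = (if i = j then 1 else 0)) \<and> (\<forall>i j. \<not> (i < k \<and> j < k) \<longrightarrow> ?N i j = 0)"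
      using inv[OF B] by auto
    fix C assume C: "(\<forall>i<k. \<forall>j<k. (\<Sum>l<k. A i l * C l j) = (if i = j then 1 else 0)) \<and> (\<forall>i j. \<not> (i < k \<and> j < k) \<longrightarrow> C i j = 0)"
    show "C = ?N"
    proof (intro ext)
      fix l j
      show "C l j = ?N l j"
      proof (cases "l < k \<and> j < k")
        case True
        have "C l j - B $ \<phi> l $ \<phi> j = 0"
        proof (rule ker[where c = "\<lambda>l. C l j - B $ \<phi> l $ \<phi> j"])
          fix i assume "i < k"
          then show "(\<Sum>l<k. A i l * (C l j - B $ \<phi> l $ \<phi> j)) = 0"
            using C inv[OF B, of i j] True by (simp add: right_diff_distrib sum_subtractf)
        qed (use True in simp)
        then show ?thesis using True by simp
      qed (use C in auto)
    qed
  qed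
  then show "nmat_inverse k A i j = B $ \<phi> i $ \<phi> j" using ij by simp
qed

lemma independent_image_sum_0:
  fixes e :: "nat \<Rightarrow> 'n::finite cvec"
  assumes "inj_on e {..<k}" "vec.independent (e ` {..<k})" "(\<Sum>l<k. c l *s e l) = 0" "l < k"
  shows "c l = 0"
proof -
  let ?d = "\<lambda>x. c (inv_into {..<k} e x)"
  have "(\<Sum>x\<in>e ` {..<k}. ?d x *s x) = (\<Sum>l<k. c l *s e l)"
    unfolding sum.reindex[OF assms(1)] by (intro sum.cong refl) (simp add: inv_into_f_f[OF assms(1)])
  then have "?d (e l) = 0"
    using vec.independentD[OF assms(2), of "e ` {..<k}" ?d "e l"] assms(3,4) by simp
  then show ?thesis using assms(1,4) by (simp add: inv_into_f_f)
qed

text \<open>The section is differentiable only within \<open>U\<close>, which need not be open among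
  all matrices. Along complex lines that stay in \<open>U\<close> its complex linear derivative
  becomes an ordinary one; joint continuity comes from continuity on \<open>U\<close>.\<close>

lemma section_holomorphic2:
  fixes u v :: "'n::finite cmat" and s :: "'n cmat \<Rightarrow> 'n cvec"
  assumes s: "holomorphic_section U s"
    and U: "\<And>z w. norm z < \<epsilon> \<Longrightarrow> norm w < \<epsilon> \<Longrightarrow> cscale_mat z u + cscale_mat w v \<in> U"
  shows "holomorphic2 \<epsilon> (\<lambda>z w. s (cscale_mat z u + cscale_mat w v) $ i)"
proof -
  have line: "(\<lambda>\<zeta>. s (cscale_mat \<zeta> a + b) $ i) holomorphic_on ball 0 \<epsilon>"
    if m: "\<And>\<zeta>. norm \<zeta> < \<epsilon> \<Longrightarrow> cscale_mat \<zeta> a + b \<in> U" for a b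
    unfolding holomorphic_on_open[OF open_ball]
  proof
    fix z assume z: "z \<in> ball (0 :: complex) \<epsilon>"
    let ?c = "\<lambda>\<zeta>. cscale_mat \<zeta> a + b"
    obtain L where L: "(s has_derivative L) (at (?c z) within U)" "\<And>y. L (cscale_mat \<i> y) = \<i> *s L y"
      using s m z unfolding holomorphic_section_def by (metis mem_ball_0)
    have lin: "linear L" using L(1) has_derivative_linear by blast
    have Lc: "L (cscale_mat h a) = h *s L a" for h
    proof -
      have "L (cscale_mat h a) = Re h *\<^sub>R L a + Im h *\<^sub>R (\<i> *s L a)"
        by (subst cscale_mat_expand) (simp add: linear_add[OF lin] linear_scale[OF lin] L(2))
      also have "\<dots> = h *s L a" by (simp add: vec_eq_iff complex_eq_iff)
      finally show ?thesis .
    qed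
    have c: "(?c has_derivative (\<lambda>h. cscale_mat h a)) (at z within ball 0 \<epsilon>)"
      using has_derivative_add[OF bounded_linear_imp_has_derivative[OF cscale_mat_bounded_linear] has_derivative_const] by simp
    have "((\<lambda>\<zeta>. s (?c \<zeta>)) has_derivative (\<lambda>h. L (cscale_mat h a))) (at z within ball 0 \<epsilon>)"
      by (rule has_derivative_in_compose[OF c has_derivative_subset[OF L(1)]]) (use m in auto)
    then have "((\<lambda>\<zeta>. s (?c \<zeta>) $ i) has_derivative (\<lambda>h. L (cscale_mat h a) $ i)) (at z within ball 0 \<epsilon>)"
      by (rule bounded_linear.has_derivative[OF bounded_linear_vec_nth])
    moreover have "(\<lambda>h. L (cscale_mat h a) $ i) = (*) (L a $ i)" by (simp add: fun_eq_iff Lc mult.commute)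
    ultimately have "((\<lambda>\<zeta>. s (?c \<zeta>) $ i) has_field_derivative L a $ i) (at z)"
      unfolding has_field_derivative_def at_within_open[OF z open_ball] by simp
    then show "\<exists>f'. ((\<lambda>\<zeta>. s (?c \<zeta>) $ i) has_field_derivative f') (at z)" by blast
  qed
  have "continuous_on U s"
    using s unfolding holomorphic_section_def continuous_on_eq_continuous_within
    by (meson has_derivative_continuous)
  moreover have "continuous_on (ball 0 \<epsilon> \<times> ball 0 \<epsilon>) (\<lambda>p. cscale_mat (fst p) u + cscale_mat (snd p) v)"
    by (subst (1 2) cscale_mat_expand) (intro continuous_intros)
  moreover have "(\<lambda>p. cscale_mat (fst p) u + cscale_mat (snd p) v) ` (ball 0 \<epsilon> \<times> ball 0 \<epsilon>) \<subseteq> U"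
    using U by auto
  ultimately have "continuous_on (ball 0 \<epsilon> \<times> ball 0 \<epsilon>) (\<lambda>p. s (cscale_mat (fst p) u + cscale_mat (snd p) v))"
    by (rule continuous_on_compose2)
  then have "continuous_on (ball 0 \<epsilon> \<times> ball 0 \<epsilon>) (\<lambda>p. s (cscale_mat (fst p) u + cscale_mat (snd p) v) $ i)"
    by (intro continuous_intros)
  moreover have "(\<lambda>z. s (cscale_mat z u + cscale_mat w v) $ i) holomorphic_on ball 0 \<epsilon>" if "w \<in> ball 0 \<epsilon>" for w
    using U that by (intro line) auto
  moreover have "(\<lambda>w. s (cscale_mat z u + cscale_mat w v) $ i) holomorphic_on ball 0 \<epsilon>" if "z \<in> ball 0 \<epsilon>" for z
  proof -
    have "(\<lambda>w. s (cscale_mat w v + cscale_mat z u) $ i) holomorphic_on ball 0 \<epsilon>"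
    proof (rule line)
      fix \<zeta> :: complex assume "norm \<zeta> < \<epsilon>"
      then have "cscale_mat z u + cscale_mat \<zeta> v \<in> U" using that by (intro U) auto
      then show "cscale_mat \<zeta> v + cscale_mat z u \<in> U" by (simp add: add.commute)
    qed
    then show ?thesis by (simp add: add.commute)
  qed
  ultimately show ?thesis by (simp add: holomorphic2_def case_prod_unfold)
qed

context moving_mhs begin

text \<open>With H the Gram matrix, the connection form satisfies H \<theta> = d_z H.
  Differentiating this relation along the conjugate of w, rather than the inverse of H, gives H R =
  (d_wb H) \<theta> - d_wb d_z H, an identity between pairings with the frame vectors. Both sides of
  the claim lie in F^p, where such pairings determine a vector.\<close>

lemma curvature_frame:
  fixes s :: "nat \<Rightarrow> 'n cmat \<Rightarrow> 'n cvec"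
  assumes s: "\<And>j. j < k \<Longrightarrow> vreg (\<lambda>z w. s j (xx z w))"
    and s_bar: "\<And>j. j < k \<Longrightarrow> vdzb (\<lambda>z w. s j (xx z w)) = 0" "\<And>j. j < k \<Longrightarrow> vdwb (\<lambda>z w. s j (xx z w)) = 0"
      "\<And>j. j < k \<Longrightarrow> vdzwb (\<lambda>z w. s j (xx z w)) = 0" "\<And>j. j < k \<Longrightarrow> vdzbw (\<lambda>z w. s j (xx z w)) = 0"
    and frame: "\<And>z w. norm z < \<epsilon> \<Longrightarrow> norm w < \<epsilon> \<Longrightarrow> inj_on (\<lambda>j. s j (xx z w)) {..<k}"
      "\<And>z w. norm z < \<epsilon> \<Longrightarrow> norm w < \<epsilon> \<Longrightarrow> vec.independent ((\<lambda>j. s j (xx z w)) ` {..<k})"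
      "\<And>z w. norm z < \<epsilon> \<Longrightarrow> norm w < \<epsilon> \<Longrightarrow> vec.span ((\<lambda>j. s j (xx z w)) ` {..<k}) = act (mexp (xx z w)) F p"
    and a: "a \<in> F p"
  shows "hodge_bundle_curvature W Q F k s u v a =
    (- bracket (PF p ** adj (part Np (cnj_mat u))) (part Np (cnj_mat v)) + part {(0, 0)} (bracket (cnj_mat v) u)
      + (part Np (bracket (cnj_mat v) u) + PF p ** adj (part Np (bracket (cnj_mat u) v)))) *v a"
proof -
  define e where "e j = s j 0" for j
  \<comment> \<open>The frame pulled back by e^x takes its values in the fixed space F^p and is
    still holomorphic in the parameters.\<close>
  define \<sigma> where "\<sigma> j z w = mexp (- xx z w) *v s j (xx z w)" for j z w
  \<comment> \<open>The vector to which \<open>metric_moved\<close> applies the twisted metric of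
    \<open>F\<close>.\<close>
  define \<eta> where "\<eta> j z w = ff z w *v \<sigma> j z w" for j z w
  let ?up = "part Np (cnj_mat u)" and ?vp = "part Np (cnj_mat v)"
  let ?vu = "bracket (cnj_mat v) u" and ?uv = "bracket (cnj_mat u) v"
  let ?A = "adj ?up"
  have \<sigma>r: "vreg (\<sigma> j)" if "j < k" for j
    unfolding \<sigma>_def by (rule vreg_mult(1)[OF Ei(1) s[OF that]])
  have \<sigma>b: "vdzb (\<sigma> j) = 0" "vdwb (\<sigma> j) = 0" "vdzwb (\<sigma> j) = 0" "vdzbw (\<sigma> j) = 0" if "j < k" for j
    unfolding \<sigma>_def vreg_mult[OF Ei(1) s[OF that]] Ei s_bar[OF that] by simp_all
  have \<sigma>0: "\<sigma> j 0 0 = e j" for j by (simp add: \<sigma>_def e_def)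
  have \<sigma>F: "\<sigma> j z w \<in> F p" if "j < k" "norm z < \<epsilon>" "norm w < \<epsilon>" for j z w
  proof -
    have "s j (xx z w) \<in> act (mexp (xx z w)) F p"
      unfolding frame(3)[OF that(2,3), symmetric] using that(1) by (intro vec.span_base) auto
    then show ?thesis using moved_mhs.act_F[OF moved_xx[OF that(2,3)]] by (simp add: \<sigma>_def)
  qed
  have eF: "e j \<in> F p" if "j < k" for j using \<sigma>F[OF that, of 0 0] \<epsilon> by (simp add: \<sigma>0)
  have dF: "vdz (\<sigma> j) \<in> F p" "vdw (\<sigma> j) \<in> F p" if "j < k" for j
    using vreg_F[OF \<epsilon> \<sigma>r[OF that] \<sigma>F[OF that]] by blast+
  have \<eta>r: "vreg (\<eta> j)" if "j < k" for j
    unfolding \<eta>_def by (rule vreg_mult(1)[OF mreg_ff \<sigma>r[OF that]])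
  have \<eta>0: "\<eta> j 0 0 = e j" for j by (simp add: \<eta>_def \<sigma>0 ff_0)
  have \<eta>d: "vdz (\<eta> j) = vdz (\<sigma> j)" "vdzb (\<eta> j) = - (?up *v e j)" "vdw (\<eta> j) = vdw (\<sigma> j)" "vdwb (\<eta> j) = - (?vp *v e j)"
    "vdzwb (\<eta> j) = - (part Np ?vu *v e j) - ?vp *v vdz (\<sigma> j)" "vdzbw (\<eta> j) = - (part Np ?uv *v e j) - ?up *v vdw (\<sigma> j)"
    if "j < k" for j
    unfolding \<eta>_def vreg_mult[OF mreg_ff \<sigma>r[OF that]] ff_first ff_second \<sigma>b[OF that] \<sigma>0
    by (simp_all add: ff_0 uminus_mat_vec)
  define hh where "hh i j z w = transposed_gram W Q F s (xx z w) i j" for i j z w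
  have hS: "S (\<eta> j z w) (tt z w) (\<eta> i z w) = hh i j z w" if "norm z < \<epsilon>" "norm w < \<epsilon>" for i j z w
  proof -
    interpret Y: moved_mhs W Q F "xx z w" using that by (rule moved_xx)
    have "mexp (xx z w) *v \<sigma> l z w = s l (xx z w)" for l using Y.g_gi by (simp add: \<sigma>_def)
    then show ?thesis using Y.metric_moved[of "\<sigma> j z w" "\<sigma> i z w"] by (simp add: hh_def transposed_gram_def \<eta>_def)
  qed
  have hr: "regular2 (hh i j)" if "i < k" "j < k" for i j
    by (rule regular2_cong(1)[OF \<epsilon> hS S_derivatives(1)[OF \<eta>r[OF that(2)] \<eta>r[OF that(1)] tt(1-4)]])
  have h0: "hh i j 0 0 = h (e j) (e i)" for i j
    using hS[of 0 0 j i, unfolded tt(2) \<eta>0 S_one] \<epsilon> by simp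
  have hz: "dz (hh i j) = h (vdz (\<sigma> j)) (e i) - h (e j) (?up *v e i)"
    and hwb: "dwb (hh i j) = - h (?vp *v e j) (e i) + h (e j) (vdw (\<sigma> i))"
    and hzwb: "dzwb (hh i j) = - h (part Np ?vu *v e j) (e i) - h (?vp *v vdz (\<sigma> j)) (e i) + h (vdz (\<sigma> j)) (vdw (\<sigma> i))
      + h (?vp *v e j) (?up *v e i) - h (e j) (part Np ?uv *v e i) - h (e j) (?up *v vdw (\<sigma> i))
      + S (e j) (part {(0, 0)} ?vu) (e i)"
    if ij: "i < k" "j < k" for i j
  proof -
    note D = S_derivatives[OF \<eta>r[OF ij(2)] \<eta>r[OF ij(1)] tt(1-4)]
    let ?f = "\<lambda>z w. S (\<eta> j z w) (tt z w) (\<eta> i z w)"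
    have C: "dz (hh i j) = dz ?f" "dwb (hh i j) = dwb ?f" "dzwb (hh i j) = dzwb ?f"
      by (rule regular2_cong[OF \<epsilon> hS D(1)]; assumption)+
    show "dz (hh i j) = h (vdz (\<sigma> j)) (e i) - h (e j) (?up *v e i)"
      unfolding C(1) D(2) by (simp add: \<eta>d ij \<eta>0 h_minus)
    show "dwb (hh i j) = - h (?vp *v e j) (e i) + h (e j) (vdw (\<sigma> i))"
      unfolding C(2) D(3) by (simp add: \<eta>d ij \<eta>0 h_minus)
    show "dzwb (hh i j) = - h (part Np ?vu *v e j) (e i) - h (?vp *v vdz (\<sigma> j)) (e i) + h (vdz (\<sigma> j)) (vdw (\<sigma> i))
      + h (?vp *v e j) (?up *v e i) - h (e j) (part Np ?uv *v e i) - h (e j) (?up *v vdw (\<sigma> i))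
      + S (e j) (part {(0, 0)} ?vu) (e i)"
      unfolding C(3) D(4) by (simp add: \<eta>d ij \<eta>0 h_minus h_diff tt(5))
  qed
  have indep: "inj_on e {..<k}" "vec.independent (e ` {..<k})" "vec.span (e ` {..<k}) = F p"
  proof -
    show "inj_on e {..<k}" "vec.independent (e ` {..<k})" using frame(1,2)[of 0 0] \<epsilon> by (simp_all add: e_def[abs_def])
    have "act (mat 1) F p = F p" by (simp add: act_def)
    then show "vec.span (e ` {..<k}) = F p" using frame(3)[of 0 0] \<epsilon> by (simp add: e_def[abs_def])
  qed
  have "k \<le> CARD('n)"
  proof -
    have "card (e ` {..<k}) \<le> vec.dim (UNIV :: 'n cvec set)"
      by (rule vec.independent_card_le_dim[OF subset_UNIV indep(2)])
    then show ?thesis unfolding vec_dim_card card_image[OF indep(1)] by simp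
  qed
  then obtain \<phi> :: "nat \<Rightarrow> 'n" where \<phi>: "inj_on \<phi> {..<k}"
    using card_le_inj[of "{..<k}" "UNIV :: 'n set"] by auto
  \<comment> \<open>Positivity of the metric at the moved point makes the Gram matrix injective, so
    it can be inverted at every nearby point.\<close>
  have ker: "\<forall>c. (\<forall>i<k. (\<Sum>l<k. hh i l z w * c l) = 0) \<longrightarrow> (\<forall>l<k. c l = 0)"
    if zw: "norm z < \<epsilon>" "norm w < \<epsilon>" for z w
  proof (intro allI impI)
    fix c l assume c: "\<forall>i<k. (\<Sum>l<k. hh i l z w * c l) = 0" and "l < k"
    interpret Y: polarized_mhs W Q "act (mexp (xx z w)) F" using zw by (rule moving)
    let ?y = "\<Sum>l<k. c l *s s l (xx z w)"
    have "Y.h ?y (s i (xx z w)) = 0" if "i < k" for i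
      using c that by (simp add: Y.h_sum Y.h_lin hh_def transposed_gram_def mult.commute)
    then have "Y.h ?y (\<Sum>i<k. c i *s s i (xx z w)) = 0" by (simp only: Y.h_sum(2)) (simp add: Y.h_lin)
    then have "?y = 0" using Y.h_pos[of ?y] by fastforce
    from independent_image_sum_0[OF frame(1,2)[OF zw] this \<open>l < k\<close>] show "c l = 0" .
  qed
  define E where "E z w = embed \<phi> k (\<lambda>i l. hh i l z w)" for z w
  define N where "N z w = (SOME B. E z w ** B = mat 1)" for z w
  have EN: "E z w ** N z w = mat 1" if "norm z < \<epsilon>" "norm w < \<epsilon>" for z w
    unfolding N_def E_def by (rule someI_ex[OF embed_inverse(1)[OF \<phi> ker[OF that]]])
  have "mreg E"
    unfolding mreg_def
  proof (intro allI)
    fix b c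
    show "regular2 (\<lambda>z w. E z w $ b $ c)"
    proof (cases "b \<in> \<phi> ` {..<k} \<and> c \<in> \<phi> ` {..<k}")
      case True
      then have "inv_into {..<k} \<phi> b < k" "inv_into {..<k} \<phi> c < k"
        using inv_into_into[of b \<phi> "{..<k}"] inv_into_into[of c \<phi> "{..<k}"] by auto
      then show ?thesis using True hr by (simp add: E_def embed_def)
    next
      case False
      then have "(\<lambda>z w. E z w $ b $ c) = (\<lambda>z w. if b = c then 1 else 0)" by (auto simp: E_def embed_def fun_eq_iff)
      then show ?thesis by (simp add: regular2_const)
    qed
  qed
  then have Nr: "mreg N" by (rule mreg_inverse[OF \<epsilon>]) (rule EN)
  define A where "A m j w = wz (\<lambda>z. hh m j z w) 0" for m j w
  define \<theta> where "\<theta> l j w = (\<Sum>m<k. N 0 w $ \<phi> l $ \<phi> m * A m j w)" for l j w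
  have Ad: "A m j differentiable (at 0)" if "m < k" "j < k" for m j
    unfolding A_def[abs_def] by (rule regular2D(4)[OF hr[OF that]])
  have Nd: "(\<lambda>w. N 0 w $ b $ c) differentiable (at 0)" for b c
    by (rule regular2D(3)[OF mregD[OF Nr]])
  have \<theta>d: "\<theta> l j differentiable (at 0)" if "l < k" "j < k" for l j
  proof -
    have "regular2 (\<lambda>z w. \<Sum>m<k. N 0 w $ \<phi> l $ \<phi> m * A m j w)"
      using that by (intro regular2_sum(1) regular2_mult(1) regular2_second Nd Ad) auto
    from regular2D(3)[OF this] show ?thesis by (simp add: \<theta>_def[abs_def])
  qed
  have small: "\<forall>\<^sub>F w in nhds 0. norm (w :: complex) < \<epsilon>"
    using \<epsilon> by (auto simp: eventually_nhds_metric dist_norm)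
  have rel: "(\<Sum>l<k. hh m l 0 w * \<theta> l j w) = A m j w" if w: "norm w < \<epsilon>" and m: "m < k" "j < k" for m j w
  proof -
    have "(\<Sum>l<k. hh m l 0 w * \<theta> l j w) = (\<Sum>n<k. (\<Sum>l<k. hh m l 0 w * N 0 w $ \<phi> l $ \<phi> n) * A n j w)"
      unfolding \<theta>_def sum_distrib_left sum_distrib_right by (subst sum.swap) (simp add: mult.assoc)
    also have "\<dots> = (\<Sum>n<k. (if m = n then 1 else 0) * A n j w)"
    proof (rule sum.cong[OF refl])
      fix n assume "n \<in> {..<k}"
      then show "(\<Sum>l<k. hh m l 0 w * N 0 w $ \<phi> l $ \<phi> n) * A n j w = (if m = n then 1 else 0) * A n j w"
        using embed_inverse(2)[OF \<phi> ker[of 0 w], of "N 0 w" m n] EN[of 0 w] w \<epsilon> m by (simp add: E_def)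
    qed
    also have "\<dots> = A m j w" using m by (simp add: if_distrib[of "\<lambda>x. x * _"] sum.delta cong: if_cong)
    finally show ?thesis .
  qed
  have conn: "\<forall>\<^sub>F w in nhds 0. \<theta> l j w = connection_form k (transposed_gram W Q F s) u (0 + cscale_mat w v) l j"
    if l: "l < k" "j < k" for l j
  proof -
    have "\<forall>\<^sub>F w in nhds 0. \<forall>m\<in>{..<k}. (\<lambda>z. hh m j z w) differentiable (at 0)"
      using regular2D(1)[OF hr] l by (intro eventually_ball_finite) auto
    with small show ?thesis
    proof eventually_elim
      case (elim w)
      have wz: "wirtinger (\<lambda>y. transposed_gram W Q F s y m j) u (0 + cscale_mat w v) = A m j w" if "m < k" for m
      proof -
        have e: "(\<lambda>z. transposed_gram W Q F s (0 + cscale_mat w v + cscale_mat z u) m j) = (\<lambda>z. hh m j z w)"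
          by (simp add: hh_def fun_eq_iff add.commute)
        show ?thesis using wirtinger_eq(1)[of "\<lambda>y. transposed_gram W Q F s y m j" "0 + cscale_mat w v" u] elim(2) that
          unfolding e A_def by auto
      qed
      have "transposed_gram W Q F s (0 + cscale_mat w v) = (\<lambda>i j. hh i j 0 w)"
        by (simp add: hh_def fun_eq_iff cscale_mat_def map_matrix_def zero_vec_def[symmetric])
      then have "nmat_inverse k (transposed_gram W Q F s (0 + cscale_mat w v)) l m = N 0 w $ \<phi> l $ \<phi> m" if "m < k" for m
        using embed_inverse(3)[OF \<phi> ker[of 0 w], of "N 0 w" l m] EN[of 0 w] elim(1) \<epsilon> l that by (simp add: E_def)
      then show ?case unfolding connection_form_def \<theta>_def
        by (intro sum.cong refl) (simp only: wz lessThan_iff)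
    qed
  qed
  have curv: "curvature_matrix k (transposed_gram W Q F s) u v 0 l j = - wzb (\<theta> l j) 0" if l: "l < k" "j < k" for l j
  proof -
    have d: "(\<lambda>w. connection_form k (transposed_gram W Q F s) u (0 + cscale_mat w v) l j) differentiable (at 0)"
      by (rule differentiable_eventually[OF \<theta>d[OF l] conn[OF l]])
    show ?thesis
      unfolding curvature_matrix_def wirtinger_eq(2)[where f = "\<lambda>y. connection_form k (transposed_gram W Q F s) u y l j" and x = 0, OF d]
      using wirtinger_cong(2)[OF conn[OF l]] by simp
  qed
  define R where "R l j = - wzb (\<theta> l j) 0" for l j
  have diff: "(\<Sum>l<k. hh m l 0 0 * R l j) = (\<Sum>l<k. dwb (hh m l) * \<theta> l j 0) - dzwb (hh m j)" if m: "m < k" "j < k" for m j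
  proof -
    have ev: "\<forall>\<^sub>F w in nhds 0. (\<Sum>l<k. hh m l 0 w * \<theta> l j w) = A m j w"
      using small by eventually_elim (rule rel[OF _ m])
    have "wzb (\<lambda>w. \<Sum>l<k. hh m l 0 w * \<theta> l j w) 0 = (\<Sum>l<k. dwb (hh m l) * \<theta> l j 0 + hh m l 0 0 * wzb (\<theta> l j) 0)"
    proof -
      have r: "regular2 (\<lambda>z w. hh m l 0 w)" "regular2 (\<lambda>z w. \<theta> l j w)" if "l < k" for l
        using regular2D(3)[OF hr[OF m(1) that]] \<theta>d[OF that m(2)] by (simp_all add: regular2_second)
      have "dwb (\<lambda>z w. \<Sum>l<k. hh m l 0 w * \<theta> l j w) = (\<Sum>l<k. dwb (\<lambda>z w. hh m l 0 w * \<theta> l j w))"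
      proof (rule regular2_sum(5)[where f = "\<lambda>l z w. hh m l 0 w * \<theta> l j w"])
        fix l assume "l \<in> {..<k}"
        then have l: "l < k" by simp
        show "regular2 (\<lambda>z w. hh m l 0 w * \<theta> l j w)" by (rule regular2_mult(1)[OF r(1)[OF l] r(2)[OF l]])
      qed
      also have "\<dots> = (\<Sum>l<k. dwb (\<lambda>z w. hh m l 0 w) * \<theta> l j 0 + hh m l 0 0 * dwb (\<lambda>z w. \<theta> l j w))"
      proof (rule sum.cong[OF refl])
        fix l assume "l \<in> {..<k}"
        then have l: "l < k" by simp
        show "dwb (\<lambda>z w. hh m l 0 w * \<theta> l j w) =
            dwb (\<lambda>z w. hh m l 0 w) * \<theta> l j 0 + hh m l 0 0 * dwb (\<lambda>z w. \<theta> l j w)"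
          by (rule regular2_mult(5)[OF r(1)[OF l] r(2)[OF l]])
      qed
      finally show ?thesis by (simp add: dwb_def)
    qed
    moreover have "wzb (\<lambda>w. \<Sum>l<k. hh m l 0 w * \<theta> l j w) 0 = dzwb (hh m j)"
      unfolding wirtinger_cong(2)[OF ev] dzwb_def A_def ..
    ultimately show ?thesis by (simp add: R_def sum.distrib sum_negf eq_diff_eq)
  qed
  have F0: "d = 0" if "d \<in> F p" "\<And>m. m < k \<Longrightarrow> h d (e m) = 0" for d
  proof -
    have "F p \<subseteq> {y. h d y = 0}"
      unfolding indep(3)[symmetric]
      by (rule vec.span_minimal) (use that(2) in \<open>auto simp: vec.subspace_def h_lin\<close>)
    then have "h d d = 0" using that(1) by blast
    then show ?thesis using h_pos[of d] by fastforce
  qed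
  have hPF: "h (PF p *v y) z = h y z" if "z \<in> F p" for y z using h_PF[OF that, of y] by (simp add: h_diff)
  \<comment> \<open>The connection form as a vector: the derivative of the frame, corrected by the
    first derivative of f in the conjugated argument, which becomes an adjoint followed by
    projection to F^p.\<close>
  have \<Theta>: "(\<Sum>l<k. \<theta> l j 0 *s e l) = vdz (\<sigma> j) - PF p *v (?A *v e j)" if j: "j < k" for j
  proof -
    let ?d = "(\<Sum>l<k. \<theta> l j 0 *s e l) - (vdz (\<sigma> j) - PF p *v (?A *v e j))"
    have "?d = 0"
    proof (rule F0)
      show "?d \<in> F p"
        using eF dF[OF j] PF_in by (intro vec.subspace_diff[OF F_subspace] vec.subspace_sum[OF F_subspace] vec.subspace_scale[OF F_subspace]) auto
      fix m assume m: "m < k"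
      have "h (\<Sum>l<k. \<theta> l j 0 *s e l) (e m) = (\<Sum>l<k. hh m l 0 0 * \<theta> l j 0)"
        by (simp add: h_sum h_lin h0 mult.commute)
      also have "\<dots> = dz (hh m j)" using rel[of 0 m j] m j \<epsilon> by (simp add: A_def dz_def)
      also have "\<dots> = h (vdz (\<sigma> j)) (e m) - h (e j) (?up *v e m)" by (rule hz[OF m j])
      finally show "h ?d (e m) = 0" by (simp add: h_diff hPF eF m h_adj')
    qed
    then show ?thesis by simp
  qed
  let ?T = "- bracket (PF p ** ?A) ?vp + part {(0, 0)} ?vu + (part Np ?vu + PF p ** adj (part Np ?uv))"
  have vuL: "lie ?vu" by (rule lie_bracket[OF lie_cnj[OF lie_v] lie_u])
  have typeF: "btype T X \<Longrightarrow> T \<subseteq> {(r, s). 0 \<le> r} \<Longrightarrow> y \<in> F p \<Longrightarrow> X *v y \<in> F p" for T X y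
    using btype_FD[OF btype_mono] by blast
  have Npsub: "Np \<subseteq> {(r, s). 0 \<le> r}" "{(0, 0)} \<subseteq> {(r, s :: int). 0 \<le> (r :: int)}" by (auto simp: Np_def)
  have Tvec: "?T *v y = - (PF p *v (?A *v (?vp *v y))) + ?vp *v (PF p *v (?A *v y)) + part {(0, 0)} ?vu *v y
      + part Np ?vu *v y + PF p *v (adj (part Np ?uv) *v y)" for y
    by (simp add: bracket_def matrix_vector_mult_add_rdistrib matrix_vector_mult_diff_rdistrib uminus_mat_vec
        matrix_vector_mul_assoc[symmetric])
  have Rj: "(\<Sum>l<k. R l j *s e l) = ?T *v e j" if j: "j < k" for j
  proof -
    let ?d = "(\<Sum>l<k. R l j *s e l) - ?T *v e j"
    have "?d = 0"
    proof (rule F0)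
      \<comment> \<open>Pairings with the frame detect only vectors of F^p. Parts of type
        \<open>Np\<close> and (0, 0) do not lower the first degree, and the other terms end with the
        projection.\<close>
      have "?T *v e j \<in> F p"
        unfolding Tvec using eF[OF j] PF_in
        by (intro vec.subspace_add[OF F_subspace] vec.subspace_neg[OF F_subspace] typeF[OF btype_part] Npsub)
      then show "?d \<in> F p"
        using eF by (intro vec.subspace_diff[OF F_subspace] vec.subspace_sum[OF F_subspace] vec.subspace_scale[OF F_subspace]) auto
      fix m assume m: "m < k"
      have "h (\<Sum>l<k. R l j *s e l) (e m) = (\<Sum>l<k. hh m l 0 0 * R l j)"
        by (simp add: h_sum h_lin h0 mult.commute)
      also have "\<dots> = (\<Sum>l<k. dwb (hh m l) * \<theta> l j 0) - dzwb (hh m j)" by (rule diff[OF m j])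
      also have "(\<Sum>l<k. dwb (hh m l) * \<theta> l j 0) = (\<Sum>l<k. \<theta> l j 0 * (- h (?vp *v e l) (e m) + h (e l) (vdw (\<sigma> m))))"
        by (intro sum.cong refl) (simp add: hwb m mult.commute)
      also have "\<dots> = - h (?vp *v (\<Sum>l<k. \<theta> l j 0 *s e l)) (e m) + h (\<Sum>l<k. \<theta> l j 0 *s e l) (vdw (\<sigma> m))"
        by (simp add: matrix_vector_mult_sum_right vector_scalar_commute h_sum h_lin right_diff_distrib sum_subtractf)
      also have "\<dots> = - h (?vp *v vdz (\<sigma> j)) (e m) + h (?vp *v (PF p *v (?A *v e j))) (e m)
          + h (vdz (\<sigma> j)) (vdw (\<sigma> m)) - h (e j) (?up *v vdw (\<sigma> m))"
        unfolding \<Theta>[OF j] by (simp add: matrix_vector_mult_diff_distrib h_diff hPF dF m h_adj')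
      \<comment> \<open>Every term that contains a derivative of the frame occurs in the mixed
        derivative of the metric as well and cancels.\<close>
      also have "\<dots> - dzwb (hh m j) = h (?T *v e j) (e m)"
        unfolding hzwb[OF m j] S_lie[OF lie_part_lie[OF vuL] btype_part] Tvec
        by (simp add: h_lin h_minus h_diff hPF eF m h_adj')
      finally show "h ?d (e m) = 0" by (simp add: h_diff)
    qed
    then show ?thesis by simp
  qed
  define c where "c j = vec.representation (e ` {..<k}) a (e j)" for j
  have "a \<in> vec.span (e ` {..<k})" using a indep(3) by simp
  then have "(\<Sum>b\<in>e ` {..<k}. vec.representation (e ` {..<k}) a b *s b) = a"
    using vec.sum_representation_eq[OF indep(2), of a "e ` {..<k}"] by simp
  then have rep: "a = (\<Sum>j<k. c j *s e j)" by (simp add: sum.reindex[OF indep(1)] c_def)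
  have "hodge_bundle_curvature W Q F k s u v a = (\<Sum>j<k. \<Sum>i<k. (R i j * c j) *s e i)"
    unfolding hodge_bundle_curvature_def frame_endomorphism_def e_def[symmetric] c_def[symmetric]
    by (intro sum.cong refl) (simp add: curv R_def)
  also have "\<dots> = (\<Sum>j<k. c j *s (\<Sum>i<k. R i j *s e i))"
    by (intro sum.cong refl) (simp add: vec.scale_sum_right mult.commute)
  also have "\<dots> = (\<Sum>j<k. c j *s (?T *v e j))" by (intro sum.cong refl) (simp add: Rj)
  also have "\<dots> = ?T *v a"
    by (subst rep) (simp add: matrix_vector_mult_sum_right vector_scalar_commute)
  finally show ?thesis .
qed

end

theorem corollary5p1:
  fixes W :: "'n::finite weight_filtration"
    and Q :: "'n graded_forms"
    and hn :: "int \<Rightarrow> int \<Rightarrow> nat"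
    and F :: "'n filtration"
    and p :: int
    and u v :: "'n cmat"
    and U :: "'n cmat set"
    and k :: nat
    and s :: "nat \<Rightarrow> 'n cmat \<Rightarrow> 'n cvec"
  assumes "graded_polarization_data W Q"
    and "F \<in> classifying_space W Q hn"
    and "u \<in> lie_q W Q F"
    and "v \<in> lie_q W Q F"
    and "hodge_bundle_frame W Q hn F p U k s"
  shows "let P = hodge_proj W Q F p;
             adj = hodge_adjoint W Q F;
             plus = plus_part W Q F;
             zero = zero_part W Q F;
             ubar = cnj_mat u;
             vbar = cnj_mat v
         in \<forall>w\<in>F p. hodge_bundle_curvature W Q F k s u v w =
              (- bracket (P ** adj (plus ubar)) (plus vbar)
               - (1/2) *\<^sub>R (zero (bracket u vbar) + adj (zero (bracket v ubar)))
               + (plus (bracket vbar u) + P ** adj (plus (bracket ubar v)))) *v w"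
proof -
  have pm: "polarized_mhs W Q G" if "G \<in> classifying_space W Q hn" for G
    using assms(1) that by unfold_locales (auto simp: classifying_space_def)
  interpret polarized_mhs W Q F using assms(2) by (rule pm)
  have q: "lie X \<and> btype {(r, s). r < 0} X \<longleftrightarrow> X \<in> lie_q W Q F" for X
    by (simp add: lie_q_def lie_part_iff)
  have u: "lie u" "btype {(r, s). r < 0} u" and v: "lie v" "btype {(r, s). r < 0} v"
    using assms(3,4) q by blast+
  obtain T where T: "open T" "U = lie_q W Q F \<inter> T"
    using assms(5) by (auto simp: hodge_bundle_frame_def openin_open)
  have U0: "0 \<in> U" and UD: "\<And>x. x \<in> U \<Longrightarrow> act (mexp x) F \<in> classifying_space W Q hn"
    and hol: "\<And>j. j < k \<Longrightarrow> holomorphic_section U (s j)"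
    and fr: "\<And>x. x \<in> U \<Longrightarrow> inj_on (\<lambda>j. s j x) {..<k}" "\<And>x. x \<in> U \<Longrightarrow> vec.independent ((\<lambda>j. s j x) ` {..<k})"
      "\<And>x. x \<in> U \<Longrightarrow> vec.span ((\<lambda>j. s j x) ` {..<k}) = act (mexp x) F p"
    using assms(5) by (auto simp: hodge_bundle_frame_def)
  let ?x = "\<lambda>z w. cscale_mat z u + cscale_mat w v"
  \<comment> \<open>\<open>U\<close> is open relative to \<open>lie_q\<close> only, but this complex
    subspace contains z u + w v for all parameters; so a small bidisc stays in
    \<open>U\<close>.\<close>
  obtain \<epsilon> where eps: "\<epsilon> > 0" "\<And>z w. norm z < \<epsilon> \<Longrightarrow> norm w < \<epsilon> \<Longrightarrow> ?x z w \<in> U"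
  proof -
    have "continuous_on UNIV (\<lambda>p. ?x (fst p) (snd p))"
      by (subst (1 2) cscale_mat_expand) (intro continuous_intros)
    then have "open ((\<lambda>p. ?x (fst p) (snd p)) -` T)" using T(1) by (simp add: open_vimage)
    moreover have "(0, 0) \<in> (\<lambda>p. ?x (fst p) (snd p)) -` T"
      using U0 T(2) by (simp add: cscale_mat_def map_matrix_def zero_vec_def[symmetric])
    ultimately obtain A B where AB: "open A" "open B" "0 \<in> A" "0 \<in> B" "A \<times> B \<subseteq> (\<lambda>p. ?x (fst p) (snd p)) -` T"
      by (auto elim!: open_prod_elim)
    obtain \<delta>1 \<delta>2 where d: "\<delta>1 > 0" "ball 0 \<delta>1 \<subseteq> A" "\<delta>2 > 0" "ball 0 \<delta>2 \<subseteq> B"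
      using AB open_contains_ball by metis
    have "?x z w \<in> U" if "norm z < min \<delta>1 \<delta>2" "norm w < min \<delta>1 \<delta>2" for z w
    proof -
      have "(z, w) \<in> A \<times> B" using d that by auto
      then have "?x z w \<in> T" using AB(5) by fastforce
      moreover have "?x z w \<in> lie_q W Q F"
        unfolding q[symmetric] using u v by (simp add: lie_add lie_cscale btype_add btype_cscale)
      ultimately show ?thesis using T(2) by blast
    qed
    then show ?thesis using that[of "min \<delta>1 \<delta>2"] d by simp
  qed
  interpret moving_mhs W Q F u v \<epsilon>
    using eps u v pm[OF UD] by unfold_locales (auto simp: polarized_mhs_def polarized_mhs_axioms_def)
  note H = holomorphic2_regular2[OF eps(1) section_holomorphic2[OF hol eps(2)]]
  have vr: "vreg (\<lambda>z w. s j (xx z w))" "vdzb (\<lambda>z w. s j (xx z w)) = 0" "vdwb (\<lambda>z w. s j (xx z w)) = 0"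
    "vdzwb (\<lambda>z w. s j (xx z w)) = 0" "vdzbw (\<lambda>z w. s j (xx z w)) = 0" if "j < k" for j
    unfolding vreg_def vd_defs using H[OF that] by (simp_all add: vec_eq_iff)
  have L: "lie (cnj_mat u)" "lie (cnj_mat v)" "lie (bracket u (cnj_mat v))" "lie (bracket v (cnj_mat u))"
    "lie (bracket (cnj_mat v) u)" "lie (bracket (cnj_mat u) v)"
    using u v by (simp_all add: lie_cnj lie_bracket)
  have b: "bracket (cnj_mat v) u = - bracket u (cnj_mat v)" "cnj_mat (bracket v (cnj_mat u)) = bracket (cnj_mat v) u"
    by (simp_all add: bracket_def cnj_mat_diff cnj_mat_mult)
  \<comment> \<open>The two summands agree: by \<open>adj_part0\<close> the adjoint is minus the (0,
    0) part of the conjugate of [v, conj u], and this conjugate is [conj v, u] = -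
    [u, conj v].\<close>
  have "(1 / 2) *\<^sub>R (part {(0, 0)} (bracket u (cnj_mat v)) + adj (part {(0, 0)} (bracket v (cnj_mat u)))) =
      - part {(0, 0)} (bracket (cnj_mat v) u)"
    unfolding adj_part0[OF L(4)] b(2) by (simp add: b(1) part_minus scaleR_2[symmetric])
  then have zero: "- X - (1 / 2) *\<^sub>R (part {(0, 0)} (bracket u (cnj_mat v)) + adj (part {(0, 0)} (bracket v (cnj_mat u)))) + Y =
      - X + part {(0, 0)} (bracket (cnj_mat v) u) + Y" for X Y by simp
  show ?thesis
    unfolding Let_def hodge_proj_eq plus_part_eq[OF L(1)] plus_part_eq[OF L(2)] plus_part_eq[OF L(5)] plus_part_eq[OF L(6)]
      zero_part_eq[OF L(3)] zero_part_eq[OF L(4)] zero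
    by (intro ballI curvature_frame vr fr eps(2))
qed

end
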